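(* There exists a critical edge length $\lambda_0>0$ such that, for any $0<\lambda<\lambda_0$, the symmetric critical point $(q_1,q_2,q_3)=(q_1^s,q_2^s,q_3^s)$, constructed by minimization on $\Omega_q$ and reflection as described in the context, is the unique critical point of the energy $J$ in $\mathcal{A}_0$.
   Context: Parameters: $A<0$, $B,C,L,\lambda>0$ and $L_2\in(-1,\infty)$ are real constants, and $s_+=\frac{B+\sqrt{B^2+24|A|C}}{4C}>0$. The constants $A,B,C,L,L_2$ and the domain are fixed, while $\lambda$ varies. Domain: for a fixed small $\epsilon>0$ ($\epsilon\ll1$), $\Omega=\{(x,y)\in\mathbb{R}^2:|x|<1,|y|<1,|x+y|<2-\epsilon,|x-y|<2-\epsilon\}$. Its boundary consists of four long edges, labelled clockwise, $C_1$ (on $y=1$), $C_2$ (on $x=1$), $C_3$ (on $y=-1$), $C_4$ (on $x=-1$), and four short edges, labelled clockwise from the top left, $S_1$ (on $y-x=2-\epsilon$), $S_2$ (on $x+y=2-\epsilon$), $S_3$ (on $x-y=2-\epsilon$), $S_4$ (on $x+y=-(2-\epsilon)$). Boundary function: with $g(l)=\frac{s_+}{2\epsilon}l$ for $-\epsilon\le l\le\epsilon$, define $q_b=s_+/2$ on $C_1\cup C_3$, $q_b=-s_+/2$ on $C_2\cup C_4$, $q_b=g(x+y)$ on $S_1$, $q_b=g(y-x)$ on $S_2$, $q_b=g(-x-y)$ on $S_3$, $q_b=g(x-y)$ on $S_4$. Energy: $J[q_1,q_2,q_3]=\int_\Omega f_{el}(q_1,q_2,q_3)+\frac{\lambda^2}{L}f_b(q_1,q_2,q_3)\,\mathrm{dA}$,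 where \begin{align*} f_{el}=&\Big(1+\tfrac{L_2}{2}\Big)|\nabla q_1|^2+\Big(1+\tfrac{L_2}{2}\Big)|\nabla q_2|^2+\Big(3+\tfrac{L_2}{2}\Big)|\nabla q_3|^2\\&+L_2(q_{1,y}q_{3,y}-q_{1,x}q_{3,x}-q_{2,y}q_{3,x}-q_{2,x}q_{3,y})+|L_2|(q_{2,y}q_{1,x}-q_{1,y}q_{2,x}),\\ f_b=&A(q_1^2+q_2^2+3q_3^2)+C(q_1^2+q_2^2+3q_3^2)^2+2Bq_3(q_1^2+q_2^2-q_3^2). \end{align*} The admissible space is $\mathcal{A}_0=\{(q_1,q_2,q_3)\in W^{1,2}(\Omega;\mathbb{R}^3):q_1=q_b,\ q_2=0,\ q_3=-s_+/6\text{ on }\partial\Omega\}$. A critical point of $J$ in $\mathcal{A}_0$ is a (weak) solution in $\mathcal{A}_0$ of the Euler-Lagrange equations of $J$. Construction of the symmetric critical point (for each $\lambda>0$): let $\Omega_q=\{(x,y)\in\Omega:0<y<x,\ 0<x<1\}$. Let $(q_1^*,q_2^*,q_3^* )\in W^{1,2}(\Omega_q;\mathbb{R}^3)$ be a minimizer of $\int_{\Omega_q}f_{el}+\frac{\lambda^2}{L}f_b\,\mathrm{dA}$ subject to the conditions: $q_1=q_b$, $q_2=0$, $q_3=-s_+/6$ on $\partial\Omega_q\cap\partial\Omega$; $q_1=\partial_\nu q_2=\partial_\nu q_3=0$ on $\partial\Omega_q\cap\{y=x\}$; $\partial_\nu q_1=q_2=\partial_\nu q_3=0$ on $\partial\Omega_q\cap\{y=0\}$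 (where $\partial_\nu$ is the outward normal derivative; the Neumann conditions are understood as natural boundary conditions). Define $q_1^s$ on $\Omega$ by odd reflection of $q_1^*$ about the diagonals $y=\pm x$ and even reflection about the $x$- and $y$-axes; $q_2^s$ by even reflection of $q_2^*$ about the diagonals and odd reflection about the axes; $q_3^s$ by even reflection of $q_3^*$ about the diagonals and the axes. The triple $(q_1^s,q_2^s,q_3^s)$ is a critical point of $J$ in $\mathcal{A}_0$ with $q_1^s=0$ on $y=\pm x$ and $q_2^s=0$ on $x=0$ and $y=0$. *)

theory Defs
  imports "HOL-Analysis.Analysis"
begin

type_synonym plane = "real \<times> real"

section \<open>Sobolev functions on planar domains and their traces\<close>

definition pderiv_dir :: "plane \<Rightarrow> (plane \<Rightarrow> real) \<Rightarrow> plane \<Rightarrow> real" where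
  "pderiv_dir v f z = frechet_derivative f (at z) v"

primrec Ck :: "nat \<Rightarrow> (plane \<Rightarrow> real) \<Rightarrow> bool" where
  "Ck 0 f \<longleftrightarrow> continuous_on UNIV f"
| "Ck (Suc k) f \<longleftrightarrow> f differentiable_on UNIV \<and> (\<forall>v\<in>Basis. Ck k (pderiv_dir v f))"

definition smooth :: "(plane \<Rightarrow> real) \<Rightarrow> bool" where
  "smooth f \<longleftrightarrow> (\<forall>k. Ck k f)"

text \<open>Elements of $C_c^\infty(U)$, extended by zero to the whole plane.\<close>

definition test_function :: "plane set \<Rightarrow> (plane \<Rightarrow> real) \<Rightarrow> bool" where
  "test_function U \<phi> \<longleftrightarrow>
     smooth \<phi> \<and> compact (closure {z. \<phi> z \<noteq> 0}) \<and> closure {z. \<phi> z \<noteq> 0} \<subseteq> U"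

definition L2_fun :: "'a measure \<Rightarrow> ('a \<Rightarrow> real) \<Rightarrow> bool" where
  "L2_fun M f \<longleftrightarrow> f \<in> borel_measurable M \<and> integrable M (\<lambda>z. (f z)\<^sup>2)"

definition L2_tendsto :: "'a measure \<Rightarrow> (nat \<Rightarrow> 'a \<Rightarrow> real) \<Rightarrow> ('a \<Rightarrow> real) \<Rightarrow> bool" where
  "L2_tendsto M f g \<longleftrightarrow> (\<forall>n. L2_fun M (f n)) \<and> L2_fun M g
     \<and> (\<lambda>n. LINT z|M. (f n z - g z)\<^sup>2) \<longlonglongrightarrow> 0"

definition loc_integrable :: "plane set \<Rightarrow> (plane \<Rightarrow> real) \<Rightarrow> bool" where
  "loc_integrable U u \<longleftrightarrow> (\<forall>K. compact K \<and> K \<subseteq> U \<longrightarrow> integrable (lebesgue_on K) u)"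

definition has_weak_deriv ::
  "plane set \<Rightarrow> plane \<Rightarrow> (plane \<Rightarrow> real) \<Rightarrow> (plane \<Rightarrow> real) \<Rightarrow> bool" where
  "has_weak_deriv U v u g \<longleftrightarrow> loc_integrable U u \<and> loc_integrable U g \<and>
     (\<forall>\<phi>. test_function U \<phi> \<longrightarrow>
        (LINT z|lebesgue_on U. u z * pderiv_dir v \<phi> z) = - (LINT z|lebesgue_on U. g z * \<phi> z))"

text \<open>A weak derivative is determined only up to a null set; \<open>weak_deriv\<close> selects a representative.\<close>

definition weak_deriv :: "plane set \<Rightarrow> plane \<Rightarrow> (plane \<Rightarrow> real) \<Rightarrow> plane \<Rightarrow> real" where
  "weak_deriv U v u = (SOME g. has_weak_deriv U v u g)"

text \<open>The space $W^{1,2}(U)$, as a set of representatives.\<close>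

definition W12 :: "plane set \<Rightarrow> (plane \<Rightarrow> real) set" where
  "W12 U = {u. L2_fun (lebesgue_on U) u \<and>
     (\<forall>v\<in>Basis. \<exists>g. has_weak_deriv U v u g \<and> L2_fun (lebesgue_on U) g)}"

text \<open>
  \<open>trace_on U \<Gamma> u g\<close>: the Sobolev function \<open>u\<close> equals \<open>g\<close> on the part \<open>\<Gamma>\<close> of the boundary of \<open>U\<close>,
  in the sense of traces. As usual the trace is obtained by continuous extension of the
  restriction map from functions smooth up to the boundary, where the boundary carries the
  $L^2$ norm of arc length. The domains below are polygons, so it suffices to compare on the
  nondegenerate line segments contained in \<open>\<Gamma>\<close>; parametrizing a segment by \<open>linepath\<close> changes
  the arc length norm only by the constant factor \<open>norm (b - a)\<close>.
\<close>

definition trace_on ::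
  "plane set \<Rightarrow> plane set \<Rightarrow> (plane \<Rightarrow> real) \<Rightarrow> (plane \<Rightarrow> real) \<Rightarrow> bool" where
  "trace_on U \<Gamma> u g \<longleftrightarrow> u \<in> W12 U \<and>
     (\<forall>a b. a \<noteq> b \<and> closed_segment a b \<subseteq> \<Gamma> \<longrightarrow>
       (\<exists>\<phi>. (\<forall>n. smooth (\<phi> n))
          \<and> L2_tendsto (lebesgue_on U) \<phi> u
          \<and> (\<forall>v\<in>Basis. L2_tendsto (lebesgue_on U) (\<lambda>n. pderiv_dir v (\<phi> n)) (weak_deriv U v u))
          \<and> L2_tendsto (lebesgue_on {0..1}) (\<lambda>n t. \<phi> n (linepath a b t)) (\<lambda>t. g (linepath a b t))))"

section \<open>The domain and the boundary data\<close>

definition Omega :: "real \<Rightarrow> plane set" where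
  "Omega \<epsilon> = {(x, y). \<bar>x\<bar> < 1 \<and> \<bar>y\<bar> < 1 \<and> \<bar>x + y\<bar> < 2 - \<epsilon> \<and> \<bar>x - y\<bar> < 2 - \<epsilon>}"

definition Omega_q :: "real \<Rightarrow> plane set" where
  "Omega_q \<epsilon> = {(x, y). (x, y) \<in> Omega \<epsilon> \<and> 0 < y \<and> y < x \<and> 0 < x \<and> x < 1}"

definition s_plus :: "real \<Rightarrow> real \<Rightarrow> real \<Rightarrow> real" where
  "s_plus A B C = (B + sqrt (B\<^sup>2 + 24 * \<bar>A\<bar> * C)) / (4 * C)"

text \<open>
  Only the values on the boundary of \<open>Omega \<epsilon>\<close> matter. There, \<open>\<bar>y\<bar> = 1\<close> describes the long edges
  $C_1\cup C_3$, \<open>\<bar>x\<bar> = 1\<close> the long edges $C_2\cup C_4$, and the remaining cases are the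
  short edges $S_1$, $S_2$, $S_3$, $S_4$. The prescriptions agree at the common
  endpoints of adjacent edges.
\<close>

definition q_b :: "real \<Rightarrow> real \<Rightarrow> real \<Rightarrow> real \<Rightarrow> plane \<Rightarrow> real" where
  "q_b A B C \<epsilon> = (\<lambda>(x, y).
     let s = s_plus A B C; g = (\<lambda>l. s / (2 * \<epsilon>) * l) in
     if \<bar>y\<bar> = 1 then s / 2
     else if \<bar>x\<bar> = 1 then - s / 2
     else if y - x = 2 - \<epsilon> then g (x + y)
     else if x + y = 2 - \<epsilon> then g (y - x)
     else if x - y = 2 - \<epsilon> then g (- x - y)
     else g (x - y))"

section \<open>The energy and its critical points\<close>

text \<open>The argument of \<open>f_el\<close> is the pair $(\partial_x q, \partial_y q)$.\<close>

definition f_el :: "real \<Rightarrow> (real^3) \<times> (real^3) \<Rightarrow> real" where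
  "f_el L2 = (\<lambda>(qx, qy).
     (1 + L2 / 2) * ((qx $ 1)\<^sup>2 + (qy $ 1)\<^sup>2)
   + (1 + L2 / 2) * ((qx $ 2)\<^sup>2 + (qy $ 2)\<^sup>2)
   + (3 + L2 / 2) * ((qx $ 3)\<^sup>2 + (qy $ 3)\<^sup>2)
   + L2 * (qy $ 1 * qy $ 3 - qx $ 1 * qx $ 3 - qy $ 2 * qx $ 3 - qx $ 2 * qy $ 3)
   + \<bar>L2\<bar> * (qy $ 2 * qx $ 1 - qy $ 1 * qx $ 2))"

definition f_b :: "real \<Rightarrow> real \<Rightarrow> real \<Rightarrow> real^3 \<Rightarrow> real" where
  "f_b A B C q =
     A * ((q $ 1)\<^sup>2 + (q $ 2)\<^sup>2 + 3 * (q $ 3)\<^sup>2)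
   + C * ((q $ 1)\<^sup>2 + (q $ 2)\<^sup>2 + 3 * (q $ 3)\<^sup>2)\<^sup>2
   + 2 * B * q $ 3 * ((q $ 1)\<^sup>2 + (q $ 2)\<^sup>2 - (q $ 3)\<^sup>2)"

definition weak_grad :: "plane set \<Rightarrow> (plane \<Rightarrow> real^3) \<Rightarrow> plane \<Rightarrow> (real^3) \<times> (real^3)" where
  "weak_grad U q z =
     (\<chi> i. weak_deriv U (1, 0) (\<lambda>w. q w $ i) z, \<chi> i. weak_deriv U (0, 1) (\<lambda>w. q w $ i) z)"

definition grad :: "(plane \<Rightarrow> real^3) \<Rightarrow> plane \<Rightarrow> (real^3) \<times> (real^3)" where
  "grad \<phi> z = (\<chi> i. pderiv_dir (1, 0) (\<lambda>w. \<phi> w $ i) z, \<chi> i. pderiv_dir (0, 1) (\<lambda>w. \<phi> w $ i) z)"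

text \<open>The energy on a subdomain \<open>U\<close>; $J$ is the case \<open>U = Omega \<epsilon>\<close>.\<close>

definition energy ::
  "real \<Rightarrow> real \<Rightarrow> real \<Rightarrow> real \<Rightarrow> real \<Rightarrow> real \<Rightarrow> plane set \<Rightarrow> (plane \<Rightarrow> real^3) \<Rightarrow> real" where
  "energy A B C L L2 lam U q =
     (LINT z|lebesgue_on U. f_el L2 (weak_grad U q z) + lam\<^sup>2 / L * f_b A B C (q z))"

definition admissible :: "real \<Rightarrow> real \<Rightarrow> real \<Rightarrow> real \<Rightarrow> (plane \<Rightarrow> real^3) set" where
  "admissible A B C \<epsilon> = {q. (\<forall>i. (\<lambda>z. q z $ i) \<in> W12 (Omega \<epsilon>)) \<and>
     trace_on (Omega \<epsilon>) (frontier (Omega \<epsilon>)) (\<lambda>z. q z $ 1) (q_b A B C \<epsilon>) \<and>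
     trace_on (Omega \<epsilon>) (frontier (Omega \<epsilon>)) (\<lambda>z. q z $ 2) (\<lambda>z. 0) \<and>
     trace_on (Omega \<epsilon>) (frontier (Omega \<epsilon>)) (\<lambda>z. q z $ 3) (\<lambda>z. - s_plus A B C / 6)}"

text \<open>Weak form of the Euler-Lagrange equations of $J$, tested with $C_c^\infty(\Omega;\mathbb{R}^3)$.\<close>

definition weak_Euler_Lagrange ::
  "real \<Rightarrow> real \<Rightarrow> real \<Rightarrow> real \<Rightarrow> real \<Rightarrow> real \<Rightarrow> plane set \<Rightarrow> (plane \<Rightarrow> real^3) \<Rightarrow> bool" where
  "weak_Euler_Lagrange A B C L L2 lam U q \<longleftrightarrow>
     (\<forall>\<phi> :: plane \<Rightarrow> real^3. (\<forall>i. test_function U (\<lambda>z. \<phi> z $ i)) \<longrightarrow>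
       (LINT z|lebesgue_on U.
           frechet_derivative (f_el L2) (at (weak_grad U q z)) (grad \<phi> z)
         + lam\<^sup>2 / L * frechet_derivative (f_b A B C) (at (q z)) (\<phi> z)) = 0)"

definition critical_point ::
  "real \<Rightarrow> real \<Rightarrow> real \<Rightarrow> real \<Rightarrow> real \<Rightarrow> real \<Rightarrow> real \<Rightarrow> (plane \<Rightarrow> real^3) \<Rightarrow> bool" where
  "critical_point A B C L L2 \<epsilon> lam q \<longleftrightarrow>
     q \<in> admissible A B C \<epsilon> \<and> weak_Euler_Lagrange A B C L L2 lam (Omega \<epsilon>) q"

section \<open>The symmetric critical point\<close>

text \<open>
  Admissible class of the problem on \<open>Omega_q \<epsilon>\<close>. The Neumann conditions are the natural boundary
  conditions of the minimization and hence do not appear.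
\<close>

definition admissible_q :: "real \<Rightarrow> real \<Rightarrow> real \<Rightarrow> real \<Rightarrow> (plane \<Rightarrow> real^3) set" where
  "admissible_q A B C \<epsilon> =
    (let U = Omega_q \<epsilon>; \<Gamma> = frontier (Omega_q \<epsilon>) \<inter> frontier (Omega \<epsilon>) in
     {q. (\<forall>i. (\<lambda>z. q z $ i) \<in> W12 U) \<and>
       trace_on U \<Gamma> (\<lambda>z. q z $ 1) (q_b A B C \<epsilon>) \<and>
       trace_on U \<Gamma> (\<lambda>z. q z $ 2) (\<lambda>z. 0) \<and>
       trace_on U \<Gamma> (\<lambda>z. q z $ 3) (\<lambda>z. - s_plus A B C / 6) \<and>
       trace_on U (frontier U \<inter> {(x, y). y = x}) (\<lambda>z. q z $ 1) (\<lambda>z. 0) \<and>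
       trace_on U (frontier U \<inter> {(x, y). y = 0}) (\<lambda>z. q z $ 2) (\<lambda>z. 0)})"

definition minimizer_q ::
  "real \<Rightarrow> real \<Rightarrow> real \<Rightarrow> real \<Rightarrow> real \<Rightarrow> real \<Rightarrow> real \<Rightarrow> (plane \<Rightarrow> real^3) \<Rightarrow> bool" where
  "minimizer_q A B C L L2 \<epsilon> lam q \<longleftrightarrow> q \<in> admissible_q A B C \<epsilon> \<and>
     (\<forall>p \<in> admissible_q A B C \<epsilon>.
        energy A B C L L2 lam (Omega_q \<epsilon>) q \<le> energy A B C L L2 lam (Omega_q \<epsilon>) p)"

text \<open>
  The reflections about the axes and the diagonals carry $(x,y)$ to the point
  $(\max(|x|,|y|),\min(|x|,|y|))$ of the closure of \<open>Omega_q \<epsilon>\<close>. The factor \<open>sgn (\<bar>x\<bar> - \<bar>y\<bar>)\<close> is odd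
  about both diagonals and even about both axes; \<open>sgn (x * y)\<close> is even about both diagonals and
  odd about both axes.
\<close>

definition symmetric_extension :: "(plane \<Rightarrow> real^3) \<Rightarrow> plane \<Rightarrow> real^3" where
  "symmetric_extension q = (\<lambda>(x, y).
     let w = (max \<bar>x\<bar> \<bar>y\<bar>, min \<bar>x\<bar> \<bar>y\<bar>) in
     vector [sgn (\<bar>x\<bar> - \<bar>y\<bar>) * q w $ 1, sgn (x * y) * q w $ 2, q w $ 3])"

end

theory Submission
  imports Defs "HOL-Real_Asymp.Real_Asymp"
begin

text \<open>
  The elastic density is a positive definite quadratic form of the gradient (\<open>f_el_coercive\<close>). The bulk potential is a
  quartic polynomial whose leading part dominates the cubic one, so it is convex up to a quadratic defect
  (\<open>f_b_semiconvex\<close>). For fields with vanishing boundary values Poincare's inequality bounds that defect by the elastic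
  energy, with a factor proportional to $\lambda^2$. Hence for small $\lambda$ the energy is uniformly convex along
  increments with vanishing boundary values: $J(q + e) \ge J(q) + J'(q) e + c \int |\nabla e|^2$ (\<open>En_convex\<close>).

  Everything follows from this inequality. Two critical points with the same boundary values have the same gradient
  and therefore agree (\<open>critical_fields_agree\<close>). On the fundamental domain \<open>Omega_q \<epsilon>\<close> a minimizing sequence is a Cauchy
  sequence in $W^{1,2}$, and its limit is a minimizer (\<open>minimizing_fields\<close>). It remains to see that the reflected
  minimizer is a critical point. The densities are invariant under the dihedral group of the square, acting on the
  plane and on the components of \<open>q\<close> (\<open>density_invariant\<close>); so the first variation of the extension in the direction of a
  test field is the first variation of the minimizer in the direction of the symmetrized test field, which satisfies the
  boundary conditions on the fundamental domain (\<open>symmetric_extension_critical\<close>).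

  The analytic work lies in the boundary conditions, which are given by traces on segments. After subtraction of a smooth
  extension of the boundary data (\<open>lift1_boundary\<close>), integration by parts along lines shows that the extension by zero
  has a weak gradient on the whole plane (\<open>trace_zero_W0\<close>), and the same computation on the fundamental domain shows that
  the reflections produce no jumps (\<open>unfold_W0\<close>). Mollification after a slight dilation then approximates the functions
  by test functions (\<open>W0_from_plane\<close>). For these the inequalities of Poincare and of Ladyzhenskaya are elementary
  (\<open>test_poincare\<close>, \<open>test_L4\<close>); the latter makes the quartic bulk energy finite and the first variation continuous.
\<close>

section \<open>Smooth functions on the plane\<close>

abbreviation dx :: "(plane \<Rightarrow> real) \<Rightarrow> plane \<Rightarrow> real" where "dx \<equiv> pderiv_dir (1, 0)"
abbreviation dy :: "(plane \<Rightarrow> real) \<Rightarrow> plane \<Rightarrow> real" where "dy \<equiv> pderiv_dir (0, 1)"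

lemma plane_Basis: "(Basis :: plane set) = {(1, 0), (0, 1)}"
  by (auto simp: Basis_prod_def)

lemma has_derivative_partials:
  assumes "f differentiable at z"
  shows "(f has_derivative (\<lambda>h. fst h * dx f z + snd h * dy f z)) (at z)"
proof -
  have D: "(f has_derivative frechet_derivative f (at z)) (at z)"
    using assms frechet_derivative_works by blast
  interpret bounded_linear "frechet_derivative f (at z)"
    using D by (rule has_derivative_bounded_linear)
  have "frechet_derivative f (at z) h = fst h * dx f z + snd h * dy f z" for h
  proof -
    have "h = fst h *\<^sub>R (1, 0) + snd h *\<^sub>R (0, 1)" by (simp add: prod_eq_iff)
    then have "frechet_derivative f (at z) h = frechet_derivative f (at z) (fst h *\<^sub>R (1, 0) + snd h *\<^sub>R (0, 1))"
      by simp
    then show ?thesis unfolding add scaleR by (simp add: pderiv_dir_def)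
  qed
  then show ?thesis using D by (metis (no_types, lifting) ext)
qed

lemma pderiv_dirI: "(f has_derivative f') (at z) \<Longrightarrow> pderiv_dir v f z = f' v"
  unfolding pderiv_dir_def using frechet_derivative_at by metis

lemma Ck_SucI:
  assumes "\<And>z. (f has_derivative (\<lambda>h. fst h * a z + snd h * b z)) (at z)" "Ck n a" "Ck n b"
  shows "Ck (Suc n) f"
proof -
  have "dx f = a" "dy f = b" using pderiv_dirI[OF assms(1)] by fastforce+
  moreover have "f differentiable_on UNIV"
    using assms(1) unfolding differentiable_on_def differentiable_def by blast
  ultimately show ?thesis using assms by (simp add: plane_Basis)
qed

lemma Ck_SucD:
  assumes "Ck (Suc n) f"
  shows "(f has_derivative (\<lambda>h. fst h * dx f z + snd h * dy f z)) (at z)" (is ?A) "Ck n (dx f)" "Ck n (dy f)"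
proof -
  have "f differentiable (at z)" using assms by (metis Ck.simps(2) UNIV_I differentiable_on_def)
  then show ?A
    by (rule has_derivative_partials)
qed (use assms in \<open>auto simp: plane_Basis\<close>)

lemma Ck_continuous: "Ck n f \<Longrightarrow> continuous_on UNIV f"
  by (metis Ck.simps differentiable_imp_continuous_on not0_implies_Suc)

lemma Ck_Suc_imp: "Ck (Suc n) f \<Longrightarrow> Ck n f"
proof (induction n arbitrary: f)
  case 0
  then show ?case using Ck_continuous[OF 0] by simp
next
  case (Suc n)
  then show ?case by (metis Ck.simps(2))
qed

lemma Ck_const: "Ck n (\<lambda>z. c)"
proof (induction n arbitrary: c)
  case (Suc n)
  show ?case by (rule Ck_SucI[of _ "\<lambda>_. 0" "\<lambda>_. 0"]) (auto intro: Suc)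
qed auto

lemma Ck_fst: "Ck n fst" and Ck_snd: "Ck n snd"
proof -
  show "Ck n fst"
  proof (cases n)
    case (Suc m)
    have "Ck (Suc m) fst"
      by (rule Ck_SucI[of _ "\<lambda>_. 1" "\<lambda>_. 0"]) (auto intro!: derivative_eq_intros Ck_const)
    then show ?thesis using Suc by simp
  qed (auto intro: continuous_intros)
  show "Ck n snd"
  proof (cases n)
    case (Suc m)
    have "Ck (Suc m) snd"
      by (rule Ck_SucI[of _ "\<lambda>_. 0" "\<lambda>_. 1"]) (auto intro!: derivative_eq_intros Ck_const)
    then show ?thesis using Suc by simp
  qed (auto intro: continuous_intros)
qed

lemma Ck_add: "Ck n f \<Longrightarrow> Ck n g \<Longrightarrow> Ck n (\<lambda>z. f z + g z)"
proof (induction n arbitrary: f g)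
  case (Suc n)
  note f = Suc.prems(1) and g = Suc.prems(2)
  have D: "((\<lambda>z. f z + g z) has_derivative (\<lambda>h. fst h * (dx f z + dx g z)
      + snd h * (dy f z + dy g z))) (at z)" for z
    by (rule has_derivative_eq_rhs[OF has_derivative_add[OF Ck_SucD(1)[OF f] Ck_SucD(1)[OF g]]])
      (simp add: algebra_simps)
  show ?case
    by (rule Ck_SucI[OF D]) (intro Suc.IH Ck_SucD(2,3)[OF f] Ck_SucD(2,3)[OF g])+
qed (auto intro: continuous_intros)

lemma Ck_mult: "Ck n f \<Longrightarrow> Ck n g \<Longrightarrow> Ck n (\<lambda>z. f z * g z)"
proof (induction n arbitrary: f g)
  case (Suc n)
  note f = Suc.prems(1) and g = Suc.prems(2)
  have D: "((\<lambda>z. f z * g z) has_derivative (\<lambda>h. fst h * (dx f z * g z + f z * dx g z)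
      + snd h * (dy f z * g z + f z * dy g z))) (at z)" for z
    by (rule has_derivative_eq_rhs[OF has_derivative_mult[OF Ck_SucD(1)[OF f] Ck_SucD(1)[OF g]]])
      (simp add: algebra_simps)
  show ?case
    by (rule Ck_SucI[OF D]) (intro Ck_add Suc.IH Ck_SucD(2,3)[OF f] Ck_SucD(2,3)[OF g] Ck_Suc_imp[OF f] Ck_Suc_imp[OF g])+
qed (auto intro: continuous_intros)

lemma Ck_inverse: "Ck n f \<Longrightarrow> (\<And>z. f z \<noteq> 0) \<Longrightarrow> Ck n (\<lambda>z. inverse (f z))"
proof (induction n arbitrary: f)
  case 0 then show ?case by (auto intro: continuous_intros)
next
  case (Suc n)
  have i: "Ck n (\<lambda>z. inverse (f z))" by (rule Suc.IH[OF Ck_Suc_imp[OF Suc.prems(1)] Suc.prems(2)])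
  have D: "((\<lambda>z. inverse (f z)) has_derivative (\<lambda>h. fst h * ((- 1) * (inverse (f z) * dx f z * inverse (f z)))
      + snd h * ((- 1) * (inverse (f z) * dy f z * inverse (f z))))) (at z)" for z
    by (rule has_derivative_eq_rhs[OF Deriv.has_derivative_inverse[OF Suc.prems(2) Ck_SucD(1)[OF Suc.prems(1)]]])
      (simp add: algebra_simps)
  show ?case
    by (rule Ck_SucI[OF D]) (intro Ck_mult Ck_const i Ck_SucD(2,3)[OF Suc.prems(1)])+
qed

lemma Ck_affine:
  fixes T :: "plane \<Rightarrow> plane"
  assumes "bounded_linear T" "Ck n f"
  shows "Ck n (\<lambda>z. f (T z + c))"
  using assms(2)
proof (induction n arbitrary: f)
  case 0
  have "continuous_on UNIV (\<lambda>z. T z + c)"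
    by (intro continuous_intros linear_continuous_on assms)
  then show ?case using 0 by (auto intro: continuous_on_compose2)
next
  case (Suc n)
  interpret bounded_linear T by fact
  have D: "((\<lambda>z. f (T z + c)) has_derivative
      (\<lambda>h. fst (T h) * dx f (T z + c) + snd (T h) * dy f (T z + c))) (at z)" for z
    by (rule has_derivative_compose[OF _ Ck_SucD(1)[OF Suc.prems]])
      (auto intro!: derivative_eq_intros simp: bounded_linear_imp_has_derivative[OF assms(1)])
  have T: "T h = fst h *\<^sub>R T (1, 0) + snd h *\<^sub>R T (0, 1)" for h
    unfolding scaleR[symmetric] add[symmetric] by (simp add: prod_eq_iff)
  have D': "((\<lambda>z. f (T z + c)) has_derivative
      (\<lambda>h. fst h * (fst (T (1,0)) * dx f (T z + c) + snd (T (1,0)) * dy f (T z + c))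
         + snd h * (fst (T (0,1)) * dx f (T z + c) + snd (T (0,1)) * dy f (T z + c)))) (at z)" for z
    by (rule has_derivative_eq_rhs[OF D]) (rule ext, subst (1 2) T, simp add: algebra_simps)
  show ?case
    by (rule Ck_SucI[OF D']) (intro Ck_add Ck_mult Ck_const Suc.IH Ck_SucD(2,3)[OF Suc.prems])+
qed

lemma smooth_has_derivative:
  "smooth f \<Longrightarrow> (f has_derivative (\<lambda>h. fst h * dx f z + snd h * dy f z)) (at z)"
  using Ck_SucD(1) unfolding smooth_def by blast

lemma pderiv_dir_expand: "smooth f \<Longrightarrow> pderiv_dir v f z = fst v * dx f z + snd v * dy f z"
  using pderiv_dirI[OF smooth_has_derivative] by blast

lemma smooth_const: "smooth (\<lambda>z. c)"
  and smooth_fst: "smooth fst" and smooth_snd: "smooth snd"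
  and smooth_add: "smooth f \<Longrightarrow> smooth g \<Longrightarrow> smooth (\<lambda>z. f z + g z)"
  and smooth_mult: "smooth f \<Longrightarrow> smooth g \<Longrightarrow> smooth (\<lambda>z. f z * g z)"
  and smooth_inverse: "smooth f \<Longrightarrow> (\<And>z. f z \<noteq> 0) \<Longrightarrow> smooth (\<lambda>z. inverse (f z))"
  unfolding smooth_def using Ck_const Ck_fst Ck_snd Ck_add Ck_mult Ck_inverse by blast+

lemma smooth_affine:
  fixes T :: "plane \<Rightarrow> plane"
  shows "bounded_linear T \<Longrightarrow> smooth f \<Longrightarrow> smooth (\<lambda>z. f (T z + c))"
  unfolding smooth_def using Ck_affine by blast

lemma smooth_minus: "smooth f \<Longrightarrow> smooth (\<lambda>z. - f z)"
  using smooth_mult[of "\<lambda>_. -1" f] smooth_const by simp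

lemma smooth_diff: "smooth f \<Longrightarrow> smooth g \<Longrightarrow> smooth (\<lambda>z. f z - g z)"
  using smooth_add[of f "\<lambda>z. - g z"] smooth_minus by simp

lemma smooth_sum: "(\<And>i. i \<in> I \<Longrightarrow> smooth (f i)) \<Longrightarrow> smooth (\<lambda>z. \<Sum>i\<in>I. f i z)"
  by (induction I rule: infinite_finite_induct) (auto intro: smooth_add smooth_const)

lemma smooth_pderiv: "smooth f \<Longrightarrow> smooth (pderiv_dir v f)"
proof -
  assume f: "smooth f"
  have "Ck n (dx f)" "Ck n (dy f)" for n using f Ck_SucD(2,3) unfolding smooth_def by blast+
  then have "smooth (dx f)" "smooth (dy f)" unfolding smooth_def by blast+
  then have "smooth (\<lambda>z. fst v * dx f z + snd v * dy f z)"
    by (intro smooth_add smooth_mult smooth_const)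
  moreover have "pderiv_dir v f = (\<lambda>z. fst v * dx f z + snd v * dy f z)"
    using pderiv_dir_expand[OF f] by blast
  ultimately show ?thesis by simp
qed

lemmas smooth_intros = smooth_const smooth_fst smooth_snd smooth_add smooth_mult smooth_minus
  smooth_diff smooth_sum smooth_pderiv

lemma smooth_continuous: "smooth f \<Longrightarrow> continuous_on UNIV f"
  unfolding smooth_def using Ck_continuous by blast

lemma smooth_borel [measurable_dest]: "smooth f \<Longrightarrow> f \<in> borel_measurable borel"
  by (rule borel_measurable_continuous_onI[OF smooth_continuous])

lemma pderiv_add: "smooth f \<Longrightarrow> smooth g \<Longrightarrow>
    pderiv_dir v (\<lambda>z. f z + g z) z = pderiv_dir v f z + pderiv_dir v g z"
  using pderiv_dirI[OF has_derivative_add[OF smooth_has_derivative[of f z] smooth_has_derivative[of g z]], of v]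
  by (simp add: pderiv_dir_expand[of _ v] algebra_simps)

lemma pderiv_mult: "smooth f \<Longrightarrow> smooth g \<Longrightarrow>
    pderiv_dir v (\<lambda>z. f z * g z) z = f z * pderiv_dir v g z + pderiv_dir v f z * g z"
  using pderiv_dirI[OF has_derivative_mult[OF smooth_has_derivative[of f z] smooth_has_derivative[of g z]], of v]
  by (simp add: pderiv_dir_expand[of _ v] algebra_simps)

lemma pderiv_const [simp]: "pderiv_dir v (\<lambda>z. c) z = 0"
  using pderiv_dirI[OF has_derivative_const] by blast

lemma pderiv_cmult: "smooth f \<Longrightarrow> pderiv_dir v (\<lambda>z. c * f z) z = c * pderiv_dir v f z"
  using pderiv_mult[OF smooth_const, of f v c z] by simp

lemma pderiv_sum: "finite I \<Longrightarrow> (\<And>i. i \<in> I \<Longrightarrow> smooth (f i)) \<Longrightarrow>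
    pderiv_dir v (\<lambda>z. \<Sum>i\<in>I. f i z) z = (\<Sum>i\<in>I. pderiv_dir v (f i) z)"
proof (induction I rule: finite_induct)
  case (insert i I)
  then have "pderiv_dir v (\<lambda>z. f i z + (\<Sum>i\<in>I. f i z)) z = pderiv_dir v (f i) z + pderiv_dir v (\<lambda>z. \<Sum>i\<in>I. f i z) z"
    by (intro pderiv_add smooth_sum) auto
  then show ?case using insert by simp
qed simp

lemma pderiv_affine:
  fixes T :: "plane \<Rightarrow> plane"
  assumes "bounded_linear T" "smooth f"
  shows "pderiv_dir v (\<lambda>z. f (T z + c)) z = pderiv_dir (T v) f (T z + c)"
proof -
  have "((\<lambda>z. f (T z + c)) has_derivative
      (\<lambda>h. fst (T h) * dx f (T z + c) + snd (T h) * dy f (T z + c))) (at z)"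
    by (rule has_derivative_compose[OF _ smooth_has_derivative[OF assms(2)]])
      (auto intro!: derivative_eq_intros simp: bounded_linear_imp_has_derivative[OF assms(1)])
  from pderiv_dirI[OF this] show ?thesis by (simp add: pderiv_dir_expand[OF assms(2), of "T v"])
qed

section \<open>Smooth cutoff functions\<close>

definition flat :: "nat \<Rightarrow> real \<Rightarrow> real" where
  "flat k t = (if t > 0 then exp (- (1 / t)) / t ^ k else 0)"

text \<open>Bounding the exponential series from below by one term shows that \<open>flat k\<close> vanishes at 0 faster than
  every power; this is what makes it differentiable there.\<close>

lemma flat_le:
  assumes "t > 0"
  shows "flat k t \<le> fact (k + n) * t ^ n"
proof -
  have "(1 / t) ^ (k + n) /\<^sub>R fact (k + n) \<le> (\<Sum>m. (1 / t) ^ m /\<^sub>R fact m)"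
    using sum_le_suminf[OF summable_exp_generic[of "1/t"], of "{k + n}"] assms by auto
  then have "(1 / t) ^ (k + n) /\<^sub>R fact (k + n) \<le> exp (1 / t)"
    unfolding exp_def .
  then have "(1 / t) ^ (k + n) \<le> fact (k + n) * exp (1 / t)"
    by (simp add: divide_inverse_commute[symmetric] pos_divide_le_eq mult.commute)
  then show ?thesis
    using assms by (simp add: flat_def exp_minus field_simps power_add)
qed

lemma flat_nonneg: "flat k t \<ge> 0" by (simp add: flat_def)
lemma flat_pos: "t > 0 \<Longrightarrow> flat k t > 0" by (simp add: flat_def)
lemma flat_eq_0: "t \<le> 0 \<Longrightarrow> flat k t = 0" by (simp add: flat_def)
lemma flat_le_1: "flat 0 t \<le> 1" by (simp add: flat_def)

lemma flat_deriv:
  "(flat k has_real_derivative flat (k + 2) t - real k * flat (k + 1) t) (at t)"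
proof (cases t "0::real" rule: linorder_cases)
  case less
  have "((\<lambda>_. 0) has_real_derivative 0) (at t)" by simp
  then have "(flat k has_real_derivative 0) (at t)"
    by (rule has_field_derivative_transform_within_open[where S="{..<0}"]) (use less in \<open>auto simp: flat_def\<close>)
  then show ?thesis using less by (simp add: flat_def)
next
  case greater
  have "((\<lambda>t. exp (- (1 / t)) / t ^ k) has_real_derivative flat (k + 2) t - real k * flat (k + 1) t) (at t)"
  proof (cases k)
    case (Suc n)
    have "((\<lambda>t. exp (- (1 / t)) / t ^ k) has_real_derivative
       (exp (- (1 / t)) * (1 / t\<^sup>2) * t ^ k - exp (- (1 / t)) * (real k * t ^ n)) / (t ^ k * t ^ k)) (at t)"
    proof (rule DERIV_divide)
      show "((\<lambda>t. exp (- (1 / t))) has_real_derivative exp (- (1 / t)) * (1 / t\<^sup>2)) (at t)"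
        using greater by (auto intro!: derivative_eq_intros simp: power2_eq_square)
      show "((\<lambda>t. t ^ k) has_real_derivative real k * t ^ n) (at t)"
        using DERIV_pow[of k t] Suc by simp
    qed (use greater in auto)
    moreover have "(exp (- (1 / t)) * (1 / t\<^sup>2) * t ^ k - exp (- (1 / t)) * (real k * t ^ n)) / (t ^ k * t ^ k)
       = flat (k + 2) t - real k * flat (k + 1) t"
      using greater Suc by (simp add: flat_def divide_simps power2_eq_square) (simp add: algebra_simps)
    ultimately show ?thesis by simp
  qed (use greater in \<open>auto intro!: derivative_eq_intros simp: flat_def field_simps power2_eq_square\<close>)
  then show ?thesis
    by (rule has_field_derivative_transform_within_open[where S="{0<..}"]) (use greater in \<open>auto simp: flat_def\<close>)
next
  case equal
  have "((\<lambda>h. (flat k h - flat k 0) / (h - 0)) \<longlongrightarrow> 0) (at 0)"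
  proof (rule Lim_null_comparison)
    show "\<forall>\<^sub>F h in at 0. norm ((flat k h - flat k 0) / (h - 0)) \<le> fact (k + 2) * \<bar>h\<bar>"
    proof (rule always_eventually, rule allI)
      fix h :: real
      show "norm ((flat k h - flat k 0) / (h - 0)) \<le> fact (k + 2) * \<bar>h\<bar>" (is "_ \<le> ?c * _")
      proof (cases "h > 0")
        case True
        then show ?thesis using flat_le[OF True, of k 2] flat_nonneg[of k h]
          by (simp add: flat_eq_0 divide_le_eq power2_eq_square mult.assoc)
      next
        case False
        have "0 \<le> ?c * \<bar>h\<bar>" by (intro mult_nonneg_nonneg) auto
        then show ?thesis using False by (simp add: flat_eq_0 del: fact_Suc add_2_eq_Suc')
      qed
    qed
    show "((\<lambda>h::real. fact (k + 2) * \<bar>h\<bar>) \<longlongrightarrow> 0) (at 0)"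
      by (auto intro!: tendsto_eq_intros)
  qed
  then show ?thesis using equal by (simp add: has_field_derivative_iff flat_eq_0)
qed

text \<open>All derivatives of a flat function are combinations of flat functions, so one induction
  over the order of differentiability, for all flat functions at once, gives smoothness.\<close>

lemma smooth_flat: "smooth p \<Longrightarrow> smooth (\<lambda>z. flat k (p z))"
proof -
  assume p: "smooth p"
  have "Ck n (\<lambda>z. flat k (p z))" for n
  proof (induction n arbitrary: k)
    case 0
    have "continuous_on UNIV (flat k)"
      using flat_deriv DERIV_isCont by (metis continuous_at_imp_continuous_on)
    then show ?case using smooth_continuous[OF p] by (auto intro: continuous_on_compose2)
  next
    case (Suc n)
    have q: "Ck m (dx p)" "Ck m (dy p)" for m
      using p smooth_pderiv unfolding smooth_def by blast+
    have D: "((\<lambda>z. flat k (p z)) has_derivative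
        (\<lambda>h. fst h * ((flat (k + 2) (p z) + (- real k) * flat (k + 1) (p z)) * dx p z)
           + snd h * ((flat (k + 2) (p z) + (- real k) * flat (k + 1) (p z)) * dy p z))) (at z)" for z
      by (rule has_derivative_eq_rhs[OF has_derivative_compose[OF smooth_has_derivative[OF p]
             flat_deriv[unfolded has_field_derivative_def]]]) (simp add: algebra_simps)
    show ?case
      by (rule Ck_SucI[OF D]) (intro Ck_mult Ck_add Ck_const Suc q)+
  qed
  then show ?thesis unfolding smooth_def by blast
qed

section \<open>Square-integrable functions\<close>

lemma L2_D: "L2_fun M f \<Longrightarrow> f \<in> borel_measurable M" "L2_fun M f \<Longrightarrow> integrable M (\<lambda>z. (f z)\<^sup>2)"
  by (auto simp: L2_fun_def)

lemma L2_dominated: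
  assumes "f \<in> borel_measurable M" "integrable M g" "\<And>z. (f z)\<^sup>2 \<le> g z"
  shows "L2_fun M f"
  unfolding L2_fun_def
proof
  show "integrable M (\<lambda>z. (f z)\<^sup>2)"
    by (rule Bochner_Integration.integrable_bound[OF assms(2)])
      (use assms in \<open>auto intro!: AE_I2 order_trans[OF assms(3) abs_ge_self]\<close>)
qed (use assms in auto)

lemma L2_mult_integrable: "L2_fun M f \<Longrightarrow> L2_fun M g \<Longrightarrow> integrable M (\<lambda>z. f z * g z)"
proof -
  assume f: "L2_fun M f" and g: "L2_fun M g"
  have "\<bar>f z * g z\<bar> \<le> (f z)\<^sup>2 + (g z)\<^sup>2" for z
    using sum_squares_bound[of "\<bar>f z\<bar>" "\<bar>g z\<bar>"] mult_nonneg_nonneg[of "\<bar>f z\<bar>" "\<bar>g z\<bar>"]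
    unfolding abs_mult power2_abs by linarith
  then show ?thesis
    by (intro Bochner_Integration.integrable_bound[OF Bochner_Integration.integrable_add[OF L2_D(2)[OF f] L2_D(2)[OF g]]])
      (use L2_D(1)[OF f] L2_D(1)[OF g] in auto)
qed

lemma L2_cmult: "L2_fun M f \<Longrightarrow> L2_fun M (\<lambda>z. c * f z)"
  by (auto simp: L2_fun_def power_mult_distrib)

lemma L2_zero: "L2_fun M (\<lambda>z. 0)" by (simp add: L2_fun_def)

lemma sq_add_le: "(a + b)\<^sup>2 \<le> 2 * a\<^sup>2 + 2 * (b::real)\<^sup>2"
  using sum_squares_bound[of a b] by (simp add: power2_sum)

lemma sq_diff_le: "(a - b)\<^sup>2 \<le> 2 * a\<^sup>2 + 2 * (b::real)\<^sup>2"
  using sq_add_le[of a "-b"] by simp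

lemma L2_add: "L2_fun M f \<Longrightarrow> L2_fun M g \<Longrightarrow> L2_fun M (\<lambda>z. f z + g z)"
  by (rule L2_dominated[of _ _ "\<lambda>z. 2 * (f z)\<^sup>2 + 2 * (g z)\<^sup>2"]) (auto simp: L2_fun_def sq_add_le)

lemma L2_diff: "L2_fun M f \<Longrightarrow> L2_fun M g \<Longrightarrow> L2_fun M (\<lambda>z. f z - g z)"
  by (rule L2_dominated[of _ _ "\<lambda>z. 2 * (f z)\<^sup>2 + 2 * (g z)\<^sup>2"]) (auto simp: L2_fun_def sq_diff_le)

lemma L2_cong_AE: "L2_fun M f \<Longrightarrow> g \<in> borel_measurable M \<Longrightarrow> AE z in M. f z = g z \<Longrightarrow> L2_fun M g"
  unfolding L2_fun_def
  by (auto intro!: integrable_cong_AE_imp[of M "\<lambda>z. (f z)\<^sup>2" "\<lambda>z. (g z)\<^sup>2"] elim: AE_mp)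

lemma (in finite_measure) L2_bounded:
  assumes "f \<in> borel_measurable M" "\<And>z. z \<in> space M \<Longrightarrow> \<bar>f z\<bar> \<le> B"
  shows "L2_fun M f"
  unfolding L2_fun_def
proof
  show "integrable M (\<lambda>z. (f z)\<^sup>2)"
  proof (rule integrable_const_bound[of _ "B\<^sup>2"])
    show "AE z in M. norm ((f z)\<^sup>2) \<le> B\<^sup>2"
      using assms(2) by (auto intro!: AE_I2) (metis abs_le_square_iff abs_of_nonneg abs_ge_zero order_trans)
  qed (use assms in auto)
qed (use assms in auto)

lemma (in finite_measure) L2_integrable: "L2_fun M f \<Longrightarrow> integrable M f"
  using L2_mult_integrable[of M f "\<lambda>_. 1"] L2_bounded[of "\<lambda>_. 1" 1] by auto

lemma integral_sq_add_le:
  assumes "L2_fun M f" "L2_fun M g"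
  shows "(LINT z|M. (f z + g z)\<^sup>2) \<le> 2 * (LINT z|M. (f z)\<^sup>2) + 2 * (LINT z|M. (g z)\<^sup>2)"
proof -
  have "(LINT z|M. (f z + g z)\<^sup>2) \<le> (LINT z|M. 2 * (f z)\<^sup>2 + 2 * (g z)\<^sup>2)"
    by (rule integral_mono) (use assms L2_add[OF assms] in \<open>auto simp: L2_fun_def sq_add_le\<close>)
  then show ?thesis using assms by (simp add: L2_fun_def)
qed

lemma L2_tendsto_D:
  assumes "L2_tendsto M f g"
  shows "L2_fun M (f n)" "L2_fun M g" "(\<lambda>n. LINT z|M. (f n z - g z)\<^sup>2) \<longlonglongrightarrow> 0"
  using assms by (auto simp: L2_tendsto_def)

lemma L2_tendsto_const: "L2_fun M f \<Longrightarrow> L2_tendsto M (\<lambda>_. f) f"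
  by (simp add: L2_tendsto_def)

lemma L2_tendsto_cmult: "L2_tendsto M f g \<Longrightarrow> L2_tendsto M (\<lambda>n z. c * f n z) (\<lambda>z. c * g z)"
proof -
  assume a: "L2_tendsto M f g"
  have "(\<lambda>n. c\<^sup>2 * (LINT z|M. (f n z - g z)\<^sup>2)) \<longlonglongrightarrow> c\<^sup>2 * 0"
    by (intro tendsto_intros L2_tendsto_D(3)[OF a])
  moreover have "(c * f n z - c * g z)\<^sup>2 = c\<^sup>2 * (f n z - g z)\<^sup>2" for n z
    by (simp add: power_mult_distrib[symmetric] right_diff_distrib)
  ultimately show ?thesis using a by (auto simp: L2_tendsto_def L2_cmult)
qed

lemma L2_tendsto_add:
  assumes "L2_tendsto M f g" "L2_tendsto M f' g'"
  shows "L2_tendsto M (\<lambda>n z. f n z + f' n z) (\<lambda>z. g z + g' z)"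
  unfolding L2_tendsto_def
proof (intro conjI allI)
  note D = L2_tendsto_D[OF assms(1)] L2_tendsto_D[OF assms(2)]
  show "(\<lambda>n. LINT z|M. (f n z + f' n z - (g z + g' z))\<^sup>2) \<longlonglongrightarrow> 0"
  proof (rule tendsto_sandwich[OF _ _ tendsto_const])
    show "(\<lambda>n. 2 * (LINT z|M. (f n z - g z)\<^sup>2) + 2 * (LINT z|M. (f' n z - g' z)\<^sup>2)) \<longlonglongrightarrow> 0"
      using tendsto_add[OF tendsto_mult_left[OF D(3), of 2] tendsto_mult_left[OF D(6), of 2]] by simp
    have "f n z + f' n z - (g z + g' z) = (f n z - g z) + (f' n z - g' z)" for n z by simp
    then show "\<forall>\<^sub>F n in sequentially. (LINT z|M. (f n z + f' n z - (g z + g' z))\<^sup>2)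
        \<le> 2 * (LINT z|M. (f n z - g z)\<^sup>2) + 2 * (LINT z|M. (f' n z - g' z)\<^sup>2)"
      by (intro always_eventually allI) (simp only: integral_sq_add_le[OF L2_diff L2_diff] D)
  qed auto
qed (auto intro: L2_add L2_tendsto_D[OF assms(1)] L2_tendsto_D[OF assms(2)])

lemma L2_tendsto_diff:
  assumes "L2_tendsto M f g" "L2_tendsto M f' g'"
  shows "L2_tendsto M (\<lambda>n z. f n z - f' n z) (\<lambda>z. g z - g' z)"
  using L2_tendsto_add[OF assms(1) L2_tendsto_cmult[OF assms(2), of "-1"]] by simp

lemma L2_tendsto_cong_AE:
  assumes "L2_tendsto M f g" "g' \<in> borel_measurable M" "AE z in M. g z = g' z"
  shows "L2_tendsto M f g'"
  unfolding L2_tendsto_def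
proof (intro conjI allI)
  have "(LINT z|M. (f n z - g' z)\<^sup>2) = (LINT z|M. (f n z - g z)\<^sup>2)" for n
    by (rule integral_cong_AE)
      (use assms(2,3) L2_D(1)[OF L2_tendsto_D(1)[OF assms(1)]] L2_D(1)[OF L2_tendsto_D(2)[OF assms(1)]] in auto)
  then show "(\<lambda>n. LINT z|M. (f n z - g' z)\<^sup>2) \<longlonglongrightarrow> 0" using L2_tendsto_D(3)[OF assms(1)] by simp
qed (use assms L2_cong_AE L2_tendsto_D[OF assms(1)] in \<open>auto\<close>)

lemma young_sq: "\<eta> > 0 \<Longrightarrow> \<bar>a * b\<bar> \<le> \<eta> * a\<^sup>2 + b\<^sup>2 / (\<eta>::real)"
proof -
  assume e: "\<eta> > 0"
  have "0 \<le> (\<eta> * \<bar>a\<bar> - \<bar>b\<bar>)\<^sup>2 / \<eta>" using e by simp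
  also have "\<dots> = \<eta> * a\<^sup>2 + b\<^sup>2 / \<eta> - 2 * \<bar>a * b\<bar>"
    using e by (simp add: power2_diff abs_mult field_simps power2_eq_square)
  finally show ?thesis using abs_ge_zero[of "a * b"] by linarith
qed

text \<open>The workhorse for limits: a quantity that Young's inequality bounds by \<open>\<eta> * K + r n / \<eta>\<^sup>k\<close>, for all
  \<open>\<eta>\<close>, tends to zero with \<open>r\<close>.\<close>

lemma tendsto_0_young:
  assumes "r \<longlonglongrightarrow> (0::real)" "K \<ge> 0" "\<And>n \<eta>. \<eta> > 0 \<Longrightarrow> \<bar>x n\<bar> \<le> \<eta> * K + r n / \<eta> ^ k"
  shows "x \<longlonglongrightarrow> (0::real)"
proof (rule LIMSEQ_I)
  fix e :: real assume e: "e > 0"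
  define \<eta> where "\<eta> = e / (2 * (K + 1))"
  have h: "\<eta> > 0" using e assms(2) by (simp add: \<eta>_def)
  have "(\<lambda>n. r n / \<eta> ^ k) \<longlonglongrightarrow> 0 / \<eta> ^ k" by (intro tendsto_intros assms) (use h in auto)
  then have "(\<lambda>n. r n / \<eta> ^ k) \<longlonglongrightarrow> 0" by simp
  then obtain N where N: "\<And>n. n \<ge> N \<Longrightarrow> norm (r n / \<eta> ^ k - 0) < e / 2"
    using LIMSEQ_D[of _ 0 "e/2"] e by (meson half_gt_zero)
  have "\<eta> * K \<le> e / 2"
    using e assms(2) by (simp add: \<eta>_def field_simps)
  then have "norm (x n - 0) < e" if "n \<ge> N" for n
  proof -
    have "r n / \<eta> ^ k < e / 2" using N[OF that] unfolding real_norm_def diff_0_right by linarith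
    then show ?thesis using assms(3)[OF h, of n] \<open>\<eta> * K \<le> e / 2\<close>
      unfolding real_norm_def diff_0_right by linarith
  qed
  then show "\<exists>N. \<forall>n\<ge>N. norm (x n - 0) < e" by blast
qed

lemma integral_mult_young:
  assumes "L2_fun M f" "L2_fun M g" "\<eta> > 0"
  shows "\<bar>LINT z|M. f z * g z\<bar> \<le> \<eta> * (LINT z|M. (f z)\<^sup>2) + (LINT z|M. (g z)\<^sup>2) / \<eta>"
proof -
  have "\<bar>LINT z|M. f z * g z\<bar> \<le> (LINT z|M. \<bar>f z * g z\<bar>)" by (rule integral_abs_bound)
  also have "\<dots> \<le> (LINT z|M. \<eta> * (f z)\<^sup>2 + (g z)\<^sup>2 / \<eta>)"
    by (rule integral_mono) (use assms young_sq L2_mult_integrable[OF assms(1,2)] in \<open>auto simp: L2_fun_def\<close>)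
  also have "\<dots> = \<eta> * (LINT z|M. (f z)\<^sup>2) + (LINT z|M. (g z)\<^sup>2) / \<eta>"
    using assms by (simp add: L2_fun_def)
  finally show ?thesis .
qed

lemma L2_tendsto_inner:
  assumes "L2_tendsto M f g" "L2_fun M h"
  shows "(\<lambda>n. LINT z|M. f n z * h z) \<longlonglongrightarrow> (LINT z|M. g z * h z)"
proof -
  note D = L2_tendsto_D[OF assms(1)]
  have "(\<lambda>n. LINT z|M. h z * (f n z - g z)) \<longlonglongrightarrow> 0"
    by (rule tendsto_0_young[OF D(3), of "LINT z|M. (h z)\<^sup>2" _ 1])
      (use integral_mult_young[OF assms(2) L2_diff[OF D(1,2)]] in auto)
  moreover have "(LINT z|M. h z * (f n z - g z)) = (LINT z|M. f n z * h z) - (LINT z|M. g z * h z)" for n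
    using L2_mult_integrable[OF D(1) assms(2)] L2_mult_integrable[OF D(2) assms(2)]
    by (simp add: right_diff_distrib mult.commute)
  ultimately show ?thesis using LIM_zero_iff[of "\<lambda>n. LINT z|M. f n z * h z"] by simp
qed

lemma L2_tendsto_sq:
  assumes "L2_tendsto M f g"
  shows "(\<lambda>n. LINT z|M. (f n z)\<^sup>2) \<longlonglongrightarrow> (LINT z|M. (g z)\<^sup>2)"
proof -
  note D = L2_tendsto_D[OF assms]
  have "(LINT z|M. (f n z)\<^sup>2) = (LINT z|M. (f n z - g z)\<^sup>2) + 2 * (LINT z|M. f n z * g z) - (LINT z|M. (g z)\<^sup>2)" for n
  proof -
    have "(\<lambda>z. (f n z)\<^sup>2) = (\<lambda>z. (f n z - g z)\<^sup>2 + 2 * (f n z * g z) - (g z)\<^sup>2)"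
      by (auto simp: power2_eq_square algebra_simps)
    then show ?thesis
      using L2_D(2)[OF L2_diff[OF D(1,2)]] L2_mult_integrable[OF D(1,2)] L2_D(2)[OF D(2)] by simp
  qed
  moreover have "(\<lambda>n. (LINT z|M. (f n z - g z)\<^sup>2) + 2 * (LINT z|M. f n z * g z) - (LINT z|M. (g z)\<^sup>2))
    \<longlonglongrightarrow> 0 + 2 * (LINT z|M. g z * g z) - (LINT z|M. (g z)\<^sup>2)"
    by (intro tendsto_intros D(3) L2_tendsto_inner[OF assms D(2)])
  ultimately show ?thesis by (simp add: power2_eq_square)
qed

lemma L2_tendsto_subseq_AE:
  assumes "L2_tendsto M f g"
  shows "\<exists>r::nat\<Rightarrow>nat. strict_mono r \<and> (AE z in M. (\<lambda>n. f (r n) z) \<longlonglongrightarrow> g z)"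
proof -
  note D = L2_tendsto_D[OF assms]
  obtain r :: "nat \<Rightarrow> nat" where r: "strict_mono r" "AE z in M. (\<lambda>n. (f (r n) z - g z)\<^sup>2) \<longlonglongrightarrow> 0"
    using tendsto_L1_AE_subseq[of M "\<lambda>n z. (f n z - g z)\<^sup>2"] D(3) L2_D(2)[OF L2_diff[OF D(1,2)]] by auto
  have "AE z in M. (\<lambda>n. f (r n) z) \<longlonglongrightarrow> g z"
    using r(2)
  proof eventually_elim
    case (elim z)
    have "(\<lambda>n. sqrt ((f (r n) z - g z)\<^sup>2)) \<longlonglongrightarrow> sqrt 0" by (intro tendsto_intros elim)
    then have "(\<lambda>n. f (r n) z - g z) \<longlonglongrightarrow> 0" by (simp add: tendsto_rabs_zero_iff)
    then show ?case by (simp add: LIM_zero_iff)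
  qed
  then show ?thesis using r by blast
qed

lemma L2_Fatou:
  assumes "\<And>n. f n \<in> borel_measurable M" "g \<in> borel_measurable M" "AE z in M. (\<lambda>n. f n z) \<longlonglongrightarrow> g z"
    "\<And>n. integrable M (\<lambda>z. f n z :: real)" "\<And>n z. f n z \<ge> 0" "\<And>n. (LINT z|M. f n z) \<le> c n" "c \<longlonglongrightarrow> C"
  shows "integrable M g" "(LINT z|M. g z) \<le> C"
proof -
  have gpos: "AE z in M. g z \<ge> 0"
    using assms(3) by eventually_elim (use assms(5) LIMSEQ_le_const in blast)
  have "0 \<le> (LINT z|M. f n z)" for n
    using assms(5) by (intro Bochner_Integration.integral_nonneg) auto
  then have "0 \<le> c n" for n using assms(6)[of n] by (meson order_trans)
  then have "C \<ge> 0" using LIMSEQ_le_const[OF assms(7)] by blast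
  have "(\<integral>\<^sup>+z. ennreal (g z) \<partial>M) = (\<integral>\<^sup>+z. liminf (\<lambda>n. ennreal (f n z)) \<partial>M)"
  proof (rule nn_integral_cong_AE)
    show "AE z in M. ennreal (g z) = liminf (\<lambda>n. ennreal (f n z))"
      using assms(3)
    proof eventually_elim
      case (elim z)
      then have "(\<lambda>n. ennreal (f n z)) \<longlonglongrightarrow> ennreal (g z)" by (rule tendsto_ennrealI)
      then show ?case using lim_imp_Liminf sequentially_bot by metis
    qed
  qed
  also have "\<dots> \<le> liminf (\<lambda>n. \<integral>\<^sup>+z. ennreal (f n z) \<partial>M)"
    by (rule nn_integral_liminf) (use assms(1) in auto)
  also have "\<dots> \<le> liminf (\<lambda>n. ennreal (c n))"
    by (rule Liminf_mono) (use assms(4,5,6) in \<open>auto intro!: always_eventually simp: nn_integral_eq_integral ennreal_leI\<close>)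
  also have "\<dots> = ennreal C"
    using tendsto_ennrealI[OF assms(7)] lim_imp_Liminf sequentially_bot by metis
  finally have le: "(\<integral>\<^sup>+z. ennreal (g z) \<partial>M) \<le> ennreal C" .
  show i: "integrable M g"
    by (rule integrableI_nonneg[OF assms(2) gpos]) (use le in \<open>auto simp: less_top[symmetric] top_unique\<close>)
  show "(LINT z|M. g z) \<le> C"
    using le \<open>C \<ge> 0\<close> by (simp add: nn_integral_eq_integral[OF i gpos])
qed

text \<open>On a finite measure space an \<open>L\<^sup>2\<close> Cauchy sequence is Cauchy in \<open>L\<^sup>1\<close>, so a subsequence converges almost
  everywhere; Fatou's lemma identifies its limit as the limit in \<open>L\<^sup>2\<close>.\<close>

lemma (in finite_measure) L2_complete:
  fixes f :: "nat \<Rightarrow> 'a \<Rightarrow> real"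
  assumes f: "\<And>n. L2_fun M (f n)"
    and C: "\<And>e. e > 0 \<Longrightarrow> \<exists>N. \<forall>i\<ge>N. \<forall>j\<ge>N. (LINT z|M. (f i z - f j z)\<^sup>2) < e"
  shows "\<exists>g. L2_tendsto M f g"
proof -
  have d: "L2_fun M (\<lambda>z. \<bar>f i z - f j z\<bar>)" for i j
    using L2_diff[OF f f, of i j] by (auto simp: L2_fun_def)
  have one: "L2_fun M (\<lambda>_. 1)" by (rule L2_bounded[of _ 1]) auto
  have C1: "\<exists>N. \<forall>i\<ge>N. \<forall>j\<ge>N. (LINT z|M. norm (f i z - f j z)) < e" if e: "e > 0" for e
  proof -
    define m where "m = measure M (space M) + 1"
    have m: "m > 0" by (simp add: m_def add_nonneg_pos)
    define \<eta> where "\<eta> = e / (2 * m)"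
    have h: "\<eta> > 0" using e m by (simp add: \<eta>_def)
    obtain N where N: "\<And>i j. i \<ge> N \<Longrightarrow> j \<ge> N \<Longrightarrow> (LINT z|M. (f i z - f j z)\<^sup>2) < \<eta> * (e / 2)"
      using C[of "\<eta> * (e / 2)"] h e by auto
    have "(LINT z|M. norm (f i z - f j z)) < e" if "i \<ge> N" "j \<ge> N" for i j
    proof -
      have "(LINT z|M. norm (f i z - f j z)) = (LINT z|M. 1 * \<bar>f i z - f j z\<bar>)" by simp
      also have "\<dots> \<le> \<eta> * (LINT z|M. 1\<^sup>2) + (LINT z|M. \<bar>f i z - f j z\<bar>\<^sup>2) / \<eta>"
        using integral_mult_young[OF one d h] abs_ge_self order_trans by blast
      also have "\<dots> \<le> \<eta> * m + (LINT z|M. (f i z - f j z)\<^sup>2) / \<eta>"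
        using h by (simp add: m_def)
      also have "\<dots> < \<eta> * m + e / 2"
        using N[OF that] h by (simp add: divide_less_eq mult.commute)
      also have "\<dots> = e" using m by (simp add: \<eta>_def)
      finally show ?thesis .
    qed
    then show ?thesis by blast
  qed
  obtain r where r: "strict_mono r" "AE z in M. Cauchy (\<lambda>i. f (r i) z)"
    using cauchy_L1_AE_cauchy_subseq[of M f] L2_integrable[OF f] C1 by blast
  define g where "g z = lim (\<lambda>i. f (r i) z)" for z
  have [measurable]: "f i \<in> borel_measurable M" for i using f by (simp add: L2_fun_def)
  have [measurable]: "g \<in> borel_measurable M" unfolding g_def by measurable
  have lim: "AE z in M. (\<lambda>i. f (r i) z) \<longlonglongrightarrow> g z"
    using r(2) by eventually_elim (auto simp: g_def Cauchy_convergent_iff convergent_LIMSEQ_iff)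
  have key: "integrable M (\<lambda>z. (f i z - g z)\<^sup>2) \<and> (LINT z|M. (f i z - g z)\<^sup>2) \<le> e"
    if N: "\<forall>i\<ge>N. \<forall>j\<ge>N. (LINT z|M. (f i z - f j z)\<^sup>2) < e" and i: "i \<ge> N" for N e i
  proof -
    have rN: "r (j + N) \<ge> N" for j using seq_suble[OF r(1), of "j + N"] by simp
    have 1: "AE z in M. (\<lambda>j. (f i z - f (r (j + N)) z)\<^sup>2) \<longlonglongrightarrow> (f i z - g z)\<^sup>2"
      using lim by eventually_elim (intro tendsto_intros LIMSEQ_ignore_initial_segment)
    show ?thesis
      using L2_Fatou[OF _ _ 1, of "\<lambda>_. e" e] N i rN L2_D(2)[OF L2_diff[OF f f]]
      by (auto intro: less_imp_le)
  qed
  obtain N1 where "\<forall>i\<ge>N1. \<forall>j\<ge>N1. (LINT z|M. (f i z - f j z)\<^sup>2) < 1" using C[of 1] by auto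
  from key[OF this order_refl] have "L2_fun M (\<lambda>z. f N1 z - g z)" by (simp add: L2_fun_def)
  from L2_diff[OF f[of N1] this] have g: "L2_fun M g" by simp
  have "(\<lambda>n. LINT z|M. (f n z - g z)\<^sup>2) \<longlonglongrightarrow> 0"
  proof (rule LIMSEQ_I)
    fix e :: real assume "e > 0"
    then obtain N where N: "\<forall>i\<ge>N. \<forall>j\<ge>N. (LINT z|M. (f i z - f j z)\<^sup>2) < e / 2" using C[of "e/2"] by auto
    then show "\<exists>N. \<forall>n\<ge>N. norm ((LINT z|M. (f n z - g z)\<^sup>2) - 0) < e"
      using key[OF N] \<open>e > 0\<close> by (intro exI[of _ N]) fastforce
  qed
  then show ?thesis using f g by (auto simp: L2_tendsto_def)
qed

lemma L2_fun_subset: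
  assumes "U \<in> sets lebesgue" "V \<in> sets lebesgue" "U \<subseteq> V" "L2_fun (lebesgue_on V) f"
  shows "L2_fun (lebesgue_on U) f"
proof -
  have m: "f \<in> borel_measurable (lebesgue_on U)"
    using L2_D(1)[OF assms(4)] assms(3) measurable_restrict_mono by blast
  have "U \<in> sets (lebesgue_on V)" using assms by (simp add: sets_restrict_space_iff)
  then have "integrable (lebesgue_on V) (\<lambda>z. indicator U z *\<^sub>R (f z)\<^sup>2)"
    using L2_D(2)[OF assms(4)] by (rule integrable_mult_indicator)
  then have "integrable lebesgue (\<lambda>z. indicator V z *\<^sub>R (indicator U z *\<^sub>R (f z)\<^sup>2))"
    using assms by (simp add: integrable_restrict_space)
  moreover have "(\<lambda>z. indicator V z *\<^sub>R (indicator U z *\<^sub>R (f z)\<^sup>2)) = (\<lambda>z. indicator U z *\<^sub>R (f z)\<^sup>2)"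
    using assms(3) by (intro ext) (auto simp: indicator_def)
  ultimately show ?thesis using assms m by (simp add: L2_fun_def integrable_restrict_space)
qed

lemma integral_sq_subset:
  assumes "U \<in> sets lebesgue" "V \<in> sets lebesgue" "U \<subseteq> V" "L2_fun (lebesgue_on V) f"
  shows "(LINT z|lebesgue_on U. (f z)\<^sup>2) \<le> (LINT z|lebesgue_on V. (f z)\<^sup>2)"
proof -
  have "(LINT z|lebesgue. indicator U z *\<^sub>R (f z)\<^sup>2) \<le> (LINT z|lebesgue. indicator V z *\<^sub>R (f z)\<^sup>2)"
    by (rule integral_mono)
      (use L2_D(2)[OF L2_fun_subset[OF assms]] L2_D(2)[OF assms(4)] assms in
        \<open>auto simp: integrable_restrict_space indicator_def\<close>)
  then show ?thesis using assms by (simp add: integral_restrict_space)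
qed

lemma L2_tendsto_subset:
  assumes "U \<in> sets lebesgue" "V \<in> sets lebesgue" "U \<subseteq> V" "L2_tendsto (lebesgue_on V) f g"
  shows "L2_tendsto (lebesgue_on U) f g"
  unfolding L2_tendsto_def
proof (intro conjI allI)
  note D = L2_tendsto_D[OF assms(4)]
  show "(\<lambda>n. LINT z|lebesgue_on U. (f n z - g z)\<^sup>2) \<longlonglongrightarrow> 0"
    by (rule tendsto_sandwich[OF _ _ tendsto_const D(3)])
      (use integral_sq_subset[OF assms(1-3) L2_diff[OF D(1,2)]] in auto)
qed (use L2_fun_subset[OF assms(1-3)] L2_tendsto_D[OF assms(4)] in auto)

section \<open>Test functions\<close>

lemma test_smooth: "test_function U \<phi> \<Longrightarrow> smooth \<phi>"
  by (simp add: test_function_def)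

lemma test_supportI:
  assumes "smooth \<phi>" "compact K" "K \<subseteq> U" "\<And>z. z \<notin> K \<Longrightarrow> \<phi> z = 0"
  shows "test_function U \<phi>"
proof -
  have "{z. \<phi> z \<noteq> 0} \<subseteq> K" using assms(4) by blast
  then have "closure {z. \<phi> z \<noteq> 0} \<subseteq> K" "bounded {z. \<phi> z \<noteq> 0}"
    using closure_minimal[OF _ compact_imp_closed[OF assms(2)]] bounded_subset[OF compact_imp_bounded[OF assms(2)]]
    by blast+
  then show ?thesis
    using assms(1,3) unfolding test_function_def compact_closure by auto
qed

lemma test_zero_outside: "test_function U \<phi> \<Longrightarrow> z \<notin> U \<Longrightarrow> \<phi> z = 0"
  using closure_subset[of "{z. \<phi> z \<noteq> 0}"] unfolding test_function_def by blast

lemma test_support: "test_function U \<phi> \<Longrightarrow>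
    compact (closure {z. \<phi> z \<noteq> 0}) \<and> closure {z. \<phi> z \<noteq> 0} \<subseteq> U \<and> (\<forall>z. z \<notin> closure {z. \<phi> z \<noteq> 0} \<longrightarrow> \<phi> z = 0)"
  using closure_subset[of "{z. \<phi> z \<noteq> 0}"] unfolding test_function_def by blast

lemma test_mult: "test_function U \<phi> \<Longrightarrow> smooth f \<Longrightarrow> test_function U (\<lambda>z. f z * \<phi> z)"
  using test_support[of U \<phi>] by (intro test_supportI[of _ "closure {z. \<phi> z \<noteq> 0}"]) (auto intro: smooth_mult test_smooth)

lemma test_cmult: "test_function U \<phi> \<Longrightarrow> test_function U (\<lambda>z. c * \<phi> z)"
  using test_mult[OF _ smooth_const] by blast

lemma test_add: "test_function U \<phi> \<Longrightarrow> test_function U \<psi> \<Longrightarrow> test_function U (\<lambda>z. \<phi> z + \<psi> z)"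
  using test_support[of U \<phi>] test_support[of U \<psi>]
  by (intro test_supportI[of _ "closure {z. \<phi> z \<noteq> 0} \<union> closure {z. \<psi> z \<noteq> 0}"])
    (auto intro: smooth_add test_smooth)

lemma test_diff: "test_function U \<phi> \<Longrightarrow> test_function U \<psi> \<Longrightarrow> test_function U (\<lambda>z. \<phi> z - \<psi> z)"
  using test_add[OF _ test_cmult[of U \<psi> "-1"], of \<phi>] by simp

lemma test_pderiv: "test_function U \<phi> \<Longrightarrow> test_function U (pderiv_dir v \<phi>)"
proof (rule test_supportI[of _ "closure {z. \<phi> z \<noteq> 0}"])
  assume t: "test_function U \<phi>"
  show "smooth (pderiv_dir v \<phi>)" using t by (intro smooth_pderiv test_smooth)
  show "compact (closure {z. \<phi> z \<noteq> 0})" "closure {z. \<phi> z \<noteq> 0} \<subseteq> U" using test_support[OF t] by blast+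
  fix z assume z: "z \<notin> closure {z. \<phi> z \<noteq> 0}"
  have "((\<lambda>_. 0) has_derivative (\<lambda>_. 0)) (at z)" by simp
  then have "(\<phi> has_derivative (\<lambda>_. 0)) (at z)"
    by (rule has_derivative_transform_within_open[where s="- closure {z. \<phi> z \<noteq> 0}"])
      (use z closure_subset[of "{z. \<phi> z \<noteq> 0}"] in \<open>auto simp: open_Compl\<close>)
  then show "pderiv_dir v \<phi> z = 0" by (rule pderiv_dirI)
qed

lemma test_affine:
  assumes "test_function U \<phi>" "bounded_linear T" "bounded_linear S" "\<And>z. S (T z) = z" "\<And>z. T (S z) = z"
    "\<And>z. T z + c \<in> U \<Longrightarrow> z \<in> V"
  shows "test_function V (\<lambda>z. \<phi> (T z + c))"
proof -
  define K where "K = (\<lambda>z. S (z - c)) ` closure {z. \<phi> z \<noteq> 0}"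
  have "compact K" unfolding K_def
    by (intro compact_continuous_image continuous_intros bounded_linear.continuous_on[OF assms(3)])
      (use test_support[OF assms(1)] in blast)
  moreover have "K \<subseteq> V"
  proof
    fix z assume "z \<in> K"
    then obtain w where w: "w \<in> closure {z. \<phi> z \<noteq> 0}" "z = S (w - c)" unfolding K_def by blast
    then have "T z + c = w" by (simp add: assms(5))
    then show "z \<in> V" using assms(6) test_support[OF assms(1)] w(1) by blast
  qed
  moreover have "\<phi> (T z + c) = 0" if "z \<notin> K" for z
  proof (rule ccontr)
    assume "\<phi> (T z + c) \<noteq> 0"
    then have "T z + c \<in> closure {z. \<phi> z \<noteq> 0}" using closure_subset[of "{z. \<phi> z \<noteq> 0}"] by blast
    then have "S (T z + c - c) \<in> K" unfolding K_def by blast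
    then show False using that assms(4) by simp
  qed
  ultimately show ?thesis using assms test_smooth smooth_affine by (intro test_supportI[of _ K]) auto
qed

lemma test_bounded: "test_function U \<phi> \<Longrightarrow> \<exists>B. \<forall>z. \<bar>\<phi> z\<bar> \<le> B"
proof -
  assume t: "test_function U \<phi>"
  let ?K = "closure {z. \<phi> z \<noteq> 0}"
  have "compact (\<phi> ` ?K)"
    using test_support[OF t] continuous_on_subset[OF smooth_continuous[OF test_smooth[OF t]]]
    by (intro compact_continuous_image) blast+
  then obtain B where B: "\<And>z. z \<in> ?K \<Longrightarrow> \<bar>\<phi> z\<bar> \<le> B"
    unfolding compact_eq_bounded_closed bounded_iff by (metis imageI real_norm_def)
  have "\<bar>\<phi> z\<bar> \<le> max B 0" for z
  proof (cases "z \<in> ?K")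
    case True then show ?thesis using B[OF True] by simp
  next
    case False
    then have "\<phi> z = 0" using test_support[OF t] by blast
    then show ?thesis by simp
  qed
  then show ?thesis by blast
qed

lemma smooth_lebesgue: "smooth f \<Longrightarrow> f \<in> borel_measurable (lebesgue_on U)"
  using smooth_borel[of f] by (intro measurable_restrict_space1 measurable_completion) auto

lemma test_lborel_integrable: "test_function U \<phi> \<Longrightarrow> integrable lborel \<phi>"
proof -
  assume t: "test_function U \<phi>"
  let ?K = "closure {z. \<phi> z \<noteq> 0}"
  have "integrable lborel (\<lambda>z. indicator ?K z *\<^sub>R \<phi> z)"
    using test_support[OF t] continuous_on_subset[OF smooth_continuous[OF test_smooth[OF t]]]
    by (intro borel_integrable_compact) blast+
  moreover have "(\<lambda>z. indicator ?K z *\<^sub>R \<phi> z) = \<phi>"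
    using closure_subset[of "{z. \<phi> z \<noteq> 0}"] by (intro ext) (auto simp: indicator_def)
  ultimately show ?thesis by simp
qed

lemma test_integrable:
  assumes "test_function V \<phi>" "U \<in> sets lebesgue"
  shows "integrable (lebesgue_on U) \<phi>"
proof -
  have "integrable lebesgue \<phi>"
    using test_lborel_integrable[OF assms(1)] by (simp add: integrable_completion borel_measurable_integrable)
  then show ?thesis using assms(2) integrable_mult_indicator[of U lebesgue \<phi>] by (simp add: integrable_restrict_space)
qed

lemma test_L2:
  assumes "test_function V \<phi>" "U \<in> sets lebesgue"
  shows "L2_fun (lebesgue_on U) \<phi>"
  using test_integrable[OF test_mult[OF assms(1) test_smooth[OF assms(1)]] assms(2)] smooth_lebesgue[OF test_smooth[OF assms(1)]]
  by (simp add: L2_fun_def power2_eq_square)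

lemma test_integral_lebesgue_on:
  assumes "test_function U \<phi>" "U \<in> sets lebesgue"
  shows "(LINT z|lebesgue_on U. \<phi> z) = (LINT z|lborel. \<phi> z)"
proof -
  have "(LINT z|lebesgue_on U. \<phi> z) = (LINT z|lebesgue. indicator U z *\<^sub>R \<phi> z)"
    using assms(2) by (simp add: integral_restrict_space)
  also have "\<dots> = (LINT z|lebesgue. \<phi> z)"
    using test_zero_outside[OF assms(1)] by (intro Bochner_Integration.integral_cong) (auto simp: indicator_def)
  also have "\<dots> = (LINT z|lborel. \<phi> z)"
    using smooth_borel[OF test_smooth[OF assms(1)]] by (simp add: integral_completion)
  finally show ?thesis .
qed

lemma FTC_compact_support:
  fixes f :: "real \<Rightarrow> real"
  assumes "\<And>x. (f has_real_derivative f' x) (at x)" "continuous_on UNIV f'" "\<And>x. \<bar>x\<bar> \<ge> R \<Longrightarrow> f x = 0"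
    "\<And>x. \<bar>x\<bar> \<ge> R \<Longrightarrow> f' x = 0"
  shows "(LINT x|lborel. f' x) = 0"
proof -
  define S where "S = \<bar>R\<bar>"
  have "(LINT x|lborel. f' x) = (LINT x|lborel. f' x * indicator {-S..S} x)"
    using assms(4) by (intro Bochner_Integration.integral_cong) (force simp: indicator_def S_def)+
  also have "\<dots> = f S - f (-S)"
    using assms(1,2) by (intro integral_FTC_Icc_real) (auto simp: S_def continuous_on_eq_continuous_at)
  also have "\<dots> = 0" using assms(3)[of S] assms(3)[of "-S"] by (simp add: S_def)
  finally show ?thesis .
qed

lemma smooth_partial_x:
  "smooth f \<Longrightarrow> ((\<lambda>x. f (x, y)) has_real_derivative dx f (x, y)) (at x)"
  and smooth_partial_y:
  "smooth f \<Longrightarrow> ((\<lambda>y. f (x, y)) has_real_derivative dy f (x, y)) (at y)"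
proof -
  assume f: "smooth f"
  have "((\<lambda>x. (x, y)) has_derivative (\<lambda>h. (h, 0::real))) (at x)"
    by (auto intro!: derivative_eq_intros)
  from has_derivative_compose[OF this smooth_has_derivative[OF f]]
  have "((\<lambda>x. f (x, y)) has_derivative (\<lambda>h. fst (h, 0::real) * dx f (x, y) + snd (h, 0::real) * dy f (x, y))) (at x)" .
  from has_derivative_eq_rhs[OF this, of "\<lambda>h. dx f (x, y) * h"]
  show "((\<lambda>x. f (x, y)) has_real_derivative dx f (x, y)) (at x)"
    by (simp add: has_field_derivative_def mult_commute_abs)
  have "((\<lambda>y. (x, y)) has_derivative (\<lambda>h. (0::real, h))) (at y)"
    by (auto intro!: derivative_eq_intros)
  from has_derivative_compose[OF this smooth_has_derivative[OF f]]
  have "((\<lambda>y. f (x, y)) has_derivative (\<lambda>h. fst (0::real, h) * dx f (x, y) + snd (0::real, h) * dy f (x, y))) (at y)" .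
  from has_derivative_eq_rhs[OF this, of "\<lambda>h. dy f (x, y) * h"]
  show "((\<lambda>y. f (x, y)) has_real_derivative dy f (x, y)) (at y)"
    by (simp add: has_field_derivative_def mult_commute_abs)
qed

lemma lborel_plane_integral:
  fixes f :: "plane \<Rightarrow> real"
  assumes "integrable lborel f"
  shows "(LINT z|lborel. f z) = (LINT y|lborel. LINT x|lborel. f (x, y))" (is ?A)
    "(LINT z|lborel. f z) = (LINT x|lborel. LINT y|lborel. f (x, y))" (is ?B)
proof -
  have i: "integrable (lborel \<Otimes>\<^sub>M lborel) (\<lambda>(x, y). f (x, y))" using assms by (simp add: lborel_prod)
  show ?A
    using lborel_pair.integral_snd[OF i] by (simp add: lborel_prod)
  show ?B
    using lborel_pair.integral_fst'[OF i] by (simp add: lborel_prod)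
qed

lemma test_bounded_support:
  assumes "test_function U \<phi>"
  shows "\<exists>R. \<forall>x y. \<bar>x\<bar> \<ge> R \<or> \<bar>y\<bar> \<ge> R \<longrightarrow> \<phi> (x, y) = 0"
proof -
  obtain R where R: "\<And>z. z \<in> closure {z. \<phi> z \<noteq> 0} \<Longrightarrow> norm z < R"
    using compact_imp_bounded[OF conjunct1[OF test_support[OF assms]]] unfolding bounded_pos_less by blast
  have "\<phi> (x, y) = 0" if "\<bar>x\<bar> \<ge> R \<or> \<bar>y\<bar> \<ge> R" for x y
  proof (rule ccontr)
    assume "\<phi> (x, y) \<noteq> 0"
    then have "norm (x, y) < R" using R[of "(x, y)"] closure_subset[of "{z. \<phi> z \<noteq> 0}"] by blast
    moreover have "\<bar>x\<bar> \<le> norm (x, y)" "\<bar>y\<bar> \<le> norm (x, y)"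
      by (simp_all add: norm_prod_def)
    ultimately show False using that by linarith
  qed
  then show ?thesis by blast
qed

lemma test_integral_pderiv:
  assumes "test_function U \<phi>"
  shows "(LINT z|lborel. pderiv_dir v \<phi> z) = 0"
proof -
  have s: "smooth \<phi>" by (rule test_smooth[OF assms])
  obtain R1 where R1: "\<forall>x y. \<bar>x\<bar> \<ge> R1 \<or> \<bar>y\<bar> \<ge> R1 \<longrightarrow> \<phi> (x, y) = 0" using test_bounded_support[OF assms] by blast
  obtain R2 where R2: "\<forall>x y. \<bar>x\<bar> \<ge> R2 \<or> \<bar>y\<bar> \<ge> R2 \<longrightarrow> dx \<phi> (x, y) = 0"
    using test_bounded_support[OF test_pderiv[OF assms]] by blast
  obtain R3 where R3: "\<forall>x y. \<bar>x\<bar> \<ge> R3 \<or> \<bar>y\<bar> \<ge> R3 \<longrightarrow> dy \<phi> (x, y) = 0"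
    using test_bounded_support[OF test_pderiv[OF assms]] by blast
  have c: "continuous_on UNIV (\<lambda>x. dx \<phi> (x, y))" "continuous_on UNIV (\<lambda>y. dy \<phi> (x, y))" for x y
    by (auto intro!: continuous_on_compose2[OF smooth_continuous[OF smooth_pderiv[OF s]]] continuous_intros)
  have "(LINT x|lborel. dx \<phi> (x, y)) = 0" for y
    by (rule FTC_compact_support[OF smooth_partial_x[OF s] c(1), of "max R1 R2"]) (use R1 R2 in auto)
  then have x: "(LINT z|lborel. dx \<phi> z) = 0"
    by (simp add: lborel_plane_integral(1)[OF test_lborel_integrable[OF test_pderiv[OF assms]]])
  have "(LINT y|lborel. dy \<phi> (x, y)) = 0" for x
    by (rule FTC_compact_support[OF smooth_partial_y[OF s] c(2), of "max R1 R3"]) (use R1 R3 in auto)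
  then have y: "(LINT z|lborel. dy \<phi> z) = 0"
    by (simp add: lborel_plane_integral(2)[OF test_lborel_integrable[OF test_pderiv[OF assms]]])
  have "pderiv_dir v \<phi> = (\<lambda>z. fst v * dx \<phi> z + snd v * dy \<phi> z)"
    using pderiv_dir_expand[OF s] by blast
  then have "(LINT z|lborel. pderiv_dir v \<phi> z) = fst v * (LINT z|lborel. dx \<phi> z) + snd v * (LINT z|lborel. dy \<phi> z)"
    using test_lborel_integrable[OF test_pderiv[OF assms]] by simp
  then show ?thesis using x y by simp
qed

section \<open>Weak derivatives\<close>

lemma finite_measure_lebesgue_on: "U \<in> lmeasurable \<Longrightarrow> finite_measure (lebesgue_on U)"
  by (rule finite_measureI) (auto simp: fmeasurable_def emeasure_restrict_space space_restrict_space)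

lemma L2_loc_integrable:
  assumes "U \<in> sets lebesgue" "L2_fun (lebesgue_on U) f"
  shows "loc_integrable U f"
  unfolding loc_integrable_def
proof (intro allI impI)
  fix K assume K: "compact K \<and> K \<subseteq> U"
  then have m: "K \<in> lmeasurable" using lmeasurable_compact by blast
  interpret finite_measure "lebesgue_on K" by (rule finite_measure_lebesgue_on[OF m])
  show "integrable (lebesgue_on K) f"
    using L2_integrable L2_fun_subset[OF _ assms(1) _ assms(2)] K m fmeasurableD by blast
qed

lemma smooth_L2:
  assumes "smooth f" "bounded U" "U \<in> sets lebesgue"
  shows "L2_fun (lebesgue_on U) f"
proof -
  have "compact (f ` closure U)"
    using assms continuous_on_subset[OF smooth_continuous[OF assms(1)]]
    by (intro compact_continuous_image) auto
  then obtain B where B: "\<And>z. z \<in> closure U \<Longrightarrow> \<bar>f z\<bar> \<le> B"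
    unfolding compact_eq_bounded_closed bounded_iff by auto
  interpret finite_measure "lebesgue_on U"
    using assms by (intro finite_measure_lebesgue_on bounded_set_imp_lmeasurable)
  show ?thesis using B closure_subset by (intro L2_bounded[OF smooth_lebesgue[OF assms(1)], of B]) (auto simp: space_restrict_space)
qed

lemma smooth_weak_deriv:
  assumes "smooth f" "bounded U" "U \<in> sets lebesgue"
  shows "has_weak_deriv U v f (pderiv_dir v f)"
  unfolding has_weak_deriv_def
proof (intro conjI allI impI)
  show "loc_integrable U f" "loc_integrable U (pderiv_dir v f)"
    using assms smooth_pderiv smooth_L2 L2_loc_integrable by blast+
  fix \<phi> assume t: "test_function U \<phi>"
  have t1: "test_function U (\<lambda>z. f z * pderiv_dir v \<phi> z)" and t2: "test_function U (\<lambda>z. pderiv_dir v f z * \<phi> z)"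
    using assms t by (auto intro: test_mult test_pderiv smooth_pderiv)
  have "pderiv_dir v (\<lambda>z. f z * \<phi> z) = (\<lambda>z. f z * pderiv_dir v \<phi> z + pderiv_dir v f z * \<phi> z)"
    using pderiv_mult[OF assms(1) test_smooth[OF t]] by blast
  then have "(LINT z|lborel. f z * pderiv_dir v \<phi> z) + (LINT z|lborel. pderiv_dir v f z * \<phi> z) = 0"
    using test_integral_pderiv[OF test_mult[OF t assms(1)], of v] test_lborel_integrable[OF t1] test_lborel_integrable[OF t2]
    by simp
  then show "(LINT z|lebesgue_on U. f z * pderiv_dir v \<phi> z) = - (LINT z|lebesgue_on U. pderiv_dir v f z * \<phi> z)"
    using test_integral_lebesgue_on[OF t1 assms(3)] test_integral_lebesgue_on[OF t2 assms(3)] by simp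
qed

lemma weak_deriv_L2_limit:
  assumes "U \<in> sets lebesgue" "\<And>n. has_weak_deriv U v (f n) (g n)"
    "L2_tendsto (lebesgue_on U) f u" "L2_tendsto (lebesgue_on U) g w"
  shows "has_weak_deriv U v u w"
  unfolding has_weak_deriv_def
proof (intro conjI allI impI)
  show "loc_integrable U u" "loc_integrable U w"
    using L2_loc_integrable[OF assms(1)] L2_tendsto_D(2)[OF assms(3)] L2_tendsto_D(2)[OF assms(4)] by auto
  fix \<phi> assume t: "test_function U \<phi>"
  have "(\<lambda>n. - (LINT z|lebesgue_on U. g n z * \<phi> z)) \<longlonglongrightarrow> - (LINT z|lebesgue_on U. w z * \<phi> z)"
    using assms t by (intro tendsto_minus L2_tendsto_inner test_L2) auto
  moreover have "(\<lambda>n. LINT z|lebesgue_on U. f n z * pderiv_dir v \<phi> z) \<longlonglongrightarrow> (LINT z|lebesgue_on U. u z * pderiv_dir v \<phi> z)"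
    by (rule L2_tendsto_inner[OF assms(3) test_L2[OF test_pderiv[OF t] assms(1)]])
  moreover have "(LINT z|lebesgue_on U. f n z * pderiv_dir v \<phi> z) = - (LINT z|lebesgue_on U. g n z * \<phi> z)" for n
    using assms(2) t by (simp add: has_weak_deriv_def)
  ultimately show "(LINT z|lebesgue_on U. u z * pderiv_dir v \<phi> z) = - (LINT z|lebesgue_on U. w z * \<phi> z)"
    by (simp add: LIMSEQ_unique)
qed

text \<open>Products of dilated flat functions are test functions that increase to the indicator of an open box.\<close>

lemma flat_tendsto: "(\<lambda>n. flat 0 (real n * t)) \<longlonglongrightarrow> (if t > 0 then 1 else 0)"
proof (cases "t > 0")
  case True
  have "(\<lambda>n. exp (- (inverse t * inverse (real n)))) \<longlonglongrightarrow> exp (- (inverse t * 0))"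
    by (intro tendsto_intros lim_inverse_n)
  moreover have "\<forall>\<^sub>F n in sequentially. exp (- (inverse t * inverse (real n))) = flat 0 (real n * t)"
    using eventually_gt_at_top[of 0] by eventually_elim (use True in \<open>simp add: flat_def divide_simps\<close>)
  ultimately show ?thesis using True Lim_transform_eventually by fastforce
next
  case False
  then have "flat 0 (real n * t) = 0" for n by (intro flat_eq_0) (simp add: mult_nonneg_nonpos)
  then show ?thesis using False by simp
qed

lemma loc_integrable_indicator:
  assumes "loc_integrable U f" "compact K" "K \<subseteq> U"
  shows "integrable lebesgue (\<lambda>z. indicator K z *\<^sub>R f z)"
proof -
  have "integrable (lebesgue_on K) f" using assms unfolding loc_integrable_def by blast
  moreover have "K \<in> sets lebesgue" using assms(2) by (simp add: compact_imp_closed)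
  ultimately show ?thesis by (simp add: integrable_restrict_space)
qed

lemma loc_integrable_mult_bounded:
  assumes "loc_integrable U f" "compact K" "K \<subseteq> U" "U \<in> sets lebesgue" "\<phi> \<in> borel_measurable borel"
    "\<And>z. \<bar>\<phi> z\<bar> \<le> B" "\<And>z. z \<notin> K \<Longrightarrow> \<phi> z = 0"
  shows "integrable lebesgue (\<lambda>z. indicator U z *\<^sub>R (f z * \<phi> z))" (is ?A)
    "\<And>z. indicator U z *\<^sub>R (f z * \<phi> z) = indicator K z *\<^sub>R f z * \<phi> z"
proof -
  have K: "K \<in> sets lebesgue" using assms(2) by (simp add: compact_imp_closed)
  have i: "integrable lebesgue (\<lambda>z. indicator K z *\<^sub>R f z)"
    by (rule loc_integrable_indicator[OF assms(1-3)])
  show *: "indicator U z *\<^sub>R (f z * \<phi> z) = indicator K z *\<^sub>R f z * \<phi> z" for z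
    using assms(3) assms(7)[of z] by (auto simp: indicator_def)
  have "integrable lebesgue (\<lambda>z. indicator K z *\<^sub>R f z * \<phi> z)"
  proof (rule Bochner_Integration.integrable_bound[OF integrable_mult_right[OF integrable_abs[OF i], of B]])
    have "\<phi> \<in> borel_measurable lebesgue" using assms(5) by (intro measurable_completion) auto
    then show "(\<lambda>z. indicator K z *\<^sub>R f z * \<phi> z) \<in> borel_measurable lebesgue"
      using borel_measurable_integrable[OF i] by simp
    have "\<bar>indicator K z *\<^sub>R f z\<bar> * \<bar>\<phi> z\<bar> \<le> B * \<bar>indicator K z *\<^sub>R f z\<bar>" for z
      using mult_right_mono[OF assms(6)[of z], of "\<bar>indicator K z *\<^sub>R f z\<bar>"] by (simp add: mult.commute)
    moreover have "B \<ge> 0" using assms(6)[of undefined] by linarith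
    ultimately show "AE z in lebesgue. norm (indicator K z *\<^sub>R f z * \<phi> z) \<le> norm (B * \<bar>indicator K z *\<^sub>R f z\<bar>)"
      by (auto simp: abs_mult)
  qed
  then show ?A by (simp only: *)
qed

lemma fundamental_lemma_box:
  assumes "loc_integrable U f" "U \<in> sets lebesgue" "\<And>\<phi>. test_function U \<phi> \<Longrightarrow> (LINT z|lebesgue_on U. f z * \<phi> z) = 0"
    "cbox (a, c) (b, d) \<subseteq> U"
  shows "(LINT z|lebesgue. indicator (box (a, c) (b, d)) z *\<^sub>R f z) = 0"
proof -
  define \<phi> where "\<phi> n z = flat 0 (real n * (fst z - a)) * flat 0 (real n * (b - fst z)) *
      (flat 0 (real n * (snd z - c)) * flat 0 (real n * (d - snd z)))" for n z
  let ?K = "cbox (a, c) (b, d)"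
  have s: "smooth (\<phi> n)" for n
    unfolding \<phi>_def by (intro smooth_intros smooth_flat)
  have b: "\<bar>\<phi> n z\<bar> \<le> 1" for n z
    unfolding \<phi>_def abs_mult by (intro mult_le_one mult_nonneg_nonneg) (auto simp: flat_nonneg flat_le_1)
  have z: "\<phi> n z = 0" if "z \<notin> ?K" for n z
  proof -
    have "fst z - a \<le> 0 \<or> b - fst z \<le> 0 \<or> snd z - c \<le> 0 \<or> d - snd z \<le> 0"
      using that by (cases z) (auto simp: cbox_Pair_eq)
    then show ?thesis unfolding \<phi>_def using flat_eq_0 by (auto simp: mult_nonneg_nonpos)
  qed
  have t: "test_function U (\<phi> n)" for n
    by (rule test_supportI[OF s compact_cbox assms(4) z])
  have L: "integrable lebesgue (\<lambda>z. indicator U z *\<^sub>R (f z * \<phi> n z))"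
    "indicator U z *\<^sub>R (f z * \<phi> n z) = indicator ?K z *\<^sub>R f z * \<phi> n z" for n z
    by (rule loc_integrable_mult_bounded[OF assms(1) compact_cbox assms(4,2) smooth_borel[OF s] b], erule z)+
  have K: "integrable lebesgue (\<lambda>z. indicator ?K z *\<^sub>R f z)"
    by (rule loc_integrable_indicator[OF assms(1) compact_cbox assms(4)])
  have I: "(LINT z|lebesgue. indicator ?K z *\<^sub>R f z * \<phi> n z) = 0" for n
    using assms(3)[OF t] assms(2) by (simp add: integral_restrict_space L(2) del: real_scaleR_def)
  have lim: "(\<lambda>n. \<phi> n z) \<longlonglongrightarrow> (if z \<in> box (a, c) (b, d) then 1 else 0)" for z
  proof -
    have "(\<lambda>n. \<phi> n z) \<longlonglongrightarrow> (if fst z - a > 0 then 1 else 0) * (if b - fst z > 0 then 1 else 0) *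
      ((if snd z - c > 0 then 1 else 0) * (if d - snd z > 0 then 1 else 0))"
      unfolding \<phi>_def by (intro tendsto_mult flat_tendsto)
    moreover have "(if fst z - a > 0 then 1 else 0) * (if b - fst z > 0 then 1 else 0) *
      ((if snd z - c > 0 then 1 else 0) * (if d - snd z > 0 then 1 else 0)) = (if z \<in> box (a, c) (b, d) then 1 else 0 :: real)"
      by (cases z) (auto simp: box_def plane_Basis)
    ultimately show ?thesis by simp
  qed
  have "(\<lambda>n. LINT z|lebesgue. indicator ?K z *\<^sub>R f z * \<phi> n z) \<longlonglongrightarrow>
      (LINT z|lebesgue. indicator ?K z *\<^sub>R f z * (if z \<in> box (a, c) (b, d) then 1 else 0))"
  proof (rule integral_dominated_convergence[where w="\<lambda>z. \<bar>indicator ?K z *\<^sub>R f z\<bar>"])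
    show m: "(\<lambda>z. indicator ?K z *\<^sub>R f z * \<phi> n z) \<in> borel_measurable lebesgue" for n
      using borel_measurable_integrable[OF L(1)[of n]] unfolding L(2) .
    show "(\<lambda>z. indicator ?K z *\<^sub>R f z * (if z \<in> box (a, c) (b, d) then 1 else 0)) \<in> borel_measurable lebesgue"
      using borel_measurable_integrable[OF K] by (intro borel_measurable_times) (auto intro!: measurable_If)
    show "AE z in lebesgue. (\<lambda>n. indicator ?K z *\<^sub>R f z * \<phi> n z) \<longlonglongrightarrow> indicator ?K z *\<^sub>R f z * (if z \<in> box (a, c) (b, d) then 1 else 0)"
      by (intro AE_I2 tendsto_intros lim)
    show "AE z in lebesgue. norm (indicator ?K z *\<^sub>R f z * \<phi> n z) \<le> \<bar>indicator ?K z *\<^sub>R f z\<bar>" for n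
      using b by (auto intro!: AE_I2 simp: abs_mult mult_left_le)
  qed (use K in auto)
  then have "(LINT z|lebesgue. indicator ?K z *\<^sub>R f z * (if z \<in> box (a, c) (b, d) then 1 else 0)) = 0"
    unfolding I using LIMSEQ_unique tendsto_const by blast
  moreover have "(\<lambda>z. indicator ?K z *\<^sub>R f z * (if z \<in> box (a, c) (b, d) then 1 else 0)) = (\<lambda>z. indicator (box (a, c) (b, d)) z *\<^sub>R f z)"
    using box_subset_cbox by (fastforce simp: indicator_def)
  ultimately show ?thesis by simp
qed

text \<open>At almost every point the function is the limit of its averages over small squares, and these vanish.\<close>

lemma AE_zero_on_cbox:
  assumes "integrable lebesgue (\<lambda>z. indicator (cbox p q) z *\<^sub>R f z)"
    "\<And>a b c d. cbox (a, c) (b, d) \<subseteq> cbox p q \<Longrightarrow> (LINT z|lebesgue. indicator (box (a, c) (b, d)) z *\<^sub>R (f z :: real)) = 0"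
  shows "AE z in lebesgue. (z :: plane) \<in> cbox p q \<longrightarrow> f z = 0"
proof -
  define F where "F z = indicator (cbox p q) z *\<^sub>R f z" for z
  have F: "integrable lebesgue F" using assms(1) by (simp add: F_def[abs_def])
  have "F integrable_on cbox a b" for a b
    using F by (metis absolutely_integrable_on_def integrable_on_lebesgue integrable_on_subcbox subset_UNIV)
  then obtain N where N: "negligible N" "\<And>x e. \<lbrakk>x \<notin> N; 0 < e\<rbrakk> \<Longrightarrow>
      \<exists>d>0. \<forall>h. 0 < h \<and> h < d \<longrightarrow> norm (integral (cbox x (x + h *\<^sub>R One)) F /\<^sub>R h ^ DIM(plane) - F x) < e"
    using integrable_ccontinuous_explicit[of F] by metis
  have "f x = 0" if x: "x \<in> box p q" "x \<notin> N" for x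
  proof (rule ccontr)
    assume nz: "f x \<noteq> 0"
    have Fx: "F x = f x" using x box_subset_cbox by (fastforce simp: F_def)
    obtain d1 where d1: "d1 > 0" "\<And>h. 0 < h \<Longrightarrow> h < d1 \<Longrightarrow> norm (integral (cbox x (x + h *\<^sub>R One)) F /\<^sub>R h ^ DIM(plane) - F x) < \<bar>f x\<bar>"
      using N(2)[OF x(2), of "\<bar>f x\<bar>"] nz by auto
    define h where "h = min (d1 / 2) (min (fst q - fst x) (snd q - snd x))"
    have xx: "fst p < fst x" "fst x < fst q" "snd p < snd x" "snd x < snd q"
      using x(1) by (cases x; cases p; cases q; auto simp: box_def plane_Basis)+
    then have h: "0 < h" "h < d1" "h \<le> fst q - fst x" "h \<le> snd q - snd x" using d1 by (auto simp: h_def min_def)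
    have One: "x + h *\<^sub>R One = (fst x + h, snd x + h)" by (simp add: plane_Basis prod_eq_iff)
    have sub: "cbox (fst x, snd x) (fst x + h, snd x + h) \<subseteq> cbox p q"
    proof -
      obtain x1 x2 p1 p2 q1 q2 where "x = (x1, x2)" "p = (p1, p2)" "q = (q1, q2)"
        by (cases x; cases p; cases q) auto
      then show ?thesis using xx h by (auto simp: cbox_Pair_eq)
    qed
    let ?B = "box (fst x, snd x) (fst x + h, snd x + h)"
    let ?C = "cbox (fst x, snd x) (fst x + h, snd x + h)"
    have BC: "?B \<subseteq> ?C" by (rule box_subset_cbox)
    have "integral ?C F = integral ?B F"
    proof (rule integral_spike_set)
      show "negligible {z \<in> ?C - ?B. F z \<noteq> 0}"
        by (rule negligible_subset[OF negligible_frontier_interval]) blast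
      have "{z \<in> ?B - ?C. F z \<noteq> 0} = {}" using BC by blast
      then show "negligible {z \<in> ?B - ?C. F z \<noteq> 0}" by (simp only: negligible_empty)
    qed
    also have "\<dots> = (LINT z|lebesgue. indicator ?B z *\<^sub>R F z)"
    proof -
      have "integrable lebesgue (\<lambda>z. indicator ?B z *\<^sub>R F z)"
        using F by (intro integrable_mult_indicator) auto
      then have "set_integrable lebesgue ?B F" by (simp add: set_integrable_def)
      from set_lebesgue_integral_eq_integral(2)[OF this] show ?thesis by (simp add: set_lebesgue_integral_def)
    qed
    also have "\<dots> = (LINT z|lebesgue. indicator ?B z *\<^sub>R f z)"
      using sub box_subset_cbox[of "(fst x, snd x)" "(fst x + h, snd x + h)"]
      by (intro Bochner_Integration.integral_cong refl) (auto simp: F_def indicator_def)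
    also have "\<dots> = 0" by (rule assms(2)[OF sub])
    finally have "integral (cbox x (x + h *\<^sub>R One)) F = 0" by (simp add: One)
    then show False using d1(2)[OF h(1,2)] Fx by simp
  qed
  moreover have "negligible (N \<union> (cbox p q - box p q))"
    using N(1) negligible_frontier_interval by (simp add: negligible_Un)
  ultimately show ?thesis
    by (intro AE_I'[of "N \<union> (cbox p q - box p q)"]) (auto simp: negligible_iff_null_sets)
qed

text \<open>The fundamental lemma of the calculus of variations; an open set is a countable union of boxes.\<close>

lemma fundamental_lemma:
  assumes "open U" "loc_integrable U f" "\<And>\<phi>. test_function U \<phi> \<Longrightarrow> (LINT z|lebesgue_on U. f z * \<phi> z) = 0"
  shows "AE z in lebesgue_on U. f z = 0"
proof -
  have U: "U \<in> sets lebesgue" using assms(1) by simp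
  obtain D where D: "countable D" "D \<subseteq> Pow U" "\<And>X. X \<in> D \<Longrightarrow> \<exists>a b. X = cbox a b" "\<Union>D = U"
    using open_countable_Union_open_cbox[OF assms(1)] by metis
  have "AE z in lebesgue. z \<in> X \<longrightarrow> f z = 0" if X: "X \<in> D" for X
  proof -
    obtain p q where pq: "X = cbox p q" using D(3) X by blast
    have sub: "cbox p q \<subseteq> U" using D(2) X pq by blast
    have "integrable lebesgue (\<lambda>z. indicator (cbox p q) z *\<^sub>R f z)"
      by (rule loc_integrable_indicator[OF assms(2) compact_cbox sub])
    then show ?thesis unfolding pq
      by (rule AE_zero_on_cbox) (use fundamental_lemma_box[OF assms(2) U assms(3)] sub in blast)
  qed
  then have "AE z in lebesgue. \<forall>X\<in>D. z \<in> X \<longrightarrow> f z = 0" by (subst AE_ball_countable[OF D(1)]) blast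
  then have "AE z in lebesgue. z \<in> U \<longrightarrow> f z = 0" by eventually_elim (use D(4) in blast)
  then show ?thesis using U by (simp add: AE_restrict_space_iff)
qed

lemma weak_deriv_unique:
  assumes "open U" "has_weak_deriv U v u g" "has_weak_deriv U v u h"
  shows "AE z in lebesgue_on U. g z = h z"
proof -
  have U: "U \<in> sets lebesgue" using assms(1) by simp
  have "AE z in lebesgue_on U. g z - h z = 0"
  proof (rule fundamental_lemma[OF assms(1)])
    show "loc_integrable U (\<lambda>z. g z - h z)"
      using assms(2,3) by (simp add: has_weak_deriv_def loc_integrable_def)
    fix \<phi> assume t: "test_function U \<phi>"
    obtain B where B: "\<And>z. \<bar>\<phi> z\<bar> \<le> B" using test_bounded[OF t] by blast
    have i: "integrable (lebesgue_on U) (\<lambda>z. k z * \<phi> z)" if "loc_integrable U k" for k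
    proof -
      let ?K = "closure {z. \<phi> z \<noteq> 0}"
      have "compact ?K" "?K \<subseteq> U" "\<And>z. z \<notin> ?K \<Longrightarrow> \<phi> z = 0" using test_support[OF t] by blast+
      from loc_integrable_mult_bounded(1)[OF that this(1,2) U smooth_borel[OF test_smooth[OF t]] B this(3)]
      show ?thesis using U by (simp add: integrable_restrict_space)
    qed
    have "(LINT z|lebesgue_on U. g z * \<phi> z) = (LINT z|lebesgue_on U. h z * \<phi> z)"
      using assms(2,3) t by (simp add: has_weak_deriv_def)
    then show "(LINT z|lebesgue_on U. (g z - h z) * \<phi> z) = 0"
      using i[of g] i[of h] assms(2,3) by (simp add: has_weak_deriv_def left_diff_distrib)
  qed
  then show ?thesis by auto
qed

lemma has_weak_deriv_weak_deriv: "has_weak_deriv U v u g \<Longrightarrow> has_weak_deriv U v u (weak_deriv U v u)"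
  unfolding weak_deriv_def using someI[of "has_weak_deriv U v u"] by simp

lemma weak_deriv_AE_eq: "open U \<Longrightarrow> has_weak_deriv U v u g \<Longrightarrow> AE z in lebesgue_on U. weak_deriv U v u z = g z"
  using weak_deriv_unique has_weak_deriv_weak_deriv by blast

section \<open>Mollification\<close>

lemma abs_fst_le_norm: "\<bar>fst h\<bar> \<le> norm (h :: plane)" and abs_snd_le_norm: "\<bar>snd h\<bar> \<le> norm (h :: plane)"
  by (cases h, simp add: norm_prod_def)+

lemma abs_comb_le: "\<bar>a * b + c * d\<bar> \<le> \<bar>a\<bar> * \<bar>b\<bar> + \<bar>c\<bar> * \<bar>d :: real\<bar>"
  using abs_triangle_ineq[of "a * b" "c * d"] by (simp add: abs_mult)

lemma test_lipschitz:
  assumes "test_function U \<eta>"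
  shows "\<exists>B\<ge>0. \<forall>z w. \<bar>\<eta> z - \<eta> w\<bar> \<le> B * norm (z - w)"
proof -
  note s = test_smooth[OF assms]
  obtain B1 where B1: "\<And>z. \<bar>dx \<eta> z\<bar> \<le> B1" using test_bounded[OF test_pderiv[OF assms]] by blast
  obtain B2 where B2: "\<And>z. \<bar>dy \<eta> z\<bar> \<le> B2" using test_bounded[OF test_pderiv[OF assms]] by blast
  have on: "onorm (\<lambda>h. fst h * dx \<eta> z + snd h * dy \<eta> z) \<le> B1 + B2" for z
  proof (rule onorm_le)
    fix h :: plane
    have "\<bar>fst h\<bar> \<le> norm h" "\<bar>snd h\<bar> \<le> norm h" by (rule abs_fst_le_norm abs_snd_le_norm)+
    then have "\<bar>fst h\<bar> * \<bar>dx \<eta> z\<bar> \<le> norm h * B1" "\<bar>snd h\<bar> * \<bar>dy \<eta> z\<bar> \<le> norm h * B2"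
      using B1[of z] B2[of z] by (auto intro!: mult_mono)
    moreover have "\<bar>fst h * dx \<eta> z + snd h * dy \<eta> z\<bar> \<le> \<bar>fst h\<bar> * \<bar>dx \<eta> z\<bar> + \<bar>snd h\<bar> * \<bar>dy \<eta> z\<bar>"
      by (rule abs_comb_le)
    ultimately show "norm (fst h * dx \<eta> z + snd h * dy \<eta> z) \<le> (B1 + B2) * norm h"
      by (simp add: algebra_simps)
  qed
  have "norm (\<eta> z - \<eta> w) \<le> (B1 + B2) * norm (z - w)" for z w
    by (rule differentiable_bound[OF convex_UNIV _ on]) (use smooth_has_derivative[OF s] in auto)
  moreover have "B1 + B2 \<ge> 0" using B1[of 0] B2[of 0] by linarith
  ultimately show ?thesis by auto
qed

lemma test_taylor:
  assumes "test_function U \<eta>"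
  shows "\<exists>B\<ge>0. \<forall>z h. \<bar>\<eta> (z + h) - \<eta> z - (fst h * dx \<eta> z + snd h * dy \<eta> z)\<bar> \<le> B * (norm h)\<^sup>2"
proof -
  note s = test_smooth[OF assms]
  obtain B1 where B1: "B1 \<ge> 0" "\<And>z w. \<bar>dx \<eta> z - dx \<eta> w\<bar> \<le> B1 * norm (z - w)" using test_lipschitz[OF test_pderiv[OF assms]] by blast
  obtain B2 where B2: "B2 \<ge> 0" "\<And>z w. \<bar>dy \<eta> z - dy \<eta> w\<bar> \<le> B2 * norm (z - w)" using test_lipschitz[OF test_pderiv[OF assms]] by blast
  have "\<bar>\<eta> (z + h) - \<eta> z - (fst h * dx \<eta> z + snd h * dy \<eta> z)\<bar> \<le> (B1 + B2) * (norm h)\<^sup>2" for z h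
  proof -
    define q where "q t = \<eta> (z + t *\<^sub>R h)" for t
    define q' where "q' t = fst h * dx \<eta> (z + t *\<^sub>R h) + snd h * dy \<eta> (z + t *\<^sub>R h)" for t
    have "((\<lambda>t. z + t *\<^sub>R h) has_derivative (\<lambda>k. k *\<^sub>R h)) (at t)" for t
      by (auto intro!: derivative_eq_intros)
    from has_derivative_compose[OF this smooth_has_derivative[OF s]]
    have qd: "(q has_derivative (\<lambda>k. q' t * k)) (at t)" for t
      unfolding q_def q'_def by (rule has_derivative_eq_rhs) (auto simp: algebra_simps)
    have "\<exists>t. 0 < t \<and> t < 1 \<and> q 1 - q 0 = (1 - 0) * q' t"
      by (rule MVT2) (use qd in \<open>auto simp: has_field_derivative_def mult_commute_abs\<close>)
    then obtain t where t: "0 < t" "t < 1" "q 1 - q 0 = q' t" by auto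
    have nt: "norm (t *\<^sub>R h) \<le> norm h" using t by (simp add: mult_left_le_one_le)
    have b: "\<bar>dx \<eta> (z + t *\<^sub>R h) - dx \<eta> z\<bar> \<le> B1 * norm h" "\<bar>dy \<eta> (z + t *\<^sub>R h) - dy \<eta> z\<bar> \<le> B2 * norm h"
      using B1(2)[of "z + t *\<^sub>R h" z] B2(2)[of "z + t *\<^sub>R h" z] mult_left_mono[OF nt B1(1)] mult_left_mono[OF nt B2(1)]
      by simp_all
    have f: "\<bar>fst h\<bar> \<le> norm h" "\<bar>snd h\<bar> \<le> norm h" by (rule abs_fst_le_norm abs_snd_le_norm)+
    have eq: "\<eta> (z + h) - \<eta> z - (fst h * dx \<eta> z + snd h * dy \<eta> z)
       = fst h * (dx \<eta> (z + t *\<^sub>R h) - dx \<eta> z) + snd h * (dy \<eta> (z + t *\<^sub>R h) - dy \<eta> z)"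
      using t(3) by (simp add: q_def q'_def algebra_simps)
    have "\<bar>\<eta> (z + h) - \<eta> z - (fst h * dx \<eta> z + snd h * dy \<eta> z)\<bar> \<le> \<bar>fst h\<bar> * \<bar>dx \<eta> (z + t *\<^sub>R h) - dx \<eta> z\<bar> + \<bar>snd h\<bar> * \<bar>dy \<eta> (z + t *\<^sub>R h) - dy \<eta> z\<bar>"
      unfolding eq by (rule abs_comb_le)
    also have "\<dots> \<le> norm h * (B1 * norm h) + norm h * (B2 * norm h)"
      by (intro add_mono mult_mono f b) auto
    finally show ?thesis by (simp add: power2_eq_square algebra_simps)
  qed
  then show ?thesis using B1(1) B2(1) by (intro exI[of _ "B1 + B2"]) auto
qed

definition conv :: "(plane \<Rightarrow> real) \<Rightarrow> (plane \<Rightarrow> real) \<Rightarrow> plane \<Rightarrow> real" where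
  "conv \<eta> f z = (LINT w|lborel. \<eta> (z - w) * f w)"

lemma conv_integrable:
  assumes "test_function U \<eta>" "integrable lborel f"
  shows "integrable lborel (\<lambda>w. \<eta> (z - w) * f w)"
proof -
  obtain B where B: "\<And>z. \<bar>\<eta> z\<bar> \<le> B" using test_bounded[OF assms(1)] by blast
  have m [measurable]: "\<eta> \<in> borel_measurable borel" by (rule smooth_borel[OF test_smooth[OF assms(1)]])
  show ?thesis
  proof (rule Bochner_Integration.integrable_bound[OF integrable_mult_right[OF assms(2), of B]])
    show "(\<lambda>w. \<eta> (z - w) * f w) \<in> borel_measurable lborel" using assms(2) by measurable
    show "AE w in lborel. norm (\<eta> (z - w) * f w) \<le> norm (B * f w)"
      using mult_right_mono[OF order_trans[OF B abs_ge_self]] by (auto simp: abs_mult)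
  qed
qed

text \<open>The Taylor remainder of the kernel is quadratic in the increment, uniformly in the point, so it may be
  integrated against \<open>f\<close>.\<close>

lemma conv_has_derivative:
  assumes t: "test_function U \<eta>" and f: "integrable lborel f"
  shows "(conv \<eta> f has_derivative (\<lambda>h. fst h * conv (dx \<eta>) f z + snd h * conv (dy \<eta>) f z)) (at z)"
proof -
  obtain B where B: "B \<ge> 0" "\<And>z h. \<bar>\<eta> (z + h) - \<eta> z - (fst h * dx \<eta> z + snd h * dy \<eta> z)\<bar> \<le> B * (norm h)\<^sup>2"
    using test_taylor[OF t] by blast
  define I where "I = (LINT w|lborel. \<bar>f w\<bar>)"
  have I: "I \<ge> 0" by (simp add: I_def)
  note ints = conv_integrable[OF t f] conv_integrable[OF test_pderiv[OF t] f]
  have bound: "\<bar>conv \<eta> f (z + h) - conv \<eta> f z - (fst h * conv (dx \<eta>) f z + snd h * conv (dy \<eta>) f z)\<bar> \<le> B * (norm h)\<^sup>2 * I" for h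
  proof -
    have eq: "conv \<eta> f (z + h) - conv \<eta> f z - (fst h * conv (dx \<eta>) f z + snd h * conv (dy \<eta>) f z)
      = (LINT w|lborel. \<eta> (z + h - w) * f w - \<eta> (z - w) * f w - (fst h * (dx \<eta> (z - w) * f w) + snd h * (dy \<eta> (z - w) * f w)))"
      unfolding conv_def using ints by simp
    have "\<bar>conv \<eta> f (z + h) - conv \<eta> f z - (fst h * conv (dx \<eta>) f z + snd h * conv (dy \<eta>) f z)\<bar>
        \<le> (LINT w|lborel. \<bar>\<eta> (z + h - w) * f w - \<eta> (z - w) * f w - (fst h * (dx \<eta> (z - w) * f w) + snd h * (dy \<eta> (z - w) * f w))\<bar>)"
      unfolding eq by (rule integral_abs_bound)
    also have "\<dots> \<le> (LINT w|lborel. B * (norm h)\<^sup>2 * \<bar>f w\<bar>)"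
    proof (rule integral_mono)
      fix w
      have "\<eta> (z + h - w) * f w - \<eta> (z - w) * f w - (fst h * (dx \<eta> (z - w) * f w) + snd h * (dy \<eta> (z - w) * f w))
        = (\<eta> ((z - w) + h) - \<eta> (z - w) - (fst h * dx \<eta> (z - w) + snd h * dy \<eta> (z - w))) * f w"
        by (simp add: algebra_simps)
      then show "\<bar>\<eta> (z + h - w) * f w - \<eta> (z - w) * f w - (fst h * (dx \<eta> (z - w) * f w) + snd h * (dy \<eta> (z - w) * f w))\<bar> \<le> B * (norm h)\<^sup>2 * \<bar>f w\<bar>"
        using mult_right_mono[OF B(2)[of "z - w" h], of "\<bar>f w\<bar>"] by (simp add: abs_mult)
    qed (use ints f in auto)
    also have "\<dots> = B * (norm h)\<^sup>2 * I" by (simp add: I_def)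
    finally show ?thesis .
  qed
  show ?thesis
  proof (rule has_derivativeI_sandwich[of 1, where H="\<lambda>y. B * I * norm (y - z)"])
    show "bounded_linear (\<lambda>h. fst h * conv (dx \<eta>) f z + snd h * conv (dy \<eta>) f z)"
      by (intro bounded_linear_add bounded_linear_mult_const bounded_linear_fst bounded_linear_snd bounded_linear_ident
          bounded_linear_compose[OF bounded_linear_mult_left bounded_linear_fst] bounded_linear_compose[OF bounded_linear_mult_left bounded_linear_snd])
    show "((\<lambda>y. B * I * norm (y - z)) \<longlongrightarrow> 0) (at z)"
      by (auto intro!: tendsto_eq_intros)
    fix y assume y: "y \<noteq> z"
    show "norm (conv \<eta> f y - conv \<eta> f z - (fst (y - z) * conv (dx \<eta>) f z + snd (y - z) * conv (dy \<eta>) f z)) / norm (y - z) \<le> B * I * norm (y - z)"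
      using bound[of "y - z"] y by (simp add: divide_le_eq power2_eq_square algebra_simps)
  qed auto
qed

lemma smooth_conv: "test_function U \<eta> \<Longrightarrow> integrable lborel f \<Longrightarrow> smooth (conv \<eta> f)"
proof -
  assume "test_function U \<eta>" and f: "integrable lborel f"
  then have "Ck n (conv \<eta> f)" for n
  proof (induction n arbitrary: \<eta>)
    case 0
    have "isCont (conv \<eta> f) z" for z
      by (rule has_derivative_continuous[OF conv_has_derivative[OF 0]])
    then show ?case by (simp add: continuous_at_imp_continuous_on)
  next
    case (Suc n)
    show ?case by (rule Ck_SucI[OF conv_has_derivative[OF Suc.prems]]) (intro Suc.IH test_pderiv Suc.prems)+
  qed
  then show ?thesis by (simp add: smooth_def)
qed

lemma conv_pderiv: "test_function U \<eta> \<Longrightarrow> integrable lborel f \<Longrightarrow> pderiv_dir v (conv \<eta> f) z = conv (pderiv_dir v \<eta>) f z"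
proof -
  assume t: "test_function U \<eta>" and f: "integrable lborel f"
  have "pderiv_dir v \<eta> = (\<lambda>w. fst v * dx \<eta> w + snd v * dy \<eta> w)"
    using pderiv_dir_expand[OF test_smooth[OF t]] by blast
  then have "conv (pderiv_dir v \<eta>) f z = (LINT w|lborel. fst v * (dx \<eta> (z - w) * f w) + snd v * (dy \<eta> (z - w) * f w))"
    unfolding conv_def by (simp add: algebra_simps)
  also have "\<dots> = fst v * conv (dx \<eta>) f z + snd v * conv (dy \<eta>) f z"
    unfolding conv_def using conv_integrable[OF test_pderiv[OF t] f] by simp
  finally show ?thesis using pderiv_dirI[OF conv_has_derivative[OF t f]] by simp
qed

definition bump :: "plane \<Rightarrow> real" where
  "bump z = flat 0 (1 - (fst z * fst z + snd z * snd z))"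

definition kernel :: "plane \<Rightarrow> real" where
  "kernel z = inverse (LINT w|lborel. bump w) * bump z"

lemma bump_nonneg: "bump z \<ge> 0" by (simp add: bump_def flat_nonneg)

lemma norm_sq_plane: "(norm z)\<^sup>2 = fst z * fst z + snd z * snd (z :: plane)"
  by (simp add: norm_prod_def power2_eq_square)

lemma bump_test: "test_function UNIV bump"
proof (rule test_supportI[of _ "cball 0 1"])
  show "smooth bump" unfolding bump_def[abs_def] by (intro smooth_flat smooth_intros)
  fix z :: plane assume "z \<notin> cball 0 1"
  then have "1 < norm z" by simp
  then have "1 < (norm z)\<^sup>2" by (simp add: one_less_power)
  then show "bump z = 0" unfolding bump_def norm_sq_plane[symmetric] by (intro flat_eq_0) auto
qed auto

lemma indicator_integrable: "compact K \<Longrightarrow> integrable lborel (indicator K :: plane \<Rightarrow> real)"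
  using emeasure_compact_finite[of K] by (intro integrable_real_indicator) (auto simp: borel_compact)

lemma bump_integral_pos: "(LINT w|lborel. bump w) > 0"
proof -
  let ?K = "cbox (0, 0) (1/2, 1/2) :: plane set"
  have "0 < measure lborel ?K"
    by (intro content_pos_lt) (auto simp: plane_Basis)
  then have "0 < flat 0 (1/2) * measure lborel ?K"
    using flat_pos[of "1/2" 0] by simp
  also have "flat 0 (1/2) * measure lborel ?K = (LINT w|lborel. flat 0 (1/2) * indicator ?K w)"
    by simp
  also have "\<dots> \<le> (LINT w|lborel. bump w)"
  proof (rule integral_mono)
    fix w :: plane
    show "flat 0 (1/2) * indicator ?K w \<le> bump w"
    proof (cases "w \<in> ?K")
      case True
      then have "fst w * fst w \<le> 1/2 * (1/2)" "snd w * snd w \<le> 1/2 * (1/2)"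
      proof -
        have "0 \<le> fst w" "fst w \<le> 1/2" "0 \<le> snd w" "snd w \<le> 1/2"
          using True by (cases w, simp add: cbox_Pair_eq)+
        then show "fst w * fst w \<le> 1/2 * (1/2)" "snd w * snd w \<le> 1/2 * (1/2)" by (intro mult_mono; simp)+
      qed
      then have h: "1/2 \<le> 1 - (fst w * fst w + snd w * snd w)" by simp
      then have "flat 0 (1/2) \<le> bump w"
        unfolding bump_def flat_def by (auto simp: field_simps)
      then show ?thesis using True by simp
    qed (simp add: bump_nonneg)
  qed (use test_lborel_integrable[OF bump_test] indicator_integrable[of ?K] in auto)
  finally show ?thesis .
qed

lemma kernel_test: "test_function UNIV kernel"
  unfolding kernel_def[abs_def] by (rule test_cmult[OF bump_test])

lemma kernel_nonneg: "kernel z \<ge> 0"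
  using bump_integral_pos bump_nonneg by (simp add: kernel_def less_imp_le)

lemma kernel_integral: "(LINT z|lborel. kernel z) = 1"
  using bump_integral_pos by (simp add: kernel_def)

lemma kernel_zero: "norm z > 1 \<Longrightarrow> kernel z = 0"
proof -
  assume "norm z > 1"
  then have "1 < (norm z)\<^sup>2" by (simp add: one_less_power)
  then show ?thesis unfolding kernel_def bump_def norm_sq_plane[symmetric] by (simp add: flat_eq_0)
qed

text \<open>The kernel at scale \<open>\<delta>\<close>, evaluated after a slight dilation: for a function that vanishes outside
  a star-shaped domain, the dilation pulls the support of the mollified function inside.\<close>

definition eta :: "real \<Rightarrow> plane \<Rightarrow> real" where
  "eta \<delta> z = inverse (\<delta>\<^sup>2) * kernel (inverse \<delta> *\<^sub>R z + 0)"

definition moll :: "real \<Rightarrow> (plane \<Rightarrow> real) \<Rightarrow> plane \<Rightarrow> real" where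
  "moll \<delta> f z = conv (eta \<delta>) f ((1 + 4 * \<delta>) *\<^sub>R z + 0)"

lemma eta_test: "\<delta> > 0 \<Longrightarrow> test_function UNIV (eta \<delta>)"
  unfolding eta_def[abs_def]
  by (intro test_cmult test_affine[OF kernel_test, of _ "\<lambda>z. \<delta> *\<^sub>R z"]) (auto intro: bounded_linear_scaleR_right)

lemma lborel_affine_nn:
  fixes g :: "plane \<Rightarrow> ennreal"
  assumes "g \<in> borel_measurable borel" "c \<noteq> 0"
  shows "(\<integral>\<^sup>+z. g z \<partial>lborel) = ennreal (c\<^sup>2) * (\<integral>\<^sup>+z. g (t + c *\<^sub>R z) \<partial>lborel)"
proof -
  have "(\<integral>\<^sup>+z. g z \<partial>lborel) = (\<integral>\<^sup>+z. g z \<partial>(density (distr lborel borel (\<lambda>x. t + c *\<^sub>R x)) (\<lambda>_. \<bar>c\<bar>^DIM(plane))))"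
    using lborel_affine[OF assms(2), of t] by simp
  also have "\<dots> = ennreal (c\<^sup>2) * (\<integral>\<^sup>+z. g (t + c *\<^sub>R z) \<partial>lborel)"
    using assms by (simp add: nn_integral_density nn_integral_distr nn_integral_cmult plane_Basis power2_eq_square)
  finally show ?thesis .
qed

lemma lborel_affine_integral:
  fixes g :: "plane \<Rightarrow> real"
  assumes "g \<in> borel_measurable borel" "c \<noteq> 0"
  shows "(LINT z|lborel. g z) = c\<^sup>2 * (LINT z|lborel. g (t + c *\<^sub>R z))"
proof -
  have "(LINT z|lborel. g z) = (LINT z|density (distr lborel borel (\<lambda>x. t + c *\<^sub>R x)) (\<lambda>_. ennreal (c\<^sup>2)). g z)"
    using lborel_affine[OF assms(2), of t] by (simp add: plane_Basis power2_eq_square)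
  also have "\<dots> = c\<^sup>2 * (LINT z|lborel. g (t + c *\<^sub>R z))"
    using assms by (simp add: integral_density integral_distr)
  finally show ?thesis .
qed

lemma eta_reflect_integral: "\<delta> > 0 \<Longrightarrow> (LINT w|lborel. eta \<delta> (z - w)) = 1"
proof -
  assume d: "\<delta> > 0"
  have [measurable]: "eta \<delta> \<in> borel_measurable borel" by (rule smooth_borel[OF test_smooth[OF eta_test[OF d]]])
  have "(LINT w|lborel. eta \<delta> (z - w)) = (-\<delta>)\<^sup>2 * (LINT u|lborel. eta \<delta> (z - (z + (-\<delta>) *\<^sub>R u)))"
    using d by (intro lborel_affine_integral) auto
  also have "(\<lambda>u. eta \<delta> (z - (z + (-\<delta>) *\<^sub>R u))) = (\<lambda>u. inverse (\<delta>\<^sup>2) * kernel u)"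
    using d by (auto simp: eta_def)
  finally show ?thesis using d by (simp add: kernel_integral)
qed

lemma jensen_kernel:
  fixes k e :: "'a \<Rightarrow> real"
  assumes "k \<in> borel_measurable M" "integrable M e" "\<And>w. e w \<ge> 0" "(LINT w|M. e w) = 1"
    "integrable M (\<lambda>w. e w * k w)"
  shows "ennreal ((LINT w|M. e w * k w)\<^sup>2) \<le> (\<integral>\<^sup>+w. ennreal (e w * (k w)\<^sup>2) \<partial>M)"
proof (cases "integrable M (\<lambda>w. e w * (k w)\<^sup>2)")
  case True
  define m where "m = (LINT w|M. e w * k w)"
  have "0 \<le> (LINT w|M. e w * (k w - m)\<^sup>2)" using assms(3) by simp
  also have "(\<lambda>w. e w * (k w - m)\<^sup>2) = (\<lambda>w. e w * (k w)\<^sup>2 - 2 * m * (e w * k w) + m\<^sup>2 * e w)"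
    by (auto simp: power2_eq_square algebra_simps)
  also have "(LINT w|M. e w * (k w)\<^sup>2 - 2 * m * (e w * k w) + m\<^sup>2 * e w) = (LINT w|M. e w * (k w)\<^sup>2) - 2 * m * m + m\<^sup>2"
    using True assms by (simp add: m_def)
  finally have "m\<^sup>2 \<le> (LINT w|M. e w * (k w)\<^sup>2)" by (simp add: power2_eq_square)
  then show ?thesis using True assms(3) by (simp add: nn_integral_eq_integral m_def ennreal_leI)
next
  case False
  have "(\<integral>\<^sup>+w. ennreal (e w * (k w)\<^sup>2) \<partial>M) = \<infinity>"
  proof (rule ccontr)
    assume "(\<integral>\<^sup>+w. ennreal (e w * (k w)\<^sup>2) \<partial>M) \<noteq> \<infinity>"
    then have "integrable M (\<lambda>w. e w * (k w)\<^sup>2)"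
      using assms by (intro integrableI_nonneg) (auto simp: less_top[symmetric])
    then show False using False by simp
  qed
  then show ?thesis by simp
qed

text \<open>By Jensen's inequality the error of mollification is an average of the errors of the affine substitutions
  that the mollifier averages, so a uniform bound for these suffices.\<close>

lemma moll_error:
  assumes d: "\<delta> > 0" and f: "integrable lborel f" and [measurable]: "f \<in> borel_measurable borel"
    and mod: "\<And>u. norm u \<le> 1 \<Longrightarrow> (\<integral>\<^sup>+z. ennreal ((f ((1 + 4 * \<delta>) *\<^sub>R z - \<delta> *\<^sub>R u) - f z)\<^sup>2) \<partial>lborel) \<le> ennreal e"
  shows "(\<integral>\<^sup>+z. ennreal ((moll \<delta> f z - f z)\<^sup>2) \<partial>lborel) \<le> ennreal e"
proof -
  have [measurable]: "eta \<delta> \<in> borel_measurable borel" by (rule smooth_borel[OF test_smooth[OF eta_test[OF d]]])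
  have [measurable]: "kernel \<in> borel_measurable borel" by (rule smooth_borel[OF test_smooth[OF kernel_test]])
  let ?L = "1 + 4 * \<delta>"
  have en: "eta \<delta> z \<ge> 0" for z using kernel_nonneg by (simp add: eta_def)
  have ei: "integrable lborel (\<lambda>w. eta \<delta> (z - w))" for z
    using eta_reflect_integral[OF d, of z] not_integrable_integral_eq by fastforce
  have pt: "ennreal ((moll \<delta> f z - f z)\<^sup>2) \<le> (\<integral>\<^sup>+u. ennreal (kernel u * (f (?L *\<^sub>R z - \<delta> *\<^sub>R u) - f z)\<^sup>2) \<partial>lborel)" for z
  proof -
    have I: "integrable lborel (\<lambda>w. eta \<delta> (?L *\<^sub>R z - w) * (f w - f z))"
      using conv_integrable[OF eta_test[OF d] f, of "?L *\<^sub>R z"] ei[of "?L *\<^sub>R z"] by (simp add: right_diff_distrib)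
    have "moll \<delta> f z - f z = (LINT w|lborel. eta \<delta> (?L *\<^sub>R z - w) * f w) - f z * (LINT w|lborel. eta \<delta> (?L *\<^sub>R z - w))"
      using eta_reflect_integral[OF d] by (simp add: moll_def conv_def)
    also have "\<dots> = (LINT w|lborel. eta \<delta> (?L *\<^sub>R z - w) * f w - f z * eta \<delta> (?L *\<^sub>R z - w))"
      using conv_integrable[OF eta_test[OF d] f, of "?L *\<^sub>R z"] ei[of "?L *\<^sub>R z"] by simp
    also have "\<dots> = (LINT w|lborel. eta \<delta> (?L *\<^sub>R z - w) * (f w - f z))"
      by (simp add: algebra_simps)
    finally have "ennreal ((moll \<delta> f z - f z)\<^sup>2) \<le> (\<integral>\<^sup>+w. ennreal (eta \<delta> (?L *\<^sub>R z - w) * (f w - f z)\<^sup>2) \<partial>lborel)"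
      using jensen_kernel[of "\<lambda>w. f w - f z" lborel "\<lambda>w. eta \<delta> (?L *\<^sub>R z - w)"] ei en eta_reflect_integral[OF d] I by auto
    also have "\<dots> = ennreal ((-\<delta>)\<^sup>2) * (\<integral>\<^sup>+u. ennreal (eta \<delta> (?L *\<^sub>R z - (?L *\<^sub>R z + (-\<delta>) *\<^sub>R u)) * (f (?L *\<^sub>R z + (-\<delta>) *\<^sub>R u) - f z)\<^sup>2) \<partial>lborel)"
      by (rule lborel_affine_nn) (use d in auto)
    also have "\<dots> = (\<integral>\<^sup>+u. ennreal ((-\<delta>)\<^sup>2) * ennreal (eta \<delta> (?L *\<^sub>R z - (?L *\<^sub>R z + (-\<delta>) *\<^sub>R u)) * (f (?L *\<^sub>R z + (-\<delta>) *\<^sub>R u) - f z)\<^sup>2) \<partial>lborel)"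
      by (rule nn_integral_cmult[symmetric]) measurable
    also have "\<dots> = (\<integral>\<^sup>+u. ennreal (kernel u * (f (?L *\<^sub>R z - \<delta> *\<^sub>R u) - f z)\<^sup>2) \<partial>lborel)"
      using d by (intro nn_integral_cong) (simp add: eta_def ennreal_mult'[symmetric] field_simps)
    finally show ?thesis .
  qed
  have "(\<integral>\<^sup>+z. ennreal ((moll \<delta> f z - f z)\<^sup>2) \<partial>lborel) \<le>
      (\<integral>\<^sup>+z. \<integral>\<^sup>+u. ennreal (kernel u * (f (?L *\<^sub>R z - \<delta> *\<^sub>R u) - f z)\<^sup>2) \<partial>lborel \<partial>lborel)"
    by (rule nn_integral_mono) (rule pt)
  also have "\<dots> = (\<integral>\<^sup>+u. \<integral>\<^sup>+z. ennreal (kernel u * (f (?L *\<^sub>R z - \<delta> *\<^sub>R u) - f z)\<^sup>2) \<partial>lborel \<partial>lborel)"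
    by (rule lborel_pair.Fubini') measurable
  also have "\<dots> \<le> (\<integral>\<^sup>+u. ennreal (kernel u) * ennreal e \<partial>lborel)"
  proof (rule nn_integral_mono)
    fix u :: plane
    have "(\<integral>\<^sup>+z. ennreal (kernel u * (f (?L *\<^sub>R z - \<delta> *\<^sub>R u) - f z)\<^sup>2) \<partial>lborel)
      = ennreal (kernel u) * (\<integral>\<^sup>+z. ennreal ((f (?L *\<^sub>R z - \<delta> *\<^sub>R u) - f z)\<^sup>2) \<partial>lborel)"
      by (subst nn_integral_cmult[symmetric]) (auto simp: ennreal_mult' kernel_nonneg)
    also have "\<dots> \<le> ennreal (kernel u) * ennreal e"
    proof (cases "norm u \<le> 1")
      case True
      then show ?thesis by (intro mult_left_mono mod) auto
    next
      case False
      then show ?thesis by (simp add: kernel_zero)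
    qed
    finally show "(\<integral>\<^sup>+z. ennreal (kernel u * (f (?L *\<^sub>R z - \<delta> *\<^sub>R u) - f z)\<^sup>2) \<partial>lborel) \<le> ennreal (kernel u) * ennreal e" .
  qed
  also have "\<dots> = ennreal e"
    using test_lborel_integrable[OF kernel_test] kernel_nonneg
    by (subst nn_integral_multc) (auto simp: nn_integral_eq_integral kernel_integral)
  finally show ?thesis .
qed

text \<open>Truncating the values, then taking continuous functions that converge almost everywhere, cut off in value
  and in space: dominated convergence applies to both steps.\<close>

lemma L2_approx_continuous:
  fixes f :: "plane \<Rightarrow> real"
  assumes f: "L2_fun lborel f" and sup: "\<And>z. norm z > R \<Longrightarrow> f z = 0" and e: "e > 0" and R: "R > 0"
  shows "\<exists>c. continuous_on UNIV c \<and> (\<forall>z. norm z > R + 1 \<longrightarrow> c z = 0) \<and> (\<integral>\<^sup>+z. ennreal ((f z - c z)\<^sup>2) \<partial>lborel) \<le> ennreal e"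
proof -
  have [measurable]: "f \<in> borel_measurable borel" using L2_D(1)[OF f] by simp
  define B where "B = cball (0::plane) (R + 1)"
  define t where "t n z = max (- real n) (min (real n) (f z))" for n z
  have tle: "\<bar>f z - t n z\<bar> \<le> \<bar>f z\<bar>" for n z by (auto simp: t_def max_def min_def)
  have [measurable]: "t n \<in> borel_measurable borel" for n unfolding t_def by measurable
  have "(\<lambda>n. LINT z|lborel. (f z - t n z)\<^sup>2) \<longlonglongrightarrow> (LINT z|(lborel::plane measure). 0)"
  proof (rule integral_dominated_convergence[where w="\<lambda>z. (f z)\<^sup>2"])
    show "AE z in lborel. (\<lambda>n. (f z - t n z)\<^sup>2) \<longlonglongrightarrow> 0"
    proof (rule AE_I2)
      fix z
      obtain N where N: "\<bar>f z\<bar> \<le> real N" using real_arch_simple by blast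
      have "(f z - t n z)\<^sup>2 = 0" if "n \<ge> N" for n
        using N that by (auto simp: t_def max_def min_def)
      then show "(\<lambda>n. (f z - t n z)\<^sup>2) \<longlonglongrightarrow> 0"
        by (intro tendsto_eventually eventually_sequentiallyI)
    qed
    show "AE z in lborel. norm ((f z - t n z)\<^sup>2) \<le> (f z)\<^sup>2" for n
      using tle[of _ n] by (auto simp: abs_le_square_iff)
  qed (use L2_D(2)[OF f] in auto)
  then obtain n where n: "(LINT z|lborel. (f z - t n z)\<^sup>2) < e / 8"
    using order_tendstoD(2)[of _ 0 sequentially "e/8"] e by (fastforce simp: eventually_sequentially)
  have nI: "integrable lborel (\<lambda>z. (f z - t n z)\<^sup>2)"
    by (rule Bochner_Integration.integrable_bound[OF L2_D(2)[OF f]]) (use tle[of _ n] in \<open>auto simp: abs_le_square_iff\<close>)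
  have "t n \<in> borel_measurable lebesgue" by (intro measurable_completion) measurable
  then have "(t n) measurable_on UNIV"
    by (intro lebesgue_measurable_imp_measurable_on) (auto simp: lebesgue_on_UNIV_eq)
  then obtain N g where N: "negligible N" "\<And>k. continuous_on UNIV (g k)" "\<And>z. z \<notin> N \<Longrightarrow> (\<lambda>k. g k z) \<longlonglongrightarrow> t n z"
    unfolding measurable_on_def by auto
  define cut where "cut z = max 0 (min 1 (R + 1 - norm z))" for z :: plane
  define c where "c k z = cut z * max (- real n) (min (real n) (g k z))" for k z
  have cc: "continuous_on UNIV (c k)" for k
    unfolding c_def cut_def by (intro continuous_intros N)
  have [measurable]: "c k \<in> borel_measurable borel" for k by (rule borel_measurable_continuous_onI[OF cc])
  have c0: "c k z = 0" if "norm z > R + 1" for k z using that by (simp add: c_def cut_def)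
  have t0: "t n z = 0" if "norm z > R" for z using sup[OF that] by (simp add: t_def)
  have ct: "cut z * t n z = t n z" for z
    by (cases "norm z > R") (auto simp: t0 cut_def)
  have tb: "\<bar>t n z\<bar> \<le> n" and cb: "\<bar>c k z\<bar> \<le> n" for k z
  proof -
    show "\<bar>t n z\<bar> \<le> n" by (auto simp: t_def max_def min_def)
    have "\<bar>cut z\<bar> \<le> 1" "\<bar>max (- real n) (min (real n) (g k z))\<bar> \<le> n" by (auto simp: cut_def max_def min_def)
    then show "\<bar>c k z\<bar> \<le> n" unfolding c_def abs_mult using mult_mono[of "\<bar>cut z\<bar>" 1] by fastforce
  qed
  have dom: "(t n z - c k z)\<^sup>2 \<le> (2 * real n)\<^sup>2 * indicator B z" for k z
  proof (cases "z \<in> B")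
    case True
    have "\<bar>t n z - c k z\<bar> \<le> \<bar>2 * real n\<bar>" using tb[of z] cb[of k z] by linarith
    then have "(t n z - c k z)\<^sup>2 \<le> (2 * real n)\<^sup>2" by (simp only: abs_le_square_iff)
    then show ?thesis using True by simp
  next
    case False
    then show ?thesis using c0[of z k] t0[of z] by (simp add: B_def)
  qed
  have BI: "integrable lborel (\<lambda>z. (2 * real n)\<^sup>2 * indicator B z :: real)"
    unfolding B_def using indicator_integrable[of "cball 0 (R + 1)"] by simp
  have "(\<lambda>k. LINT z|lborel. (t n z - c k z)\<^sup>2) \<longlonglongrightarrow> (LINT z|(lborel::plane measure). 0)"
  proof (rule integral_dominated_convergence[where w="\<lambda>z. (2 * real n)\<^sup>2 * indicator B z"])
    have "AE z in lborel. z \<notin> N" using N(1) by (metis AE_completion_iff AE_not_in negligible_iff_null_sets)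
    then show "AE z in lborel. (\<lambda>k. (t n z - c k z)\<^sup>2) \<longlonglongrightarrow> 0"
    proof eventually_elim
      case (elim z)
      have "(\<lambda>k. c k z) \<longlonglongrightarrow> cut z * max (- real n) (min (real n) (t n z))"
        unfolding c_def by (intro tendsto_intros N(3) elim)
      also have "max (- real n) (min (real n) (t n z)) = t n z" using tb[of z] by (auto simp: max_def min_def)
      finally have "(\<lambda>k. c k z) \<longlonglongrightarrow> t n z" by (simp add: ct)
      then have "(\<lambda>k. (t n z - c k z)\<^sup>2) \<longlonglongrightarrow> (t n z - t n z)\<^sup>2" by (intro tendsto_intros)
      then show ?case by simp
    qed
  qed (use dom BI in auto)
  then obtain k where k: "(LINT z|lborel. (t n z - c k z)\<^sup>2) < e / 8"
    using order_tendstoD(2)[of _ 0 sequentially "e/8"] e by (fastforce simp: eventually_sequentially)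
  have kI: "integrable lborel (\<lambda>z. (t n z - c k z)\<^sup>2)"
    by (rule Bochner_Integration.integrable_bound[OF BI]) (use dom in auto)
  have "(\<integral>\<^sup>+z. ennreal ((f z - c k z)\<^sup>2) \<partial>lborel) \<le> (\<integral>\<^sup>+z. ennreal (2 * (f z - t n z)\<^sup>2 + 2 * (t n z - c k z)\<^sup>2) \<partial>lborel)"
    using sq_add_le[of "f z - t n z" "t n z - c k z" for z] by (intro nn_integral_mono ennreal_leI) simp
  also have "\<dots> = ennreal (LINT z|lborel. 2 * (f z - t n z)\<^sup>2 + 2 * (t n z - c k z)\<^sup>2)"
    using nI kI by (intro nn_integral_eq_integral) auto
  also have "\<dots> \<le> ennreal e" using nI kI n k e by (intro ennreal_leI) simp
  finally show ?thesis using cc c0 by blast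
qed

text \<open>The continuity of translations in \<open>L\<^sup>2\<close>, with the dilation included: it is clear for continuous functions
  with compact support, and the substitution does not increase the \<open>L\<^sup>2\<close> norm of the approximation error.\<close>

lemma L2_affine_continuity:
  fixes f :: "plane \<Rightarrow> real"
  assumes f: "L2_fun lborel f" and sup: "\<And>z. norm z > R \<Longrightarrow> f z = 0" and e: "e > 0" and R: "R > 0"
  shows "\<exists>d>0. \<forall>\<delta> u. 0 < \<delta> \<longrightarrow> \<delta> < d \<longrightarrow> norm u \<le> 1 \<longrightarrow>
    (\<integral>\<^sup>+z. ennreal ((f ((1 + 4 * \<delta>) *\<^sub>R z - \<delta> *\<^sub>R u) - f z)\<^sup>2) \<partial>lborel) \<le> ennreal e"
proof -
  have [measurable]: "f \<in> borel_measurable borel" using L2_D(1)[OF f] by simp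
  have "\<exists>c. continuous_on UNIV c \<and> (\<forall>z. norm z > R + 1 \<longrightarrow> c z = 0) \<and> (\<integral>\<^sup>+z. ennreal ((f z - c z)\<^sup>2) \<partial>lborel) \<le> ennreal (e / 9)"
    by (rule L2_approx_continuous) (use f sup e R in auto)
  then obtain c where c: "continuous_on UNIV c" "\<And>z. norm z > R + 1 \<Longrightarrow> c z = 0"
    and ce: "(\<integral>\<^sup>+z. ennreal ((f z - c z)\<^sup>2) \<partial>lborel) \<le> ennreal (e / 9)"
    by blast
  have [measurable]: "c \<in> borel_measurable borel" by (rule borel_measurable_continuous_onI[OF c(1)])
  define B where "B = cball (0::plane) (R + 2)"
  define m where "m = measure lborel B + 1"
  have m: "m > 0" by (simp add: m_def add_nonneg_pos)
  define \<kappa> where "\<kappa> = sqrt (e / (9 * m))"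
  have k: "\<kappa> > 0" "\<kappa>\<^sup>2 = e / (9 * m)" using e m by (auto simp: \<kappa>_def)
  have "uniformly_continuous_on (cball 0 (7 * (R + 2))) c"
    by (rule compact_uniformly_continuous) (auto intro: continuous_on_subset[OF c(1)])
  then obtain d0 where d0: "d0 > 0" "\<And>z w. z \<in> cball 0 (7 * (R + 2)) \<Longrightarrow> w \<in> cball 0 (7 * (R + 2)) \<Longrightarrow> dist w z < d0 \<Longrightarrow> dist (c w) (c z) < \<kappa>"
    using k(1) unfolding uniformly_continuous_on_def by metis
  define d where "d = min 1 (d0 / (4 * (R + 2) + 1))"
  have dpos: "d > 0" using d0(1) R by (simp add: d_def)
  have main: "(\<integral>\<^sup>+z. ennreal ((f ((1 + 4 * \<delta>) *\<^sub>R z - \<delta> *\<^sub>R u) - f z)\<^sup>2) \<partial>lborel) \<le> ennreal e"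
    if dl: "0 < \<delta>" "\<delta> < d" and u: "norm u \<le> 1" for \<delta> u
  proof -
    define T where "T z = - (\<delta> *\<^sub>R u) + (1 + 4 * \<delta>) *\<^sub>R z" for z :: plane
    have [measurable]: "T \<in> borel_measurable borel" unfolding T_def by measurable
    have Teq: "(1 + 4 * \<delta>) *\<^sub>R z - \<delta> *\<^sub>R u = T z" for z by (simp add: T_def)
    have d1: "\<delta> < 1" using dl by (simp add: d_def)
    have du: "norm (\<delta> *\<^sub>R u) \<le> \<delta>" using u dl by (simp add: mult_left_le)
    have mid: "(c (T z) - c z)\<^sup>2 \<le> \<kappa>\<^sup>2 * indicator B z" for z
    proof (cases "z \<in> B")
      case True
      then have nz: "norm z \<le> R + 2" by (simp add: B_def)
      have "norm (T z - z) \<le> norm (\<delta> *\<^sub>R u) + norm ((4 * \<delta>) *\<^sub>R z)"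
        unfolding T_def using norm_triangle_ineq4[of "(4 * \<delta>) *\<^sub>R z" "\<delta> *\<^sub>R u"] by (simp add: algebra_simps)
      also have "norm ((4 * \<delta>) *\<^sub>R z) \<le> 4 * \<delta> * (R + 2)" using nz dl by (simp add: mult_left_mono)
      also have "norm (\<delta> *\<^sub>R u) + 4 * \<delta> * (R + 2) \<le> \<delta> + 4 * \<delta> * (R + 2)" using du by simp
      finally have 1: "norm (T z - z) \<le> \<delta> * (4 * (R + 2) + 1)" by (simp add: algebra_simps)
      have "\<delta> * (4 * (R + 2) + 1) < d0"
        using dl R by (simp add: d_def pos_less_divide_eq)
      then have 2: "dist (T z) z < d0" using 1 by (simp add: dist_norm)
      have "norm (T z) \<le> norm z + norm (T z - z)" by (metis add_diff_cancel_left' diff_add_cancel norm_triangle_ineq add.commute)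
      also have "\<dots> \<le> (R + 2) + 1 * (4 * (R + 2) + 1)"
      proof -
        have "\<delta> * (4 * (R + 2) + 1) \<le> 1 * (4 * (R + 2) + 1)" by (rule mult_right_mono) (use d1 R in auto)
        then show ?thesis using nz 1 by linarith
      qed
      also have "\<dots> \<le> 7 * (R + 2)" using R by simp
      finally have "\<bar>c (T z) - c z\<bar> < \<kappa>" using d0(2)[OF _ _ 2] nz R by (simp add: dist_real_def)
      then have "\<bar>c (T z) - c z\<bar> \<le> \<bar>\<kappa>\<bar>" by simp
      then show ?thesis using True abs_le_square_iff[of "c (T z) - c z" \<kappa>] by simp
    next
      case False
      then have nz: "norm z > R + 2" by (simp add: B_def)
      have "norm ((1 + 4 * \<delta>) *\<^sub>R z) = (1 + 4 * \<delta>) * norm z" using dl by simp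
      also have "\<dots> \<ge> norm z" using dl by (simp add: mult_le_cancel_right1)
      finally have "norm (T z) > R + 1"
        using norm_triangle_ineq2[of "(1 + 4 * \<delta>) *\<^sub>R z" "\<delta> *\<^sub>R u"] du d1 nz unfolding Teq by linarith
      then show ?thesis using c(2)[of z] c(2)[of "T z"] nz by simp
    qed
    have fT: "(\<integral>\<^sup>+z. ennreal ((f (T z) - c (T z))\<^sup>2) \<partial>lborel) \<le> ennreal (e / 9)"
    proof -
      have "1 * (\<integral>\<^sup>+z. ennreal ((f (T z) - c (T z))\<^sup>2) \<partial>lborel) \<le> ennreal ((1 + 4 * \<delta>)\<^sup>2) * (\<integral>\<^sup>+z. ennreal ((f (T z) - c (T z))\<^sup>2) \<partial>lborel)"
        using dl by (intro mult_right_mono) (auto simp flip: ennreal_1 intro!: ennreal_leI)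
      also have "\<dots> = (\<integral>\<^sup>+z. ennreal ((f z - c z)\<^sup>2) \<partial>lborel)"
        unfolding T_def using dl by (intro lborel_affine_nn[symmetric]) auto
      finally show ?thesis using ce by simp
    qed
    have cT: "(\<integral>\<^sup>+z. ennreal ((c (T z) - c z)\<^sup>2) \<partial>lborel) \<le> ennreal (e / 9)"
    proof -
      have "(\<integral>\<^sup>+z. ennreal ((c (T z) - c z)\<^sup>2) \<partial>lborel) \<le> (\<integral>\<^sup>+z. ennreal (\<kappa>\<^sup>2 * indicator B z) \<partial>lborel)"
        by (intro nn_integral_mono ennreal_leI mid)
      also have "\<dots> = ennreal (LINT z|lborel. \<kappa>\<^sup>2 * indicator B z)"
        unfolding B_def using indicator_integrable[of "cball 0 (R + 2)"] by (intro nn_integral_eq_integral) auto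
      also have "\<dots> \<le> ennreal (e / 9)"
        using m e by (intro ennreal_leI) (simp add: k m_def divide_le_eq)
      finally show ?thesis .
    qed
    have pt: "(f (T z) - f z)\<^sup>2 \<le> 3 * (f (T z) - c (T z))\<^sup>2 + 3 * (c (T z) - c z)\<^sup>2 + 3 * (f z - c z)\<^sup>2" for z
    proof -
      have "(a + b + k)\<^sup>2 \<le> 3 * a\<^sup>2 + 3 * b\<^sup>2 + 3 * (k::real)\<^sup>2" for a b k
        using sum_squares_bound[of a b] sum_squares_bound[of a k] sum_squares_bound[of b k]
        by (simp add: power2_eq_square algebra_simps)
      from this[of "f (T z) - c (T z)" "c (T z) - c z" "c z - f z"] show ?thesis by (simp add: power2_commute)
    qed
    have "(\<integral>\<^sup>+z. ennreal ((f (T z) - f z)\<^sup>2) \<partial>lborel) \<le>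
      (\<integral>\<^sup>+z. 3 * ennreal ((f (T z) - c (T z))\<^sup>2) + 3 * ennreal ((c (T z) - c z)\<^sup>2) + 3 * ennreal ((f z - c z)\<^sup>2) \<partial>lborel)"
    proof (rule nn_integral_mono)
      fix z
      have "ennreal ((f (T z) - f z)\<^sup>2) \<le> ennreal (3 * (f (T z) - c (T z))\<^sup>2 + 3 * (c (T z) - c z)\<^sup>2 + 3 * (f z - c z)\<^sup>2)"
        by (rule ennreal_leI[OF pt])
      also have "\<dots> = 3 * ennreal ((f (T z) - c (T z))\<^sup>2) + 3 * ennreal ((c (T z) - c z)\<^sup>2) + 3 * ennreal ((f z - c z)\<^sup>2)"
        by (simp add: ennreal_plus ennreal_mult')
      finally show "ennreal ((f (T z) - f z)\<^sup>2) \<le> 3 * ennreal ((f (T z) - c (T z))\<^sup>2) + 3 * ennreal ((c (T z) - c z)\<^sup>2) + 3 * ennreal ((f z - c z)\<^sup>2)" .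
    qed
    also have "\<dots> = 3 * (\<integral>\<^sup>+z. ennreal ((f (T z) - c (T z))\<^sup>2) \<partial>lborel) + 3 * (\<integral>\<^sup>+z. ennreal ((c (T z) - c z)\<^sup>2) \<partial>lborel) + 3 * (\<integral>\<^sup>+z. ennreal ((f z - c z)\<^sup>2) \<partial>lborel)"
      by (simp add: nn_integral_add nn_integral_cmult)
    also have "\<dots> \<le> 3 * ennreal (e / 9) + 3 * ennreal (e / 9) + 3 * ennreal (e / 9)"
      by (intro add_mono mult_left_mono fT cT ce) auto
    also have "\<dots> = ennreal (3 * (e / 9) + 3 * (e / 9) + 3 * (e / 9))"
    proof -
      have "3 * ennreal (e / 9) = ennreal (3 * (e / 9))" using ennreal_mult'[of 3 "e / 9"] by simp
      then show ?thesis using e by (simp del: ennreal_plus add: ennreal_plus[symmetric])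
    qed
    also have "\<dots> = ennreal e" by simp
    finally show ?thesis by (simp add: Teq)
  qed
  then show ?thesis using dpos by blast
qed

text \<open>Approximability by test functions in \<open>W\<^sup>1\<^sup>,\<^sup>2\<close>; this is membership in \<open>W\<^sub>0\<^sup>1\<^sup>,\<^sup>2(U)\<close>, with gradient \<open>(hx, hy)\<close>.\<close>

definition W0 :: "plane set \<Rightarrow> (plane \<Rightarrow> real) \<Rightarrow> (plane \<Rightarrow> real) \<Rightarrow> (plane \<Rightarrow> real) \<Rightarrow> bool" where
  "W0 U h hx hy \<longleftrightarrow> (\<exists>\<phi>. (\<forall>n. test_function U (\<phi> n)) \<and> L2_tendsto (lebesgue_on U) \<phi> h \<and>
     L2_tendsto (lebesgue_on U) (\<lambda>n. dx (\<phi> n)) hx \<and> L2_tendsto (lebesgue_on U) (\<lambda>n. dy (\<phi> n)) hy)"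

lemma L2_tendsto_scale:
  assumes "L2_tendsto M f g" "c \<longlonglongrightarrow> 1"
  shows "L2_tendsto M (\<lambda>n z. c n * f n z) g"
proof -
  note D = L2_tendsto_D[OF assms(1)]
  have "L2_tendsto M (\<lambda>n z. (c n - 1) * f n z) (\<lambda>z. 0)"
    unfolding L2_tendsto_def
  proof (intro conjI allI L2_zero L2_cmult D(1))
    have "(\<lambda>n. (c n - 1)\<^sup>2 * (LINT z|M. (f n z)\<^sup>2)) \<longlonglongrightarrow> (1 - 1)\<^sup>2 * (LINT z|M. (g z)\<^sup>2)"
      by (intro tendsto_intros assms(2) L2_tendsto_sq[OF assms(1)])
    then show "(\<lambda>n. LINT z|M. ((c n - 1) * f n z - 0)\<^sup>2) \<longlonglongrightarrow> 0"
      by (simp add: power_mult_distrib)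
  qed
  from L2_tendsto_add[OF this assms(1)] show ?thesis by (simp add: algebra_simps)
qed

lemma L2_tendsto_lborel:
  assumes "L2_tendsto lborel f g" "U \<in> sets lebesgue"
  shows "L2_tendsto (lebesgue_on U) f g"
proof -
  note D = L2_tendsto_D[OF assms(1)]
  have L: "L2_fun (lebesgue_on UNIV) h" if "L2_fun lborel h" for h :: "'a \<Rightarrow> real"
  proof -
    have "h \<in> borel_measurable lebesgue" using L2_D(1)[OF that] by (intro measurable_completion)
    moreover have "integrable lebesgue (\<lambda>z. (h z)\<^sup>2)"
      using that by (subst integrable_completion) (auto simp: L2_fun_def)
    ultimately show ?thesis by (simp add: L2_fun_def lebesgue_on_UNIV_eq)
  qed
  have "L2_tendsto (lebesgue_on UNIV) f g"
    unfolding L2_tendsto_def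
  proof (intro conjI allI L D(1) D(2))
    have "(LINT z|lebesgue. (f n z - g z)\<^sup>2) = (LINT z|lborel. (f n z - g z)\<^sup>2)" for n
      using L2_D(1)[OF D(1)] L2_D(1)[OF D(2)] by (intro integral_completion) auto
    then show "(\<lambda>n. LINT z|lebesgue_on UNIV. (f n z - g z)\<^sup>2) \<longlonglongrightarrow> 0"
      using D(3) by (simp add: lebesgue_on_UNIV_eq)
  qed
  from L2_tendsto_subset[OF assms(2) _ subset_UNIV this] show ?thesis by simp
qed

lemma L2_bounded_support_integrable:
  fixes f :: "plane \<Rightarrow> real"
  assumes "L2_fun lborel f" "\<And>z. norm z > R \<Longrightarrow> f z = 0"
  shows "integrable lborel f"
proof -
  have "integrable lborel (indicator (cball (0::plane) R) :: plane \<Rightarrow> real)"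
    by (rule indicator_integrable) simp
  moreover have "(\<lambda>z. (indicator (cball (0::plane) R) z)\<^sup>2 :: real) = indicator (cball 0 R)"
    by (auto simp: indicator_def)
  ultimately have "L2_fun lborel (indicator (cball (0::plane) R))"
    by (simp add: L2_fun_def)
  from L2_mult_integrable[OF assms(1) this]
  have "integrable lborel (\<lambda>z. f z * indicator (cball 0 R) z)" .
  moreover have "(\<lambda>z. f z * indicator (cball 0 R) z) = f"
    using assms(2) by (force simp: indicator_def)
  ultimately show ?thesis by simp
qed

lemma moll_L2_tendsto:
  fixes f :: "plane \<Rightarrow> real"
  assumes f: "L2_fun lborel f" and sup: "\<And>z. norm z > R \<Longrightarrow> f z = 0" and R: "R > 0"
  shows "\<exists>n0. L2_tendsto lborel (\<lambda>n. moll (1 / (real (n + n0) + 2)) f) f"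
proof -
  have i: "integrable lborel f" using L2_bounded_support_integrable[of f R] f sup by blast
  have [measurable]: "f \<in> borel_measurable borel" using L2_D(1)[OF f] by simp
  define d where "d n = 1 / (real n + 2)" for n
  have d: "d n > 0" for n by (simp add: d_def)
  have sm: "smooth (moll (d n) f)" for n
    unfolding moll_def[abs_def] by (intro smooth_affine bounded_linear_scaleR_right smooth_conv[OF eta_test[OF d] i])
  have [measurable]: "moll (d n) f \<in> borel_measurable borel" for n by (rule smooth_borel[OF sm])
  have dlim: "d \<longlonglongrightarrow> 0"
    unfolding d_def by real_asymp
  have err: "\<exists>N. \<forall>n\<ge>N. (\<integral>\<^sup>+z. ennreal ((moll (d n) f z - f z)\<^sup>2) \<partial>lborel) \<le> ennreal e" if "e > 0" for e
  proof -
    have "\<exists>d>0. \<forall>\<delta> u. 0 < \<delta> \<longrightarrow> \<delta> < d \<longrightarrow> norm u \<le> 1 \<longrightarrow>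
      (\<integral>\<^sup>+z. ennreal ((f ((1 + 4 * \<delta>) *\<^sub>R z - \<delta> *\<^sub>R u) - f z)\<^sup>2) \<partial>lborel) \<le> ennreal e"
      by (rule L2_affine_continuity) (use f sup R that in auto)
    then obtain d0 where d0: "d0 > 0" "\<And>\<delta> u. 0 < \<delta> \<Longrightarrow> \<delta> < d0 \<Longrightarrow> norm u \<le> 1 \<Longrightarrow>
      (\<integral>\<^sup>+z. ennreal ((f ((1 + 4 * \<delta>) *\<^sub>R z - \<delta> *\<^sub>R u) - f z)\<^sup>2) \<partial>lborel) \<le> ennreal e"
      by blast
    obtain N where "\<And>n. n \<ge> N \<Longrightarrow> d n < d0"
      using order_tendstoD(2)[OF dlim d0(1)] by (auto simp: eventually_sequentially)
    then show ?thesis using moll_error[OF d i _ d0(2)[OF d]] by (intro exI[of _ N]) auto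
  qed
  have L: "integrable lborel (\<lambda>z. (moll (d n) f z - f z)\<^sup>2) \<and> (LINT z|lborel. (moll (d n) f z - f z)\<^sup>2) \<le> e"
    if "(\<integral>\<^sup>+z. ennreal ((moll (d n) f z - f z)\<^sup>2) \<partial>lborel) \<le> ennreal e" "e > 0" for n e
  proof -
    have I: "integrable lborel (\<lambda>z. (moll (d n) f z - f z)\<^sup>2)"
      by (rule integrableI_nonneg) (use that le_less_trans[OF that(1)] in auto)
    then show ?thesis using that by (simp add: nn_integral_eq_integral)
  qed
  obtain n0 where n0: "\<And>n. n \<ge> n0 \<Longrightarrow> (\<integral>\<^sup>+z. ennreal ((moll (d n) f z - f z)\<^sup>2) \<partial>lborel) \<le> ennreal 1"
    using err[of 1] by auto
  have L2n: "L2_fun lborel (moll (d n) f)" if "n \<ge> n0" for n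
  proof -
    have "L2_fun lborel (\<lambda>z. moll (d n) f z - f z)" using L[OF n0[OF that]] by (simp add: L2_fun_def)
    from L2_add[OF this f] show ?thesis by simp
  qed
  have "(\<lambda>n. LINT z|lborel. (moll (d n) f z - f z)\<^sup>2) \<longlonglongrightarrow> 0"
  proof (rule LIMSEQ_I)
    fix e :: real assume e: "e > 0"
    obtain N where N: "\<forall>n\<ge>N. (\<integral>\<^sup>+z. ennreal ((moll (d n) f z - f z)\<^sup>2) \<partial>lborel) \<le> ennreal (e / 2)"
      using err[of "e / 2"] e by auto
    have "norm ((LINT z|lborel. (moll (d n) f z - f z)\<^sup>2) - 0) < e" if "n \<ge> N" for n
    proof -
      have "(LINT z|lborel. (moll (d n) f z - f z)\<^sup>2) \<le> e / 2" using L[of n "e / 2"] N e that by simp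
      moreover have "0 \<le> (LINT z|lborel. (moll (d n) f z - f z)\<^sup>2)" by simp
      ultimately show ?thesis using e unfolding real_norm_def by linarith
    qed
    then show "\<exists>N. \<forall>n\<ge>N. norm ((LINT z|lborel. (moll (d n) f z - f z)\<^sup>2) - 0) < e" by blast
  qed
  from LIMSEQ_ignore_initial_segment[OF this, of n0] have "L2_tendsto lborel (\<lambda>n. moll (d (n + n0)) f) f"
    using f L2n by (simp add: L2_tendsto_def)
  then show ?thesis unfolding d_def by blast
qed

lemma L2_tendsto_shift: "L2_tendsto M f g \<Longrightarrow> L2_tendsto M (\<lambda>n. f (n + k)) g"
  unfolding L2_tendsto_def using LIMSEQ_ignore_initial_segment[of "\<lambda>n. LINT z|M. (f n z - g z)\<^sup>2" 0 k] by auto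

text \<open>The derivative falls on the kernel, the weak derivative moves it to \<open>f\<close>, and the factor \<open>1 + 4 \<delta>\<close> is the chain
  rule for the dilation.\<close>

lemma moll_pderiv:
  assumes d: "\<delta> > 0" and f: "integrable lborel f" and F: "integrable lborel F"
    and w: "\<And>\<psi>. test_function UNIV \<psi> \<Longrightarrow> (LINT z|lborel. f z * pderiv_dir v \<psi> z) = - (LINT z|lborel. F z * \<psi> z)"
  shows "pderiv_dir v (moll \<delta> f) z = (1 + 4 * \<delta>) * moll \<delta> F z"
proof -
  let ?L = "1 + 4 * \<delta>"
  define \<psi> where "\<psi> w = eta \<delta> ((-1) *\<^sub>R w + ?L *\<^sub>R z)" for w
  have bl: "bounded_linear (\<lambda>w::plane. c *\<^sub>R w)" for c by (rule bounded_linear_scaleR_right)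
  have t: "test_function UNIV \<psi>"
    unfolding \<psi>_def by (rule test_affine[OF eta_test[OF d] bl bl[of "-1"]]) auto
  have s: "smooth (eta \<delta>)" by (rule test_smooth[OF eta_test[OF d]])
  have P: "pderiv_dir v \<psi> w = - pderiv_dir v (eta \<delta>) (?L *\<^sub>R z - w)" for w
    unfolding \<psi>_def using pderiv_affine[OF bl[of "-1"] s, of v "?L *\<^sub>R z" w]
    by (simp add: pderiv_dir_expand[OF s, of "-v"] pderiv_dir_expand[OF s, of v])
  have "pderiv_dir v (moll \<delta> f) z = pderiv_dir (?L *\<^sub>R v) (conv (eta \<delta>) f) (?L *\<^sub>R z)"
    unfolding moll_def[abs_def] using pderiv_affine[OF bl[of ?L] smooth_conv[OF eta_test[OF d] f], of v 0 z] by simp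
  also have "\<dots> = ?L * pderiv_dir v (conv (eta \<delta>) f) (?L *\<^sub>R z)"
    unfolding pderiv_dir_expand[OF smooth_conv[OF eta_test[OF d] f], of "?L *\<^sub>R v"]
      pderiv_dir_expand[OF smooth_conv[OF eta_test[OF d] f], of v]
    by (simp add: distrib_left mult.assoc)
  also have "\<dots> = ?L * conv (pderiv_dir v (eta \<delta>)) f (?L *\<^sub>R z)"
    by (simp add: conv_pderiv[OF eta_test[OF d] f])
  also have "conv (pderiv_dir v (eta \<delta>)) f (?L *\<^sub>R z) = - (LINT w|lborel. f w * pderiv_dir v \<psi> w)"
    unfolding conv_def P by (simp add: mult.commute)
  also have "\<dots> = (LINT w|lborel. F w * \<psi> w)" by (simp add: w[OF t])
  also have "\<dots> = moll \<delta> F z" by (simp add: moll_def conv_def \<psi>_def mult.commute)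
  finally show ?thesis .
qed

text \<open>A compactly supported function on the plane with weak gradient in \<open>L\<^sup>2\<close> is approximated by its mollifications.
  They are test functions on \<open>U\<close> because the dilation beats the radius of the kernel (assumption \<open>shrink\<close>).\<close>

lemma W0_from_plane:
  fixes f F1 F2 :: "plane \<Rightarrow> real"
  assumes U: "open U" "bounded U"
    and f: "L2_fun lborel f" "L2_fun lborel F1" "L2_fun lborel F2"
    and z: "\<And>z. z \<notin> U \<Longrightarrow> f z = 0" "\<And>z. z \<notin> U \<Longrightarrow> F1 z = 0" "\<And>z. z \<notin> U \<Longrightarrow> F2 z = 0"
    and w1: "\<And>\<psi>. test_function UNIV \<psi> \<Longrightarrow> (LINT z|lborel. f z * dx \<psi> z) = - (LINT z|lborel. F1 z * \<psi> z)"
    and w2: "\<And>\<psi>. test_function UNIV \<psi> \<Longrightarrow> (LINT z|lborel. f z * dy \<psi> z) = - (LINT z|lborel. F2 z * \<psi> z)"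
    and shrink: "\<And>\<delta>. 0 < \<delta> \<Longrightarrow> \<delta> < 1 \<Longrightarrow> \<exists>K. compact K \<and> K \<subseteq> U \<and> (\<forall>z u. norm u \<le> 1 \<longrightarrow> (1 + 4 * \<delta>) *\<^sub>R z - \<delta> *\<^sub>R u \<in> U \<longrightarrow> z \<in> K)"
  shows "W0 U f F1 F2"
proof -
  obtain R where R: "R > 0" "\<And>z. z \<in> U \<Longrightarrow> norm z \<le> R" using U(2) unfolding bounded_pos by blast
  have s: "f z = 0" "F1 z = 0" "F2 z = 0" if "norm z > R" for z
    using z[of z] R(2)[of z] that by force+
  have i: "integrable lborel f" "integrable lborel F1" "integrable lborel F2"
    using L2_bounded_support_integrable[of _ R] f s by blast+
  obtain n1 where n1: "L2_tendsto lborel (\<lambda>n. moll (1 / (real (n + n1) + 2)) f) f"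
    using moll_L2_tendsto[OF f(1) s(1) R(1)] by blast
  obtain n2 where n2: "L2_tendsto lborel (\<lambda>n. moll (1 / (real (n + n2) + 2)) F1) F1"
    using moll_L2_tendsto[OF f(2) s(2) R(1)] by blast
  obtain n3 where n3: "L2_tendsto lborel (\<lambda>n. moll (1 / (real (n + n3) + 2)) F2) F2"
    using moll_L2_tendsto[OF f(3) s(3) R(1)] by blast
  define d where "d n = 1 / (real (n + n1 + n2 + n3) + 2)" for n
  have d: "0 < d n" "d n < 1" for n by (auto simp: d_def)
  have c: "(\<lambda>n. 1 + 4 * d n) \<longlonglongrightarrow> 1" unfolding d_def by real_asymp
  have M: "L2_tendsto lborel (\<lambda>n. moll (d n) f) f" "L2_tendsto lborel (\<lambda>n. moll (d n) F1) F1" "L2_tendsto lborel (\<lambda>n. moll (d n) F2) F2"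
    using L2_tendsto_shift[OF n1, of "n2 + n3"] L2_tendsto_shift[OF n2, of "n1 + n3"] L2_tendsto_shift[OF n3, of "n1 + n2"]
    by (simp_all add: d_def add_ac)
  have sm: "smooth (moll (d n) f)" for n
    unfolding moll_def[abs_def] by (intro smooth_affine bounded_linear_scaleR_right smooth_conv[OF eta_test[OF d(1)] i(1)])
  have t: "test_function U (moll (d n) f)" for n
  proof -
    obtain K where K: "compact K" "K \<subseteq> U" "\<And>z u. norm u \<le> 1 \<Longrightarrow> (1 + 4 * d n) *\<^sub>R z - d n *\<^sub>R u \<in> U \<Longrightarrow> z \<in> K"
      using shrink[OF d] by metis
    show ?thesis
    proof (rule test_supportI[OF sm K(1,2)])
      fix p assume p: "p \<notin> K"
      have "eta (d n) ((1 + 4 * d n) *\<^sub>R p - w) * f w = 0" for w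
      proof (cases "w \<in> U")
        case True
        define u where "u = inverse (d n) *\<^sub>R ((1 + 4 * d n) *\<^sub>R p - w)"
        have "(1 + 4 * d n) *\<^sub>R p - d n *\<^sub>R u = w" using d(1)[of n] by (simp add: u_def)
        then have "norm u > 1" using K(3)[of u p] True p by force
        then show ?thesis by (simp add: eta_def kernel_zero u_def)
      qed (simp add: z)
      then have "(\<lambda>w. eta (d n) ((1 + 4 * d n) *\<^sub>R p + 0 - w) * f w) = (\<lambda>_. 0)" by (intro ext) simp
      then show "moll (d n) f p = 0" unfolding moll_def conv_def by simp
    qed
  qed
  have x: "dx (moll (d n) f) = (\<lambda>z. (1 + 4 * d n) * moll (d n) F1 z)" for n
    using moll_pderiv[OF d(1) i(1,2) w1] by blast
  have y: "dy (moll (d n) f) = (\<lambda>z. (1 + 4 * d n) * moll (d n) F2 z)" for n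
    using moll_pderiv[OF d(1) i(1,3) w2] by blast
  have "U \<in> sets lebesgue" using U(1) by simp
  then show ?thesis unfolding W0_def
    by (intro exI[of _ "\<lambda>n. moll (d n) f"])
      (auto simp: x y intro!: t L2_tendsto_lborel M L2_tendsto_scale[OF M(2) c] L2_tendsto_scale[OF M(3) c])
qed

section \<open>Inequalities on \<open>W\<^sub>0\<^sup>1\<^sup>,\<^sup>2\<close>\<close>

text \<open>Integrate the derivative of \<open>x \<phi>\<^sup>2\<close>, which has mean zero, and absorb the mixed term by Young's inequality.\<close>

lemma test_poincare:
  assumes "test_function U \<phi>" "\<And>z. z \<in> U \<Longrightarrow> \<bar>fst z\<bar> \<le> 1"
  shows "(LINT z|lborel. (\<phi> z)\<^sup>2) \<le> 4 * (LINT z|lborel. (dx \<phi> z)\<^sup>2)"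
proof -
  note s = test_smooth[OF assms(1)]
  have sm: "smooth (\<lambda>z. fst z * \<phi> z)" by (intro smooth_intros s)
  have t: "test_function U (\<lambda>z. (fst z * \<phi> z) * \<phi> z)" by (rule test_mult[OF assms(1) sm])
  have dfst: "dx fst z = 1" for z
    using pderiv_dirI[OF bounded_linear_imp_has_derivative[OF bounded_linear_fst], of "(1, 0)" z] by simp
  have "dx (\<lambda>z. fst z * \<phi> z * \<phi> z) = (\<lambda>z. (\<phi> z)\<^sup>2 + 2 * (fst z * (\<phi> z * dx \<phi> z)))"
    unfolding pderiv_mult[OF sm s, abs_def] pderiv_mult[OF smooth_fst s] dfst
    by (simp add: power2_eq_square algebra_simps)
  then have z: "(LINT z|lborel. (\<phi> z)\<^sup>2 + 2 * (fst z * (\<phi> z * dx \<phi> z))) = 0"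
    using test_integral_pderiv[OF t, of "(1, 0)"] by simp
  have I1: "integrable lborel (\<lambda>z. (\<phi> z)\<^sup>2)"
    using test_lborel_integrable[OF test_mult[OF assms(1) s]] by (simp add: power2_eq_square)
  have I2: "integrable lborel (\<lambda>z. (dx \<phi> z)\<^sup>2)"
    using test_lborel_integrable[OF test_mult[OF test_pderiv[OF assms(1)] smooth_pderiv[OF s]], of "(1,0)" "(1,0)"] by (simp add: power2_eq_square)
  have I3: "integrable lborel (\<lambda>z. fst z * (\<phi> z * dx \<phi> z))"
    using test_lborel_integrable[OF test_mult[OF test_pderiv[OF assms(1)] sm], of "(1,0)"] by (simp add: mult.assoc)
  have "(LINT z|lborel. (\<phi> z)\<^sup>2) = (LINT z|lborel. - (2 * (fst z * (\<phi> z * dx \<phi> z))))"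
    using z I1 I3 by simp
  also have "\<dots> \<le> (LINT z|lborel. (1/2) * (\<phi> z)\<^sup>2 + 2 * (dx \<phi> z)\<^sup>2)"
  proof (rule integral_mono)
    fix z
    show "- (2 * (fst z * (\<phi> z * dx \<phi> z))) \<le> (1/2) * (\<phi> z)\<^sup>2 + 2 * (dx \<phi> z)\<^sup>2"
    proof (cases "z \<in> U")
      case True
      have "0 \<le> (\<phi> z + 2 * (fst z * dx \<phi> z))\<^sup>2" by simp
      then have "- (2 * (fst z * (\<phi> z * dx \<phi> z))) \<le> (1/2) * (\<phi> z)\<^sup>2 + 2 * ((fst z)\<^sup>2 * (dx \<phi> z)\<^sup>2)"
        by (simp add: power2_eq_square algebra_simps)
      moreover have "(fst z)\<^sup>2 * (dx \<phi> z)\<^sup>2 \<le> 1 * (dx \<phi> z)\<^sup>2"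
        using assms(2)[OF True] by (intro mult_right_mono) (auto simp: abs_square_le_1)
      ultimately show ?thesis by linarith
    qed (simp add: test_zero_outside[OF assms(1)])
  qed (use I1 I2 I3 in auto)
  also have "\<dots> = (1/2) * (LINT z|lborel. (\<phi> z)\<^sup>2) + 2 * (LINT z|lborel. (dx \<phi> z)\<^sup>2)"
    using I1 I2 by simp
  finally show ?thesis by simp
qed

lemma slice_integrable:
  assumes "test_function U \<phi>"
  shows "integrable lborel (\<lambda>x. \<phi> (x, y))" "integrable lborel (\<lambda>y. \<phi> (x, y))"
proof -
  obtain R where R: "\<And>x y. \<bar>x\<bar> \<ge> R \<or> \<bar>y\<bar> \<ge> R \<Longrightarrow> \<phi> (x, y) = 0" using test_bounded_support[OF assms] by blast
  note c = continuous_on_compose2[OF smooth_continuous[OF test_smooth[OF assms]]]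
  have "integrable lborel (\<lambda>x. indicator {-R..R} x *\<^sub>R \<phi> (x, y))"
    by (rule borel_integrable_compact) (auto intro!: c continuous_intros)
  moreover have "(\<lambda>x. indicator {-R..R} x *\<^sub>R \<phi> (x, y)) = (\<lambda>x. \<phi> (x, y))"
    using R[of _ y] by (force simp: indicator_def)
  ultimately show "integrable lborel (\<lambda>x. \<phi> (x, y))" by simp
  have "integrable lborel (\<lambda>y. indicator {-R..R} y *\<^sub>R \<phi> (x, y))"
    by (rule borel_integrable_compact) (auto intro!: c continuous_intros)
  moreover have "(\<lambda>y. indicator {-R..R} y *\<^sub>R \<phi> (x, y)) = (\<lambda>y. \<phi> (x, y))"
    using R[of x] by (force simp: indicator_def)
  ultimately show "integrable lborel (\<lambda>y. \<phi> (x, y))" by simp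
qed

lemma sup_le_integral_deriv:
  fixes g g' :: "real \<Rightarrow> real"
  assumes "\<And>x. (g has_real_derivative g' x) (at x)" "continuous_on UNIV g'" "\<And>x. \<bar>x\<bar> \<ge> R \<Longrightarrow> g x = 0"
    "integrable lborel u" "\<And>x. g' x \<le> u x" "\<And>x. 0 \<le> u x"
  shows "g x \<le> (LINT s|lborel. u s)"
proof (cases "x > - \<bar>R\<bar>")
  case True
  have "g x = g x - g (- \<bar>R\<bar>)" using assms(3)[of "- \<bar>R\<bar>"] by simp
  also have "\<dots> = (LINT s|lborel. g' s * indicator {- \<bar>R\<bar>..x} s)"
    using assms(1,2) True by (intro integral_FTC_Icc_real[symmetric]) (auto simp: continuous_on_eq_continuous_at)
  also have "\<dots> \<le> (LINT s|lborel. u s)"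
    by (rule integral_mono') (use assms(4,5,6) in \<open>auto simp: indicator_def\<close>)
  finally show ?thesis .
next
  case False
  then have "g x = 0" by (intro assms(3)) auto
  then show ?thesis using assms(6) by simp
qed

text \<open>Ladyzhenskaya's inequality: \<open>\<phi>\<^sup>2\<close> is bounded by a function of \<open>y\<close> alone and by a function of
  \<open>x\<close> alone, so the integral of the product of the two bounds factorizes.\<close>

lemma test_L4:
  assumes t: "test_function U \<phi>"
  shows "(LINT z|lborel. (\<phi> z)^4) \<le> ((LINT z|lborel. (\<phi> z)\<^sup>2) + (LINT z|lborel. (dx \<phi> z)\<^sup>2) + (LINT z|lborel. (dy \<phi> z)\<^sup>2))\<^sup>2"
proof -
  note s = test_smooth[OF t]
  define p where "p v z = \<phi> z * \<phi> z + pderiv_dir v \<phi> z * pderiv_dir v \<phi> z" for v z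
  have tp: "test_function U (p v)" for v
    unfolding p_def by (intro test_add test_mult[OF t s] test_mult[OF test_pderiv[OF t] smooth_pderiv[OF s]])
  have p0: "p v z \<ge> 0" for v z by (simp add: p_def)
  obtain R where R: "\<And>x y. \<bar>x\<bar> \<ge> R \<or> \<bar>y\<bar> \<ge> R \<Longrightarrow> \<phi> (x, y) = 0" using test_bounded_support[OF t] by blast
  have cx: "continuous_on UNIV (\<lambda>x. f (x, y))" "continuous_on UNIV (\<lambda>y. f (x, y))" if "smooth f" for f x y
    by (auto intro!: continuous_on_compose2[OF smooth_continuous[OF that]] continuous_intros)
  have am: "2 * (a * b) \<le> a * a + b * (b::real)" for a b
    using sum_squares_bound[of a b] by (simp add: power2_eq_square)
  define A where "A y = (LINT x|lborel. p (1, 0) (x, y))" for y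
  define B where "B x = (LINT y|lborel. p (0, 1) (x, y))" for x
  have leA: "(\<phi> (x, y))\<^sup>2 \<le> A y" for x y
    unfolding A_def
  proof (rule sup_le_integral_deriv[where g="\<lambda>x. (\<phi> (x, y))\<^sup>2" and g'="\<lambda>x. 2 * (\<phi> (x, y) * dx \<phi> (x, y))"])
    show "((\<lambda>x. (\<phi> (x, y))\<^sup>2) has_real_derivative 2 * (\<phi> (x, y) * dx \<phi> (x, y))) (at x)" for x
      by (rule derivative_eq_intros smooth_partial_x[OF s] refl)+ simp
    show "continuous_on UNIV (\<lambda>x. 2 * (\<phi> (x, y) * dx \<phi> (x, y)))"
      by (intro continuous_intros cx s smooth_pderiv)
  qed (use R slice_integrable(1)[OF tp] am p0 in \<open>auto simp: p_def\<close>)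
  have leB: "(\<phi> (x, y))\<^sup>2 \<le> B x" for x y
    unfolding B_def
  proof (rule sup_le_integral_deriv[where g="\<lambda>y. (\<phi> (x, y))\<^sup>2" and g'="\<lambda>y. 2 * (\<phi> (x, y) * dy \<phi> (x, y))"])
    show "((\<lambda>y. (\<phi> (x, y))\<^sup>2) has_real_derivative 2 * (\<phi> (x, y) * dy \<phi> (x, y))) (at y)" for y
      by (rule derivative_eq_intros smooth_partial_y[OF s] refl)+ simp
    show "continuous_on UNIV (\<lambda>y. 2 * (\<phi> (x, y) * dy \<phi> (x, y)))"
      by (intro continuous_intros cx s smooth_pderiv)
  qed (use R slice_integrable(2)[OF tp] am p0 in \<open>auto simp: p_def\<close>)
  have iA: "integrable lborel A" "(LINT y|lborel. A y) = (LINT z|lborel. p (1, 0) z)"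
  proof -
    have i: "integrable (lborel \<Otimes>\<^sub>M lborel) (\<lambda>(x, y). p (1, 0) (x, y))"
      using test_lborel_integrable[OF tp] by (simp add: lborel_prod)
    show "integrable lborel A" unfolding A_def by (rule lborel_pair.integrable_snd[OF i])
    show "(LINT y|lborel. A y) = (LINT z|lborel. p (1, 0) z)"
      unfolding A_def using lborel_plane_integral(1)[OF test_lborel_integrable[OF tp]] by simp
  qed
  have iB: "integrable lborel B" "(LINT x|lborel. B x) = (LINT z|lborel. p (0, 1) z)"
  proof -
    have i: "integrable (lborel \<Otimes>\<^sub>M lborel) (\<lambda>(x, y). p (0, 1) (x, y))"
      using test_lborel_integrable[OF tp] by (simp add: lborel_prod)
    show "integrable lborel B" unfolding B_def by (rule lborel_pair.integrable_fst[OF i])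
    show "(LINT x|lborel. B x) = (LINT z|lborel. p (0, 1) z)"
      unfolding B_def using lborel_plane_integral(2)[OF test_lborel_integrable[OF tp]] by simp
  qed
  have AB0: "A y \<ge> 0" "B x \<ge> 0" for x y
    using leA[of 0 y] leB[of x 0] order_trans[OF zero_le_power2] by blast+
  have sq: "(\<phi> z)^4 = (\<phi> z)\<^sup>2 * (\<phi> z)\<^sup>2" for z by (simp add: power2_eq_square power4_eq_xxxx mult.assoc)
  have t4: "test_function U (\<lambda>z. (\<phi> z)^4)"
    using test_mult[OF test_mult[OF test_mult[OF t s] s] s] by (simp add: power4_eq_xxxx mult.assoc)
  have "(LINT z|lborel. (\<phi> z)^4) = (LINT y|lborel. LINT x|lborel. (\<phi> (x, y))^4)"
    by (rule lborel_plane_integral(1)[OF test_lborel_integrable[OF t4]])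
  also have "\<dots> \<le> (LINT y|lborel. A y * (LINT x|lborel. B x))"
  proof (rule integral_mono')
    fix y
    have "(LINT x|lborel. (\<phi> (x, y))^4) \<le> (LINT x|lborel. A y * B x)"
    proof (rule integral_mono')
      show "integrable lborel (\<lambda>x. A y * B x)" using iB by simp
      show "(\<phi> (x, y))^4 \<le> A y * B x" for x
        unfolding sq by (rule mult_mono[OF leA leB]) (use AB0 in auto)
      show "0 \<le> A y * B x" for x using AB0 by simp
    qed
    then show "(LINT x|lborel. (\<phi> (x, y))^4) \<le> A y * (LINT x|lborel. B x)" by simp
    show "0 \<le> A y * (LINT x|lborel. B x)" using AB0 by simp
  qed (use iA in auto)
  also have "\<dots> = (LINT z|lborel. p (1, 0) z) * (LINT z|lborel. p (0, 1) z)"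
    using iA iB by simp
  also have "\<dots> \<le> ((LINT z|lborel. (\<phi> z)\<^sup>2) + (LINT z|lborel. (dx \<phi> z)\<^sup>2) + (LINT z|lborel. (dy \<phi> z)\<^sup>2))\<^sup>2"
  proof -
    have i: "integrable lborel (\<lambda>z. \<phi> z * \<phi> z)" "integrable lborel (\<lambda>z. pderiv_dir v \<phi> z * pderiv_dir v \<phi> z)" for v
      using test_lborel_integrable[OF test_mult[OF t s]] test_lborel_integrable[OF test_mult[OF test_pderiv[OF t] smooth_pderiv[OF s]]] by auto
    have "(LINT z|lborel. p v z) = (LINT z|lborel. (\<phi> z)\<^sup>2) + (LINT z|lborel. (pderiv_dir v \<phi> z)\<^sup>2)" for v
      unfolding p_def power2_eq_square using i by simp
    then show ?thesis unfolding power2_eq_square[of "_ + _ + _"]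
      by (auto intro!: mult_mono add_nonneg_nonneg)
  qed
  finally show ?thesis .
qed

lemma W0_D:
  assumes "W0 U h hx hy"
  shows "L2_fun (lebesgue_on U) h" "L2_fun (lebesgue_on U) hx" "L2_fun (lebesgue_on U) hy"
  using assms L2_tendsto_D(2) unfolding W0_def by blast+

lemma W0_add:
  assumes "W0 U h hx hy" "W0 U k kx ky"
  shows "W0 U (\<lambda>z. h z + c * k z) (\<lambda>z. hx z + c * kx z) (\<lambda>z. hy z + c * ky z)"
proof -
  obtain \<phi> where p: "\<forall>n. test_function U (\<phi> n)" "L2_tendsto (lebesgue_on U) \<phi> h"
    "L2_tendsto (lebesgue_on U) (\<lambda>n. dx (\<phi> n)) hx" "L2_tendsto (lebesgue_on U) (\<lambda>n. dy (\<phi> n)) hy"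
    using assms(1) unfolding W0_def by blast
  obtain \<psi> where q: "\<forall>n. test_function U (\<psi> n)" "L2_tendsto (lebesgue_on U) \<psi> k"
    "L2_tendsto (lebesgue_on U) (\<lambda>n. dx (\<psi> n)) kx" "L2_tendsto (lebesgue_on U) (\<lambda>n. dy (\<psi> n)) ky"
    using assms(2) unfolding W0_def by blast
  have s: "smooth (\<phi> n)" "smooth (\<psi> n)" "smooth (\<lambda>z. c * \<psi> n z)" for n
    using p(1) q(1) test_smooth test_cmult by blast+
  have d: "pderiv_dir v (\<lambda>z. \<phi> n z + c * \<psi> n z) = (\<lambda>z. pderiv_dir v (\<phi> n) z + c * pderiv_dir v (\<psi> n) z)" for v n
    by (intro ext) (simp add: pderiv_add[OF s(1) s(3)] pderiv_cmult[OF s(2)])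
  show ?thesis unfolding W0_def
    by (intro exI[of _ "\<lambda>n z. \<phi> n z + c * \<psi> n z"] conjI allI; (simp only: d)?)
      (use p q in \<open>auto intro!: test_add test_cmult L2_tendsto_add L2_tendsto_cmult\<close>)
qed

lemma W0_test: "test_function U \<phi> \<Longrightarrow> U \<in> sets lebesgue \<Longrightarrow> W0 U \<phi> (dx \<phi>) (dy \<phi>)"
  unfolding W0_def by (intro exI[of _ "\<lambda>_. \<phi>"]) (auto intro!: L2_tendsto_const test_L2 test_pderiv)

lemma test_sq_integral_lebesgue_on:
  assumes "test_function U \<phi>" "U \<in> sets lebesgue"
  shows "(LINT z|lebesgue_on U. (\<phi> z)\<^sup>2) = (LINT z|lborel. (\<phi> z)\<^sup>2)"
  using test_integral_lebesgue_on[OF test_mult[OF assms(1) test_smooth[OF assms(1)]] assms(2)] by (simp add: power2_eq_square)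

lemma W0_poincare:
  assumes "W0 U h hx hy" "U \<in> sets lebesgue" "\<And>z. z \<in> U \<Longrightarrow> \<bar>fst z\<bar> \<le> 1"
  shows "(LINT z|lebesgue_on U. (h z)\<^sup>2) \<le> 4 * (LINT z|lebesgue_on U. (hx z)\<^sup>2)"
proof -
  obtain \<phi> where p: "\<And>n. test_function U (\<phi> n)" "L2_tendsto (lebesgue_on U) \<phi> h" "L2_tendsto (lebesgue_on U) (\<lambda>n. dx (\<phi> n)) hx"
    using assms(1) unfolding W0_def by blast
  have "(LINT z|lebesgue_on U. (\<phi> n z)\<^sup>2) \<le> 4 * (LINT z|lebesgue_on U. (dx (\<phi> n) z)\<^sup>2)" for n
    using test_poincare[OF p(1) assms(3)]
    by (simp add: test_sq_integral_lebesgue_on[OF p(1) assms(2)] test_sq_integral_lebesgue_on[OF test_pderiv[OF p(1)] assms(2)])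
  then show ?thesis
    using LIMSEQ_le[OF L2_tendsto_sq[OF p(2)] tendsto_mult_left[OF L2_tendsto_sq[OF p(3)], of 4]] by blast
qed

lemma W0_L4:
  assumes "W0 U h hx hy" "U \<in> sets lebesgue"
  shows "integrable (lebesgue_on U) (\<lambda>z. (h z)^4)"
    "(LINT z|lebesgue_on U. (h z)^4) \<le> ((LINT z|lebesgue_on U. (h z)\<^sup>2) + (LINT z|lebesgue_on U. (hx z)\<^sup>2) + (LINT z|lebesgue_on U. (hy z)\<^sup>2))\<^sup>2" (is ?A)
proof -
  obtain \<phi> where p: "\<And>n. test_function U (\<phi> n)" "L2_tendsto (lebesgue_on U) \<phi> h"
    "L2_tendsto (lebesgue_on U) (\<lambda>n. dx (\<phi> n)) hx" "L2_tendsto (lebesgue_on U) (\<lambda>n. dy (\<phi> n)) hy"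
    using assms(1) unfolding W0_def by blast
  obtain r :: "nat \<Rightarrow> nat" where r: "strict_mono r" "AE z in lebesgue_on U. (\<lambda>n. \<phi> (r n) z) \<longlonglongrightarrow> h z"
    using L2_tendsto_subseq_AE[OF p(2)] by blast
  have t4: "test_function U (\<lambda>z. (\<phi> n z)^4)" for n
    using test_mult[OF test_mult[OF test_mult[OF p(1) test_smooth[OF p(1)]] test_smooth[OF p(1)]] test_smooth[OF p(1)], of n n n n] by (simp add: power4_eq_xxxx mult.assoc)
  define c where "c n = ((LINT z|lebesgue_on U. (\<phi> n z)\<^sup>2) + (LINT z|lebesgue_on U. (dx (\<phi> n) z)\<^sup>2) + (LINT z|lebesgue_on U. (dy (\<phi> n) z)\<^sup>2))\<^sup>2" for n
  have cl: "(LINT z|lebesgue_on U. (\<phi> n z)^4) \<le> c n" for n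
    unfolding c_def using test_L4[OF p(1)]
    by (simp add: test_sq_integral_lebesgue_on[OF p(1) assms(2)] test_sq_integral_lebesgue_on[OF test_pderiv[OF p(1)] assms(2)]
        test_integral_lebesgue_on[OF t4 assms(2)])
  have "c \<longlonglongrightarrow> ((LINT z|lebesgue_on U. (h z)\<^sup>2) + (LINT z|lebesgue_on U. (hx z)\<^sup>2) + (LINT z|lebesgue_on U. (hy z)\<^sup>2))\<^sup>2"
    unfolding c_def by (intro tendsto_intros L2_tendsto_sq p)
  then have ct: "(\<lambda>n. c (r n)) \<longlonglongrightarrow> ((LINT z|lebesgue_on U. (h z)\<^sup>2) + (LINT z|lebesgue_on U. (hx z)\<^sup>2) + (LINT z|lebesgue_on U. (hy z)\<^sup>2))\<^sup>2"
    using LIMSEQ_subseq_LIMSEQ[OF _ r(1)] by (fastforce simp: o_def)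
  have m: "h \<in> borel_measurable (lebesgue_on U)" using W0_D(1)[OF assms(1)] L2_D(1) by blast
  have ae: "AE z in lebesgue_on U. (\<lambda>n. (\<phi> (r n) z)^4) \<longlonglongrightarrow> (h z)^4"
    using r(2) by eventually_elim (intro tendsto_intros)
  note F = L2_Fatou[of "\<lambda>n z. (\<phi> (r n) z)^4" "lebesgue_on U" "\<lambda>z. (h z)^4", OF _ _ ae _ _ cl ct]
  show "integrable (lebesgue_on U) (\<lambda>z. (h z)^4)"
    by (rule F(1)) (use m test_integrable[OF t4 assms(2)] in auto)
  show ?A
    by (rule F(2)) (use m test_integrable[OF t4 assms(2)] in auto)
qed

section \<open>Measure-preserving linear substitutions\<close>

text \<open>A measure preserving linear bijection \<open>T\<close> of the plane, together with its inverse \<open>S\<close>.\<close>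

definition mpl :: "(plane \<Rightarrow> plane) \<Rightarrow> (plane \<Rightarrow> plane) \<Rightarrow> bool" where
  "mpl T S \<longleftrightarrow> bounded_linear T \<and> bounded_linear S \<and> (\<forall>z. S (T z) = z) \<and> (\<forall>z. T (S z) = z) \<and>
     distr lborel borel T = lborel"

lemma mplD:
  assumes "mpl T S"
  shows "S (T z) = z" "T (S z) = z" "bounded_linear T" "bounded_linear S" "distr lborel borel T = lborel"
  using assms unfolding mpl_def by blast+

lemma mpl_sym: "mpl T S \<Longrightarrow> mpl S T"
proof -
  assume a: "mpl T S"
  have m: "T \<in> borel \<rightarrow>\<^sub>M borel" "S \<in> borel \<rightarrow>\<^sub>M borel"
    using a linear_continuous_on unfolding mpl_def by (auto intro!: borel_measurable_continuous_onI)
  have "distr lborel borel S = distr (distr lborel borel T) borel S"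
    using a by (simp add: mpl_def)
  also have "\<dots> = distr lborel borel (S \<circ> T)" by (rule distr_distr) (use m in auto)
  also have "S \<circ> T = (\<lambda>z. z)" using a by (auto simp: mpl_def)
  finally show ?thesis using a by (simp add: mpl_def distr_id2)
qed

lemma mpl_lebesgue:
  assumes "mpl T S"
  shows "T \<in> lebesgue \<rightarrow>\<^sub>M lebesgue" "distr lebesgue lebesgue T = lebesgue"
proof -
  have b: "T \<in> borel_measurable borel"
    using assms linear_continuous_on unfolding mpl_def by (auto intro!: borel_measurable_continuous_onI)
  have m: "T \<in> lborel \<rightarrow>\<^sub>M lborel" using b by simp
  have m': "T \<in> lebesgue \<rightarrow>\<^sub>M lborel" by (rule measurable_completion[OF m])
  have "distr lebesgue lborel T = distr lborel lborel T" by (rule distr_completion[OF m])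
  also have "\<dots> = distr lborel borel T" by (rule distr_cong) auto
  also have "\<dots> = lborel" using assms by (simp add: mpl_def)
  finally have d: "distr lebesgue lborel T = lborel" .
  have ac: "null_sets lborel \<subseteq> null_sets (distr lebesgue lborel T)" using d by simp
  show "T \<in> lebesgue \<rightarrow>\<^sub>M lebesgue" by (rule completion.measurable_completion2[OF m' ac])
  then show "distr lebesgue lebesgue T = lebesgue"
    using completion.completion_distr_eq[OF m'] d by simp
qed

lemma mpl_image: "mpl T S \<Longrightarrow> T ` D = S -` D"
  unfolding mpl_def by (auto simp: image_iff) metis

lemma mpl_image_sets: "mpl T S \<Longrightarrow> D \<in> sets lebesgue \<Longrightarrow> T ` D \<in> sets lebesgue"
  using measurable_sets[OF mpl_lebesgue(1)[OF mpl_sym], of T S D] by (simp add: mpl_image)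

lemma mpl_indicator: "mpl T S \<Longrightarrow> indicator (T ` D) (T w) = indicator D w"
  using mplD(1)[of T S w] by (simp add: mpl_image indicator_def)

lemma mpl_measurable:
  fixes X :: "plane \<Rightarrow> real"
  assumes "mpl T S" "D \<in> sets lebesgue"
  shows "X \<in> borel_measurable (lebesgue_on (T ` D)) \<longleftrightarrow> (\<lambda>w. X (T w)) \<in> borel_measurable (lebesgue_on D)"
proof -
  have imp: "(\<lambda>w. Y (T w)) \<in> borel_measurable (lebesgue_on D)"
    if "mpl T S" "D \<in> sets lebesgue" "Y \<in> borel_measurable (lebesgue_on (T ` D))" for T S D and Y :: "plane \<Rightarrow> real"
  proof -
    have "(\<lambda>z. indicator (T ` D) z *\<^sub>R Y z) \<in> borel_measurable lebesgue"
      using that mpl_image_sets[OF that(1,2)] by (simp add: borel_measurable_restrict_space_iff)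
    from measurable_compose[OF mpl_lebesgue(1)[OF that(1)] this]
    have "(\<lambda>w. indicator D w *\<^sub>R Y (T w)) \<in> borel_measurable lebesgue"
      by (simp add: mpl_indicator[OF that(1)])
    then show ?thesis using that by (simp add: borel_measurable_restrict_space_iff)
  qed
  have "S ` T ` D = D" using mplD(1)[OF assms(1)] by (simp add: image_image)
  then have "X \<in> borel_measurable (lebesgue_on (T ` D))" if "(\<lambda>w. X (T w)) \<in> borel_measurable (lebesgue_on D)"
    using imp[OF mpl_sym[OF assms(1)] mpl_image_sets[OF assms], of "\<lambda>w. X (T w)"] that
    by (simp add: mplD(2)[OF assms(1)])
  then show ?thesis using imp[OF assms(1,2), of X] by blast
qed

lemma mpl_integrable:
  fixes X :: "plane \<Rightarrow> real"
  assumes "mpl T S" "D \<in> sets lebesgue"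
  shows "integrable (lebesgue_on (T ` D)) X \<longleftrightarrow> integrable (lebesgue_on D) (\<lambda>w. X (T w))"
proof (cases "X \<in> borel_measurable (lebesgue_on (T ` D))")
  case True
  have m: "(\<lambda>z. indicator (T ` D) z *\<^sub>R X z) \<in> borel_measurable lebesgue"
    using True mpl_image_sets[OF assms] by (simp add: borel_measurable_restrict_space_iff)
  have "integrable (lebesgue_on (T ` D)) X \<longleftrightarrow> integrable lebesgue (\<lambda>z. indicator (T ` D) z *\<^sub>R X z)"
    using mpl_image_sets[OF assms] by (simp add: integrable_restrict_space)
  also have "\<dots> \<longleftrightarrow> integrable lebesgue (\<lambda>w. indicator (T ` D) (T w) *\<^sub>R X (T w))"
    using integrable_distr_eq[OF mpl_lebesgue(1)[OF assms(1)] m] mpl_lebesgue(2)[OF assms(1)] by simp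
  also have "\<dots> \<longleftrightarrow> integrable (lebesgue_on D) (\<lambda>w. X (T w))"
    using assms(2) by (simp add: integrable_restrict_space mpl_indicator[OF assms(1)])
  finally show ?thesis .
next
  case False
  then show ?thesis using mpl_measurable[OF assms, of X] borel_measurable_integrable by blast
qed

lemma mpl_integral:
  fixes X :: "plane \<Rightarrow> real"
  assumes "mpl T S" "D \<in> sets lebesgue"
  shows "(LINT z|lebesgue_on (T ` D). X z) = (LINT w|lebesgue_on D. X (T w))"
proof (cases "X \<in> borel_measurable (lebesgue_on (T ` D))")
  case True
  have m: "(\<lambda>z. indicator (T ` D) z *\<^sub>R X z) \<in> borel_measurable lebesgue"
    using True mpl_image_sets[OF assms] by (simp add: borel_measurable_restrict_space_iff)
  have "(LINT z|lebesgue_on (T ` D). X z) = (LINT z|lebesgue. indicator (T ` D) z *\<^sub>R X z)"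
    using mpl_image_sets[OF assms] by (simp add: integral_restrict_space)
  also have "\<dots> = (LINT w|lebesgue. indicator (T ` D) (T w) *\<^sub>R X (T w))"
    using integral_distr[OF mpl_lebesgue(1)[OF assms(1)] m] mpl_lebesgue(2)[OF assms(1)] by simp
  also have "\<dots> = (LINT w|lebesgue_on D. X (T w))"
    using assms(2) by (simp add: integral_restrict_space mpl_indicator[OF assms(1)])
  finally show ?thesis .
next
  case False
  then show ?thesis
    using mpl_measurable[OF assms, of X] mpl_integrable[OF assms, of X] borel_measurable_integrable not_integrable_integral_eq by metis
qed

lemma mpl_L2_tendsto:
  assumes "mpl T S" "D \<in> sets lebesgue" "L2_tendsto (lebesgue_on (T ` D)) f g"
  shows "L2_tendsto (lebesgue_on D) (\<lambda>n w. f n (T w)) (\<lambda>w. g (T w))"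
proof -
  have L: "L2_fun (lebesgue_on D) (\<lambda>w. X (T w))" if "L2_fun (lebesgue_on (T ` D)) X" for X
    using that mpl_measurable[OF assms(1,2), of X] mpl_integrable[OF assms(1,2), of "\<lambda>z. (X z)\<^sup>2"] by (simp add: L2_fun_def)
  show ?thesis using assms(3) mpl_integral[OF assms(1,2), of "\<lambda>z. (f n z - g z)\<^sup>2" for n]
    by (simp add: L2_tendsto_def L)
qed

lemma mpl_swap: "mpl (\<lambda>z. (snd z, fst z)) (\<lambda>z. (snd z, fst z))"
proof -
  have "distr (lborel \<Otimes>\<^sub>M lborel) (lborel \<Otimes>\<^sub>M lborel) (\<lambda>(x, y). (y, x)) = (lborel \<Otimes>\<^sub>M lborel :: plane measure)"
    by (rule lborel_pair.distr_pair_swap[symmetric])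
  then have "distr lborel lborel (\<lambda>(x, y). (y, x)) = (lborel :: plane measure)" by (simp add: lborel_prod)
  moreover have "distr lborel lborel (\<lambda>(x, y). (y, x)) = distr lborel borel (\<lambda>z::plane. (snd z, fst z))"
    by (rule distr_cong) auto
  ultimately show ?thesis
    unfolding mpl_def by (auto intro!: bounded_linear_Pair bounded_linear_fst bounded_linear_snd)
qed

text \<open>Fubini: it suffices that horizontal lines are mapped to horizontal lines by translations and reflections.\<close>

lemma mpl_from_slices:
  assumes bl: "bounded_linear T" "bounded_linear S" "\<And>z. S (T z) = z" "\<And>z. T (S z) = z"
    and e: "\<And>y. \<exists>c t. \<bar>c\<bar> = 1 \<and> (\<forall>x. T (x, y) = (t + c * x, p y))"
    and p: "p = (\<lambda>y. y) \<or> p = (\<lambda>y. - y)"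
  shows "mpl T S"
proof -
  have m [measurable]: "T \<in> borel_measurable borel"
    using bl(1) linear_continuous_on by (auto intro!: borel_measurable_continuous_onI)
  have "emeasure (distr lborel borel T) X = emeasure lborel X" if X [measurable]: "X \<in> sets borel" for X
  proof -
    have "(\<lambda>z. indicator X (T z) :: ennreal) \<in> borel_measurable (lborel \<Otimes>\<^sub>M lborel)"
      "(\<lambda>z. indicator X z :: ennreal) \<in> borel_measurable (lborel \<Otimes>\<^sub>M lborel)"
      unfolding lborel_prod by measurable
    then have [measurable]: "(\<lambda>(x, y). indicator X (T (x, y)) :: ennreal) \<in> borel_measurable (lborel \<Otimes>\<^sub>M lborel)"
      "(\<lambda>(x, y). indicator X (x, y) :: ennreal) \<in> borel_measurable (lborel \<Otimes>\<^sub>M lborel)"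
      by simp_all
    have "emeasure (distr lborel borel T) X = (\<integral>\<^sup>+z. indicator X z \<partial>distr lborel borel T)" by simp
    also have "\<dots> = (\<integral>\<^sup>+z. indicator X (T z) \<partial>lborel)"
      by (rule nn_integral_distr) auto
    also have "\<dots> = (\<integral>\<^sup>+y. \<integral>\<^sup>+x. indicator X (T (x, y)) \<partial>lborel \<partial>lborel)"
      by (subst lborel_pair.nn_integral_snd) (auto simp: lborel_prod)
    also have "\<dots> = (\<integral>\<^sup>+y. \<integral>\<^sup>+x. indicator X (x, p y) \<partial>lborel \<partial>lborel)"
    proof (rule nn_integral_cong)
      fix y
      obtain c t where ct: "\<bar>c\<bar> = 1" "\<And>x. T (x, y) = (t + c * x, p y)" using e by blast
      have "(\<integral>\<^sup>+x. indicator X (x, p y) \<partial>lborel) = ennreal \<bar>c\<bar> * (\<integral>\<^sup>+x. indicator X (t + c * x, p y) \<partial>lborel)"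
        using ct(1) by (intro nn_integral_real_affine) auto
      then show "(\<integral>\<^sup>+x. indicator X (T (x, y)) \<partial>lborel) = (\<integral>\<^sup>+x. indicator X (x, p y) \<partial>lborel)"
        using ct by simp
    qed
    also have "\<dots> = (\<integral>\<^sup>+y. \<integral>\<^sup>+x. indicator X (x, y) \<partial>lborel \<partial>lborel)"
      using p
    proof
      assume "p = (\<lambda>y. - y)"
      moreover have "(\<integral>\<^sup>+y. \<integral>\<^sup>+x. indicator X (x, y) \<partial>lborel \<partial>lborel) = ennreal \<bar>-1\<bar> * (\<integral>\<^sup>+y. \<integral>\<^sup>+x. indicator X (x, 0 + (-1) * y) \<partial>lborel \<partial>lborel)"
        by (rule nn_integral_real_affine) measurable
      ultimately show ?thesis by simp
    qed simp
    also have "\<dots> = (\<integral>\<^sup>+z. indicator X z \<partial>lborel)"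
      by (subst lborel_pair.nn_integral_snd) (auto simp: lborel_prod)
    also have "\<dots> = emeasure lborel X" by simp
    finally show ?thesis .
  qed
  then have "distr lborel borel T = lborel" by (intro measure_eqI) auto
  then show ?thesis using bl by (simp add: mpl_def)
qed

lemma mpl_comp: "mpl T S \<Longrightarrow> mpl T' S' \<Longrightarrow> mpl (\<lambda>z. T (T' z)) (\<lambda>z. S' (S z))"
proof -
  assume a: "mpl T S" and b: "mpl T' S'"
  have m: "T \<in> borel \<rightarrow>\<^sub>M borel" "T' \<in> borel \<rightarrow>\<^sub>M borel"
    using a b linear_continuous_on unfolding mpl_def by (auto intro!: borel_measurable_continuous_onI)
  have "distr lborel borel (\<lambda>z. T (T' z)) = distr (distr lborel borel T') borel T"
    using m by (subst distr_distr) (auto simp: o_def)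
  then show ?thesis unfolding mpl_def
    using bounded_linear_compose[OF mplD(3)[OF a] mplD(3)[OF b]] bounded_linear_compose[OF mplD(4)[OF b] mplD(4)[OF a]]
      mplD(1,2,5)[OF a] mplD(1,2,5)[OF b] by simp
qed

lemma mpl_id: "mpl (\<lambda>z. z) (\<lambda>z. z)"
  by (simp add: mpl_def distr_id2 bounded_linear_ident)

section \<open>Integration by parts on strips\<close>

definition strip :: "(real \<Rightarrow> real) \<Rightarrow> (real \<Rightarrow> real) \<Rightarrow> real \<Rightarrow> real \<Rightarrow> plane set" where
  "strip l r a b = {z. a < snd z \<and> snd z < b \<and> l (snd z) < fst z \<and> fst z < r (snd z)}"

lemma strip_open:
  assumes "continuous_on UNIV l" "continuous_on UNIV r"
  shows "open (strip l r a b)"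
  unfolding strip_def
  by (intro open_Collect_conj open_Collect_less continuous_intros continuous_on_compose2[OF assms(1)] continuous_on_compose2[OF assms(2)]) auto

lemma strip_bounded:
  assumes "continuous_on UNIV l" "continuous_on UNIV r"
  shows "bounded (strip l r a b)"
proof -
  have "compact (l ` {a..b})" "compact (r ` {a..b})"
    using assms by (auto intro!: compact_continuous_image intro: continuous_on_subset)
  then obtain Bl Br where B: "\<And>t. t \<in> {a..b} \<Longrightarrow> \<bar>l t\<bar> \<le> Bl" "\<And>t. t \<in> {a..b} \<Longrightarrow> \<bar>r t\<bar> \<le> Br"
    unfolding compact_eq_bounded_closed bounded_iff by (metis imageI real_norm_def)
  have "strip l r a b \<subseteq> cbox (- Bl, a) (Br, b)"
  proof
    fix z assume z: "z \<in> strip l r a b"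
    then have t: "snd z \<in> {a..b}" by (simp add: strip_def)
    have "- Bl \<le> fst z" "fst z \<le> Br" using B(1)[OF t] B(2)[OF t] z by (auto simp: strip_def)
    then show "z \<in> cbox (- Bl, a) (Br, b)" using t by (cases z) (simp add: cbox_Pair_eq)
  qed
  then show ?thesis using bounded_cbox bounded_subset by blast
qed

lemma strip_lmeasurable:
  assumes "continuous_on UNIV l" "continuous_on UNIV r"
  shows "strip l r a b \<in> lmeasurable"
  using strip_open[OF assms] strip_bounded[OF assms] by (intro bounded_set_imp_lmeasurable) auto

lemma borel_L2_strip:
  assumes "continuous_on UNIV l" "continuous_on UNIV r" "k \<in> borel_measurable borel" "\<And>z. z \<in> strip l r a b \<Longrightarrow> \<bar>k z\<bar> \<le> B"
  shows "L2_fun (lebesgue_on (strip l r a b)) k"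
proof -
  interpret finite_measure "lebesgue_on (strip l r a b)"
    by (rule finite_measure_lebesgue_on[OF strip_lmeasurable[OF assms(1,2)]])
  have "k \<in> borel_measurable (lebesgue_on (strip l r a b))"
    using assms(3) by (intro measurable_restrict_space1 measurable_completion) auto
  then show ?thesis by (rule L2_bounded) (use assms(4) in \<open>auto simp: space_restrict_space\<close>)
qed

text \<open>The fundamental theorem of calculus on each horizontal line, integrated over the lines. Only differentiability
  in the first variable is asked of the weight \<open>k\<close>, which later depends on the shape of the strip.\<close>

lemma strip_identity:
  assumes s: "smooth \<phi>" and lr: "continuous_on UNIV l" "continuous_on UNIV r"
    and le: "\<And>t. a < t \<Longrightarrow> t < b \<Longrightarrow> l t \<le> r t"
    and k: "\<And>s t. a < t \<Longrightarrow> t < b \<Longrightarrow> ((\<lambda>s. k (s, t)) has_real_derivative k' (s, t)) (at s)"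
    and kc: "\<And>t. a < t \<Longrightarrow> t < b \<Longrightarrow> continuous_on UNIV (\<lambda>s. k' (s, t))"
    and m [measurable]: "k \<in> borel_measurable borel" "k' \<in> borel_measurable borel"
    and B: "\<And>z. z \<in> strip l r a b \<Longrightarrow> \<bar>k z\<bar> \<le> B" "\<And>z. z \<in> strip l r a b \<Longrightarrow> \<bar>k' z\<bar> \<le> B"
  shows "(LINT z|lebesgue_on (strip l r a b). \<phi> z * k' z + dx \<phi> z * k z)
    = (LINT t|lborel. indicator {a<..<b} t * (\<phi> (r t, t) * k (r t, t) - \<phi> (l t, t) * k (l t, t)))"
proof -
  let ?S = "strip l r a b"
  have [measurable]: "\<phi> \<in> borel_measurable borel" "dx \<phi> \<in> borel_measurable borel"
    using smooth_borel[OF s] smooth_borel[OF smooth_pderiv[OF s]] by auto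
  have S [measurable]: "?S \<in> sets borel" using strip_open[OF lr] by simp
  have Sl: "?S \<in> sets lebesgue" using strip_lmeasurable[OF lr] by blast
  have L: "L2_fun (lebesgue_on ?S) \<phi>" "L2_fun (lebesgue_on ?S) (dx \<phi>)"
    using smooth_L2[OF _ strip_bounded[OF lr] Sl] s smooth_pderiv by blast+
  have "integrable (lebesgue_on ?S) (\<lambda>z. \<phi> z * k' z + dx \<phi> z * k z)"
    using L2_mult_integrable[OF L(1) borel_L2_strip[OF lr m(2) B(2)]] L2_mult_integrable[OF L(2) borel_L2_strip[OF lr m(1) B(1)]] by auto
  then have "integrable lebesgue (\<lambda>z. indicator ?S z *\<^sub>R (\<phi> z * k' z + dx \<phi> z * k z))"
    using Sl by (simp add: integrable_restrict_space)
  then have I: "integrable lborel (\<lambda>z. indicator ?S z *\<^sub>R (\<phi> z * k' z + dx \<phi> z * k z))"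
    by (subst (asm) integrable_completion) measurable
  have "(LINT z|lebesgue_on ?S. \<phi> z * k' z + dx \<phi> z * k z) = (LINT z|lebesgue. indicator ?S z *\<^sub>R (\<phi> z * k' z + dx \<phi> z * k z))"
    using Sl by (simp add: integral_restrict_space)
  also have "\<dots> = (LINT z|lborel. indicator ?S z *\<^sub>R (\<phi> z * k' z + dx \<phi> z * k z))"
    by (rule integral_completion) measurable
  also have "\<dots> = (LINT t|lborel. LINT s|lborel. indicator ?S (s, t) *\<^sub>R (\<phi> (s, t) * k' (s, t) + dx \<phi> (s, t) * k (s, t)))"
    by (rule lborel_plane_integral(1)[OF I])
  also have "\<dots> = (LINT t|lborel. indicator {a<..<b} t * (\<phi> (r t, t) * k (r t, t) - \<phi> (l t, t) * k (l t, t)))"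
  proof (rule Bochner_Integration.integral_cong[OF refl])
    fix t
    show "(LINT s|lborel. indicator ?S (s, t) *\<^sub>R (\<phi> (s, t) * k' (s, t) + dx \<phi> (s, t) * k (s, t)))
      = indicator {a<..<b} t * (\<phi> (r t, t) * k (r t, t) - \<phi> (l t, t) * k (l t, t))"
    proof (cases "a < t \<and> t < b")
      case True
      then have t: "a < t" "t < b" by auto
      have c: "continuous_on UNIV (\<lambda>s. f (s, t))" if "smooth f" for f
        by (auto intro!: continuous_on_compose2[OF smooth_continuous[OF that]] continuous_intros)
      have kk: "continuous_on UNIV (\<lambda>s. k (s, t))" using k[OF t] DERIV_isCont continuous_at_imp_continuous_on by blast
      have "(LINT s|lborel. indicator ?S (s, t) *\<^sub>R (\<phi> (s, t) * k' (s, t) + dx \<phi> (s, t) * k (s, t)))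
        = (LINT s|lborel. (\<phi> (s, t) * k' (s, t) + dx \<phi> (s, t) * k (s, t)) * indicator {l t..r t} s)"
      proof (rule integral_cong_AE)
        show "AE s in lborel. indicator ?S (s, t) *\<^sub>R (\<phi> (s, t) * k' (s, t) + dx \<phi> (s, t) * k (s, t))
            = (\<phi> (s, t) * k' (s, t) + dx \<phi> (s, t) * k (s, t)) * indicator {l t..r t} s"
          using AE_lborel_singleton[of "l t"] AE_lborel_singleton[of "r t"]
          by eventually_elim (use t in \<open>auto simp: strip_def indicator_def\<close>)
      qed measurable
      also have "\<dots> = \<phi> (r t, t) * k (r t, t) - \<phi> (l t, t) * k (l t, t)"
      proof (rule integral_FTC_Icc_real[where F="\<lambda>s. \<phi> (s, t) * k (s, t)"])
        show "l t \<le> r t" by (rule le[OF t])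
        show "((\<lambda>s. \<phi> (s, t) * k (s, t)) has_real_derivative \<phi> (s, t) * k' (s, t) + dx \<phi> (s, t) * k (s, t)) (at s)" for s
          using DERIV_mult[OF smooth_partial_x[OF s, of t s] k[OF t, of s]] by (simp add: algebra_simps)
        have "continuous_on UNIV (\<lambda>s. \<phi> (s, t) * k' (s, t) + dx \<phi> (s, t) * k (s, t))"
          by (intro continuous_intros c s smooth_pderiv kk kc[OF t])
        then show "isCont (\<lambda>s. \<phi> (s, t) * k' (s, t) + dx \<phi> (s, t) * k (s, t)) s" for s
          by (simp add: continuous_on_eq_continuous_at)
      qed
      finally show ?thesis using t by simp
    qed (auto simp: strip_def)
  qed
  finally show ?thesis .
qed

text \<open>Passing to the limit in the previous identity: the weight vanishes at one end of each line, and at the other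
  end, on the graph of \<open>p\<close>, the boundary values of the approximating functions tend to zero.\<close>

lemma strip_zero_weighted:
  assumes s: "\<And>n. smooth (\<phi> n)" and lr: "continuous_on UNIV l" "continuous_on UNIV r" "continuous_on UNIV p"
    and le: "\<And>t. a < t \<Longrightarrow> t < b \<Longrightarrow> l t \<le> r t"
    and k: "\<And>s t. a < t \<Longrightarrow> t < b \<Longrightarrow> ((\<lambda>s. k (s, t)) has_real_derivative k' (s, t)) (at s)"
    and kc: "\<And>t. a < t \<Longrightarrow> t < b \<Longrightarrow> continuous_on UNIV (\<lambda>s. k' (s, t))"
    and m [measurable]: "k \<in> borel_measurable borel" "k' \<in> borel_measurable borel"
    and B: "\<And>z. z \<in> strip l r a b \<Longrightarrow> \<bar>k z\<bar> \<le> B" "\<And>z. z \<in> strip l r a b \<Longrightarrow> \<bar>k' z\<bar> \<le> B"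
    and Bp: "\<And>t. a < t \<Longrightarrow> t < b \<Longrightarrow> \<bar>k (p t, t)\<bar> \<le> B"
    and L: "L2_tendsto (lebesgue_on (strip l r a b)) \<phi> h" "L2_tendsto (lebesgue_on (strip l r a b)) (\<lambda>n. dx (\<phi> n)) g"
    and tr: "(\<lambda>n. LINT t|lborel. indicator {a..b} t * (\<phi> n (p t, t))\<^sup>2) \<longlonglongrightarrow> 0"
    and p: "p = r \<and> (\<forall>t. a < t \<longrightarrow> t < b \<longrightarrow> k (l t, t) = 0) \<or> p = l \<and> (\<forall>t. a < t \<longrightarrow> t < b \<longrightarrow> k (r t, t) = 0)"
  shows "(LINT z|lebesgue_on (strip l r a b). h z * k' z + g z * k z) = 0"
proof -
  let ?S = "strip l r a b"
  note kL = borel_L2_strip[OF lr(1,2) m(1) B(1)] and kL' = borel_L2_strip[OF lr(1,2) m(2) B(2)]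
  have lim: "(\<lambda>n. LINT z|lebesgue_on ?S. \<phi> n z * k' z + dx (\<phi> n) z * k z) \<longlonglongrightarrow> (LINT z|lebesgue_on ?S. h z * k' z + g z * k z)"
  proof -
    have "(\<lambda>n. (LINT z|lebesgue_on ?S. \<phi> n z * k' z) + (LINT z|lebesgue_on ?S. dx (\<phi> n) z * k z))
        \<longlonglongrightarrow> (LINT z|lebesgue_on ?S. h z * k' z) + (LINT z|lebesgue_on ?S. g z * k z)"
      by (intro tendsto_add L2_tendsto_inner L kL kL')
    then show ?thesis
      using L2_mult_integrable[OF L2_tendsto_D(1)[OF L(1)] kL'] L2_mult_integrable[OF L2_tendsto_D(1)[OF L(2)] kL]
        L2_mult_integrable[OF L2_tendsto_D(2)[OF L(1)] kL'] L2_mult_integrable[OF L2_tendsto_D(2)[OF L(2)] kL] by simp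
  qed
  define K where "K t = indicator {a<..<b} t * k (p t, t)" for t
  have [measurable]: "p \<in> borel_measurable borel" by (rule borel_measurable_continuous_onI[OF lr(3)])
  have [measurable]: "\<phi> n \<in> borel_measurable borel" for n by (rule smooth_borel[OF s])
  have "integrable lborel (indicator {a..b} :: real \<Rightarrow> real)"
    by (rule integrable_real_indicator) (auto simp: emeasure_lborel_Icc_eq)
  then have I: "integrable lborel (\<lambda>t. B\<^sup>2 * indicator {a..b} t :: real)" by simp
  have KL: "L2_fun lborel K"
  proof (rule L2_dominated[OF _ I])
    show "K \<in> borel_measurable lborel" unfolding K_def by measurable
    show "(K t)\<^sup>2 \<le> B\<^sup>2 * indicator {a..b} t" for t
      using Bp[of t] abs_le_square_iff[of "k (p t, t)" B] by (auto simp: K_def indicator_def)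
  qed
  define f where "f n t = indicator {a..b} t * \<phi> n (p t, t)" for n t
  have fL: "L2_fun lborel (f n)" for n
  proof -
    have "continuous_on UNIV (\<lambda>t. (\<phi> n (p t, t))\<^sup>2)"
      by (intro continuous_intros continuous_on_compose2[OF smooth_continuous[OF s]] lr) auto
    then have "integrable lborel (\<lambda>t. indicator {a..b} t *\<^sub>R (\<phi> n (p t, t))\<^sup>2)"
      by (intro borel_integrable_compact) (auto intro: continuous_on_subset)
    moreover have "(\<lambda>t. (f n t)\<^sup>2) = (\<lambda>t. indicator {a..b} t *\<^sub>R (\<phi> n (p t, t))\<^sup>2)"
      by (auto simp: f_def indicator_def)
    moreover have "f n \<in> borel_measurable lborel" unfolding f_def by measurable
    ultimately show ?thesis by (simp add: L2_fun_def)
  qed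
  have f2: "(LINT t|lborel. (f n t)\<^sup>2) = (LINT t|lborel. indicator {a..b} t * (\<phi> n (p t, t))\<^sup>2)" for n
    by (rule Bochner_Integration.integral_cong) (auto simp: f_def indicator_def)
  have bd: "\<bar>LINT z|lebesgue_on ?S. \<phi> n z * k' z + dx (\<phi> n) z * k z\<bar> = \<bar>LINT t|lborel. K t * f n t\<bar>" for n
  proof -
    have id: "(LINT z|lebesgue_on ?S. \<phi> n z * k' z + dx (\<phi> n) z * k z)
      = (LINT t|lborel. indicator {a<..<b} t * (\<phi> n (r t, t) * k (r t, t) - \<phi> n (l t, t) * k (l t, t)))"
      by (rule strip_identity[OF s lr(1,2) le k kc m B])
    from p show ?thesis
    proof
      assume q: "p = r \<and> (\<forall>t. a < t \<longrightarrow> t < b \<longrightarrow> k (l t, t) = 0)"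
      have "(LINT t|lborel. indicator {a<..<b} t * (\<phi> n (r t, t) * k (r t, t) - \<phi> n (l t, t) * k (l t, t))) = (LINT t|lborel. K t * f n t)"
        using q by (intro Bochner_Integration.integral_cong) (auto simp: K_def f_def indicator_def)
      then show ?thesis using id by simp
    next
      assume q: "p = l \<and> (\<forall>t. a < t \<longrightarrow> t < b \<longrightarrow> k (r t, t) = 0)"
      have "(LINT t|lborel. indicator {a<..<b} t * (\<phi> n (r t, t) * k (r t, t) - \<phi> n (l t, t) * k (l t, t))) = (LINT t|lborel. - (K t * f n t))"
        using q by (intro Bochner_Integration.integral_cong) (auto simp: K_def f_def indicator_def)
      then show ?thesis using id by simp
    qed
  qed
  have "(\<lambda>n. LINT z|lebesgue_on ?S. \<phi> n z * k' z + dx (\<phi> n) z * k z) \<longlonglongrightarrow> 0"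
    by (rule tendsto_0_young[OF tr, of "LINT t|lborel. (K t)\<^sup>2" _ 1])
      (use integral_mult_young[OF KL fL] in \<open>auto simp: bd f2\<close>)
  then show ?thesis using LIMSEQ_unique[OF lim] by blast
qed

definition ztrace :: "plane set \<Rightarrow> (plane \<Rightarrow> real) \<Rightarrow> (plane \<Rightarrow> real) \<Rightarrow> (real \<Rightarrow> real) \<Rightarrow> real \<Rightarrow> real \<Rightarrow> bool" where
  "ztrace S h g p a b \<longleftrightarrow> (\<exists>\<phi>. (\<forall>n. smooth (\<phi> n)) \<and> L2_tendsto (lebesgue_on S) \<phi> h \<and>
     L2_tendsto (lebesgue_on S) (\<lambda>n. dx (\<phi> n)) g \<and>
     (\<lambda>n. LINT t|lborel. indicator {a..b} t * (\<phi> n (p t, t))\<^sup>2) \<longlonglongrightarrow> 0)"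

lemma ztrace_substrip:
  assumes lr: "continuous_on UNIV l" "continuous_on UNIV r" "continuous_on UNIV p"
    and sub: "a \<le> a'" "b' \<le> b" and zt: "ztrace (strip l r a b) h g p a b"
  shows "ztrace (strip l r a' b') h g p a' b'"
proof -
  obtain \<phi> where f: "\<And>n. smooth (\<phi> n)" "L2_tendsto (lebesgue_on (strip l r a b)) \<phi> h"
    "L2_tendsto (lebesgue_on (strip l r a b)) (\<lambda>n. dx (\<phi> n)) g"
    "(\<lambda>n. LINT t|lborel. indicator {a..b} t * (\<phi> n (p t, t))\<^sup>2) \<longlonglongrightarrow> 0"
    using zt unfolding ztrace_def by blast
  have S: "strip l r a' b' \<in> sets lebesgue" "strip l r a b \<in> sets lebesgue" "strip l r a' b' \<subseteq> strip l r a b"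
    using strip_lmeasurable[OF lr(1,2)] sub by (auto simp: strip_def)
  have I: "integrable lborel (\<lambda>t. indicator {c..d} t * (\<phi> n (p t, t))\<^sup>2)" for c d n
  proof -
    have "continuous_on UNIV (\<lambda>t. (\<phi> n (p t, t))\<^sup>2)"
      by (intro continuous_intros continuous_on_compose2[OF smooth_continuous[OF f(1)]] lr) auto
    then have "integrable lborel (\<lambda>t. indicator {c..d} t *\<^sub>R (\<phi> n (p t, t))\<^sup>2)"
      by (intro borel_integrable_compact) (auto intro: continuous_on_subset)
    then show ?thesis by simp
  qed
  have "(\<lambda>n. LINT t|lborel. indicator {a'..b'} t * (\<phi> n (p t, t))\<^sup>2) \<longlonglongrightarrow> 0"
  proof (rule tendsto_sandwich[OF _ _ tendsto_const f(4)])
    show "\<forall>\<^sub>F n in sequentially. 0 \<le> (LINT t|lborel. indicator {a'..b'} t * (\<phi> n (p t, t))\<^sup>2)" by simp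
    have "(LINT t|lborel. indicator {a'..b'} t * (\<phi> n (p t, t))\<^sup>2) \<le> (LINT t|lborel. indicator {a..b} t * (\<phi> n (p t, t))\<^sup>2)" for n
      by (rule integral_mono[OF I I]) (use sub in \<open>auto simp: indicator_def\<close>)
    then show "\<forall>\<^sub>F n in sequentially. (LINT t|lborel. indicator {a'..b'} t * (\<phi> n (p t, t))\<^sup>2) \<le> (LINT t|lborel. indicator {a..b} t * (\<phi> n (p t, t))\<^sup>2)"
      by simp
  qed
  then show ?thesis unfolding ztrace_def
    using f(1) L2_tendsto_subset[OF S f(2)] L2_tendsto_subset[OF S f(3)] by blast
qed

text \<open>The boundary values on the two sides vanish along two unrelated approximating sequences. Hence \<open>\<psi>\<close> is split by
  the affine weight \<open>\<theta>\<close>, which is 0 on the left and 1 on the right side, into two parts that each see one side.\<close>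

lemma strip_zero_compact:
  assumes lr: "continuous_on UNIV l" "continuous_on UNIV r"
    and lt: "\<And>t. a \<le> t \<Longrightarrow> t \<le> b \<Longrightarrow> l t < r t" and ab: "a < b"
    and t: "test_function UNIV \<psi>"
    and R: "ztrace (strip l r a b) h g r a b"
    and L: "ztrace (strip l r a b) h g l a b \<or> (\<forall>t. a < t \<longrightarrow> t < b \<longrightarrow> \<psi> (l t, t) = 0)"
  shows "(LINT z|lebesgue_on (strip l r a b). h z * dx \<psi> z + g z * \<psi> z) = 0"
proof -
  let ?S = "strip l r a b"
  note s = test_smooth[OF t]
  obtain B1 where B1: "\<And>z. \<bar>\<psi> z\<bar> \<le> B1" using test_bounded[OF t] by blast
  obtain B2 where B2: "\<And>z. \<bar>dx \<psi> z\<bar> \<le> B2" using test_bounded[OF test_pderiv[OF t]] by blast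
  have B0: "B1 \<ge> 0" "B2 \<ge> 0" using B1[of 0] B2[of 0] by linarith+
  have [measurable]: "\<psi> \<in> borel_measurable borel" "dx \<psi> \<in> borel_measurable borel"
    "l \<in> borel_measurable borel" "r \<in> borel_measurable borel"
    using smooth_borel[OF s] smooth_borel[OF smooth_pderiv[OF s]] lr by (auto intro: borel_measurable_continuous_onI)
  have cs: "continuous_on UNIV (\<lambda>s. f (s, t))" if "smooth f" for f t
    by (auto intro!: continuous_on_compose2[OF smooth_continuous[OF that]] continuous_intros)
  obtain \<phi> where f: "\<And>n. smooth (\<phi> n)" "L2_tendsto (lebesgue_on ?S) \<phi> h"
    "L2_tendsto (lebesgue_on ?S) (\<lambda>n. dx (\<phi> n)) g"
    "(\<lambda>n. LINT t|lborel. indicator {a..b} t * (\<phi> n (r t, t))\<^sup>2) \<longlonglongrightarrow> 0"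
    using R unfolding ztrace_def by blast
  from L show ?thesis
  proof
    assume z: "\<forall>t. a < t \<longrightarrow> t < b \<longrightarrow> \<psi> (l t, t) = 0"
    show ?thesis
      by (rule strip_zero_weighted[OF f(1) lr lr(2) less_imp_le[OF lt] smooth_partial_x[OF s] cs[OF smooth_pderiv[OF s]], where B="max B1 B2"])
        (use z f B1 B2 in \<open>auto simp: le_max_iff_disj\<close>)
  next
    assume "ztrace ?S h g l a b"
    then obtain \<phi>' where f': "\<And>n. smooth (\<phi>' n)" "L2_tendsto (lebesgue_on ?S) \<phi>' h"
      "L2_tendsto (lebesgue_on ?S) (\<lambda>n. dx (\<phi>' n)) g"
      "(\<lambda>n. LINT t|lborel. indicator {a..b} t * (\<phi>' n (l t, t))\<^sup>2) \<longlonglongrightarrow> 0"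
      unfolding ztrace_def by blast
    have "continuous_on {a..b} (\<lambda>t. r t - l t)"
      using lr by (auto intro!: continuous_intros intro: continuous_on_subset)
    then obtain t0 where t0: "t0 \<in> {a..b}" "\<And>t. t \<in> {a..b} \<Longrightarrow> r t0 - l t0 \<le> r t - l t"
      using continuous_attains_inf[of "{a..b}" "\<lambda>t. r t - l t"] ab by auto
    define d where "d = r t0 - l t0"
    have d: "d > 0" using lt t0(1) by (simp add: d_def)
    have dle: "d \<le> r t - l t" if "a < t" "t < b" for t using t0(2)[of t] that by (simp add: d_def)
    define \<theta> where "\<theta> z = (fst z - l (snd z)) / (r (snd z) - l (snd z))" for z
    define k where "k z = \<theta> z * \<psi> z" for z
    define k' where "k' z = \<psi> z / (r (snd z) - l (snd z)) + \<theta> z * dx \<psi> z" for z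
    define j where "j z = \<psi> z - k z" for z
    define j' where "j' z = dx \<psi> z - k' z" for z
    have nz: "r t - l t \<noteq> 0" if "a < t" "t < b" for t using dle[OF that] d by linarith
    have D: "((\<lambda>s. k (s, t)) has_real_derivative k' (s, t)) (at s)" if "a < t" "t < b" for s t
    proof -
      have "((\<lambda>s. \<theta> (s, t)) has_real_derivative 1 / (r t - l t)) (at s)"
        unfolding \<theta>_def using nz[OF that] by (auto intro!: derivative_eq_intros)
      from DERIV_mult[OF this smooth_partial_x[OF s, of t s]] show ?thesis
        unfolding k_def k'_def by (simp add: algebra_simps)
    qed
    have Dj: "((\<lambda>s. j (s, t)) has_real_derivative j' (s, t)) (at s)" if "a < t" "t < b" for s t
      unfolding j_def j'_def by (intro DERIV_diff smooth_partial_x[OF s] D that)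
    have c: "continuous_on UNIV (\<lambda>s. k' (s, t))" if "a < t" "t < b" for t
      unfolding k'_def \<theta>_def fst_conv snd_conv
      using nz[OF that] by (intro continuous_intros cs[OF s] cs[OF smooth_pderiv[OF s]]) auto
    have cj: "continuous_on UNIV (\<lambda>s. j' (s, t))" if "a < t" "t < b" for t
      unfolding j'_def by (intro continuous_intros c that cs[OF smooth_pderiv[OF s]])
    have [measurable]: "(\<lambda>z::plane. fst z) \<in> borel_measurable borel" "(\<lambda>z::plane. l (snd z)) \<in> borel_measurable borel"
      "(\<lambda>z::plane. r (snd z)) \<in> borel_measurable borel"
      by (auto intro!: borel_measurable_continuous_onI continuous_intros continuous_on_compose2[OF lr(1)] continuous_on_compose2[OF lr(2)])
    have [measurable]: "\<theta> \<in> borel_measurable borel" unfolding \<theta>_def by measurable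
    have mk [measurable]: "k \<in> borel_measurable borel" "k' \<in> borel_measurable borel" unfolding k_def k'_def by measurable
    have mj [measurable]: "j \<in> borel_measurable borel" "j' \<in> borel_measurable borel" unfolding j_def j'_def by measurable
    have th: "\<bar>\<theta> z\<bar> \<le> 1" if "z \<in> ?S" for z
      using that dle[of "snd z"] d by (auto simp: \<theta>_def strip_def)
    have bk: "\<bar>k z\<bar> \<le> B1" if "z \<in> ?S" for z
      using mult_mono[OF th[OF that] B1[of z]] by (simp add: k_def abs_mult)
    have bk': "\<bar>k' z\<bar> \<le> B1 / d + B2" if z: "z \<in> ?S" for z
    proof -
      have "\<bar>\<psi> z / (r (snd z) - l (snd z))\<bar> \<le> B1 / d"
        unfolding abs_divide using z dle[of "snd z"] d B0 by (intro frac_le B1) (auto simp: strip_def)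
      moreover have "\<bar>\<theta> z * dx \<psi> z\<bar> \<le> B2"
        using mult_mono[OF th[OF z] B2[of z]] by (simp add: abs_mult)
      ultimately show ?thesis unfolding k'_def by linarith
    qed
    define B where "B = 2 * B1 + 2 * B2 + B1 / d"
    have Bg: "B1 \<le> B" "B1 / d + B2 \<le> B" "B1 + B1 \<le> B" "B2 + (B1 / d + B2) \<le> B"
      using B0 d by (simp_all add: B_def)
    have kb: "\<bar>k z\<bar> \<le> B" "\<bar>k' z\<bar> \<le> B" "\<bar>j z\<bar> \<le> B" "\<bar>j' z\<bar> \<le> B" if "z \<in> ?S" for z
      using bk[OF that] bk'[OF that] B1[of z] B2[of z] Bg by (auto simp: j_def j'_def)
    have kr: "k (r t, t) = \<psi> (r t, t)" "k (l t, t) = 0" "j (l t, t) = \<psi> (l t, t)" "j (r t, t) = 0" if "a < t" "t < b" for t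
      using nz[OF that] by (auto simp: k_def j_def \<theta>_def)
    have 1: "(LINT z|lebesgue_on ?S. h z * k' z + g z * k z) = 0"
      by (rule strip_zero_weighted[OF f(1) lr lr(2) less_imp_le[OF lt] D c mk kb(1,2)])
        (use f kr B1 order_trans[OF B1 Bg(1)] in auto)
    have 2: "(LINT z|lebesgue_on ?S. h z * j' z + g z * j z) = 0"
      by (rule strip_zero_weighted[OF f'(1) lr lr(1) less_imp_le[OF lt] Dj cj mj kb(3,4)])
        (use f' kr B1 order_trans[OF B1 Bg(1)] in auto)
    note hL = L2_tendsto_D(2)[OF f(2)] and gL = L2_tendsto_D(2)[OF f(3)]
    note KL = borel_L2_strip[OF lr mk(1) kb(1)] borel_L2_strip[OF lr mk(2) kb(2)] borel_L2_strip[OF lr mj(1) kb(3)] borel_L2_strip[OF lr mj(2) kb(4)]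
    have "(LINT z|lebesgue_on ?S. h z * dx \<psi> z + g z * \<psi> z) = (LINT z|lebesgue_on ?S. (h z * k' z + g z * k z) + (h z * j' z + g z * j z))"
      by (simp add: j_def j'_def algebra_simps)
    also have "\<dots> = (LINT z|lebesgue_on ?S. h z * k' z + g z * k z) + (LINT z|lebesgue_on ?S. h z * j' z + g z * j z)"
      using L2_mult_integrable[OF hL KL(2)] L2_mult_integrable[OF gL KL(1)] L2_mult_integrable[OF hL KL(4)] L2_mult_integrable[OF gL KL(3)]
      by (intro Bochner_Integration.integral_add) auto
    finally show ?thesis using 1 2 by simp
  qed
qed

text \<open>The weight \<open>\<theta>\<close> degenerates where the two sides meet, as at the corners of a triangle; slightly shorter strips
  avoid these points.\<close>

lemma strip_exhaust:
  assumes lr: "continuous_on UNIV l" "continuous_on UNIV r" and ab: "a < b"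
    and X: "integrable (lebesgue_on (strip l r a b)) (X :: plane \<Rightarrow> real)"
    and z: "\<And>a' b'. a < a' \<Longrightarrow> a' < b' \<Longrightarrow> b' < b \<Longrightarrow> (LINT z|lebesgue_on (strip l r a' b'). X z) = 0"
  shows "(LINT z|lebesgue_on (strip l r a b). X z) = 0"
proof -
  let ?S = "strip l r a b"
  define e where "e n = (b - a) / (real n + 3)" for n
  define Sn where "Sn n = strip l r (a + e n) (b - e n)" for n
  have e: "e n > 0" "e n \<le> (b - a) / 3" for n
    using ab divide_left_mono[of 3 "real n + 3" "b - a"] by (simp_all add: e_def)
  have el: "e \<longlonglongrightarrow> 0" unfolding e_def by real_asymp
  have S: "strip l r a' b' \<in> sets lebesgue" for a' b' using strip_lmeasurable[OF lr] by blast
  have I: "integrable lebesgue (\<lambda>z. indicator ?S z *\<^sub>R X z)" using X S by (simp add: integrable_restrict_space)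
  have sub: "Sn n \<subseteq> ?S" for n
  proof -
    have "0 \<le> e n" using e(1)[of n] by simp
    then show ?thesis by (auto simp: Sn_def strip_def)
  qed
  have eq: "indicator (Sn n) z *\<^sub>R X z = indicator (Sn n) z *\<^sub>R (indicator ?S z *\<^sub>R X z)" for n z
    using sub[of n] by (auto simp: indicator_def)
  have "(\<lambda>n. LINT z|lebesgue. indicator (Sn n) z *\<^sub>R X z) \<longlonglongrightarrow> (LINT z|lebesgue. indicator ?S z *\<^sub>R X z)"
  proof (rule integral_dominated_convergence[where w="\<lambda>z. \<bar>indicator ?S z *\<^sub>R X z\<bar>"])
    show "(\<lambda>z. indicator ?S z *\<^sub>R X z) \<in> borel_measurable lebesgue" using I by blast
    show "(\<lambda>z. indicator (Sn n) z *\<^sub>R X z) \<in> borel_measurable lebesgue" for n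
      unfolding eq unfolding Sn_def by (rule borel_measurable_scaleR[OF borel_measurable_indicator[OF S] borel_measurable_integrable[OF I]])
    show "AE z in lebesgue. (\<lambda>n. indicator (Sn n) z *\<^sub>R X z) \<longlonglongrightarrow> indicator ?S z *\<^sub>R X z"
    proof (rule AE_I2)
      fix z
      show "(\<lambda>n. indicator (Sn n) z *\<^sub>R X z) \<longlonglongrightarrow> indicator ?S z *\<^sub>R X z"
      proof (cases "z \<in> ?S")
        case True
        then have "0 < snd z - a" "0 < b - snd z" by (auto simp: strip_def)
        then have "\<forall>\<^sub>F n in sequentially. e n < snd z - a" "\<forall>\<^sub>F n in sequentially. e n < b - snd z"
          using order_tendstoD(2)[OF el] by auto
        then have "\<forall>\<^sub>F n in sequentially. indicator (Sn n) z *\<^sub>R X z = indicator ?S z *\<^sub>R X z"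
          by eventually_elim (use True in \<open>auto simp: Sn_def strip_def indicator_def\<close>)
        then show ?thesis by (rule tendsto_eventually)
      next
        case False
        then have "z \<notin> Sn n" for n using sub by blast
        then show ?thesis using False by simp
      qed
    qed
    show "AE z in lebesgue. norm (indicator (Sn n) z *\<^sub>R X z) \<le> \<bar>indicator ?S z *\<^sub>R X z\<bar>" for n
      using sub[of n] by (auto simp: indicator_def)
  qed (use I in auto)
  moreover have "(LINT z|lebesgue. indicator (Sn n) z *\<^sub>R X z) = 0" for n
    using z[of "a + e n" "b - e n"] e[of n] S ab by (simp add: integral_restrict_space Sn_def)
  ultimately have "(\<lambda>n::nat. 0) \<longlonglongrightarrow> (LINT z|lebesgue. indicator ?S z *\<^sub>R X z)" by simp
  then have "(LINT z|lebesgue. indicator ?S z *\<^sub>R X z) = 0" by (simp add: LIMSEQ_const_iff)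
  then show ?thesis using S by (simp add: integral_restrict_space)
qed

lemma strip_zero:
  assumes lr: "continuous_on UNIV l" "continuous_on UNIV r"
    and lt: "\<And>t. a < t \<Longrightarrow> t < b \<Longrightarrow> l t < r t" and ab: "a < b"
    and t: "test_function UNIV \<psi>"
    and R: "ztrace (strip l r a b) h g r a b"
    and L: "ztrace (strip l r a b) h g l a b \<or> (\<forall>t. a < t \<longrightarrow> t < b \<longrightarrow> \<psi> (l t, t) = 0)"
  shows "(LINT z|lebesgue_on (strip l r a b). h z * dx \<psi> z + g z * \<psi> z) = 0"
proof (rule strip_exhaust[OF lr ab])
  have S: "strip l r a b \<in> sets lebesgue" using strip_lmeasurable[OF lr] by blast
  have "L2_fun (lebesgue_on (strip l r a b)) h" "L2_fun (lebesgue_on (strip l r a b)) g"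
    using R L2_tendsto_D(2) unfolding ztrace_def by blast+
  then show "integrable (lebesgue_on (strip l r a b)) (\<lambda>z. h z * dx \<psi> z + g z * \<psi> z)"
    using test_L2[OF t S] test_L2[OF test_pderiv[OF t] S] by (intro Bochner_Integration.integrable_add L2_mult_integrable) auto
  fix a' b' assume ab': "a < a'" "a' < b'" "b' < b"
  show "(LINT z|lebesgue_on (strip l r a' b'). h z * dx \<psi> z + g z * \<psi> z) = 0"
  proof (rule strip_zero_compact[OF lr _ ab'(2) t])
    show "ztrace (strip l r a' b') h g r a' b'"
      by (rule ztrace_substrip[OF lr lr(2) _ _ R]) (use ab' in auto)
    show "ztrace (strip l r a' b') h g l a' b' \<or> (\<forall>t. a' < t \<longrightarrow> t < b' \<longrightarrow> \<psi> (l t, t) = 0)"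
      using L ztrace_substrip[OF lr lr(1), of a a' b' b h g] ab' by fastforce
  qed (use lt ab' in auto)
qed

text \<open>Vanishing boundary values along the curve \<open>t \<mapsto> T (p t, t)\<close>. In the linear coordinates \<open>(s, t) \<mapsto> T (s, t)\<close> lines run
  in the direction \<open>T (1, 0)\<close>, which gives the formulas of this section for sides and lines of any direction.\<close>

definition zero_trace where
  "zero_trace U h hx hy T p a b \<longleftrightarrow> (\<exists>\<phi>. (\<forall>n. smooth (\<phi> n)) \<and> L2_tendsto (lebesgue_on U) \<phi> h \<and>
     L2_tendsto (lebesgue_on U) (\<lambda>n. dx (\<phi> n)) hx \<and> L2_tendsto (lebesgue_on U) (\<lambda>n. dy (\<phi> n)) hy \<and>
     (\<lambda>n. LINT t|lborel. indicator {a..b} t * (\<phi> n (T (p t, t)))\<^sup>2) \<longlonglongrightarrow> 0)" for T :: "plane \<Rightarrow> plane"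

lemma zero_trace_ztrace:
  assumes T: "mpl T S" and D: "D \<in> sets lebesgue" and U: "U \<in> sets lebesgue" "T ` D \<subseteq> U"
    and z: "zero_trace U h hx hy T p a b"
  shows "ztrace D (\<lambda>w. h (T w)) (\<lambda>w. fst (T (1, 0)) * hx (T w) + snd (T (1, 0)) * hy (T w)) p a b"
proof -
  obtain \<phi> where f: "\<And>n. smooth (\<phi> n)" "L2_tendsto (lebesgue_on U) \<phi> h" "L2_tendsto (lebesgue_on U) (\<lambda>n. dx (\<phi> n)) hx"
     "L2_tendsto (lebesgue_on U) (\<lambda>n. dy (\<phi> n)) hy" "(\<lambda>n. LINT t|lborel. indicator {a..b} t * (\<phi> n (T (p t, t)))\<^sup>2) \<longlonglongrightarrow> 0"
    using z unfolding zero_trace_def by blast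
  have d: "dx (\<lambda>w. \<phi> n (T w)) = (\<lambda>w. fst (T (1, 0)) * dx (\<phi> n) (T w) + snd (T (1, 0)) * dy (\<phi> n) (T w))" for n
    using pderiv_affine[OF mplD(3)[OF T] f(1), of "(1, 0)" n 0] pderiv_dir_expand[OF f(1), of "T (1, 0)" n] by auto
  have L: "L2_tendsto (lebesgue_on D) (\<lambda>n w. k n (T w)) (\<lambda>w. k0 (T w))" if "L2_tendsto (lebesgue_on U) k k0" for k k0
    by (rule mpl_L2_tendsto[OF T D L2_tendsto_subset[OF mpl_image_sets[OF T D] U that]])
  have sm: "smooth (\<lambda>w. \<phi> n (T w))" for n
    using smooth_affine[OF mplD(3)[OF T] f(1), of n 0] by simp
  show ?thesis unfolding ztrace_def
    by (intro exI[of _ "\<lambda>n w. \<phi> n (T w)"] conjI allI sm)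
      (use L f in \<open>auto simp: d intro!: L2_tendsto_add L2_tendsto_cmult\<close>)
qed

lemma strip_zero_mapped:
  assumes T: "mpl T S" and U: "U \<in> sets lebesgue" "T ` strip l r a b \<subseteq> U"
    and lr: "continuous_on UNIV l" "continuous_on UNIV r"
    and lt: "\<And>t. a < t \<Longrightarrow> t < b \<Longrightarrow> l t < r t" and ab: "a < b"
    and t: "test_function UNIV \<psi>"
    and R: "zero_trace U h hx hy T r a b"
    and L: "zero_trace U h hx hy T l a b \<or> (\<forall>t. a < t \<longrightarrow> t < b \<longrightarrow> \<psi> (T (l t, t)) = 0)"
  shows "(LINT z|lebesgue_on (T ` strip l r a b). h z * pderiv_dir (T (1, 0)) \<psi> z + (fst (T (1, 0)) * hx z + snd (T (1, 0)) * hy z) * \<psi> z) = 0"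
proof -
  have D: "strip l r a b \<in> sets lebesgue" using strip_lmeasurable[OF lr] by blast
  note bl = mplD(3)[OF T] and s = test_smooth[OF t]
  have t': "test_function UNIV (\<lambda>w. \<psi> (T w))"
    using test_affine[OF t mplD(3)[OF T] mplD(4)[OF T] mplD(1)[OF T] mplD(2)[OF T], of 0 UNIV] by simp
  have d: "dx (\<lambda>w. \<psi> (T w)) w = pderiv_dir (T (1, 0)) \<psi> (T w)" for w
    using pderiv_affine[OF bl s, of "(1, 0)" 0 w] by simp
  have "(LINT w|lebesgue_on (strip l r a b). h (T w) * dx (\<lambda>w. \<psi> (T w)) w + (fst (T (1, 0)) * hx (T w) + snd (T (1, 0)) * hy (T w)) * \<psi> (T w)) = 0"
    by (rule strip_zero[OF lr lt ab t' zero_trace_ztrace[OF T D U R]])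
      (use L zero_trace_ztrace[OF T D U, of h hx hy l a b] in auto)
  then show ?thesis by (simp add: mpl_integral[OF T D] d)
qed

lemma lborel_interval_affine:
  fixes f :: "real \<Rightarrow> real"
  assumes "a < b"
  shows "(LINT t|lborel. indicator {a..b} t * f t) = (b - a) * (LINT \<tau>|lborel. indicator {0..1} \<tau> * f (a + (b - a) * \<tau>))"
proof -
  have "(LINT t|lborel. indicator {a..b} t * f t) = \<bar>b - a\<bar> *\<^sub>R (LINT \<tau>|lborel. indicator {a..b} (a + (b - a) * \<tau>) * f (a + (b - a) * \<tau>))"
    using assms by (intro lborel_integral_real_affine) simp
  also have "(\<lambda>\<tau>. indicator {a..b} (a + (b - a) * \<tau>) * f (a + (b - a) * \<tau>)) = (\<lambda>\<tau>. indicator {0..1} \<tau> * f (a + (b - a) * \<tau>))"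
  proof
    fix \<tau>
    have "a \<le> a + (b - a) * \<tau> \<longleftrightarrow> 0 \<le> \<tau>" using assms by (simp add: zero_le_mult_iff)
    moreover have "a + (b - a) * \<tau> \<le> b \<longleftrightarrow> \<tau> \<le> 1"
    proof -
      have "(b - a) * \<tau> \<le> (b - a) * 1 \<longleftrightarrow> \<tau> \<le> 1" using assms by (intro mult_le_cancel_left_pos) simp
      then show ?thesis by auto
    qed
    ultimately show "indicator {a..b} (a + (b - a) * \<tau>) * f (a + (b - a) * \<tau>) = indicator {0..1} \<tau> * f (a + (b - a) * \<tau>)"
      by (simp add: indicator_def)
  qed
  finally show ?thesis using assms by simp
qed

text \<open>Subtracting a smooth extension \<open>G\<close> of the datum makes the boundary values zero; \<open>linepath\<close> and the coordinates
  \<open>(p t, t)\<close> parametrize the segment at constant speeds.\<close>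

lemma zero_trace_from_trace_on:
  assumes T: "mpl T S" and U: "U \<in> sets lebesgue" "bounded U"
    and tr: "trace_on U \<Gamma> u g" and G: "smooth G" "\<And>z. z \<in> \<Gamma> \<Longrightarrow> G z = g z"
    and ab: "a < b" and p: "\<And>t. p t = \<alpha> + \<beta> * t"
    and seg: "\<And>t. a \<le> t \<Longrightarrow> t \<le> b \<Longrightarrow> T (p t, t) \<in> \<Gamma>"
  shows "zero_trace U (\<lambda>z. u z - G z) (\<lambda>z. weak_deriv U (1, 0) u z - dx G z) (\<lambda>z. weak_deriv U (0, 1) u z - dy G z) T p a b"
proof -
  interpret bounded_linear T by (rule mplD(3)[OF T])
  define A where "A = T (p a, a)"
  define B where "B = T (p b, b)"
  have lp: "linepath A B \<tau> = T (p (a + (b - a) * \<tau>), a + (b - a) * \<tau>)" for \<tau>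
  proof -
    have "linepath A B \<tau> = T ((1 - \<tau>) *\<^sub>R (p a, a) + \<tau> *\<^sub>R (p b, b))"
      unfolding linepath_def A_def B_def add scaleR ..
    also have "(1 - \<tau>) *\<^sub>R (p a, a) + \<tau> *\<^sub>R (p b, b) = (p (a + (b - a) * \<tau>), a + (b - a) * \<tau>)"
      by (simp add: p algebra_simps)
    finally show ?thesis .
  qed
  have in\<Gamma>: "linepath A B \<tau> \<in> \<Gamma>" if "0 \<le> \<tau>" "\<tau> \<le> 1" for \<tau>
    unfolding lp
  proof (rule seg)
    show "a \<le> a + (b - a) * \<tau>" using ab that by simp
    have "(b - a) * \<tau> \<le> (b - a) * 1" using ab that by (intro mult_left_mono) auto
    then show "a + (b - a) * \<tau> \<le> b" by simp
  qed
  have "A \<noteq> B"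
  proof
    assume "A = B"
    then have "S A = S B" by simp
    then show False using ab by (simp add: A_def B_def mplD(1)[OF T])
  qed
  moreover have "closed_segment A B \<subseteq> \<Gamma>"
    unfolding linepath_image_01[symmetric] using in\<Gamma> by auto
  ultimately obtain \<phi> where f: "\<And>n. smooth (\<phi> n)" "L2_tendsto (lebesgue_on U) \<phi> u"
    "\<And>v. v \<in> Basis \<Longrightarrow> L2_tendsto (lebesgue_on U) (\<lambda>n. pderiv_dir v (\<phi> n)) (weak_deriv U v u)"
    "L2_tendsto (lebesgue_on {0..1}) (\<lambda>n t. \<phi> n (linepath A B t)) (\<lambda>t. g (linepath A B t))"
    using tr unfolding trace_on_def by blast
  have s: "smooth (\<lambda>z. \<phi> n z - G z)" for n by (intro smooth_diff f G)
  have d: "pderiv_dir v (\<lambda>z. \<phi> n z - G z) = (\<lambda>z. pderiv_dir v (\<phi> n) z - pderiv_dir v G z)" for v n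
    using pderiv_add[OF f(1) smooth_minus[OF G(1)], of v n] pderiv_cmult[OF G(1), of v "-1"] by auto
  have c: "L2_tendsto (lebesgue_on U) (\<lambda>_. G) G" "L2_tendsto (lebesgue_on U) (\<lambda>_. pderiv_dir v G) (pderiv_dir v G)" for v
    using G(1) U by (auto intro!: L2_tendsto_const smooth_L2 smooth_pderiv)
  have "(LINT t|lborel. indicator {a..b} t * (\<phi> n (T (p t, t)) - G (T (p t, t)))\<^sup>2) =
      (b - a) * (LINT t|lebesgue_on {0..1}. (\<phi> n (linepath A B t) - g (linepath A B t))\<^sup>2)" for n
  proof -
    have cl: "continuous_on UNIV (linepath A B)" by (rule continuous_on_linepath)
    have [measurable]: "(\<lambda>\<tau>. (\<phi> n (linepath A B \<tau>) - G (linepath A B \<tau>))\<^sup>2) \<in> borel_measurable borel"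
      by (intro borel_measurable_continuous_onI continuous_intros continuous_on_compose2[OF smooth_continuous[OF f(1)] cl]
          continuous_on_compose2[OF smooth_continuous[OF G(1)] cl]) auto
    have "(LINT t|lborel. indicator {a..b} t * (\<phi> n (T (p t, t)) - G (T (p t, t)))\<^sup>2)
      = (b - a) * (LINT \<tau>|lborel. indicator {0..1} \<tau> * (\<phi> n (linepath A B \<tau>) - G (linepath A B \<tau>))\<^sup>2)"
      by (simp add: lborel_interval_affine[OF ab] lp)
    also have "(LINT \<tau>|lborel. indicator {0..1} \<tau> * (\<phi> n (linepath A B \<tau>) - G (linepath A B \<tau>))\<^sup>2)
      = (LINT \<tau>|lebesgue. indicator {0..1} \<tau> * (\<phi> n (linepath A B \<tau>) - G (linepath A B \<tau>))\<^sup>2)"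
      by (rule integral_completion[symmetric]) measurable
    also have "\<dots> = (LINT \<tau>|lebesgue. indicator {0..1} \<tau> *\<^sub>R (\<phi> n (linepath A B \<tau>) - g (linepath A B \<tau>))\<^sup>2)"
      using G(2) in\<Gamma> by (intro Bochner_Integration.integral_cong) (auto simp: indicator_def)
    also have "\<dots> = (LINT t|lebesgue_on {0..1}. (\<phi> n (linepath A B t) - g (linepath A B t))\<^sup>2)"
      by (simp add: integral_restrict_space)
    finally show ?thesis .
  qed
  then have tz: "(\<lambda>n. LINT t|lborel. indicator {a..b} t * (\<phi> n (T (p t, t)) - G (T (p t, t)))\<^sup>2) \<longlonglongrightarrow> 0"
    using tendsto_mult_left[OF L2_tendsto_D(3)[OF f(4)], of "b - a"] by simp
  show ?thesis unfolding zero_trace_def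
    by (intro exI[of _ "\<lambda>n z. \<phi> n z - G z"] conjI allI s tz; (simp only: d)?)
      (use f(2,3) c in \<open>auto intro!: L2_tendsto_diff simp: plane_Basis\<close>)
qed

section \<open>Decomposing integrals over null-set partitions\<close>

lemma AE_mult: "AE z in M. f z = g z \<Longrightarrow> AE z in M. f z * h z = g z * (h z :: real)"
  by (erule AE_mp) (rule AE_I2, simp)

lemma AE_measurable_lebesgue_on:
  fixes f g :: "plane \<Rightarrow> real"
  assumes U: "U \<in> sets lebesgue" and f: "f \<in> borel_measurable (lebesgue_on U)" and ae: "AE z in lebesgue_on U. f z = g z"
  shows "g \<in> borel_measurable (lebesgue_on U)"
proof -
  define F where "F z = indicator U z *\<^sub>R f z" for z
  define G where "G z = indicator U z *\<^sub>R g z" for z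
  have F: "F \<in> borel_measurable lebesgue" unfolding F_def using f U by (simp add: borel_measurable_restrict_space_iff)
  have ae': "AE z in lebesgue. F z = G z"
  proof -
    have "AE z in lebesgue. z \<in> U \<longrightarrow> f z = g z" using ae U by (simp add: AE_restrict_space_iff)
    then show ?thesis by eventually_elim (simp add: F_def G_def indicator_def)
  qed
  have "G \<in> borel_measurable lebesgue"
    unfolding borel_measurable_iff_greater
  proof
    fix c
    have "{z \<in> space lebesgue. c < F z} \<in> sets lebesgue" using F unfolding borel_measurable_iff_greater by blast
    moreover have "AE z in lebesgue. z \<in> {z \<in> space lebesgue. c < F z} \<longleftrightarrow> z \<in> {z \<in> space lebesgue. c < G z}"
      using ae' by eventually_elim auto
    ultimately show "{z \<in> space lebesgue. c < G z} \<in> sets lebesgue"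
      using completion.in_sets_AE[of "{z \<in> space lebesgue. c < F z}" "{z \<in> space lebesgue. c < G z}" lborel] by blast
  qed
  then show ?thesis unfolding G_def using U by (simp add: borel_measurable_restrict_space_iff)
qed

lemma W0_cong_AE:
  assumes "W0 U h hx hy" "U \<in> sets lebesgue" "AE z in lebesgue_on U. h z = h' z"
    "AE z in lebesgue_on U. hx z = hx' z" "AE z in lebesgue_on U. hy z = hy' z"
  shows "W0 U h' hx' hy'"
proof -
  note m = L2_D(1)[OF W0_D(1)[OF assms(1)]] L2_D(1)[OF W0_D(2)[OF assms(1)]] L2_D(1)[OF W0_D(3)[OF assms(1)]]
  obtain \<phi> where p: "\<forall>n. test_function U (\<phi> n)" "L2_tendsto (lebesgue_on U) \<phi> h"
    "L2_tendsto (lebesgue_on U) (\<lambda>n. dx (\<phi> n)) hx" "L2_tendsto (lebesgue_on U) (\<lambda>n. dy (\<phi> n)) hy"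
    using assms(1) unfolding W0_def by blast
  show ?thesis unfolding W0_def
    using p(1) L2_tendsto_cong_AE[OF p(2) AE_measurable_lebesgue_on[OF assms(2) m(1) assms(3)] assms(3)]
      L2_tendsto_cong_AE[OF p(3) AE_measurable_lebesgue_on[OF assms(2) m(2) assms(4)] assms(4)]
      L2_tendsto_cong_AE[OF p(4) AE_measurable_lebesgue_on[OF assms(2) m(3) assms(5)] assms(5)] by blast
qed

lemma integral_pieces:
  fixes X :: "plane \<Rightarrow> real"
  assumes U: "U \<in> sets lebesgue" and I: "finite I" and E: "\<And>i. i \<in> I \<Longrightarrow> E i \<in> sets lebesgue"
    and ae: "AE z in lebesgue. indicator U z = (\<Sum>i\<in>I. indicator (E i) z :: real)"
    and X: "\<And>i. i \<in> I \<Longrightarrow> integrable (lebesgue_on (E i)) X"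
  shows "integrable (lebesgue_on U) X" "(LINT z|lebesgue_on U. X z) = (\<Sum>i\<in>I. LINT z|lebesgue_on (E i). X z)" (is ?A)
proof -
  have iE: "integrable lebesgue (\<lambda>z. indicator (E i) z *\<^sub>R X z)" if "i \<in> I" for i
    using X[OF that] E[OF that] by (simp add: integrable_restrict_space)
  have iS: "integrable lebesgue (\<lambda>z. \<Sum>i\<in>I. indicator (E i) z *\<^sub>R X z)"
    using iE by (rule Bochner_Integration.integrable_sum)
  have ae': "AE z in lebesgue. (\<Sum>i\<in>I. indicator (E i) z *\<^sub>R X z) = indicator U z *\<^sub>R X z"
    using ae by eventually_elim (simp add: sum_distrib_right)
  have mU: "(\<lambda>z. indicator U z *\<^sub>R X z) \<in> borel_measurable lebesgue"
  proof -
    have "AE z in lebesgue_on UNIV. (\<Sum>i\<in>I. indicator (E i) z *\<^sub>R X z) = indicator U z *\<^sub>R X z"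
      using ae' unfolding lebesgue_on_UNIV_eq .
    from AE_measurable_lebesgue_on[OF _ _ this] show ?thesis
      using borel_measurable_integrable[OF iS] unfolding lebesgue_on_UNIV_eq by simp
  qed
  have iU: "integrable lebesgue (\<lambda>z. indicator U z *\<^sub>R X z)"
    by (rule integrable_cong_AE_imp[OF iS mU ae'])
  then show "integrable (lebesgue_on U) X" using U by (simp add: integrable_restrict_space)
  have "(LINT z|lebesgue_on U. X z) = (LINT z|lebesgue. (\<Sum>i\<in>I. indicator (E i) z *\<^sub>R X z))"
    using U integral_cong_AE[OF borel_measurable_integrable[OF iS] mU ae'] by (simp add: integral_restrict_space)
  also have "\<dots> = (\<Sum>i\<in>I. LINT z|lebesgue. indicator (E i) z *\<^sub>R X z)"
    using iE by (rule Bochner_Integration.integral_sum)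
  also have "\<dots> = (\<Sum>i\<in>I. LINT z|lebesgue_on (E i). X z)"
    using E by (intro sum.cong) (auto simp: integral_restrict_space)
  finally show ?A .
qed

lemma integrable_subset:
  fixes X :: "plane \<Rightarrow> real"
  assumes "integrable (lebesgue_on U) X" "U \<in> sets lebesgue" "V \<in> sets lebesgue" "V \<subseteq> U"
  shows "integrable (lebesgue_on V) X"
proof -
  have "integrable lebesgue (\<lambda>z. indicator U z *\<^sub>R X z)" using assms by (simp add: integrable_restrict_space)
  from integrable_mult_indicator[OF assms(3) this] have "integrable lebesgue (\<lambda>z. indicator V z *\<^sub>R (indicator U z *\<^sub>R X z))" .
  moreover have "(\<lambda>z. indicator V z *\<^sub>R (indicator U z *\<^sub>R X z)) = (\<lambda>z. indicator V z *\<^sub>R X z)"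
    using assms(4) by (intro ext) (auto simp: indicator_def)
  ultimately show ?thesis using assms(3) by (simp add: integrable_restrict_space)
qed

lemma AE_not_on_line:
  assumes "\<alpha> \<noteq> 0 \<or> \<beta> \<noteq> 0"
  shows "AE z in lebesgue. \<alpha> * fst z + \<beta> * snd z \<noteq> (c::real)"
proof -
  have "(\<alpha>, \<beta>) \<noteq> 0 \<or> c \<noteq> 0" using assms by (auto simp: zero_prod_def)
  from negligible_hyperplane[OF this] have "negligible {z. \<alpha> * fst z + \<beta> * snd z = c}"
    by (simp add: inner_prod_def case_prod_beta')
  then show ?thesis
    by (intro AE_I'[of "{z. \<alpha> * fst z + \<beta> * snd z = c}"]) (auto simp: negligible_iff_null_sets)
qed

section \<open>The octagon and its fundamental domain\<close>

lemma Omega_iff: "z \<in> Omega \<epsilon> \<longleftrightarrow> \<bar>fst z\<bar> < 1 \<and> \<bar>snd z\<bar> < 1 \<and> \<bar>fst z + snd z\<bar> < 2 - \<epsilon> \<and> \<bar>fst z - snd z\<bar> < 2 - \<epsilon>"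
  by (cases z) (simp add: Omega_def)

locale domain_eps =
  fixes \<epsilon> :: real
  assumes eps: "0 < \<epsilon>" "\<epsilon> < 1"
begin

lemma Omega_q_iff: "z \<in> Omega_q \<epsilon> \<longleftrightarrow> 0 < snd z \<and> snd z < fst z \<and> fst z < 1 \<and> fst z + snd z < 2 - \<epsilon>"
  using eps by (cases z) (auto simp: Omega_q_def Omega_iff)

abbreviation MO where "MO \<equiv> lebesgue_on (Omega \<epsilon>)"
abbreviation MQ where "MQ \<equiv> lebesgue_on (Omega_q \<epsilon>)"

lemma Omega_open: "open (Omega \<epsilon>)"
proof -
  have "Omega \<epsilon> = {z. \<bar>fst z\<bar> < 1 \<and> \<bar>snd z\<bar> < 1 \<and> \<bar>fst z + snd z\<bar> < 2 - \<epsilon> \<and> \<bar>fst z - snd z\<bar> < 2 - \<epsilon>}"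
    using Omega_iff by blast
  then show ?thesis by (auto intro!: open_Collect_conj open_Collect_less continuous_intros)
qed

lemma Omega_q_open: "open (Omega_q \<epsilon>)"
proof -
  have "Omega_q \<epsilon> = {z. 0 < snd z \<and> snd z < fst z \<and> fst z < 1 \<and> fst z + snd z < 2 - \<epsilon>}"
    using Omega_q_iff by blast
  then show ?thesis by (auto intro!: open_Collect_conj open_Collect_less continuous_intros)
qed

lemma Omega_q_subset: "Omega_q \<epsilon> \<subseteq> Omega \<epsilon>" by (auto simp: Omega_q_def)

lemma Omega_bounded: "bounded (Omega \<epsilon>)"
proof (rule bounded_subset[OF bounded_cbox])
  show "Omega \<epsilon> \<subseteq> cbox (-1, -1) (1, 1)"
    by (auto simp: Omega_def cbox_Pair_eq abs_less_iff)
qed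

lemma Omega_q_bounded: "bounded (Omega_q \<epsilon>)" using Omega_bounded Omega_q_subset bounded_subset by blast

lemma Omega_sets: "Omega \<epsilon> \<in> sets lebesgue" "Omega_q \<epsilon> \<in> sets lebesgue"
  using Omega_open Omega_q_open by auto

lemma Omega_lmeasurable: "Omega \<epsilon> \<in> lmeasurable" "Omega_q \<epsilon> \<in> lmeasurable"
  using Omega_bounded Omega_q_bounded Omega_sets bounded_set_imp_lmeasurable by auto

text \<open>The points of the segment from \<open>z\<close> towards \<open>c\<close> lie in \<open>S\<close> and converge to \<open>z\<close>.\<close>

lemma frontier_by_shrinking:
  assumes "open S" "z \<notin> S" "\<And>\<tau>. 0 < \<tau> \<Longrightarrow> \<tau> < 1 \<Longrightarrow> (1 - \<tau>) *\<^sub>R z + \<tau> *\<^sub>R c \<in> S"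
  shows "(z :: plane) \<in> frontier S"
proof -
  have "(\<lambda>n. (1 - 1 / (real n + 2)) *\<^sub>R z + (1 / (real n + 2)) *\<^sub>R c) \<longlonglongrightarrow> (1 - 0) *\<^sub>R z + 0 *\<^sub>R c"
  proof (intro tendsto_intros)
    show "(\<lambda>n. 1 / (real n + 2)) \<longlonglongrightarrow> 0" by real_asymp
    then show "(\<lambda>n. 1 / (real n + 2)) \<longlonglongrightarrow> 0" .
  qed
  moreover have "(1 - 1 / (real n + 2)) *\<^sub>R z + (1 / (real n + 2)) *\<^sub>R c \<in> S" for n
    by (rule assms(3)) auto
  ultimately have "z \<in> closure S" unfolding closure_sequential by force
  then show ?thesis using assms(1,2) by (simp add: frontier_def interior_open)
qed

lemma frontier_OmegaI:
  assumes "\<bar>x\<bar> \<le> 1" "\<bar>y\<bar> \<le> 1" "\<bar>x + y\<bar> \<le> 2 - \<epsilon>" "\<bar>x - y\<bar> \<le> 2 - \<epsilon>"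
    "\<bar>x\<bar> = 1 \<or> \<bar>y\<bar> = 1 \<or> \<bar>x + y\<bar> = 2 - \<epsilon> \<or> \<bar>x - y\<bar> = 2 - \<epsilon>"
  shows "(x, y) \<in> frontier (Omega \<epsilon>)"
proof (rule frontier_by_shrinking[OF Omega_open, of _ 0])
  show "(x, y) \<notin> Omega \<epsilon>" using assms by (auto simp: Omega_iff)
  fix \<tau> :: real assume t: "0 < \<tau>" "\<tau> < 1"
  have lt: "\<bar>(1 - \<tau>) * u\<bar> < v" if "\<bar>u\<bar> \<le> v" "0 < v" for u v :: real
  proof -
    have "(1 - \<tau>) * \<bar>u\<bar> \<le> (1 - \<tau>) * v" using that t by (intro mult_left_mono) auto
    also have "\<dots> < 1 * v" using that t by (intro mult_strict_right_mono) auto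
    finally show ?thesis using t by (simp add: abs_mult)
  qed
  show "(1 - \<tau>) *\<^sub>R (x, y) + \<tau> *\<^sub>R 0 \<in> Omega \<epsilon>"
    using lt[OF assms(1)] lt[OF assms(2)] lt[OF assms(3)] lt[OF assms(4)] eps
    by (simp add: Omega_iff algebra_simps)
qed

lemma frontier_OmegaD:
  assumes "(x, y) \<in> frontier (Omega \<epsilon>)"
  shows "\<bar>x\<bar> \<le> 1" "\<bar>y\<bar> \<le> 1" "\<bar>x + y\<bar> \<le> 2 - \<epsilon>" "\<bar>x - y\<bar> \<le> 2 - \<epsilon>"
    "\<bar>x\<bar> = 1 \<or> \<bar>y\<bar> = 1 \<or> \<bar>x + y\<bar> = 2 - \<epsilon> \<or> \<bar>x - y\<bar> = 2 - \<epsilon>" (is ?A)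
proof -
  let ?C = "{z. \<bar>fst z\<bar> \<le> 1 \<and> \<bar>snd z\<bar> \<le> 1 \<and> \<bar>fst z + snd z\<bar> \<le> 2 - \<epsilon> \<and> \<bar>fst z - snd z\<bar> \<le> 2 - \<epsilon>} :: plane set"
  have "closed ?C" by (auto intro!: closed_Collect_conj closed_Collect_le continuous_intros)
  moreover have "Omega \<epsilon> \<subseteq> ?C" by (auto simp: Omega_iff)
  ultimately have "closure (Omega \<epsilon>) \<subseteq> ?C" by (rule closure_minimal[rotated])
  moreover have "(x, y) \<in> closure (Omega \<epsilon>)" and n: "(x, y) \<notin> Omega \<epsilon>"
    using assms Omega_open by (auto simp: frontier_def interior_open)
  ultimately have "(x, y) \<in> ?C" by blast
  then show c: "\<bar>x\<bar> \<le> 1" "\<bar>y\<bar> \<le> 1" "\<bar>x + y\<bar> \<le> 2 - \<epsilon>" "\<bar>x - y\<bar> \<le> 2 - \<epsilon>"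
    unfolding mem_Collect_eq fst_conv snd_conv by blast+
  show ?A
    using n c unfolding Omega_iff fst_conv snd_conv less_le by blast
qed

lemma frontier_Omega_qI:
  assumes "0 \<le> y" "y \<le> x" "x \<le> 1" "x + y \<le> 2 - \<epsilon>" "y = 0 \<or> y = x \<or> x = 1 \<or> x + y = 2 - \<epsilon>"
  shows "(x, y) \<in> frontier (Omega_q \<epsilon>)"
proof (rule frontier_by_shrinking[OF Omega_q_open, of _ "(1/2, 1/4)"])
  show "(x, y) \<notin> Omega_q \<epsilon>" using assms by (auto simp: Omega_q_iff)
  fix \<tau> :: real assume t: "0 < \<tau>" "\<tau> < 1"
  have lt: "0 < (1 - \<tau>) * u + \<tau> * v" if "0 \<le> u" "0 < v" for u v :: real
    using that t by (intro add_nonneg_pos mult_nonneg_nonneg mult_pos_pos) auto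
  show "(1 - \<tau>) *\<^sub>R (x, y) + \<tau> *\<^sub>R (1/2, 1/4) \<in> Omega_q \<epsilon>"
    using lt[of y "1/4"] lt[of "x - y" "1/4"] lt[of "1 - x" "1/2"] lt[of "2 - \<epsilon> - (x + y)" "2 - \<epsilon> - 3/4"] assms eps
    by (simp add: Omega_q_iff algebra_simps)
qed

text \<open>If \<open>(1 + 4 \<delta>) z\<close> lies within \<open>\<delta>\<close> of the octagon, \<open>z\<close> satisfies the inequalities of the octagon with a margin.\<close>

lemma Omega_shrink:
  assumes d: "0 < \<delta>" "\<delta> < 1"
  shows "\<exists>K. compact K \<and> K \<subseteq> Omega \<epsilon> \<and> (\<forall>z u. norm u \<le> 1 \<longrightarrow> (1 + 4 * \<delta>) *\<^sub>R z - \<delta> *\<^sub>R u \<in> Omega \<epsilon> \<longrightarrow> z \<in> K)"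
proof -
  let ?L = "1 + 4 * \<delta>"
  let ?K = "{z. \<bar>?L * fst z\<bar> \<le> 1 + \<delta> \<and> \<bar>?L * snd z\<bar> \<le> 1 + \<delta> \<and> \<bar>?L * (fst z + snd z)\<bar> \<le> 2 - \<epsilon> + 2 * \<delta> \<and> \<bar>?L * (fst z - snd z)\<bar> \<le> 2 - \<epsilon> + 2 * \<delta>} :: plane set"
  have key: "\<bar>u\<bar> < v" if "\<bar>?L * u\<bar> \<le> v + w" "w < 4 * \<delta> * v" for u v w :: real
  proof -
    have "?L * \<bar>u\<bar> < ?L * v" using that d by (simp add: abs_mult algebra_simps)
    then show ?thesis using d mult_less_cancel_left_pos[of ?L] by simp
  qed
  have 2: "2 * \<delta> < 4 * \<delta> * (2 - \<epsilon>)"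
  proof -
    have "4 * \<delta> * 1 < 4 * \<delta> * (2 - \<epsilon>)" using d eps by (intro mult_strict_left_mono) auto
    then show ?thesis using d by linarith
  qed
  have sub: "?K \<subseteq> Omega \<epsilon>"
  proof
    fix z assume "z \<in> ?K"
    then have K: "\<bar>?L * fst z\<bar> \<le> 1 + \<delta>" "\<bar>?L * snd z\<bar> \<le> 1 + \<delta>" "\<bar>?L * (fst z + snd z)\<bar> \<le> 2 - \<epsilon> + 2 * \<delta>"
      "\<bar>?L * (fst z - snd z)\<bar> \<le> 2 - \<epsilon> + 2 * \<delta>" by blast+
    have 1: "\<delta> < 4 * \<delta> * 1" using d by simp
    show "z \<in> Omega \<epsilon>" unfolding Omega_iff
      by (intro conjI key[OF K(1) 1] key[OF K(2) 1] key[OF K(3) 2] key[OF K(4) 2])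
  qed
  have "closed ?K" by (auto intro!: closed_Collect_conj closed_Collect_le continuous_intros)
  moreover have "bounded ?K" using sub Omega_bounded bounded_subset by blast
  ultimately have "compact ?K" by (simp add: compact_eq_bounded_closed)
  moreover have "z \<in> ?K" if u: "norm u \<le> 1" and z: "?L *\<^sub>R z - \<delta> *\<^sub>R u \<in> Omega \<epsilon>" for z u :: plane
  proof -
    have "\<bar>fst u\<bar> \<le> 1" "\<bar>snd u\<bar> \<le> 1" using u abs_fst_le_norm[of u] abs_snd_le_norm[of u] by linarith+
    then have "\<bar>\<delta> * fst u\<bar> \<le> \<delta>" "\<bar>\<delta> * snd u\<bar> \<le> \<delta>" using d by (simp_all add: abs_mult mult_left_le)
    then have b: "\<bar>\<delta> * fst u + \<delta> * snd u\<bar> \<le> 2 * \<delta>" "\<bar>\<delta> * fst u - \<delta> * snd u\<bar> \<le> 2 * \<delta>" "\<bar>\<delta> * fst u\<bar> \<le> \<delta>" "\<bar>\<delta> * snd u\<bar> \<le> \<delta>"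
      by (fastforce intro: order_trans[OF abs_triangle_ineq] order_trans[OF abs_triangle_ineq4])+
    have tri: "\<bar>p\<bar> \<le> v + w" if "\<bar>p - q\<bar> < v" "\<bar>q\<bar> \<le> w" for p q v w :: real
      using that abs_triangle_ineq[of "p - q" q] by simp
    have "\<bar>?L * fst z - \<delta> * fst u\<bar> < 1" "\<bar>?L * snd z - \<delta> * snd u\<bar> < 1"
      "\<bar>(?L * fst z - \<delta> * fst u) + (?L * snd z - \<delta> * snd u)\<bar> < 2 - \<epsilon>"
      "\<bar>(?L * fst z - \<delta> * fst u) - (?L * snd z - \<delta> * snd u)\<bar> < 2 - \<epsilon>"
      using z unfolding Omega_iff by simp_all
    moreover have "(?L * fst z - \<delta> * fst u) + (?L * snd z - \<delta> * snd u) = ?L * (fst z + snd z) - (\<delta> * fst u + \<delta> * snd u)"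
      "(?L * fst z - \<delta> * fst u) - (?L * snd z - \<delta> * snd u) = ?L * (fst z - snd z) - (\<delta> * fst u - \<delta> * snd u)"
      by (simp_all add: algebra_simps)
    ultimately have c: "\<bar>?L * fst z - \<delta> * fst u\<bar> < 1" "\<bar>?L * snd z - \<delta> * snd u\<bar> < 1"
      "\<bar>?L * (fst z + snd z) - (\<delta> * fst u + \<delta> * snd u)\<bar> < 2 - \<epsilon>"
      "\<bar>?L * (fst z - snd z) - (\<delta> * fst u - \<delta> * snd u)\<bar> < 2 - \<epsilon>" by (simp_all only:)
    show ?thesis unfolding mem_Collect_eq
      by (intro conjI tri[OF c(1) b(3)] tri[OF c(2) b(4)] tri[OF c(3) b(1)] tri[OF c(4) b(2)])
  qed
  ultimately show ?thesis using sub by blast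
qed

text \<open>The hypotheses say that the extension by zero has the extended gradient as its weak gradient on the whole
  plane, since they hold for all \<open>\<psi>\<close>, not only for those supported in the octagon.\<close>

lemma W0_Omega:
  assumes h: "L2_fun MO h" "L2_fun MO hx" "L2_fun MO hy"
    and w1: "\<And>\<psi>. test_function UNIV \<psi> \<Longrightarrow> (LINT z|MO. h z * dx \<psi> z + hx z * \<psi> z) = 0"
    and w2: "\<And>\<psi>. test_function UNIV \<psi> \<Longrightarrow> (LINT z|MO. h z * dy \<psi> z + hy z * \<psi> z) = 0"
  shows "W0 (Omega \<epsilon>) h hx hy"
proof -
  let ?U = "Omega \<epsilon>"
  have Ub: "?U \<in> sets borel" using Omega_open by simp
  have rep: "\<exists>g. L2_fun lborel g \<and> (\<forall>z. z \<notin> ?U \<longrightarrow> g z = 0) \<and> (AE z in lebesgue_on ?U. g z = k z) \<and>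
      (\<forall>\<psi>. test_function UNIV \<psi> \<longrightarrow> (LINT z|lborel. g z * \<psi> z) = (LINT z|lebesgue_on ?U. k z * \<psi> z))"
    if k: "L2_fun (lebesgue_on ?U) k" for k
  proof -
    have "(\<lambda>z. indicator ?U z *\<^sub>R k z) \<in> borel_measurable lebesgue"
      using L2_D(1)[OF k] Omega_sets by (simp add: borel_measurable_restrict_space_iff)
    from completion_ex_borel_measurable_real[OF this]
    obtain g0 where g0: "g0 \<in> borel_measurable lborel" "AE z in lborel. indicator ?U z *\<^sub>R k z = g0 z" by blast
    define g where "g z = indicator ?U z * g0 z" for z
    have gm [measurable]: "g \<in> borel_measurable borel" unfolding g_def using g0(1) Ub by (auto intro!: borel_measurable_times)
    have ae: "AE z in lborel. indicator ?U z * k z = g z"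
      using g0(2) by eventually_elim (auto simp: g_def indicator_def split: if_splits)
    have ael: "AE z in lebesgue. indicator ?U z * k z = g z" using AE_completion[OF ae] .
    have aeU: "AE z in lebesgue_on ?U. g z = k z"
    proof -
      have "AE z in lebesgue. z \<in> ?U \<longrightarrow> g z = k z" using ael by eventually_elim auto
      then show ?thesis using Omega_sets by (simp add: AE_restrict_space_iff)
    qed
    have gl: "g \<in> borel_measurable (lebesgue_on ?U)" by (intro measurable_restrict_space1 measurable_completion) simp
    have "L2_fun (lebesgue_on ?U) g"
      by (rule L2_cong_AE[OF k gl]) (rule AE_symmetric[OF aeU])
    then have "integrable lebesgue (\<lambda>z. indicator ?U z *\<^sub>R (g z)\<^sup>2)"
      using Omega_sets by (simp add: L2_fun_def integrable_restrict_space)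
    moreover have "(\<lambda>z. indicator ?U z *\<^sub>R (g z)\<^sup>2) = (\<lambda>z. (g z)\<^sup>2)" by (auto simp: g_def indicator_def)
    ultimately have "integrable lborel (\<lambda>z. (g z)\<^sup>2)" by (simp add: integrable_completion)
    then have 1: "L2_fun lborel g" by (simp add: L2_fun_def)
    have "(LINT z|lborel. g z * \<psi> z) = (LINT z|lebesgue_on ?U. k z * \<psi> z)" if t: "test_function UNIV \<psi>" for \<psi>
    proof -
      have [measurable]: "\<psi> \<in> borel_measurable borel" by (rule smooth_borel[OF test_smooth[OF t]])
      have "(LINT z|lborel. g z * \<psi> z) = (LINT z|lebesgue. g z * \<psi> z)"
        by (rule integral_completion[symmetric]) measurable
      also have "\<dots> = (LINT z|lebesgue. indicator ?U z *\<^sub>R (g z * \<psi> z))"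
        by (intro Bochner_Integration.integral_cong) (auto simp: g_def indicator_def)
      also have "\<dots> = (LINT z|lebesgue_on ?U. g z * \<psi> z)" using Omega_sets by (simp add: integral_restrict_space)
      also have "\<dots> = (LINT z|lebesgue_on ?U. k z * \<psi> z)"
        by (rule integral_cong_AE) (use gl L2_D(1)[OF k] smooth_lebesgue[OF test_smooth[OF t]] AE_mult[OF aeU] in auto)
      finally show ?thesis .
    qed
    then show ?thesis using 1 aeU by (intro exI[of _ g]) (auto simp: g_def)
  qed
  obtain f where f: "L2_fun lborel f" "\<And>z. z \<notin> ?U \<Longrightarrow> f z = 0" "AE z in lebesgue_on ?U. f z = h z"
    "\<And>\<psi>. test_function UNIV \<psi> \<Longrightarrow> (LINT z|lborel. f z * \<psi> z) = (LINT z|lebesgue_on ?U. h z * \<psi> z)" using rep[OF h(1)] by blast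
  obtain F1 where F1: "L2_fun lborel F1" "\<And>z. z \<notin> ?U \<Longrightarrow> F1 z = 0" "AE z in lebesgue_on ?U. F1 z = hx z"
    "\<And>\<psi>. test_function UNIV \<psi> \<Longrightarrow> (LINT z|lborel. F1 z * \<psi> z) = (LINT z|lebesgue_on ?U. hx z * \<psi> z)" using rep[OF h(2)] by blast
  obtain F2 where F2: "L2_fun lborel F2" "\<And>z. z \<notin> ?U \<Longrightarrow> F2 z = 0" "AE z in lebesgue_on ?U. F2 z = hy z"
    "\<And>\<psi>. test_function UNIV \<psi> \<Longrightarrow> (LINT z|lborel. F2 z * \<psi> z) = (LINT z|lebesgue_on ?U. hy z * \<psi> z)" using rep[OF h(3)] by blast
  have tU: "L2_fun (lebesgue_on ?U) \<psi>" if "test_function UNIV \<psi>" for \<psi> using test_L2[OF that Omega_sets(1)] .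
  have "W0 ?U f F1 F2"
  proof (rule W0_from_plane[OF Omega_open Omega_bounded f(1) F1(1) F2(1) f(2) F1(2) F2(2) _ _ Omega_shrink])
    fix \<psi> :: "plane \<Rightarrow> real" assume t: "test_function UNIV \<psi>"
    show "(LINT z|lborel. f z * dx \<psi> z) = - (LINT z|lborel. F1 z * \<psi> z)"
      using w1[OF t] L2_mult_integrable[OF h(1) tU[OF test_pderiv[OF t]]] L2_mult_integrable[OF h(2) tU[OF t]]
      by (simp add: f(4)[OF test_pderiv[OF t]] F1(4)[OF t])
    show "(LINT z|lborel. f z * dy \<psi> z) = - (LINT z|lborel. F2 z * \<psi> z)"
      using w2[OF t] L2_mult_integrable[OF h(1) tU[OF test_pderiv[OF t]]] L2_mult_integrable[OF h(3) tU[OF t]]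
      by (simp add: f(4)[OF test_pderiv[OF t]] F2(4)[OF t])
  qed
  then show ?thesis by (rule W0_cong_AE[OF _ Omega_sets(1) f(3) F1(3) F2(3)])
qed

end

context domain_eps begin

subsection \<open>Functions on the octagon with zero trace\<close>

text \<open>Cut along horizontal lines, the octagon consists of a trapezoid, a rectangle and a trapezoid, numbered 0, 1, 2
  from below; \<open>oct_a i\<close> is the lower end of piece \<open>i\<close>, and \<open>oct_w i t\<close> its half width at height \<open>t\<close>.\<close>

definition oct_w :: "nat \<Rightarrow> real \<Rightarrow> real" where
  "oct_w i t = (if i = 0 then 2 - \<epsilon> + t else if i = 1 then 1 else 2 - \<epsilon> - t)"

definition oct_a :: "nat \<Rightarrow> real" where
  "oct_a i = (if i = 0 then -1 else if i = 1 then - (1 - \<epsilon>) else 1 - \<epsilon>)"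

lemma oct_strip: "z \<in> strip (\<lambda>t. - oct_w i t) (oct_w i) (oct_a i) (if i = 2 then 1 else oct_a (Suc i)) \<longleftrightarrow>
   oct_a i < snd z \<and> snd z < (if i = 2 then 1 else oct_a (Suc i)) \<and> \<bar>fst z\<bar> < oct_w i (snd z)"
  by (auto simp: strip_def)

lemma abs_sum_max: "max \<bar>x + y\<bar> \<bar>x - y\<bar> = \<bar>x\<bar> + \<bar>y :: real\<bar>"
  by (simp add: max_def abs_if)

lemma abs_sum_iff: "\<bar>x + y\<bar> < c \<and> \<bar>x - y\<bar> < c \<longleftrightarrow> \<bar>x\<bar> + \<bar>y\<bar> < (c :: real)"
  and abs_sum_le_iff: "\<bar>x + y\<bar> \<le> c \<and> \<bar>x - y\<bar> \<le> c \<longleftrightarrow> \<bar>x\<bar> + \<bar>y\<bar> \<le> (c :: real)"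
  unfolding abs_sum_max[symmetric] by simp_all

lemma Omega_iff_abs: "z \<in> Omega \<epsilon> \<longleftrightarrow> \<bar>fst z\<bar> < 1 \<and> \<bar>snd z\<bar> < 1 \<and> \<bar>fst z\<bar> + \<bar>snd z\<bar> < 2 - \<epsilon>"
  unfolding Omega_iff abs_sum_iff[symmetric] ..

lemma frontier_OmegaI_abs:
  assumes "\<bar>x\<bar> \<le> 1" "\<bar>y\<bar> \<le> 1" "\<bar>x\<bar> + \<bar>y\<bar> \<le> 2 - \<epsilon>" "\<bar>x\<bar> = 1 \<or> \<bar>y\<bar> = 1 \<or> \<bar>x\<bar> + \<bar>y\<bar> = 2 - \<epsilon>"
  shows "(x, y) \<in> frontier (Omega \<epsilon>)"
proof (rule frontier_OmegaI[OF assms(1,2)])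
  show 1: "\<bar>x + y\<bar> \<le> 2 - \<epsilon>" "\<bar>x - y\<bar> \<le> 2 - \<epsilon>" using assms(3) abs_sum_le_iff by blast+
  have "\<bar>x\<bar> + \<bar>y\<bar> = \<bar>x + y\<bar> \<or> \<bar>x\<bar> + \<bar>y\<bar> = \<bar>x - y\<bar>" unfolding abs_sum_max[symmetric] max_def by simp
  then show "\<bar>x\<bar> = 1 \<or> \<bar>y\<bar> = 1 \<or> \<bar>x + y\<bar> = 2 - \<epsilon> \<or> \<bar>x - y\<bar> = 2 - \<epsilon>" using assms(4) by metis
qed

lemma oct_pieces:
  assumes "snd z \<noteq> - (1 - \<epsilon>)" "snd z \<noteq> 1 - \<epsilon>"
  shows "indicator (Omega \<epsilon>) z = (\<Sum>i\<in>{0,1,2}. indicator (strip (\<lambda>t. - oct_w i t) (oct_w i) (oct_a i) (if i = 2 then 1 else oct_a (Suc i))) z :: real)"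
proof -
  obtain x y where z: "z = (x, y)" by (cases z)
  define u where "u = \<bar>x\<bar>"
  let ?E = "\<lambda>i. strip (\<lambda>t. - oct_w i t) (oct_w i) (oct_a i) (if i = 2 then 1 else oct_a (Suc i))"
  have O: "z \<in> Omega \<epsilon> \<longleftrightarrow> u < 1 \<and> \<bar>y\<bar> < 1 \<and> u + \<bar>y\<bar> < 2 - \<epsilon>" by (simp add: Omega_iff_abs z u_def)
  have E: "z \<in> ?E 0 \<longleftrightarrow> -1 < y \<and> y < - (1 - \<epsilon>) \<and> u < 2 - \<epsilon> + y"
    "z \<in> ?E 1 \<longleftrightarrow> - (1 - \<epsilon>) < y \<and> y < 1 - \<epsilon> \<and> u < 1"
    "z \<in> ?E 2 \<longleftrightarrow> 1 - \<epsilon> < y \<and> y < 1 \<and> u < 2 - \<epsilon> - y"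
    unfolding oct_strip by (simp_all add: oct_w_def oct_a_def z u_def)
  have s: "(\<Sum>i\<in>{0,1,2}. indicator (?E i) z :: real) = indicator (?E 0) z + indicator (?E 1) z + indicator (?E 2) z"
    by simp
  consider "y < - (1 - \<epsilon>)" | "- (1 - \<epsilon>) < y" "y < 1 - \<epsilon>" | "1 - \<epsilon> < y" using assms unfolding z snd_conv by linarith
  then show ?thesis
  proof cases
    case 1
    then have "z \<in> Omega \<epsilon> \<longleftrightarrow> z \<in> ?E 0" "z \<notin> ?E 1" "z \<notin> ?E 2" unfolding O E using eps by linarith+
    then show ?thesis unfolding s indicator_def by simp
  next
    case 2
    then have "z \<in> Omega \<epsilon> \<longleftrightarrow> z \<in> ?E 1" "z \<notin> ?E 0" "z \<notin> ?E 2" unfolding O E using eps by linarith+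
    then show ?thesis unfolding s indicator_def by simp
  next
    case 3
    then have "z \<in> Omega \<epsilon> \<longleftrightarrow> z \<in> ?E 2" "z \<notin> ?E 0" "z \<notin> ?E 1" unfolding O E using eps by linarith+
    then show ?thesis unfolding s indicator_def by simp
  qed
qed

lemma oct_sub:
  assumes "i \<in> {0,1,2}"
  shows "strip (\<lambda>t. - oct_w i t) (oct_w i) (oct_a i) (if i = 2 then 1 else oct_a (Suc i)) \<subseteq> Omega \<epsilon>"
proof
  fix z assume z: "z \<in> strip (\<lambda>t. - oct_w i t) (oct_w i) (oct_a i) (if i = 2 then 1 else oct_a (Suc i))"
  define u where "u = \<bar>fst z\<bar>"
  consider "i = 0" | "i = 1" | "i = 2" using assms by blast
  then have "u < 1 \<and> \<bar>snd z\<bar> < 1 \<and> u + \<bar>snd z\<bar> < 2 - \<epsilon>"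
  proof cases
    case 1
    then have "-1 < snd z" "snd z < - (1 - \<epsilon>)" "u < 2 - \<epsilon> + snd z"
      using z[unfolded oct_strip] by (simp_all add: oct_w_def oct_a_def u_def)
    moreover from this(2) have "\<bar>snd z\<bar> = - snd z" using eps by (intro abs_of_neg) linarith
    ultimately show ?thesis using eps by linarith
  next
    case 2
    then have "- (1 - \<epsilon>) < snd z" "snd z < 1 - \<epsilon>" "u < 1"
      using z[unfolded oct_strip] by (simp_all add: oct_w_def oct_a_def u_def)
    moreover from this have "\<bar>snd z\<bar> < 1 - \<epsilon>" unfolding abs_less_iff by linarith
    ultimately show ?thesis using eps by linarith
  next
    case 3
    then have "1 - \<epsilon> < snd z" "snd z < 1" "u < 2 - \<epsilon> - snd z"
      using z[unfolded oct_strip] by (simp_all add: oct_w_def oct_a_def u_def)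
    moreover from this(1) have "\<bar>snd z\<bar> = snd z" using eps by (intro abs_of_pos) linarith
    ultimately show ?thesis using eps by linarith
  qed
  then show "z \<in> Omega \<epsilon>" by (simp add: Omega_iff_abs u_def)
qed

lemma oct_cont: "continuous_on UNIV (oct_w i)" "continuous_on UNIV (\<lambda>t. - oct_w i t)"
  unfolding oct_w_def by (cases "i = 0"; cases "i = 1"; auto intro!: continuous_intros)+

lemma oct_edge:
  assumes "i \<in> {0, 1, 2}" "oct_a i \<le> t" "t \<le> (if i = 2 then 1 else oct_a (Suc i))" "\<sigma> = 1 \<or> \<sigma> = -1"
  shows "(\<sigma> * oct_w i t, t) \<in> frontier (Omega \<epsilon>)" (is ?A) "(t, \<sigma> * oct_w i t) \<in> frontier (Omega \<epsilon>)"
proof -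
  have s: "\<bar>\<sigma> * oct_w i t\<bar> = \<bar>oct_w i t\<bar>" using assms(4) by auto
  consider "i = 0" | "i = 1" | "i = 2" using assms(1) by blast
  then have "\<bar>oct_w i t\<bar> \<le> 1 \<and> \<bar>t\<bar> \<le> 1 \<and> \<bar>oct_w i t\<bar> + \<bar>t\<bar> \<le> 2 - \<epsilon> \<and> (\<bar>oct_w i t\<bar> = 1 \<or> \<bar>oct_w i t\<bar> + \<bar>t\<bar> = 2 - \<epsilon>)"
  proof cases
    case 1
    then have "oct_w i t = 2 - \<epsilon> + t" "-1 \<le> t" "t \<le> - (1 - \<epsilon>)" using assms by (simp_all add: oct_w_def oct_a_def)
    then have "\<bar>oct_w i t\<bar> = 2 - \<epsilon> + t" "\<bar>t\<bar> = - t" "-1 \<le> t" "t \<le> - (1 - \<epsilon>)"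
      using eps by (auto intro!: abs_of_nonneg abs_of_nonpos)
    then show ?thesis by auto
  next
    case 2
    then have "oct_w i t = 1" "- (1 - \<epsilon>) \<le> t" "t \<le> 1 - \<epsilon>" using assms by (simp_all add: oct_w_def oct_a_def)
    moreover from this have "\<bar>t\<bar> \<le> 1 - \<epsilon>" unfolding abs_le_iff by linarith
    ultimately show ?thesis using eps by auto
  next
    case 3
    then have "oct_w i t = 2 - \<epsilon> - t" "t \<le> 1" "1 - \<epsilon> \<le> t" using assms by (simp_all add: oct_w_def oct_a_def)
    then have "\<bar>oct_w i t\<bar> = 2 - \<epsilon> - t" "\<bar>t\<bar> = t" "t \<le> 1" "1 - \<epsilon> \<le> t"
      using eps by (auto intro!: abs_of_nonneg)
    then show ?thesis by auto
  qed
  then show ?A "(t, \<sigma> * oct_w i t) \<in> frontier (Omega \<epsilon>)"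
    using frontier_OmegaI_abs[of "\<sigma> * oct_w i t" t] frontier_OmegaI_abs[of t "\<sigma> * oct_w i t"]
    unfolding s by (simp_all add: add.commute disj_commute) blast+
qed

lemma oct_zero_trace_integral:
  assumes T: "mpl T S" and TO: "T ` Omega \<epsilon> = Omega \<epsilon>"
    and t: "test_function UNIV \<psi>" and hL: "L2_fun MO h" "L2_fun MO hx" "L2_fun MO hy"
    and z: "\<And>i \<sigma>. i \<in> {0,1,2} \<Longrightarrow> \<sigma> = 1 \<or> \<sigma> = -1 \<Longrightarrow> zero_trace (Omega \<epsilon>) h hx hy T (\<lambda>t. \<sigma> * oct_w i t) (oct_a i) (if i = 2 then 1 else oct_a (Suc i))"
  shows "(LINT z|MO. h z * pderiv_dir (T (1, 0)) \<psi> z + (fst (T (1, 0)) * hx z + snd (T (1, 0)) * hy z) * \<psi> z) = 0"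
proof -
  let ?b = "\<lambda>i::nat. if i = 2 then 1 else oct_a (Suc i)"
  let ?E = "\<lambda>i. strip (\<lambda>t. - oct_w i t) (oct_w i) (oct_a i) (?b i)"
  let ?X = "\<lambda>z. h z * pderiv_dir (T (1, 0)) \<psi> z + (fst (T (1, 0)) * hx z + snd (T (1, 0)) * hy z) * \<psi> z"
  have E: "?E i \<in> sets lebesgue" for i using strip_lmeasurable[OF oct_cont(2,1)] by blast
  note sub = oct_sub
  have TE: "T ` ?E i \<subseteq> Omega \<epsilon>" if "i \<in> {0,1,2}" for i using sub[OF that] TO by blast
  have X: "integrable MO ?X"
    using L2_mult_integrable[OF hL(1) test_L2[OF test_pderiv[OF t] Omega_sets(1)]]
      L2_mult_integrable[OF L2_add[OF L2_cmult[OF hL(2)] L2_cmult[OF hL(3)]] test_L2[OF t Omega_sets(1)]]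
    by (intro Bochner_Integration.integrable_add)
  have zero: "(LINT z|lebesgue_on (T ` ?E i). ?X z) = 0" if i: "i \<in> {0,1,2}" for i
  proof (rule strip_zero_mapped[OF T Omega_sets(1) TE[OF i] oct_cont(2,1) _ _ t])
    show "zero_trace (Omega \<epsilon>) h hx hy T (oct_w i) (oct_a i) (?b i)" using z[OF i, of 1] by simp
    show "zero_trace (Omega \<epsilon>) h hx hy T (\<lambda>t. - oct_w i t) (oct_a i) (?b i) \<or> (\<forall>t. oct_a i < t \<longrightarrow> t < ?b i \<longrightarrow> \<psi> (T (- oct_w i t, t)) = 0)"
      using z[OF i, of "-1"] by simp
    show "oct_a i < ?b i" using i eps by (auto simp: oct_a_def)
    show "- oct_w i t < oct_w i t" if "oct_a i < t" "t < ?b i" for t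
      using i that eps by (auto simp: oct_a_def oct_w_def split: if_splits)
  qed
  have ae: "AE z in lebesgue. indicator (Omega \<epsilon>) z = (\<Sum>i\<in>{0,1,2}. indicator (?E i) z :: real)"
  proof -
    have "AE z in lebesgue. 0 * fst z + 1 * snd z \<noteq> - (1 - \<epsilon>)" "AE z in lebesgue. 0 * fst z + 1 * snd z \<noteq> 1 - \<epsilon>"
      by (rule AE_not_on_line, simp)+
    then show ?thesis by eventually_elim (rule oct_pieces, auto)
  qed
  have XT: "integrable (lebesgue_on (?E i)) (\<lambda>w. ?X (T w))" if "i \<in> {0,1,2}" for i
    using integrable_subset[OF X Omega_sets(1) mpl_image_sets[OF T E] TE[OF that]] mpl_integrable[OF T E, of i ?X] by simp
  have "(LINT z|MO. ?X z) = (LINT w|MO. ?X (T w))"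
    using mpl_integral[OF T Omega_sets(1), of ?X] TO by simp
  also have "\<dots> = (\<Sum>i\<in>{0,1,2}. LINT w|lebesgue_on (?E i). ?X (T w))"
    by (rule integral_pieces(2)[where I="{0,1,2}" and E="?E", OF Omega_sets(1) _ _ ae XT]) (use E in auto)
  also have "\<dots> = (\<Sum>i\<in>{0,1,2}. LINT z|lebesgue_on (T ` ?E i). ?X z)"
    by (intro sum.cong refl mpl_integral[OF T E, symmetric])
  also have "\<dots> = 0" using zero by (intro sum.neutral) blast
  finally show ?thesis .
qed

text \<open>Each oblique or vertical edge bounds one of the three pieces, so horizontal lines give the weak derivative in \<open>x\<close>
  of the extension by zero; the symmetry of the octagon under the exchange of coordinates gives the one in \<open>y\<close>.\<close>

lemma trace_zero_W0:
  assumes tr: "trace_on (Omega \<epsilon>) (frontier (Omega \<epsilon>)) u g" and G: "smooth G" "\<And>z. z \<in> frontier (Omega \<epsilon>) \<Longrightarrow> G z = g z"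
  shows "W0 (Omega \<epsilon>) (\<lambda>z. u z - G z) (\<lambda>z. weak_deriv (Omega \<epsilon>) (1, 0) u z - dx G z) (\<lambda>z. weak_deriv (Omega \<epsilon>) (0, 1) u z - dy G z)"
proof -
  let ?h = "\<lambda>z. u z - G z" and ?hx = "\<lambda>z. weak_deriv (Omega \<epsilon>) (1, 0) u z - dx G z" and ?hy = "\<lambda>z. weak_deriv (Omega \<epsilon>) (0, 1) u z - dy G z"
  have zt: "zero_trace (Omega \<epsilon>) ?h ?hx ?hy T (\<lambda>t. \<sigma> * oct_w i t) (oct_a i) (if i = 2 then 1 else oct_a (Suc i))"
    if T: "T = (\<lambda>z. z) \<or> T = (\<lambda>z. (snd z, fst z))" and i: "i \<in> {0,1,2}" and s: "\<sigma> = 1 \<or> \<sigma> = -1" for T i \<sigma>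
  proof -
    obtain S where S: "mpl T S" using T mpl_id mpl_swap by blast
    show ?thesis
    proof (rule zero_trace_from_trace_on[OF S Omega_sets(1) Omega_bounded tr G])
      show "oct_a i < (if i = 2 then 1 else oct_a (Suc i))" using i eps by (auto simp: oct_a_def)
      show "\<sigma> * oct_w i t = \<sigma> * (if i = 1 then 1 else 2 - \<epsilon>) + (if i = 0 then \<sigma> else if i = 1 then 0 else - \<sigma>) * t" for t
        by (auto simp: oct_w_def algebra_simps)
      show "T (\<sigma> * oct_w i t, t) \<in> frontier (Omega \<epsilon>)" if "oct_a i \<le> t" "t \<le> (if i = 2 then 1 else oct_a (Suc i))" for t
        using T oct_edge[OF i that s] by auto
    qed
  qed
  have "zero_trace (Omega \<epsilon>) ?h ?hx ?hy (\<lambda>z. z) (\<lambda>t. 1 * oct_w 1 t) (oct_a 1) (if (1::nat) = 2 then 1 else oct_a (Suc 1))"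
    by (rule zt) auto
  then have L: "L2_fun MO ?h" "L2_fun MO ?hx" "L2_fun MO ?hy"
    unfolding zero_trace_def using L2_tendsto_D(2) by blast+
  show ?thesis
  proof (rule W0_Omega[OF L])
    fix \<psi> :: "plane \<Rightarrow> real" assume t: "test_function UNIV \<psi>"
    have "(LINT z|MO. ?h z * pderiv_dir (1, 0) \<psi> z + (fst (1::real, 0::real) * ?hx z + snd (1::real, 0::real) * ?hy z) * \<psi> z) = 0"
      by (rule oct_zero_trace_integral[OF mpl_id _ t L]) (use zt in auto)
    then show "(LINT z|MO. ?h z * dx \<psi> z + ?hx z * \<psi> z) = 0" by simp
    have sw: "(\<lambda>z. (snd z, fst z)) ` Omega \<epsilon> = Omega \<epsilon>"
      unfolding mpl_image[OF mpl_swap] by (auto simp: Omega_iff add.commute abs_minus_commute)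
    have "(LINT z|MO. ?h z * pderiv_dir (snd (1::real, 0::real), fst (1::real, 0::real)) \<psi> z
        + (fst (snd (1::real, 0::real), fst (1::real, 0::real)) * ?hx z + snd (snd (1::real, 0::real), fst (1::real, 0::real)) * ?hy z) * \<psi> z) = 0"
      by (rule oct_zero_trace_integral[OF mpl_swap sw t L]) (use zt in auto)
    then show "(LINT z|MO. ?h z * dy \<psi> z + ?hy z * \<psi> z) = 0" by simp
  qed
qed

end

section \<open>The dihedral group acting on the octagon\<close>

text \<open>The parameter \<open>(a, b, s)\<close> with signs \<open>a\<close>, \<open>b\<close> stands for the isometry that swaps the coordinates if \<open>s\<close>
  holds and then multiplies them by \<open>a\<close> and \<open>b\<close>.\<close>

definition act :: "real \<times> real \<times> bool \<Rightarrow> plane \<Rightarrow> plane" where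
  "act g z = (case g of (a, b, s) \<Rightarrow> if s then (a * snd z, b * fst z) else (a * fst z, b * snd z))"

definition iact :: "real \<times> real \<times> bool \<Rightarrow> plane \<Rightarrow> plane" where
  "iact g z = (case g of (a, b, s) \<Rightarrow> if s then (b * snd z, a * fst z) else (a * fst z, b * snd z))"

definition D4 :: "(real \<times> real \<times> bool) set" where
  "D4 = {1, -1} \<times> {1, -1} \<times> UNIV"

lemma D4_cases:
  assumes "g \<in> D4"
  obtains a b s where "g = (a, b, s)" "a = 1 \<or> a = -1" "b = 1 \<or> b = -1" "a * a = 1" "b * b = 1"
proof -
  obtain a b s where g: "g = (a, b, s)" by (cases g)
  have "a = 1 \<or> a = -1" "b = 1 \<or> b = -1" using assms unfolding D4_def g by simp_all
  moreover from this have "a * a = 1" "b * b = 1" by auto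
  ultimately show ?thesis using that[OF g] by blast
qed

lemma D4_sum: "(\<Sum>g\<in>D4. f g) = f (1,1,False) + f (1,-1,False) + f (-1,1,False) + f (-1,-1,False)
    + f (1,1,True) + f (1,-1,True) + f (-1,1,True) + f (-1,-1,True :: bool)" for f :: "_ \<Rightarrow> real"
proof -
  have "sum f D4 = (\<Sum>a\<in>{1, -1::real}. \<Sum>b\<in>{1, -1::real}. \<Sum>s\<in>UNIV. f (a, b, s))"
    unfolding D4_def sum.cartesian_product by (rule sum.cong) auto
  also have "\<dots> = (f (1,1,False) + f (1,1,True)) + (f (1,-1,False) + f (1,-1,True))
      + ((f (-1,1,False) + f (-1,1,True)) + (f (-1,-1,False) + f (-1,-1,True)))"
    by (simp add: UNIV_bool)
  finally show ?thesis by simp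
qed

lemma D4_finite [simp]: "finite D4" by (simp add: D4_def)

lemma mpl_shear: "mpl (\<lambda>z. (fst z + snd z, snd z)) (\<lambda>z. (fst z - snd z, snd z))"
proof (rule mpl_from_slices[where p="\<lambda>y. y"])
  show "\<exists>c t. \<bar>c\<bar> = 1 \<and> (\<forall>x. (fst (x, y) + snd (x, y), snd (x, y)) = (t + c * x, y))" for y :: real
    by (rule exI[of _ 1], rule exI[of _ y]) auto
qed (auto intro!: bounded_linear_Pair bounded_linear_add bounded_linear_sub bounded_linear_fst bounded_linear_snd)

lemma mpl_flip:
  assumes a: "a = 1 \<or> a = -1" and b: "b = 1 \<or> b = -1"
  shows "mpl (\<lambda>z. (a * fst z, b * snd z)) (\<lambda>z. (a * fst z, b * snd z))"
proof (rule mpl_from_slices[where p="\<lambda>y. b * y"])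
  show "\<exists>c t. \<bar>c\<bar> = 1 \<and> (\<forall>x. (a * fst (x, y), b * snd (x, y)) = (t + c * x, b * y))" for y :: real
    by (rule exI[of _ a], rule exI[of _ 0]) (use a in auto)
  show "(\<lambda>y. b * y) = (\<lambda>y. y) \<or> (\<lambda>y. b * y) = (\<lambda>y. - y)" using b by auto
  show "(a * fst (a * fst z, b * snd z), b * snd (a * fst z, b * snd z)) = z" for z :: plane
    using a b by (cases z) auto
  then show "(a * fst (a * fst z, b * snd z), b * snd (a * fst z, b * snd z)) = z" for z :: plane .
qed (intro bounded_linear_Pair bounded_linear_const_mult bounded_linear_fst bounded_linear_snd)+

lemma mpl_act:
  assumes "g \<in> D4"
  shows "mpl (act g) (iact g)"
proof -
  obtain a b s where g: "g = (a, b, s)" "a = 1 \<or> a = -1" "b = 1 \<or> b = -1" using D4_cases[OF assms] .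
  show ?thesis
  proof (cases s)
    case True
    have "act g = (\<lambda>z. (a * fst (snd z, fst z), b * snd (snd z, fst z)))"
      "iact g = (\<lambda>z. (snd (a * fst z, b * snd z), fst (a * fst z, b * snd z)))"
      by (simp_all add: fun_eq_iff act_def iact_def g True)
    then show ?thesis using mpl_comp[OF mpl_flip[OF g(2,3)] mpl_swap] by simp
  next
    case False
    have "act g = (\<lambda>z. (a * fst z, b * snd z))" "iact g = (\<lambda>z. (a * fst z, b * snd z))"
      by (simp_all add: fun_eq_iff act_def iact_def g False)
    then show ?thesis using mpl_flip[OF g(2,3)] by simp
  qed
qed

text \<open>Coordinates in which the lines \<open>s \<mapsto> diag (s, t)\<close> run parallel to the diagonal and \<open>t\<close> is the abscissa where the line meets the bottom edge.\<close>

definition diag :: "plane \<Rightarrow> plane" where "diag z = (fst z + snd z, fst z)"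

lemma mpl_diag: "mpl diag (\<lambda>z. (snd z, fst z - snd z))"
  using mpl_comp[OF mpl_shear mpl_swap] by (simp add: diag_def[abs_def] add.commute)

context domain_eps
begin

lemma D4_pieces:
  assumes "fst z \<noteq> 0" "snd z \<noteq> 0" "fst z + snd z \<noteq> 0" "fst z - snd z \<noteq> 0"
  shows "indicator (Omega \<epsilon>) z = (\<Sum>g\<in>D4. indicator (act g ` Omega_q \<epsilon>) z :: real)"
proof -
  obtain x y where z: "z = (x, y)" by (cases z)
  have i: "indicator (act g ` Omega_q \<epsilon>) z = (if iact g z \<in> Omega_q \<epsilon> then 1 else 0 :: real)" if "g \<in> D4" for g
    using mpl_image[OF mpl_act[OF that]] by (simp add: indicator_def)
  have d: "(1, 1, s) \<in> D4" "(1, -1, s) \<in> D4" "(-1, 1, s) \<in> D4" "(-1, -1, s) \<in> D4" for s by (auto simp: D4_def)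
  have O: "indicator (Omega \<epsilon>) z = (if \<bar>x\<bar> < 1 \<and> \<bar>y\<bar> < 1 \<and> \<bar>x\<bar> + \<bar>y\<bar> < 2 - \<epsilon> then 1 else 0 :: real)"
    by (simp add: indicator_def Omega_iff_abs z)
  consider "0 < x" "0 < y" | "0 < x" "y < 0" | "x < 0" "0 < y" | "x < 0" "y < 0"
    using assms z by fastforce
  then show ?thesis
    unfolding D4_sum i[OF d(1)] i[OF d(2)] i[OF d(3)] i[OF d(4)] O
    by cases (use assms in \<open>auto simp: iact_def z Omega_q_iff\<close>)
qed

lemma D4_pieces_AE: "AE z in lebesgue. indicator (Omega \<epsilon>) z = (\<Sum>g\<in>D4. indicator (act g ` Omega_q \<epsilon>) z :: real)"
proof -
  have "AE z in lebesgue. 1 * fst z + 0 * snd z \<noteq> (0::real)" by (rule AE_not_on_line) simp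
  moreover have "AE z in lebesgue. 0 * fst z + 1 * snd z \<noteq> (0::real)" by (rule AE_not_on_line) simp
  moreover have "AE z in lebesgue. 1 * fst z + 1 * snd z \<noteq> (0::real)" by (rule AE_not_on_line) simp
  moreover have "AE z in lebesgue. 1 * fst z + (-1) * snd z \<noteq> (0::real)" by (rule AE_not_on_line) simp
  ultimately show ?thesis by eventually_elim (rule D4_pieces, auto)
qed

lemma unfold_integral:
  fixes X :: "plane \<Rightarrow> real"
  assumes "\<And>g. g \<in> D4 \<Longrightarrow> integrable MQ (\<lambda>z. X (act g z))"
  shows "integrable MO X"
    "(LINT z|MO. X z) = (\<Sum>g\<in>D4. LINT z|MQ. X (act g z))" (is ?A)
proof -
  have E: "act g ` Omega_q \<epsilon> \<in> sets lebesgue" if "g \<in> D4" for g by (rule mpl_image_sets[OF mpl_act[OF that] Omega_sets(2)])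
  have X: "integrable (lebesgue_on (act g ` Omega_q \<epsilon>)) X" if "g \<in> D4" for g
    using assms[OF that] mpl_integrable[OF mpl_act[OF that] Omega_sets(2), of X] by simp
  note P = integral_pieces[where I=D4 and E="\<lambda>g. act g ` Omega_q \<epsilon>", OF Omega_sets(1) D4_finite E D4_pieces_AE X]
  show "integrable MO X" by (rule P(1))
  have "(LINT z|MO. X z) = (\<Sum>g\<in>D4. LINT z|lebesgue_on (act g ` Omega_q \<epsilon>). X z)" by (rule P(2))
  also have "\<dots> = (\<Sum>g\<in>D4. LINT z|MQ. X (act g z))"
    by (rule sum.cong[OF refl]) (rule mpl_integral[OF mpl_act Omega_sets(2)])
  finally show ?A .
qed

lemma unfold_L2:
  assumes "\<And>g. g \<in> D4 \<Longrightarrow> L2_fun MQ (\<lambda>z. X (act g z))"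
  shows "L2_fun MO X"
proof -
  interpret finite_measure "MQ" by (rule finite_measure_lebesgue_on[OF Omega_lmeasurable(2)])
  have "integrable MO X" by (rule unfold_integral(1)) (use L2_integrable assms in blast)
  moreover have "integrable MO (\<lambda>z. (X z)\<^sup>2)"
    by (rule unfold_integral(1)) (use assms in \<open>simp add: L2_fun_def\<close>)
  ultimately show ?thesis by (simp add: L2_fun_def)
qed

text \<open>The images of the fundamental domain miss only points on the axes and on the diagonals.\<close>

lemma AE_unfold:
  assumes "\<And>z g. z \<in> Omega_q \<epsilon> \<Longrightarrow> g \<in> D4 \<Longrightarrow> P (act g z)"
  shows "AE z in MO. P z"
proof -
  have "AE z in lebesgue. z \<in> Omega \<epsilon> \<longrightarrow> P z"
    using D4_pieces_AE
  proof eventually_elim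
    case (elim z)
    show ?case
    proof
      assume "z \<in> Omega \<epsilon>"
      then have "(\<Sum>g\<in>D4. indicator (act g ` Omega_q \<epsilon>) z :: real) \<noteq> 0" using elim by simp
      then obtain g where "g \<in> D4" "indicator (act g ` Omega_q \<epsilon>) z \<noteq> (0::real)" by (meson sum.neutral)
      then obtain w where "w \<in> Omega_q \<epsilon>" "z = act g w" by (fastforce simp: indicator_def split: if_splits)
      then show "P z" using assms \<open>g \<in> D4\<close> by blast
    qed
  qed
  then show ?thesis using Omega_sets(1) by (simp add: AE_restrict_space_iff)
qed

section \<open>Green's formula on the fundamental domain\<close>

text \<open>The outer boundary seen along horizontal lines (the first two conditions, for the vertical and the oblique edge)
  and along diagonal lines (the last two, for the oblique and the vertical edge).\<close>

definition outer_zero where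
  "outer_zero h hx hy \<longleftrightarrow>
     zero_trace (Omega_q \<epsilon>) h hx hy (\<lambda>z. z) (\<lambda>t. 1) 0 (1 - \<epsilon>) \<and>
     zero_trace (Omega_q \<epsilon>) h hx hy (\<lambda>z. z) (\<lambda>t. 2 - \<epsilon> - t) (1 - \<epsilon>) (1 - \<epsilon> / 2) \<and>
     zero_trace (Omega_q \<epsilon>) h hx hy diag (\<lambda>t. (2 - \<epsilon> - t) / 2) 0 \<epsilon> \<and>
     zero_trace (Omega_q \<epsilon>) h hx hy diag (\<lambda>t. 1 - t) \<epsilon> 1"

definition diag_zero where
  "diag_zero h hx hy \<longleftrightarrow>
     zero_trace (Omega_q \<epsilon>) h hx hy (\<lambda>z. z) (\<lambda>t. t) 0 (1 - \<epsilon>) \<and>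
     zero_trace (Omega_q \<epsilon>) h hx hy (\<lambda>z. z) (\<lambda>t. t) (1 - \<epsilon>) (1 - \<epsilon> / 2)"

definition axis_zero where
  "axis_zero h hx hy \<longleftrightarrow>
     zero_trace (Omega_q \<epsilon>) h hx hy diag (\<lambda>t. 0) 0 \<epsilon> \<and>
     zero_trace (Omega_q \<epsilon>) h hx hy diag (\<lambda>t. 0) \<epsilon> 1"

lemma outer_zero_L2:
  assumes "outer_zero h hx hy"
  shows "L2_fun MQ h" "L2_fun MQ hx" "L2_fun MQ hy"
  using assms L2_tendsto_D(2) unfolding outer_zero_def zero_trace_def by blast+

lemma two_strips:
  assumes T: "mpl T S" and lr: "continuous_on UNIV l" "continuous_on UNIV r1" "continuous_on UNIV r2"
    and X: "integrable MQ (X :: plane \<Rightarrow> real)"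
    and iff: "\<And>s t. t \<noteq> b \<Longrightarrow> T (s, t) \<in> Omega_q \<epsilon> \<longleftrightarrow> (a < t \<and> t < b \<and> l t < s \<and> s < r1 t) \<or> (b < t \<and> t < c \<and> l t < s \<and> s < r2 t)"
    and z: "T ` strip l r1 a b \<subseteq> Omega_q \<epsilon> \<Longrightarrow> (LINT z|lebesgue_on (T ` strip l r1 a b). X z) = 0"
      "T ` strip l r2 b c \<subseteq> Omega_q \<epsilon> \<Longrightarrow> (LINT z|lebesgue_on (T ` strip l r2 b c). X z) = 0"
  shows "(LINT z|MQ. X z) = 0"
proof -
  define E where "E i = (if i then T ` strip l r1 a b else T ` strip l r2 b c)" for i
  have s: "strip l r1 a b \<in> sets lebesgue" "strip l r2 b c \<in> sets lebesgue"
    using strip_lmeasurable lr by blast+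
  have Es: "E i \<in> sets lebesgue" for i unfolding E_def using mpl_image_sets[OF T] s by simp
  have sub: "T ` strip l r1 a b \<subseteq> Omega_q \<epsilon>" "T ` strip l r2 b c \<subseteq> Omega_q \<epsilon>"
    using iff by (force simp: strip_def)+
  have Ei: "E i \<subseteq> Omega_q \<epsilon>" for i using sub by (simp add: E_def)
  have "AE w in lebesgue. 0 * fst w + 1 * snd w \<noteq> b" by (rule AE_not_on_line) simp
  then have "AE w in distr lebesgue lebesgue S. snd w \<noteq> b"
    unfolding mpl_lebesgue(2)[OF mpl_sym[OF T]] by simp
  then have Sb: "AE z in lebesgue. snd (S z) \<noteq> b"
    by (rule AE_distrD[OF mpl_lebesgue(1)[OF mpl_sym[OF T]]])
  have ae: "AE z in lebesgue. indicator (Omega_q \<epsilon>) z = (\<Sum>i\<in>{True, False}. indicator (E i) z :: real)"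
    using Sb
  proof eventually_elim
    case (elim z)
    have Tz: "T (fst (S z), snd (S z)) = z" by (simp add: mplD(2)[OF T])
    have "z \<in> T ` strip l r a' b' \<longleftrightarrow> S z \<in> strip l r a' b'" for l r a' b' by (simp add: mpl_image[OF T])
    then show ?case using iff[OF elim, of "fst (S z)"] unfolding Tz
      by (auto simp: E_def indicator_def strip_def)
  qed
  have "(LINT z|MQ. X z) = (\<Sum>i\<in>{True, False}. LINT z|lebesgue_on (E i). X z)"
    by (rule integral_pieces(2)[where E=E, OF Omega_sets(2) _ Es ae integrable_subset[OF X Omega_sets(2) Es Ei]]) auto
  then show ?thesis using z sub by (simp add: E_def)
qed

lemma green_horizontal:
  assumes o: "outer_zero h hx hy" and t: "test_function UNIV \<psi>"
    and d: "diag_zero h hx hy \<or> (\<forall>t. \<psi> (t, t) = 0)"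
  shows "(LINT z|MQ. h z * dx \<psi> z + hx z * \<psi> z) = 0"
proof -
  note L = outer_zero_L2[OF o]
  let ?X = "\<lambda>z. h z * dx \<psi> z + hx z * \<psi> z"
  have I: "integrable MQ ?X"
    using L2_mult_integrable[OF L(1) test_L2[OF test_pderiv[OF t] Omega_sets(2)]] L2_mult_integrable[OF L(2) test_L2[OF t Omega_sets(2)]] by auto
  have c: "continuous_on UNIV (\<lambda>t::real. t)" "continuous_on UNIV (\<lambda>t::real. 1::real)" "continuous_on UNIV (\<lambda>t::real. 2 - \<epsilon> - t)"
    by (auto intro!: continuous_intros)
  show ?thesis
  proof (rule two_strips[OF mpl_id c I])
    show "(s, t) \<in> Omega_q \<epsilon> \<longleftrightarrow> (0 < t \<and> t < 1 - \<epsilon> \<and> t < s \<and> s < 1) \<or> (1 - \<epsilon> < t \<and> t < 1 - \<epsilon> / 2 \<and> t < s \<and> s < 2 - \<epsilon> - t)"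
      if "t \<noteq> 1 - \<epsilon>" for s t :: real
      using that eps unfolding Omega_q_iff by auto
    assume sub: "(\<lambda>z. z) ` strip (\<lambda>t. t) (\<lambda>t. 1) 0 (1 - \<epsilon>) \<subseteq> Omega_q \<epsilon>"
    have "(LINT z|lebesgue_on ((\<lambda>z. z) ` strip (\<lambda>t. t) (\<lambda>t. 1) 0 (1 - \<epsilon>)). h z * pderiv_dir (1, 0) \<psi> z + (fst (1::real, 0::real) * hx z + snd (1::real, 0::real) * hy z) * \<psi> z) = 0"
      by (rule strip_zero_mapped[OF mpl_id Omega_sets(2) sub c(1,2) _ _ t])
        (use o d eps in \<open>auto simp: outer_zero_def diag_zero_def\<close>)
    then show "(LINT z|lebesgue_on ((\<lambda>z. z) ` strip (\<lambda>t. t) (\<lambda>t. 1) 0 (1 - \<epsilon>)). ?X z) = 0" by simp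
  next
    assume sub: "(\<lambda>z. z) ` strip (\<lambda>t. t) (\<lambda>t. 2 - \<epsilon> - t) (1 - \<epsilon>) (1 - \<epsilon> / 2) \<subseteq> Omega_q \<epsilon>"
    have "(LINT z|lebesgue_on ((\<lambda>z. z) ` strip (\<lambda>t. t) (\<lambda>t. 2 - \<epsilon> - t) (1 - \<epsilon>) (1 - \<epsilon> / 2)). h z * pderiv_dir (1, 0) \<psi> z + (fst (1::real, 0::real) * hx z + snd (1::real, 0::real) * hy z) * \<psi> z) = 0"
      by (rule strip_zero_mapped[OF mpl_id Omega_sets(2) sub c(1,3) _ _ t])
        (use o d eps in \<open>auto simp: outer_zero_def diag_zero_def\<close>)
    then show "(LINT z|lebesgue_on ((\<lambda>z. z) ` strip (\<lambda>t. t) (\<lambda>t. 2 - \<epsilon> - t) (1 - \<epsilon>) (1 - \<epsilon> / 2)). ?X z) = 0" by simp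
  qed
qed

lemma green_diagonal:
  assumes o: "outer_zero h hx hy" and t: "test_function UNIV \<psi>"
    and d: "axis_zero h hx hy \<or> (\<forall>t. \<psi> (t, 0) = 0)"
  shows "(LINT z|MQ. h z * pderiv_dir (1, 1) \<psi> z + (hx z + hy z) * \<psi> z) = 0"
proof -
  note L = outer_zero_L2[OF o]
  let ?X = "\<lambda>z. h z * pderiv_dir (1, 1) \<psi> z + (hx z + hy z) * \<psi> z"
  have I: "integrable MQ ?X"
    using L2_mult_integrable[OF L(1) test_L2[OF test_pderiv[OF t] Omega_sets(2)]] L2_mult_integrable[OF L2_add[OF L(2,3)] test_L2[OF t Omega_sets(2)]] by auto
  have c: "continuous_on UNIV (\<lambda>t::real. 0::real)" "continuous_on UNIV (\<lambda>t::real. (2 - \<epsilon> - t) / 2)" "continuous_on UNIV (\<lambda>t::real. 1 - t)"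
    by (auto intro!: continuous_intros)
  have d1: "diag (1, 0) = (1, 1)" by (simp add: diag_def)
  show ?thesis
  proof (rule two_strips[OF mpl_diag c I])
    show "diag (s, t) \<in> Omega_q \<epsilon> \<longleftrightarrow> (0 < t \<and> t < \<epsilon> \<and> 0 < s \<and> s < (2 - \<epsilon> - t) / 2) \<or> (\<epsilon> < t \<and> t < 1 \<and> 0 < s \<and> s < 1 - t)"
      if "t \<noteq> \<epsilon>" for s t :: real
      using that eps unfolding Omega_q_iff by (auto simp: diag_def)
    assume sub: "diag ` strip (\<lambda>t. 0) (\<lambda>t. (2 - \<epsilon> - t) / 2) 0 \<epsilon> \<subseteq> Omega_q \<epsilon>"
    have "(LINT z|lebesgue_on (diag ` strip (\<lambda>t. 0) (\<lambda>t. (2 - \<epsilon> - t) / 2) 0 \<epsilon>). h z * pderiv_dir (diag (1, 0)) \<psi> z + (fst (diag (1, 0)) * hx z + snd (diag (1, 0)) * hy z) * \<psi> z) = 0"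
      by (rule strip_zero_mapped[OF mpl_diag Omega_sets(2) sub c(1,2) _ _ t])
        (use o d eps in \<open>auto simp: outer_zero_def axis_zero_def diag_def\<close>)
    then show "(LINT z|lebesgue_on (diag ` strip (\<lambda>t. 0) (\<lambda>t. (2 - \<epsilon> - t) / 2) 0 \<epsilon>). ?X z) = 0" by (simp add: d1)
  next
    assume sub: "diag ` strip (\<lambda>t. 0) (\<lambda>t. 1 - t) \<epsilon> 1 \<subseteq> Omega_q \<epsilon>"
    have "(LINT z|lebesgue_on (diag ` strip (\<lambda>t. 0) (\<lambda>t. 1 - t) \<epsilon> 1). h z * pderiv_dir (diag (1, 0)) \<psi> z + (fst (diag (1, 0)) * hx z + snd (diag (1, 0)) * hy z) * \<psi> z) = 0"
      by (rule strip_zero_mapped[OF mpl_diag Omega_sets(2) sub c(1,3) _ _ t])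
        (use o d eps in \<open>auto simp: outer_zero_def axis_zero_def diag_def\<close>)
    then show "(LINT z|lebesgue_on (diag ` strip (\<lambda>t. 0) (\<lambda>t. 1 - t) \<epsilon> 1). ?X z) = 0" by (simp add: d1)
  qed
qed

text \<open>The vector field \<open>(\<xi>, \<zeta>)\<close> is split along the diagonal direction and the horizontal one; lines of the
  first kind miss the diagonal edge, lines of the second kind miss the bottom edge.\<close>

lemma green_Omega_q:
  assumes o: "outer_zero h hx hy" and t: "test_function UNIV \<xi>" "test_function UNIV \<zeta>"
    and d: "diag_zero h hx hy \<or> (\<forall>t. \<xi> (t, t) = \<zeta> (t, t))"
    and a: "axis_zero h hx hy \<or> (\<forall>t. \<zeta> (t, 0) = 0)"
  shows "(LINT z|MQ. h z * dx \<xi> z + hx z * \<xi> z + (h z * dy \<zeta> z + hy z * \<zeta> z)) = 0"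
proof -
  note L = outer_zero_L2[OF o] and s = test_smooth[OF t(1)] test_smooth[OF t(2)]
  have T: "L2_fun MQ \<phi>" if "test_function UNIV \<phi>" for \<phi> by (rule test_L2[OF that Omega_sets(2)])
  have td: "test_function UNIV (\<lambda>z. \<xi> z - \<zeta> z)" by (rule test_diff[OF t])
  have dd: "dx (\<lambda>z. \<xi> z - \<zeta> z) z = dx \<xi> z - dx \<zeta> z" for z
    using pderiv_add[OF s(1) smooth_minus[OF s(2)], of "(1,0)" z] pderiv_cmult[OF s(2), of "(1,0)" "-1" z] by simp
  have p: "pderiv_dir (1, 1) \<zeta> z = dx \<zeta> z + dy \<zeta> z" for z
    using pderiv_dir_expand[OF s(2), of "(1, 1)" z] by simp
  have 1: "(LINT z|MQ. h z * pderiv_dir (1, 1) \<zeta> z + (hx z + hy z) * \<zeta> z) = 0"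
    by (rule green_diagonal[OF o t(2) a])
  have 2: "(LINT z|MQ. h z * dx (\<lambda>z. \<xi> z - \<zeta> z) z + hx z * (\<xi> z - \<zeta> z)) = 0"
    by (rule green_horizontal[OF o td]) (use d in auto)
  have "(LINT z|MQ. h z * dx \<xi> z + hx z * \<xi> z + (h z * dy \<zeta> z + hy z * \<zeta> z))
    = (LINT z|MQ. (h z * pderiv_dir (1, 1) \<zeta> z + (hx z + hy z) * \<zeta> z) + (h z * dx (\<lambda>z. \<xi> z - \<zeta> z) z + hx z * (\<xi> z - \<zeta> z)))"
    by (simp add: dd p algebra_simps)
  also have "\<dots> = 0 + 0" unfolding 1[symmetric]
    by (subst Bochner_Integration.integral_add)
      (use L2_mult_integrable[OF L(1) T[OF test_pderiv[OF t(2)]]] L2_mult_integrable[OF L2_add[OF L(2,3)] T[OF t(2)]]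
        L2_mult_integrable[OF L(1) T[OF test_pderiv[OF td]]] L2_mult_integrable[OF L(2) T[OF td]] 1 2 in auto)
  finally show ?thesis by simp
qed

section \<open>Unfolding a function with zero traces\<close>

text \<open>The reflected function \<open>\<rho> g * u\<close> at \<open>g z\<close>: the signs of the coordinates and the comparison of their absolute
  values recover \<open>g\<close>. The functions \<open>unf_x\<close> and \<open>unf_y\<close> are its partial derivatives by the chain rule.\<close>

definition unf :: "(real \<times> real \<times> bool \<Rightarrow> real) \<Rightarrow> (plane \<Rightarrow> real) \<Rightarrow> plane \<Rightarrow> real" where
  "unf \<rho> u z = \<rho> (sgn (fst z), sgn (snd z), \<bar>fst z\<bar> < \<bar>snd z\<bar>) * u (max \<bar>fst z\<bar> \<bar>snd z\<bar>, min \<bar>fst z\<bar> \<bar>snd z\<bar>)"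

definition unf_x :: "(real \<times> real \<times> bool \<Rightarrow> real) \<Rightarrow> (plane \<Rightarrow> real) \<Rightarrow> (plane \<Rightarrow> real) \<Rightarrow> plane \<Rightarrow> real" where
  "unf_x \<rho> ux uy z = sgn (fst z) * (if \<bar>fst z\<bar> < \<bar>snd z\<bar> then unf \<rho> uy z else unf \<rho> ux z)"

definition unf_y :: "(real \<times> real \<times> bool \<Rightarrow> real) \<Rightarrow> (plane \<Rightarrow> real) \<Rightarrow> (plane \<Rightarrow> real) \<Rightarrow> plane \<Rightarrow> real" where
  "unf_y \<rho> ux uy z = sgn (snd z) * (if \<bar>fst z\<bar> < \<bar>snd z\<bar> then unf \<rho> ux z else unf \<rho> uy z)"

lemma unf_act:
  assumes "z \<in> Omega_q \<epsilon>" "(a, b, s) \<in> D4"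
  shows "unf \<rho> u (act (a, b, s) z) = \<rho> (a, b, s) * u z"
    "unf_x \<rho> ux uy (act (a, b, s) z) = a * \<rho> (a, b, s) * (if s then uy z else ux z)" (is ?B)
    "unf_y \<rho> ux uy (act (a, b, s) z) = b * \<rho> (a, b, s) * (if s then ux z else uy z)"
proof -
  obtain x y where z: "z = (x, y)" by (cases z)
  have xy: "0 < y" "y < x" using assms(1) unfolding Omega_q_iff z by auto
  have ab: "a = 1 \<or> a = -1" "b = 1 \<or> b = -1" using assms(2) by (auto simp: D4_def)
  then have m: "\<bar>a * c\<bar> = \<bar>c\<bar>" "\<bar>b * c\<bar> = \<bar>c\<bar>" "sgn a = a" "sgn b = b" for c by auto
  have g: "sgn (fst (act (a, b, s) z)) = a" "sgn (snd (act (a, b, s) z)) = b"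
    "\<bar>fst (act (a, b, s) z)\<bar> < \<bar>snd (act (a, b, s) z)\<bar> \<longleftrightarrow> s"
    "max \<bar>fst (act (a, b, s) z)\<bar> \<bar>snd (act (a, b, s) z)\<bar> = x" "min \<bar>fst (act (a, b, s) z)\<bar> \<bar>snd (act (a, b, s) z)\<bar> = y"
    using xy by (cases s; simp add: act_def z m sgn_mult)+
  show u: "unf \<rho> u (act (a, b, s) z) = \<rho> (a, b, s) * u z" for u
    unfolding unf_def g by (simp add: z)
  show ?B
    "unf_y \<rho> ux uy (act (a, b, s) z) = b * \<rho> (a, b, s) * (if s then ux z else uy z)"
    unfolding unf_x_def unf_y_def u g by simp_all
qed

text \<open>Reflection produces no jump: either \<open>\<rho>\<close> is even about a mirror or \<open>h\<close> vanishes on it. Pulled back to the fundamental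
  domain, the eight copies of a test function add up to the pair \<open>(\<xi>, \<zeta>)\<close> in Green's formula; it is even reflections
  that make \<open>\<xi>\<close> and \<open>\<zeta>\<close> agree on the diagonal and make \<open>\<zeta>\<close> vanish on the axis.\<close>

lemma unfold_W0:
  assumes o: "outer_zero h hx hy"
    and d: "diag_zero h hx hy \<or> (\<forall>a b s. \<rho> (a, b, s) = \<rho> (a, b, False))"
    and a: "axis_zero h hx hy \<or> (\<forall>a b s. \<rho> (a, b, s) = \<rho> (1, 1, s))"
  shows "W0 (Omega \<epsilon>) (unf \<rho> h) (unf_x \<rho> hx hy) (unf_y \<rho> hx hy)"
proof (rule W0_Omega)
  note L = outer_zero_L2[OF o]
  let ?Q = "Omega_q \<epsilon>"
  have cg: "L2_fun MQ g" if f: "L2_fun MQ f" and fg: "\<And>z. z \<in> ?Q \<Longrightarrow> g z = f z" for f g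
  proof -
    have ae: "AE z in MQ. f z = g z" by (rule AE_I2) (simp add: space_restrict_space fg)
    show ?thesis by (rule L2_cong_AE[OF f AE_measurable_lebesgue_on[OF Omega_sets(2) L2_D(1)[OF f] ae] ae])
  qed
  have LO: "L2_fun MO X"
    if X: "\<And>a b s z. (a, b, s) \<in> D4 \<Longrightarrow> z \<in> ?Q \<Longrightarrow> X (act (a, b, s) z) = c (a, b, s) * f s z" and f: "\<And>s. L2_fun MQ (f s)" for X c f
  proof (rule unfold_L2)
    fix g assume g: "g \<in> D4"
    obtain a b s where g': "g = (a, b, s)" by (cases g)
    show "L2_fun MQ (\<lambda>z. X (act g z))" by (rule cg[OF L2_cmult[OF f, of "c g" s]]) (use X g in \<open>simp add: g'\<close>)
  qed
  show "L2_fun MO (unf \<rho> h)"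
    by (rule LO[where c = \<rho> and f = "\<lambda>s. h"]) (simp_all add: unf_act L)
  show "L2_fun MO (unf_x \<rho> hx hy)"
    by (rule LO[where c = "\<lambda>(a, b, s). a * \<rho> (a, b, s)" and f = "\<lambda>s. if s then hy else hx"]) (simp_all add: unf_act L)
  show "L2_fun MO (unf_y \<rho> hx hy)"
    by (rule LO[where c = "\<lambda>(a, b, s). b * \<rho> (a, b, s)" and f = "\<lambda>s. if s then hx else hy"]) (simp_all add: unf_act L)
  fix \<psi> :: "plane \<Rightarrow> real" assume t: "test_function UNIV \<psi>"
  define \<psi>' where "\<psi>' g z = \<psi> (act g z)" for g z
  have tg: "test_function UNIV (\<psi>' g)" if "g \<in> D4" for g
    unfolding \<psi>'_def using test_affine[OF t mplD(3,4,1,2)[OF mpl_act[OF that]], of 0 UNIV] by simp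
  have pd: "pderiv_dir v (\<psi>' g) z = fst (act g v) * dx \<psi> (act g z) + snd (act g v) * dy \<psi> (act g z)" if "g \<in> D4" for v g z
    unfolding \<psi>'_def
    using pderiv_affine[OF mplD(3)[OF mpl_act[OF that]] test_smooth[OF t], of v 0 z]
      pderiv_dir_expand[OF test_smooth[OF t], of "act g v" "act g z"] by simp
  have LT: "L2_fun MQ \<phi>" if "test_function UNIV \<phi>" for \<phi> by (rule test_L2[OF that Omega_sets(2)])
  define Y where "Y k z = (case k of (c, \<phi>, True) \<Rightarrow> c * (h z * dy \<phi> z + hy z * \<phi> z) | (c, \<phi>, False) \<Rightarrow> c * (h z * dx \<phi> z + hx z * \<phi> z))"
    for k :: "real \<times> (plane \<Rightarrow> real) \<times> bool" and z
  have Yi: "integrable MQ (Y (c, \<phi>, i))" if "test_function UNIV \<phi>" for c \<phi> i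
    unfolding Y_def using L2_mult_integrable[OF L(1) LT[OF test_pderiv[OF that]]] L2_mult_integrable[OF L(2) LT[OF that]] L2_mult_integrable[OF L(3) LT[OF that]]
    by (cases i) auto
  \<comment> \<open>The integrand of the unfolded pairing, pulled back by \<open>g\<close>, is a pairing on the fundamental domain.\<close>
  have main: "(LINT z|MO. X z) = 0"
    if X: "\<And>a b s z. z \<in> ?Q \<Longrightarrow> (a, b, s) \<in> D4 \<Longrightarrow> X (act (a, b, s) z) = Y (c (a, b, s), \<psi>' (a, b, s), j s) z"
      and j: "\<And>s. j s = (s \<noteq> jz)"
      and c: "c = (\<lambda>(a, b, s). (if jz then b else a) * \<rho> (a, b, s))" for X c jz j
  proof -
    define \<xi> where "\<xi> z = c (1,1,jz) * \<psi>' (1,1,jz) z + c (1,-1,jz) * \<psi>' (1,-1,jz) z + c (-1,1,jz) * \<psi>' (-1,1,jz) z + c (-1,-1,jz) * \<psi>' (-1,-1,jz) z" for z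
    define \<zeta> where "\<zeta> z = c (1,1,\<not>jz) * \<psi>' (1,1,\<not>jz) z + c (1,-1,\<not>jz) * \<psi>' (1,-1,\<not>jz) z + c (-1,1,\<not>jz) * \<psi>' (-1,1,\<not>jz) z + c (-1,-1,\<not>jz) * \<psi>' (-1,-1,\<not>jz) z" for z
    have D: "(1, 1, s) \<in> D4" "(1, -1, s) \<in> D4" "(-1, 1, s) \<in> D4" "(-1, -1, s) \<in> D4" for s by (auto simp: D4_def)
    have tt: "test_function UNIV \<xi>" "test_function UNIV \<zeta>"
      unfolding \<xi>_def \<zeta>_def by (intro test_add test_cmult tg D)+
    have sg: "smooth (\<lambda>z. e * \<psi>' (a, b, s) z)" "smooth (\<psi>' (a, b, s))" if "(a, b, s) \<in> D4" for e a b s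
      using test_smooth[OF tg[OF that]] test_smooth[OF test_cmult[OF tg[OF that]]] by auto
    have dxi: "dx \<xi> z = c (1,1,jz) * dx (\<psi>' (1,1,jz)) z + c (1,-1,jz) * dx (\<psi>' (1,-1,jz)) z + c (-1,1,jz) * dx (\<psi>' (-1,1,jz)) z + c (-1,-1,jz) * dx (\<psi>' (-1,-1,jz)) z" for z
      unfolding \<xi>_def by (simp add: pderiv_add pderiv_cmult smooth_add sg D)
    have dze: "dy \<zeta> z = c (1,1,\<not>jz) * dy (\<psi>' (1,1,\<not>jz)) z + c (1,-1,\<not>jz) * dy (\<psi>' (1,-1,\<not>jz)) z + c (-1,1,\<not>jz) * dy (\<psi>' (-1,1,\<not>jz)) z + c (-1,-1,\<not>jz) * dy (\<psi>' (-1,-1,\<not>jz)) z" for z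
      unfolding \<zeta>_def by (simp add: pderiv_add pderiv_cmult smooth_add sg D)
    have Xi: "integrable MQ (\<lambda>z. X (act g z))" if g: "g \<in> D4" for g
    proof -
      obtain a b s where g': "g = (a, b, s)" using D4_cases[OF g] .
      have "integrable MQ (Y (c g, \<psi>' g, j s))" by (rule Yi[OF tg[OF g]])
      then show ?thesis using X g g'
        by (subst Bochner_Integration.integrable_cong[OF refl, of _ _ "Y (c g, \<psi>' g, j s)"]) auto
    qed
    have "(LINT z|MO. X z) = (\<Sum>g\<in>D4. LINT z|MQ. X (act g z))"
      by (rule unfold_integral(2)[OF Xi])
    also have "\<dots> = (\<Sum>g\<in>D4. LINT z|MQ. Y (c g, \<psi>' g, j (snd (snd g))) z)"
    proof (rule sum.cong[OF refl])
      fix g assume g: "g \<in> D4"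
      obtain a b s where g': "g = (a, b, s)" using D4_cases[OF g] .
      show "(LINT z|MQ. X (act g z)) = (LINT z|MQ. Y (c g, \<psi>' g, j (snd (snd g))) z)"
        using X g g' by (intro Bochner_Integration.integral_cong) auto
    qed
    also have "\<dots> = (LINT z|MQ. (\<Sum>g\<in>D4. Y (c g, \<psi>' g, j (snd (snd g))) z))"
      by (rule Bochner_Integration.integral_sum[symmetric]) (use Yi tg in auto)
    also have "\<dots> = (LINT z|MQ. h z * dx \<xi> z + hx z * \<xi> z + (h z * dy \<zeta> z + hy z * \<zeta> z))"
    proof (rule Bochner_Integration.integral_cong[OF refl])
      fix z
      show "(\<Sum>g\<in>D4. Y (c g, \<psi>' g, j (snd (snd g))) z) = h z * dx \<xi> z + hx z * \<xi> z + (h z * dy \<zeta> z + hy z * \<zeta> z)"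
        unfolding D4_sum dxi dze unfolding \<xi>_def \<zeta>_def
        by (cases jz) (simp_all add: Y_def j algebra_simps)
    qed
    also have "\<dots> = 0"
    proof (rule green_Omega_q[OF o tt])
      show "diag_zero h hx hy \<or> (\<forall>t. \<xi> (t, t) = \<zeta> (t, t))"
      proof (rule disj_forward[OF d])
        assume "\<forall>a b s. \<rho> (a, b, s) = \<rho> (a, b, False)"
        then have ch: "\<rho> (a, b, True) = \<rho> (a, b, False)" for a b by blast
        show "\<forall>t. \<xi> (t, t) = \<zeta> (t, t)"
          by (cases jz) (simp_all add: \<xi>_def \<zeta>_def \<psi>'_def act_def c ch algebra_simps)
      qed
      show "axis_zero h hx hy \<or> (\<forall>t. \<zeta> (t, 0) = 0)"
      proof (rule disj_forward[OF a])
        assume "\<forall>a b s. \<rho> (a, b, s) = \<rho> (1, 1, s)"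
        then have ch: "\<rho> (a, -1, s) = \<rho> (1, 1, s)" "\<rho> (-1, b, s) = \<rho> (1, 1, s)" for a b s by blast+
        show "\<forall>t. \<zeta> (t, 0) = 0"
          by (cases jz) (simp_all add: \<zeta>_def \<psi>'_def act_def c ch)
      qed
    qed
    finally show ?thesis .
  qed
  have sq: "a * a = 1" "b * b = 1" if "(a, b, s) \<in> D4" for a b s using that by (auto simp: D4_def)
  show "(LINT z|MO. unf \<rho> h z * dx \<psi> z + unf_x \<rho> hx hy z * \<psi> z) = 0"
  proof (rule main[where jz=False and j="\<lambda>s. s" and c="\<lambda>(a, b, s). a * \<rho> (a, b, s)"])
    fix a b s z assume z: "z \<in> ?Q" and g: "(a, b, s) \<in> D4"
    have "a * (if s then dy (\<psi>' (a, b, s)) z else dx (\<psi>' (a, b, s)) z) = dx \<psi> (act (a, b, s) z)"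
      using sq[OF g] unfolding pd[OF g] by (cases s) (simp_all add: act_def mult.assoc[symmetric])
    then show "unf \<rho> h (act (a, b, s) z) * dx \<psi> (act (a, b, s) z) + unf_x \<rho> hx hy (act (a, b, s) z) * \<psi> (act (a, b, s) z)
        = Y ((\<lambda>(a, b, s). a * \<rho> (a, b, s)) (a, b, s), \<psi>' (a, b, s), s) z"
      unfolding unf_act[OF z g] by (cases s) (simp_all only: Y_def prod.case bool.case \<psi>'_def if_True if_False, simp_all add: algebra_simps)
  qed auto
  show "(LINT z|MO. unf \<rho> h z * dy \<psi> z + unf_y \<rho> hx hy z * \<psi> z) = 0"
  proof (rule main[where jz=True and j="\<lambda>s. \<not> s" and c="\<lambda>(a, b, s). b * \<rho> (a, b, s)"])
    fix a b s z assume z: "z \<in> ?Q" and g: "(a, b, s) \<in> D4"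
    have "b * (if s then dx (\<psi>' (a, b, s)) z else dy (\<psi>' (a, b, s)) z) = dy \<psi> (act (a, b, s) z)"
      using sq[OF g] unfolding pd[OF g] by (cases s) (simp_all add: act_def mult.assoc[symmetric])
    then show "unf \<rho> h (act (a, b, s) z) * dy \<psi> (act (a, b, s) z) + unf_y \<rho> hx hy (act (a, b, s) z) * \<psi> (act (a, b, s) z)
        = Y ((\<lambda>(a, b, s). b * \<rho> (a, b, s)) (a, b, s), \<psi>' (a, b, s), \<not> s) z"
      unfolding unf_act[OF z g] by (cases s) (simp_all only: Y_def prod.case bool.case \<psi>'_def if_True if_False, simp_all add: algebra_simps)
  qed auto
qed

end

section \<open>The energy densities\<close>

text \<open>The symmetric bilinear form of the quadratic form \<open>f_el\<close>; \<open>2 * bel L2 P\<close> is the derivative of \<open>f_el\<close> at \<open>P\<close>.\<close>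

definition bel :: "real \<Rightarrow> (real^3) \<times> (real^3) \<Rightarrow> (real^3) \<times> (real^3) \<Rightarrow> real" where
  "bel L2 P Q = (1 + L2 / 2) * (fst P $ 1 * fst Q $ 1 + snd P $ 1 * snd Q $ 1)
   + (1 + L2 / 2) * (fst P $ 2 * fst Q $ 2 + snd P $ 2 * snd Q $ 2)
   + (3 + L2 / 2) * (fst P $ 3 * fst Q $ 3 + snd P $ 3 * snd Q $ 3)
   + L2 / 2 * ((snd P $ 1 * snd Q $ 3 + snd Q $ 1 * snd P $ 3) - (fst P $ 1 * fst Q $ 3 + fst Q $ 1 * fst P $ 3)
       - (snd P $ 2 * fst Q $ 3 + snd Q $ 2 * fst P $ 3) - (fst P $ 2 * snd Q $ 3 + fst Q $ 2 * snd P $ 3))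
   + \<bar>L2\<bar> / 2 * ((snd P $ 2 * fst Q $ 1 + snd Q $ 2 * fst P $ 1) - (snd P $ 1 * fst Q $ 2 + snd Q $ 1 * fst P $ 2))"

definition gsq :: "(real^3) \<times> (real^3) \<Rightarrow> real" where
  "gsq P = (\<Sum>i\<in>UNIV. (fst P $ i)\<^sup>2 + (snd P $ i)\<^sup>2)"

lemma f_el_bel: "f_el L2 P = bel L2 P P"
  by (cases P) (simp add: f_el_def bel_def power2_eq_square algebra_simps)

lemma bel_add: "bel L2 P (Q + R) = bel L2 P Q + bel L2 P R" "bel L2 P (c *\<^sub>R Q) = c * bel L2 P Q"
  by (simp_all add: bel_def algebra_simps)

lemma bel_commute: "bel L2 P Q = bel L2 Q P"
  by (simp add: bel_def mult.commute add.commute)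

lemma f_el_add: "f_el L2 (P + Q) = f_el L2 P + 2 * bel L2 P Q + f_el L2 Q"
  unfolding f_el_bel bel_def by (simp add: field_simps)

lemma f_el_has_derivative: "(f_el L2 has_derivative (\<lambda>Q. 2 * bel L2 P Q)) (at P)"
proof -
  have c: "((\<lambda>P::(real^3) \<times> (real^3). fst P $ i) has_derivative (\<lambda>H. fst H $ i)) (at P)"
    "((\<lambda>P::(real^3) \<times> (real^3). snd P $ i) has_derivative (\<lambda>H. snd H $ i)) (at P)" for i
    by (intro bounded_linear_imp_has_derivative bounded_linear_compose[OF bounded_linear_vec_nth] bounded_linear_fst bounded_linear_snd)+
  have "f_el L2 = (\<lambda>P. bel L2 P P)" using f_el_bel by blast
  moreover have "((\<lambda>P. bel L2 P P) has_derivative (\<lambda>Q. 2 * bel L2 P Q)) (at P)"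
    unfolding bel_def
    by (rule has_derivative_eq_rhs, (rule derivative_intros c)+) (simp add: fun_eq_iff field_simps)
  ultimately show ?thesis by simp
qed

lemma f_el_frechet: "frechet_derivative (f_el L2) (at P) Q = 2 * bel L2 P Q"
  using frechet_derivative_at[OF f_el_has_derivative] by metis

text \<open>The mixed terms complete squares, with different signs for \<open>L2 \<ge> 0\<close> and for \<open>L2 < 0\<close>.\<close>

lemma f_el_coercive:
  assumes "L2 > -1"
  shows "f_el L2 P \<ge> min 1 (1 + L2) * gsq P"
proof -
  obtain p q where P: "P = (p, q)" by (cases P)
  have g: "gsq P = (p $ 1)\<^sup>2 + (p $ 2)\<^sup>2 + (p $ 3)\<^sup>2 + (q $ 1)\<^sup>2 + (q $ 2)\<^sup>2 + (q $ 3)\<^sup>2"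
    by (simp add: gsq_def P sum_3)
  show ?thesis
  proof (cases "L2 \<ge> 0")
    case True
    have "f_el L2 P = gsq P + 2 * (p $ 3)\<^sup>2 + 2 * (q $ 3)\<^sup>2 + L2 / 2 * ((p $ 1 + q $ 2 - p $ 3)\<^sup>2 + (p $ 2 - q $ 1 - q $ 3)\<^sup>2)"
      unfolding g using True by (simp add: f_el_def P power2_eq_square field_simps)
    moreover have "0 \<le> L2 / 2 * ((p $ 1 + q $ 2 - p $ 3)\<^sup>2 + (p $ 2 - q $ 1 - q $ 3)\<^sup>2)" using True by simp
    moreover have "min 1 (1 + L2) = 1" using True by simp
    ultimately show ?thesis by simp
  next
    case False
    have "f_el L2 P = (1 + L2) * gsq P + 2 * (p $ 3)\<^sup>2 + 2 * (q $ 3)\<^sup>2 + (- L2) / 2 * ((p $ 1 + q $ 2 + p $ 3)\<^sup>2 + (p $ 2 - q $ 1 + q $ 3)\<^sup>2)"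
      unfolding g using False by (simp add: f_el_def P power2_eq_square field_simps)
    moreover have "0 \<le> (- L2) / 2 * ((p $ 1 + q $ 2 + p $ 3)\<^sup>2 + (p $ 2 - q $ 1 + q $ 3)\<^sup>2)"
      using False by (intro mult_nonneg_nonneg) auto
    moreover have "0 \<le> (p $ 3)\<^sup>2" "0 \<le> (q $ 3)\<^sup>2" using False by simp_all
    ultimately have "f_el L2 P \<ge> (1 + L2) * gsq P" by linarith
    then show ?thesis using False by simp
  qed
qed

lemma gsq_component: "(fst P $ i)\<^sup>2 \<le> gsq P" "(snd P $ i)\<^sup>2 \<le> gsq P"
proof -
  have "(fst P $ i)\<^sup>2 + (snd P $ i)\<^sup>2 \<le> gsq P"
    unfolding gsq_def by (rule member_le_sum) auto
  then show "(fst P $ i)\<^sup>2 \<le> gsq P" "(snd P $ i)\<^sup>2 \<le> gsq P"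
    using zero_le_power2[of "fst P $ i"] zero_le_power2[of "snd P $ i"] by linarith+
qed

lemma gsq_nonneg: "gsq P \<ge> 0" by (simp add: gsq_def sum_nonneg)

lemma abs_add_le: "\<bar>a\<bar> \<le> r \<Longrightarrow> \<bar>b\<bar> \<le> s \<Longrightarrow> \<bar>a + b\<bar> \<le> r + (s :: real)"
  and abs_diff_le: "\<bar>a\<bar> \<le> r \<Longrightarrow> \<bar>b\<bar> \<le> s \<Longrightarrow> \<bar>a - b\<bar> \<le> r + (s :: real)"
  and prod_le: "\<bar>a\<bar> \<le> r \<Longrightarrow> \<bar>b\<bar> \<le> s \<Longrightarrow> \<bar>a * b\<bar> \<le> r * (s :: real)"
  unfolding abs_mult by (linarith, linarith, intro mult_mono) auto

lemma bel_bound: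
  assumes "\<eta> > 0"
  shows "\<bar>bel L2 P Q\<bar> \<le> 18 * (3 + \<bar>L2\<bar>) * (\<eta> * gsq P + gsq Q / \<eta>)"
proof -
  define Y where "Y = \<eta> * gsq P + gsq Q / \<eta>"
  define c where "c = 3 + \<bar>L2\<bar>"
  have c: "\<bar>1 + L2 / 2\<bar> \<le> c" "\<bar>3 + L2 / 2\<bar> \<le> c" "\<bar>L2 / 2\<bar> \<le> c" "\<bar>\<bar>L2\<bar> / 2\<bar> \<le> c" by (auto simp: c_def)
  have y: "\<bar>a * b\<bar> \<le> Y" if "a\<^sup>2 \<le> gsq P" "b\<^sup>2 \<le> gsq Q" for a b
  proof -
    have "\<bar>a * b\<bar> \<le> \<eta> * a\<^sup>2 + b\<^sup>2 / \<eta>" by (rule young_sq[OF assms])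
    also have "\<dots> \<le> Y" unfolding Y_def using that assms by (intro add_mono mult_left_mono divide_right_mono) auto
    finally show ?thesis .
  qed
  have yy: "\<bar>fst P $ i * fst Q $ j\<bar> \<le> Y" "\<bar>fst P $ i * snd Q $ j\<bar> \<le> Y" "\<bar>snd P $ i * fst Q $ j\<bar> \<le> Y" "\<bar>snd P $ i * snd Q $ j\<bar> \<le> Y"
    "\<bar>fst Q $ j * fst P $ i\<bar> \<le> Y" "\<bar>fst Q $ j * snd P $ i\<bar> \<le> Y" "\<bar>snd Q $ j * fst P $ i\<bar> \<le> Y" "\<bar>snd Q $ j * snd P $ i\<bar> \<le> Y" for i j
    using y gsq_component by (simp_all add: mult.commute[of "_ Q $ j"])
  have "\<bar>bel L2 P Q\<bar> \<le> c * (Y + Y) + c * (Y + Y) + c * (Y + Y) + c * ((Y + Y) + (Y + Y) + (Y + Y) + (Y + Y)) + c * ((Y + Y) + (Y + Y))"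
    unfolding bel_def by (intro abs_add_le abs_diff_le prod_le c yy)
  then show ?thesis unfolding Y_def[symmetric] c_def[symmetric] by (simp add: algebra_simps)
qed

text \<open>The derivative of the bulk potential at \<open>q\<close> in the direction \<open>e\<close>.\<close>

definition fb' :: "real \<Rightarrow> real \<Rightarrow> real \<Rightarrow> real^3 \<Rightarrow> real^3 \<Rightarrow> real" where
  "fb' A B C q e = (2 * A + 4 * C * ((q $ 1)\<^sup>2 + (q $ 2)\<^sup>2 + 3 * (q $ 3)\<^sup>2)) * (q $ 1 * e $ 1 + q $ 2 * e $ 2 + 3 * (q $ 3 * e $ 3))
     + 2 * B * (e $ 3 * ((q $ 1)\<^sup>2 + (q $ 2)\<^sup>2 - (q $ 3)\<^sup>2) + q $ 3 * (2 * (q $ 1 * e $ 1) + 2 * (q $ 2 * e $ 2) - 2 * (q $ 3 * e $ 3)))"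

lemma fb'_add: "fb' A B C q (e + d) = fb' A B C q e + fb' A B C q d" "fb' A B C q (c *\<^sub>R e) = c * fb' A B C q e"
  by (simp_all add: fb'_def algebra_simps)

lemma f_b_has_derivative: "(f_b A B C has_derivative fb' A B C q) (at q)"
proof -
  have c: "((\<lambda>q::real^3. q $ i) has_derivative (\<lambda>h. h $ i)) (at q)" for i
    by (intro bounded_linear_imp_has_derivative bounded_linear_vec_nth)
  show ?thesis
    unfolding f_b_def[abs_def]
    by (rule has_derivative_eq_rhs, (rule derivative_intros c)+) (simp add: fun_eq_iff fb'_def power2_eq_square algebra_simps)
qed

lemma f_b_frechet: "frechet_derivative (f_b A B C) (at q) e = fb' A B C q e"
  using frechet_derivative_at[OF f_b_has_derivative] by metis

text \<open>The defect of convexity of the bulk potential.\<close>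

definition KB :: "real \<Rightarrow> real \<Rightarrow> real \<Rightarrow> real" where
  "KB A B C = 3 * (\<bar>A\<bar> + 6 * B\<^sup>2 / C)"

definition esq :: "real^3 \<Rightarrow> real" where "esq e = (\<Sum>i\<in>UNIV. (e $ i)\<^sup>2)"

text \<open>The exact Taylor remainder is \<open>Ne\<close> times terms of second order, apart from \<open>T\<close>, which is only linear in \<open>q\<close> and \<open>e\<close> up to
  the factor \<open>Ne\<close>. The quartic part dominates \<open>T\<close> up to a multiple of \<open>Ne\<close>.\<close>

lemma f_b_semiconvex:
  assumes "C > 0" "B > 0"
  shows "f_b A B C (q + e) \<ge> f_b A B C q + fb' A B C q e - KB A B C * esq e"
proof -
  define Nq where "Nq = (q $ 1)\<^sup>2 + (q $ 2)\<^sup>2 + 3 * (q $ 3)\<^sup>2"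
  define Ne where "Ne = (e $ 1)\<^sup>2 + (e $ 2)\<^sup>2 + 3 * (e $ 3)\<^sup>2"
  define X where "X = q $ 1 * e $ 1 + q $ 2 * e $ 2 + 3 * (q $ 3 * e $ 3)"
  define T where "T = q $ 3 * ((e $ 1)\<^sup>2 + (e $ 2)\<^sup>2 - 3 * (e $ 3)\<^sup>2) + (q $ 1 * (2 * (e $ 3 * e $ 1)) + q $ 2 * (2 * (e $ 3 * e $ 2)))
      + e $ 3 * ((e $ 1)\<^sup>2 + (e $ 2)\<^sup>2 - (e $ 3)\<^sup>2)"
  have R: "f_b A B C (q + e) = f_b A B C q + fb' A B C q e + (A * Ne + C * (2 * Nq * Ne + (2 * X + Ne)\<^sup>2) + 2 * B * T)"
    unfolding f_b_def fb'_def Nq_def Ne_def X_def T_def by (simp add: power2_eq_square algebra_simps)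
  have am: "\<bar>2 * (a * b)\<bar> \<le> a\<^sup>2 + b\<^sup>2" for a b :: real
    using sum_squares_bound[of "\<bar>a\<bar>" "\<bar>b\<bar>"] by (simp add: abs_mult mult.assoc)
  have sq: "(e $ 1)\<^sup>2 \<ge> 0" "(e $ 2)\<^sup>2 \<ge> 0" "(e $ 3)\<^sup>2 \<ge> 0" by simp_all
  have m: "\<bar>c * x\<bar> \<le> \<bar>c\<bar> * Ne" if "\<bar>x\<bar> \<le> Ne" for c x unfolding abs_mult using that by (intro mult_left_mono) auto
  have 1: "\<bar>q $ 3 * ((e $ 1)\<^sup>2 + (e $ 2)\<^sup>2 - 3 * (e $ 3)\<^sup>2)\<bar> \<le> \<bar>q $ 3\<bar> * Ne"
    by (rule m) (use sq in \<open>auto simp: Ne_def abs_le_iff\<close>)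
  have 2: "\<bar>q $ 1 * (2 * (e $ 3 * e $ 1))\<bar> \<le> \<bar>q $ 1\<bar> * Ne"
    by (rule m, rule order_trans[OF am]) (use sq in \<open>auto simp: Ne_def\<close>)
  have 3: "\<bar>q $ 2 * (2 * (e $ 3 * e $ 2))\<bar> \<le> \<bar>q $ 2\<bar> * Ne"
    by (rule m, rule order_trans[OF am]) (use sq in \<open>auto simp: Ne_def\<close>)
  have 4: "\<bar>e $ 3 * ((e $ 1)\<^sup>2 + (e $ 2)\<^sup>2 - (e $ 3)\<^sup>2)\<bar> \<le> \<bar>e $ 3\<bar> * Ne"
    by (rule m) (use sq in \<open>auto simp: Ne_def abs_le_iff\<close>)
  have "\<bar>T\<bar> \<le> \<bar>q $ 3\<bar> * Ne + (\<bar>q $ 1\<bar> * Ne + \<bar>q $ 2\<bar> * Ne) + \<bar>e $ 3\<bar> * Ne"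
    unfolding T_def by (intro abs_add_le 1 2 3 4)
  then have TB: "\<bar>T\<bar> \<le> (\<bar>q $ 1\<bar> + \<bar>q $ 2\<bar> + \<bar>q $ 3\<bar> + \<bar>e $ 3\<bar>) * Ne" by (simp add: algebra_simps)
  have "Nq * Ne - X\<^sup>2 = (q $ 1 * e $ 2 - q $ 2 * e $ 1)\<^sup>2 + 3 * (q $ 1 * e $ 3 - q $ 3 * e $ 1)\<^sup>2 + 3 * (q $ 2 * e $ 3 - q $ 3 * e $ 2)\<^sup>2"
    unfolding Nq_def Ne_def X_def by (simp add: power2_eq_square algebra_simps)
  also have "\<dots> \<ge> 0" by simp
  finally have XB: "X\<^sup>2 \<le> Nq * Ne" by simp
  have Ne0: "Ne \<ge> 0" by (simp add: Ne_def)
  have 1: "2 * Nq * Ne + (2 * X + Ne)\<^sup>2 \<ge> Nq * Ne + Ne\<^sup>2 / 8"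
  proof -
    have "0 \<le> (4 * X + Ne)\<^sup>2" by simp
    then have "(2 * X + Ne)\<^sup>2 \<ge> Ne\<^sup>2 / 2 - 4 * X\<^sup>2" by (simp add: power2_eq_square algebra_simps)
    moreover have "(2 * X + Ne)\<^sup>2 \<ge> 0" by simp
    ultimately show ?thesis using XB by linarith
  qed
  have lin: "C * x\<^sup>2 - 2 * B * \<bar>x\<bar> \<ge> - (B\<^sup>2 / C)" for x
  proof -
    have "0 \<le> (C * \<bar>x\<bar> - B)\<^sup>2 / C" using assms by simp
    also have "\<dots> = C * x\<^sup>2 - 2 * B * \<bar>x\<bar> + B\<^sup>2 / C"
      using assms by (simp add: power2_diff field_simps power2_eq_square)
    finally show ?thesis by simp
  qed
  have lin3: "3 * C / 8 * x\<^sup>2 - 2 * B * \<bar>x\<bar> \<ge> - (3 * B\<^sup>2 / C)" for x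
  proof -
    have "0 \<le> (3 * C / 8 * \<bar>x\<bar> - B)\<^sup>2 / (3 * C / 8)" using assms by simp
    also have "\<dots> = 3 * C / 8 * x\<^sup>2 - 2 * B * \<bar>x\<bar> + 8 / 3 * (B\<^sup>2 / C)"
      using assms by (simp add: power2_diff field_simps power2_eq_square)
    also have "8 / 3 * (B\<^sup>2 / C) \<le> 3 * (B\<^sup>2 / C)" using assms by (intro mult_right_mono) auto
    finally show ?thesis by simp
  qed
  have "C * Nq - 2 * B * (\<bar>q $ 1\<bar> + \<bar>q $ 2\<bar> + \<bar>q $ 3\<bar>) \<ge> - 3 * (B\<^sup>2 / C)"
  proof -
    have "C * Nq \<ge> C * (q $ 1)\<^sup>2 + C * (q $ 2)\<^sup>2 + C * (q $ 3)\<^sup>2"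
      using assms by (simp add: Nq_def distrib_left)
    then show ?thesis using lin[of "q $ 1"] lin[of "q $ 2"] lin[of "q $ 3"] by (simp add: distrib_left)
  qed
  moreover have "C * Ne / 8 - 2 * B * \<bar>e $ 3\<bar> \<ge> - 3 * (B\<^sup>2 / C)"
  proof -
    have "3 * C / 8 * (e $ 3)\<^sup>2 \<le> C * Ne / 8" using assms by (simp add: Ne_def)
    then show ?thesis using lin3[of "e $ 3"] by simp
  qed
  ultimately have "(C * Nq + C * Ne / 8 - 2 * B * (\<bar>q $ 1\<bar> + \<bar>q $ 2\<bar> + \<bar>q $ 3\<bar> + \<bar>e $ 3\<bar>)) * Ne \<ge> (- 6 * (B\<^sup>2 / C)) * Ne"
    using Ne0 by (intro mult_right_mono) (simp_all add: distrib_left)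
  moreover have "C * (2 * Nq * Ne + (2 * X + Ne)\<^sup>2) \<ge> C * (Nq * Ne + Ne\<^sup>2 / 8)"
    using 1 assms by (intro mult_left_mono) auto
  moreover have "2 * B * T \<ge> - (2 * B * ((\<bar>q $ 1\<bar> + \<bar>q $ 2\<bar> + \<bar>q $ 3\<bar> + \<bar>e $ 3\<bar>) * Ne))"
  proof -
    have "2 * B * (- T) \<le> 2 * B * ((\<bar>q $ 1\<bar> + \<bar>q $ 2\<bar> + \<bar>q $ 3\<bar> + \<bar>e $ 3\<bar>) * Ne)"
      using assms by (intro mult_left_mono order_trans[OF abs_ge_minus_self TB]) simp
    then show ?thesis by (simp only: mult_minus_right minus_le_iff)
  qed
  moreover have "A * Ne \<ge> - \<bar>A\<bar> * Ne" using Ne0 by (intro mult_right_mono) auto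
  moreover have "C * (Nq * Ne + Ne\<^sup>2 / 8) = (C * Nq + C * Ne / 8) * Ne"
    by (simp add: power2_eq_square algebra_simps)
  ultimately have "A * Ne + C * (2 * Nq * Ne + (2 * X + Ne)\<^sup>2) + 2 * B * T \<ge> - (\<bar>A\<bar> + 6 * (B\<^sup>2 / C)) * Ne"
    by (simp add: left_diff_distrib distrib_right mult.assoc)
  moreover have "(\<bar>A\<bar> + 6 * (B\<^sup>2 / C)) * Ne \<le> (\<bar>A\<bar> + 6 * (B\<^sup>2 / C)) * (3 * esq e)"
    using assms by (intro mult_left_mono) (auto simp: Ne_def esq_def sum_3)
  ultimately show ?thesis unfolding R KB_def by (simp add: algebra_simps)
qed

definition qs :: "real^3 \<Rightarrow> real" where "qs q = (\<Sum>i\<in>UNIV. (q $ i)^4)"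

lemma qs_nonneg: "qs q \<ge> 0" by (simp add: qs_def sum_nonneg)

lemma fourth_power_add_le: "(a + b)^4 \<le> 8 * (a^4 + (b::real)^4)"
proof -
  have sq: "(x + y)\<^sup>2 \<le> 2 * (x\<^sup>2 + y\<^sup>2)" for x y :: real using sq_add_le[of x y] by simp
  have "((a + b)\<^sup>2)\<^sup>2 \<le> (2 * (a\<^sup>2 + b\<^sup>2))\<^sup>2" using sq by (intro power_mono) auto
  also have "\<dots> = 4 * (a\<^sup>2 + b\<^sup>2)\<^sup>2" by (simp only: power_mult_distrib) simp
  also have "\<dots> \<le> 4 * (2 * ((a\<^sup>2)\<^sup>2 + (b\<^sup>2)\<^sup>2))" by (intro mult_left_mono sq) simp
  finally show ?thesis by (simp flip: power_mult)
qed

lemma qs_add_le: "qs (q + e) \<le> 8 * (qs q + qs e)"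
  unfolding qs_def sum.distrib[symmetric] sum_distrib_left vector_add_component by (intro sum_mono fourth_power_add_le)

lemma qs_scale: "qs (c *\<^sub>R e) = c^4 * qs e"
  by (simp add: qs_def power_mult_distrib sum_distrib_left)

lemma esq_le_qs: "esq e \<le> 3 + qs e"
proof -
  have "x\<^sup>2 \<le> 1 + x^4" for x :: real
  proof -
    have "0 \<le> (x\<^sup>2 - 1)\<^sup>2 + x\<^sup>2 * x\<^sup>2 + 1" by simp
    then show ?thesis by (simp add: power2_eq_square power4_eq_xxxx algebra_simps)
  qed
  then have "esq e \<le> (\<Sum>i\<in>UNIV. 1 + (e $ i)^4)" unfolding esq_def by (intro sum_mono)
  then show ?thesis by (simp add: qs_def sum.distrib)
qed

definition MB :: "real \<Rightarrow> real \<Rightarrow> real \<Rightarrow> real" where "MB A B C = 60 * (\<bar>A\<bar> + \<bar>B\<bar> + \<bar>C\<bar>)"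

lemma f_b_bound: "\<bar>f_b A B C q\<bar> \<le> MB A B C * (1 + qs q)"
proof -
  define N x T where "N = (q $ 1)\<^sup>2 + (q $ 2)\<^sup>2 + 3 * (q $ 3)\<^sup>2" and "x = q $ 3" and "T = (q $ 1)\<^sup>2 + (q $ 2)\<^sup>2 - (q $ 3)\<^sup>2"
  have N: "0 \<le> N" "x\<^sup>2 \<le> N" "\<bar>T\<bar> \<le> N" by (auto simp: N_def x_def T_def abs_le_iff)
  have "0 \<le> ((q $ 1)\<^sup>2 - (q $ 2)\<^sup>2)\<^sup>2 + ((q $ 1)\<^sup>2 - 3 * (q $ 3)\<^sup>2)\<^sup>2 + ((q $ 2)\<^sup>2 - 3 * (q $ 3)\<^sup>2)\<^sup>2" by simp
  then have "N\<^sup>2 \<le> 3 * ((q $ 1)^4 + (q $ 2)^4 + 9 * (q $ 3)^4)"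
    by (simp add: N_def power2_eq_square power4_eq_xxxx algebra_simps)
  also have "\<dots> \<le> 27 * qs q" by (simp add: qs_def sum_3 zero_le_even_power)
  finally have N2: "N\<^sup>2 \<le> 27 * qs q" .
  have "0 \<le> (N - 1)\<^sup>2" by simp
  then have N1: "N \<le> 1 + N\<^sup>2" using N(1) by (simp add: power2_eq_square algebra_simps)
  have T2: "T\<^sup>2 \<le> N\<^sup>2" using N power_mono[of "\<bar>T\<bar>" N 2] by simp
  have "2 * \<bar>x * T\<bar> \<le> x\<^sup>2 + T\<^sup>2" using sum_squares_bound[of "\<bar>x\<bar>" "\<bar>T\<bar>"] by (simp add: abs_mult)
  then have xT: "\<bar>2 * (x * T)\<bar> \<le> 1 + 2 * N\<^sup>2" using N T2 N1 by simp
  have "\<bar>f_b A B C q\<bar> = \<bar>A * N + C * N\<^sup>2 + B * (2 * (x * T))\<bar>"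
    by (simp add: f_b_def N_def x_def T_def algebra_simps)
  also have "\<dots> \<le> \<bar>A\<bar> * (1 + 2 * N\<^sup>2) + \<bar>C\<bar> * (1 + 2 * N\<^sup>2) + \<bar>B\<bar> * (1 + 2 * N\<^sup>2)"
    by (intro abs_add_le prod_le[OF order_refl] xT) (use N(1) in \<open>auto intro: order_trans[OF N1]\<close>)
  also have "\<dots> = (\<bar>A\<bar> + \<bar>B\<bar> + \<bar>C\<bar>) * (1 + 2 * N\<^sup>2)" by (simp add: algebra_simps)
  also have "\<dots> \<le> (\<bar>A\<bar> + \<bar>B\<bar> + \<bar>C\<bar>) * (60 * (1 + qs q))" using N2 qs_nonneg[of q] by (intro mult_left_mono) auto
  finally show ?thesis unfolding MB_def by (simp only: mult_ac)
qed

definition YB :: "real \<Rightarrow> real \<Rightarrow> real \<Rightarrow> real" where "YB A B C = 9 * MB A B C + 3 * KB A B C"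

lemma YB_nonneg: "C > 0 \<Longrightarrow> YB A B C \<ge> 0" by (simp add: YB_def MB_def KB_def)

text \<open>Semiconvexity bounds the derivative by values: \<open>fb' q d \<le> f_b (q + d) - f_b q + KB * esq d\<close>. Taking
  \<open>d = \<plusminus> e / \<eta>\<close> gives a Young inequality for the quartic growth.\<close>

lemma fb'_young:
  assumes "\<eta> > 0" and p: "C > 0" "B > 0"
  shows "\<bar>fb' A B C q e\<bar> \<le> YB A B C * (\<eta> * (1 + qs q) + qs e / \<eta>^3)"
proof -
  have M: "MB A B C \<ge> 0" "KB A B C \<ge> 0" using p by (auto simp: MB_def KB_def)
  have *: "c * fb' A B C q e \<le> YB A B C * (\<eta> * (1 + qs q) + qs e / \<eta>^3)" if "c = 1 \<or> c = -1" for c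
  proof -
    define d where "d = (c / \<eta>) *\<^sub>R e"
    have d: "qs d = qs e / \<eta>^4" using that by (auto simp: d_def qs_scale power_divide)
    have "fb' A B C q d \<le> f_b A B C (q + d) - f_b A B C q + KB A B C * esq d" using f_b_semiconvex[OF p, of A q d] by simp
    also have "\<dots> \<le> MB A B C * (1 + 8 * (qs q + qs d)) + MB A B C * (1 + qs q) + KB A B C * (3 + qs d)"
    proof -
      have "f_b A B C (q + d) \<le> MB A B C * (1 + 8 * (qs q + qs d))"
        using qs_add_le[of q d] M by (intro order_trans[OF abs_ge_self order_trans[OF f_b_bound]] mult_left_mono) auto
      moreover have "- f_b A B C q \<le> MB A B C * (1 + qs q)" by (rule order_trans[OF abs_ge_minus_self f_b_bound])
      moreover have "KB A B C * esq d \<le> KB A B C * (3 + qs d)" by (intro mult_left_mono esq_le_qs M)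
      ultimately show ?thesis by linarith
    qed
    also have "\<dots> \<le> YB A B C * (1 + qs q + qs d)"
    proof -
      have "0 \<le> MB A B C * qs d" "0 \<le> MB A B C * 1" "0 \<le> KB A B C * qs q" "0 \<le> KB A B C * qs d" using M qs_nonneg by (auto intro: mult_nonneg_nonneg)
      then show ?thesis unfolding YB_def by (simp add: algebra_simps)
    qed
    finally have "\<eta> * fb' A B C q d \<le> \<eta> * (YB A B C * (1 + qs q + qs d))" using assms by (intro mult_left_mono) auto
    also have "\<dots> = YB A B C * (\<eta> * (1 + qs q) + qs e / \<eta>^3)"
      unfolding d using assms by (simp add: field_simps power4_eq_xxxx power3_eq_cube)
    finally show ?thesis using assms by (simp add: d_def fb'_add)
  qed
  show ?thesis using *[of 1] *[of "-1"] by (simp add: abs_le_iff)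
qed

section \<open>Smooth extension of the boundary data\<close>

text \<open>A smooth step from 1 (for \<open>t \<le> 0\<close>) to 0 (for \<open>t \<ge> 1\<close>) with \<open>sig t + sig (1 - t) = 1\<close>. Consequently \<open>ramp t - ramp (1 - t)\<close> is
  the affine function \<open>1 - 2 t\<close>, the profile of the boundary datum on a short edge.\<close>

definition sig :: "real \<Rightarrow> real" where "sig t = flat 0 (1 - t) * inverse (flat 0 t + flat 0 (1 - t))"

lemma sig_denominator: "flat 0 t + flat 0 (1 - t) > 0"
  using flat_pos[of t 0] flat_pos[of "1 - t" 0] flat_nonneg[of 0 t] flat_nonneg[of 0 "1 - t"]
  by (cases "t > 0") (auto intro: add_pos_nonneg add_nonneg_pos)

lemma sig_reflect: "sig t + sig (1 - t) = 1"
proof -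
  have "sig t + sig (1 - t) = (flat 0 t + flat 0 (1 - t)) * inverse (flat 0 t + flat 0 (1 - t))"
    unfolding sig_def by (simp add: algebra_simps)
  then show ?thesis using sig_denominator[of t] by simp
qed

definition ramp :: "real \<Rightarrow> real" where "ramp t = (1 - 2 * t) * sig t"

lemma ramp_eq_0: "t \<ge> 1 \<Longrightarrow> ramp t = 0" by (simp add: ramp_def sig_def flat_eq_0)

lemma ramp_0: "ramp 0 = 1" using sig_reflect[of 0] by (simp add: ramp_def sig_def flat_eq_0)

lemma ramp_reflect: "ramp t - ramp (1 - t) = 1 - 2 * t"
proof -
  have "ramp t - ramp (1 - t) = (1 - 2 * t) * (sig t + sig (1 - t))" by (simp add: ramp_def algebra_simps)
  then show ?thesis by (simp add: sig_reflect)
qed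

lemma smooth_ramp: "smooth p \<Longrightarrow> smooth (\<lambda>z. ramp (p z))"
  unfolding ramp_def sig_def
  by (intro smooth_mult smooth_inverse smooth_diff smooth_const smooth_add smooth_flat) (use sig_denominator in \<open>auto simp: less_le\<close>)

text \<open>With the reflected summand the function is even and smooth; for \<open>\<bar>x\<bar> \<le> 1\<close> only the summand of \<open>1 - \<bar>x\<bar>\<close> is nonzero.\<close>

definition cutoff :: "real \<Rightarrow> real \<Rightarrow> real" where "cutoff \<epsilon> x = ramp ((1 - x) / \<epsilon>) + ramp ((1 + x) / \<epsilon>)"

definition lift1 :: "real \<Rightarrow> real \<Rightarrow> plane \<Rightarrow> real" where
  "lift1 s \<epsilon> z = - (s / 2) * (cutoff \<epsilon> (fst z) - cutoff \<epsilon> (snd z))"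

lemma cutoff_even: "cutoff \<epsilon> (- x) = cutoff \<epsilon> x" by (simp add: cutoff_def add.commute)

lemma smooth_lift1: "smooth (lift1 s \<epsilon>)"
proof -
  have "smooth (\<lambda>z. cutoff \<epsilon> (fst z))" "smooth (\<lambda>z. cutoff \<epsilon> (snd z))"
    unfolding cutoff_def divide_inverse by (intro smooth_mult smooth_const smooth_diff smooth_add smooth_ramp smooth_fst smooth_snd)+
  then show ?thesis unfolding lift1_def[abs_def] by (intro smooth_mult smooth_const smooth_diff)
qed

lemma lift1_act: "(a = 1 \<or> a = -1) \<Longrightarrow> (b = 1 \<or> b = -1) \<Longrightarrow> lift1 s \<epsilon> (act (a, b, d) z) = (if d then -1 else 1) * lift1 s \<epsilon> z"
  by (cases d; elim disjE) (simp_all add: lift1_def act_def cutoff_even minus_mult_right)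

lemma lift1_diagonal: "lift1 s \<epsilon> (t, t) = 0" by (simp add: lift1_def)

context domain_eps
begin

lemma cutoff_abs: assumes "\<bar>x\<bar> \<le> 1" shows "cutoff \<epsilon> x = ramp ((1 - \<bar>x\<bar>) / \<epsilon>)"
proof (cases "x \<ge> 0")
  case True
  have "(1 + x) / \<epsilon> \<ge> 1" using True eps by (simp add: field_simps)
  then show ?thesis using True by (simp add: cutoff_def ramp_eq_0)
next
  case False
  have "(1 - x) / \<epsilon> \<ge> 1" using False eps by (simp add: field_simps)
  then show ?thesis using False by (simp add: cutoff_def ramp_eq_0)
qed

text \<open>On a long edge one of the two cutoffs is 1 and the other is 0; on a short edge the arguments of \<open>ramp\<close> add up to 1.\<close>

lemma lift1_boundary:
  assumes "z \<in> frontier (Omega \<epsilon>)"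
  shows "lift1 (s_plus A B C) \<epsilon> z = q_b A B C \<epsilon> z"
proof -
  obtain x y where z: "z = (x, y)" by (cases z)
  define s where "s = s_plus A B C"
  note f = frontier_OmegaD[OF assms[unfolded z]]
  have sum: "\<bar>x\<bar> + \<bar>y\<bar> \<le> 2 - \<epsilon>" using f(3,4) abs_sum_le_iff by blast
  have L: "lift1 s \<epsilon> z = - (s / 2) * (ramp ((1 - \<bar>x\<bar>) / \<epsilon>) - ramp ((1 - \<bar>y\<bar>) / \<epsilon>))"
    using f(1,2) by (simp add: lift1_def z cutoff_abs)
  consider "\<bar>y\<bar> = 1" | "\<bar>x\<bar> = 1" "\<bar>y\<bar> \<noteq> 1" | "\<bar>x\<bar> \<noteq> 1" "\<bar>y\<bar> \<noteq> 1" "\<bar>x\<bar> + \<bar>y\<bar> = 2 - \<epsilon>"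
  proof -
    have "\<bar>x\<bar> + \<bar>y\<bar> = 2 - \<epsilon>" if "\<bar>x + y\<bar> = 2 - \<epsilon> \<or> \<bar>x - y\<bar> = 2 - \<epsilon>"
      using that sum abs_triangle_ineq[of x y] abs_triangle_ineq4[of x y] by linarith
    then show thesis using f(5) that by blast
  qed
  then show ?thesis
  proof cases
    case 1
    then have "(1 - \<bar>x\<bar>) / \<epsilon> \<ge> 1" using sum eps by (simp add: field_simps)
    then show ?thesis using 1 L by (simp add: z q_b_def ramp_0 ramp_eq_0 s_def)
  next
    case 2
    then have "(1 - \<bar>y\<bar>) / \<epsilon> \<ge> 1" using sum eps by (simp add: field_simps)
    then show ?thesis using 2 L by (simp add: z q_b_def ramp_0 ramp_eq_0 s_def)
  next
    case 3
    have "(1 - \<bar>y\<bar>) / \<epsilon> = 1 - (1 - \<bar>x\<bar>) / \<epsilon>" using 3 eps by (simp add: field_simps)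
    then have "lift1 s \<epsilon> z = - (s / 2) * (1 - 2 * ((1 - \<bar>x\<bar>) / \<epsilon>))" using L ramp_reflect by simp
    also have "\<dots> = s / (2 * \<epsilon>) * (\<bar>y\<bar> - \<bar>x\<bar>)"
    proof -
      have y: "\<bar>y\<bar> = 2 - \<epsilon> - \<bar>x\<bar>" using 3 by simp
      show ?thesis unfolding y using eps by (simp add: field_simps)
    qed
    also have "\<dots> = q_b A B C \<epsilon> z"
    proof -
      have p: "x \<noteq> 0" "y \<noteq> 0" using 3 f(1,2) eps by auto
      consider "x > 0" "y > 0" | "x > 0" "y < 0" | "x < 0" "y > 0" | "x < 0" "y < 0" using p by linarith
      then show ?thesis
        by cases (use 3 eps in \<open>auto simp: z q_b_def s_def[symmetric] Let_def\<close>)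
    qed
    finally show ?thesis by (simp add: s_def)
  qed
qed

end

section \<open>Traces\<close>

lemma W12_D:
  assumes "u \<in> W12 U"
  shows "L2_fun (lebesgue_on U) u" "v \<in> Basis \<Longrightarrow> has_weak_deriv U v u (weak_deriv U v u)"
    "open U \<Longrightarrow> v \<in> Basis \<Longrightarrow> L2_fun (lebesgue_on U) (weak_deriv U v u)"
proof -
  show "L2_fun (lebesgue_on U) u" using assms by (simp add: W12_def)
  show 1: "has_weak_deriv U v u (weak_deriv U v u)" if "v \<in> Basis"
    using assms that has_weak_deriv_weak_deriv unfolding W12_def by blast
  show "L2_fun (lebesgue_on U) (weak_deriv U v u)" if U: "open U" and v: "v \<in> Basis"
  proof -
    obtain g where g: "has_weak_deriv U v u g" "L2_fun (lebesgue_on U) g" using assms v by (auto simp: W12_def)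
    have ae: "AE z in lebesgue_on U. g z = weak_deriv U v u z" using weak_deriv_AE_eq[OF U g(1)] by eventually_elim simp
    have "U \<in> sets lebesgue" using U by (simp add: borel_open)
    then show ?thesis using L2_cong_AE[OF g(2) AE_measurable_lebesgue_on[OF _ L2_D(1)[OF g(2)] ae] ae] by blast
  qed
qed

lemma has_weak_deriv_lincomb:
  assumes U: "U \<in> sets lebesgue" and u: "L2_fun (lebesgue_on U) u" "L2_fun (lebesgue_on U) g" "has_weak_deriv U v u g"
    and w: "L2_fun (lebesgue_on U) w" "L2_fun (lebesgue_on U) h" "has_weak_deriv U v w h"
  shows "has_weak_deriv U v (\<lambda>z. u z + c * w z) (\<lambda>z. g z + c * h z)"
proof -
  note L = L2_mult_integrable[OF u(1)] L2_mult_integrable[OF u(2)] L2_mult_integrable[OF w(1)] L2_mult_integrable[OF w(2)]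
  have "(LINT z|lebesgue_on U. (u z + c * w z) * pderiv_dir v \<phi> z) = - (LINT z|lebesgue_on U. (g z + c * h z) * \<phi> z)"
    if t: "test_function U \<phi>" for \<phi>
  proof -
    note t2 = test_L2[OF t U] test_L2[OF test_pderiv[OF t] U, of v]
    have "(LINT z|lebesgue_on U. (u z + c * w z) * pderiv_dir v \<phi> z)
        = (LINT z|lebesgue_on U. u z * pderiv_dir v \<phi> z) + c * (LINT z|lebesgue_on U. w z * pderiv_dir v \<phi> z)"
      using L(1,3)[OF t2(2)] by (simp add: distrib_right mult.assoc)
    also have "\<dots> = - (LINT z|lebesgue_on U. g z * \<phi> z) + c * - (LINT z|lebesgue_on U. h z * \<phi> z)"
      using u(3) w(3) t unfolding has_weak_deriv_def by simp
    also have "\<dots> = - (LINT z|lebesgue_on U. (g z + c * h z) * \<phi> z)"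
      using L(2,4)[OF t2(1)] by (simp add: distrib_right mult.assoc)
    finally show ?thesis .
  qed
  then show ?thesis unfolding has_weak_deriv_def
    using L2_loc_integrable[OF U] L2_add[OF u(1) L2_cmult[OF w(1)]] L2_add[OF u(2) L2_cmult[OF w(2)]] by blast
qed

text \<open>Carrying a gradient along makes linear combinations and limits literal identities; \<open>weak_deriv\<close> selects an
  arbitrary representative and respects them only up to null sets.\<close>

definition sobolev :: "plane set \<Rightarrow> (plane \<Rightarrow> real) \<Rightarrow> (plane \<Rightarrow> real) \<Rightarrow> (plane \<Rightarrow> real) \<Rightarrow> bool" where
  "sobolev U u ux uy \<longleftrightarrow> L2_fun (lebesgue_on U) u \<and> L2_fun (lebesgue_on U) ux \<and> L2_fun (lebesgue_on U) uy
     \<and> has_weak_deriv U (1, 0) u ux \<and> has_weak_deriv U (0, 1) u uy"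

lemma sobolev_W12: "sobolev U u ux uy \<Longrightarrow> u \<in> W12 U"
  by (auto simp: sobolev_def W12_def plane_Basis)

lemma W12_sobolev: "u \<in> W12 U \<Longrightarrow> open U \<Longrightarrow> sobolev U u (weak_deriv U (1, 0) u) (weak_deriv U (0, 1) u)"
  using W12_D[of u U] by (auto simp: sobolev_def plane_Basis)

lemma sobolev_lincomb:
  assumes "U \<in> sets lebesgue" "sobolev U u ux uy" "sobolev U w wx wy"
  shows "sobolev U (\<lambda>z. u z + c * w z) (\<lambda>z. ux z + c * wx z) (\<lambda>z. uy z + c * wy z)"
  using assms unfolding sobolev_def by (auto intro!: has_weak_deriv_lincomb L2_add L2_cmult)

lemma smooth_sobolev: "smooth f \<Longrightarrow> bounded U \<Longrightarrow> U \<in> sets lebesgue \<Longrightarrow> sobolev U f (dx f) (dy f)"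
  unfolding sobolev_def by (auto intro: smooth_L2 smooth_weak_deriv smooth_pderiv)

lemma sobolev_AE:
  assumes "open U" "sobolev U u ux uy"
  shows "AE z in lebesgue_on U. weak_deriv U (1, 0) u z = ux z" "AE z in lebesgue_on U. weak_deriv U (0, 1) u z = uy z"
  using assms weak_deriv_AE_eq unfolding sobolev_def by blast+

lemma W0_sobolev:
  assumes U: "U \<in> sets lebesgue" "bounded U" and w: "W0 U h hx hy"
  shows "sobolev U h hx hy"
proof -
  obtain \<phi> where \<phi>: "\<And>n. test_function U (\<phi> n)" "L2_tendsto (lebesgue_on U) \<phi> h"
    "L2_tendsto (lebesgue_on U) (\<lambda>n. dx (\<phi> n)) hx" "L2_tendsto (lebesgue_on U) (\<lambda>n. dy (\<phi> n)) hy"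
    using w unfolding W0_def by blast
  have s: "has_weak_deriv U v (\<phi> n) (pderiv_dir v (\<phi> n))" for v n
    by (rule smooth_weak_deriv[OF test_smooth[OF \<phi>(1)] U(2,1)])
  show ?thesis unfolding sobolev_def
    using W0_D[OF w] weak_deriv_L2_limit[OF U(1) s \<phi>(2,3)] weak_deriv_L2_limit[OF U(1) s \<phi>(2,4)] by blast
qed

definition approx_on :: "plane set \<Rightarrow> (plane \<Rightarrow> real) \<Rightarrow> (plane \<Rightarrow> real) \<Rightarrow> (plane \<Rightarrow> real) \<Rightarrow> (plane \<Rightarrow> real) \<Rightarrow> plane \<Rightarrow> plane \<Rightarrow> (nat \<Rightarrow> plane \<Rightarrow> real) \<Rightarrow> bool" where
  "approx_on U u ux uy g a b \<phi> \<longleftrightarrow> (\<forall>n. smooth (\<phi> n)) \<and> L2_tendsto (lebesgue_on U) \<phi> u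
     \<and> L2_tendsto (lebesgue_on U) (\<lambda>n. dx (\<phi> n)) ux \<and> L2_tendsto (lebesgue_on U) (\<lambda>n. dy (\<phi> n)) uy
     \<and> L2_tendsto (lebesgue_on {0..1}) (\<lambda>n t. \<phi> n (linepath a b t)) (\<lambda>t. g (linepath a b t))"

lemma approx_on_cong_AE:
  assumes U: "U \<in> sets lebesgue" and a: "approx_on U u ux uy g a b \<phi>"
    and ae: "AE z in lebesgue_on U. ux z = ux' z" "AE z in lebesgue_on U. uy z = uy' z"
  shows "approx_on U u ux' uy' g a b \<phi>"
  using a L2_tendsto_cong_AE[OF _ AE_measurable_lebesgue_on[OF U _ ae(1)] ae(1)]
    L2_tendsto_cong_AE[OF _ AE_measurable_lebesgue_on[OF U _ ae(2)] ae(2)]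
  unfolding approx_on_def by (meson L2_D(1) L2_tendsto_D(2))

lemma trace_on_iff:
  assumes U: "open U" and s: "sobolev U u ux uy"
  shows "trace_on U \<Gamma> u g \<longleftrightarrow> (\<forall>a b. a \<noteq> b \<and> closed_segment a b \<subseteq> \<Gamma> \<longrightarrow> (\<exists>\<phi>. approx_on U u ux uy g a b \<phi>))"
proof -
  have M: "U \<in> sets lebesgue" using U by (simp add: borel_open)
  have ae: "AE z in lebesgue_on U. ux z = weak_deriv U (1, 0) u z" "AE z in lebesgue_on U. uy z = weak_deriv U (0, 1) u z"
    using sobolev_AE[OF U s] by (auto elim: eventually_mono)
  have "approx_on U u ux uy g a b \<phi> \<longleftrightarrow> approx_on U u (weak_deriv U (1, 0) u) (weak_deriv U (0, 1) u) g a b \<phi>" for a b \<phi>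
    using approx_on_cong_AE[OF M _ ae] approx_on_cong_AE[OF M _ sobolev_AE[OF U s]] by blast
  then show ?thesis
    unfolding trace_on_def using sobolev_W12[OF s] by (simp add: approx_on_def plane_Basis)
qed

lemma trace_on_cong: "trace_on U \<Gamma> u g \<Longrightarrow> (\<And>z. z \<in> \<Gamma> \<Longrightarrow> g z = h z) \<Longrightarrow> trace_on U \<Gamma> u h"
proof -
  assume t: "trace_on U \<Gamma> u g" and eq: "\<And>z. z \<in> \<Gamma> \<Longrightarrow> g z = h z"
  have "L2_tendsto (lebesgue_on {0..1}) f (\<lambda>t. g (linepath a b t)) \<longleftrightarrow> L2_tendsto (lebesgue_on {0..1}) f (\<lambda>t. h (linepath a b t))"
    if "closed_segment a b \<subseteq> \<Gamma>" for a b and f :: "nat \<Rightarrow> real \<Rightarrow> real"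
  proof -
    have "g (linepath a b t) = h (linepath a b t)" if "t \<in> {0..1}" for t
      using that \<open>closed_segment a b \<subseteq> \<Gamma>\<close> by (intro eq) (auto simp: linepath_image_01[symmetric])
    then show ?thesis unfolding L2_tendsto_def L2_fun_def
      by (intro conj_cong arg_cong[where f = "\<lambda>x. (\<lambda>n. x n) \<longlonglongrightarrow> 0"] ext Bochner_Integration.integral_cong Bochner_Integration.integrable_cong measurable_cong) auto
  qed
  then show ?thesis using t unfolding trace_on_def by auto
qed

lemma trace_on_lincomb:
  assumes U: "open U" and t: "trace_on U \<Gamma> u g" "trace_on U \<Gamma> w h"
  shows "trace_on U \<Gamma> (\<lambda>z. u z + c * w z) (\<lambda>z. g z + c * h z)"
proof -
  have M: "U \<in> sets lebesgue" using U by (simp add: borel_open)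
  have w: "u \<in> W12 U" "w \<in> W12 U" using t by (auto simp: trace_on_def)
  note s = w[THEN W12_sobolev, OF U]
  show ?thesis unfolding trace_on_iff[OF U sobolev_lincomb[OF M s]]
  proof (intro allI impI)
    fix a b assume ab: "a \<noteq> b \<and> closed_segment a b \<subseteq> \<Gamma>"
    obtain \<phi> \<psi> where p: "approx_on U u (weak_deriv U (1, 0) u) (weak_deriv U (0, 1) u) g a b \<phi>"
      "approx_on U w (weak_deriv U (1, 0) w) (weak_deriv U (0, 1) w) h a b \<psi>"
      using t ab unfolding trace_on_iff[OF U s(1)] trace_on_iff[OF U s(2)] by blast
    have sm: "smooth (\<phi> n)" "smooth (\<psi> n)" for n using p by (auto simp: approx_on_def)
    have d: "pderiv_dir v (\<lambda>z. \<phi> n z + c * \<psi> n z) = (\<lambda>z. pderiv_dir v (\<phi> n) z + c * pderiv_dir v (\<psi> n) z)" for v n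
      using sm by (simp add: fun_eq_iff pderiv_add pderiv_cmult smooth_mult smooth_const)
    show "\<exists>\<phi>. approx_on U (\<lambda>z. u z + c * w z) (\<lambda>z. weak_deriv U (1, 0) u z + c * weak_deriv U (1, 0) w z)
        (\<lambda>z. weak_deriv U (0, 1) u z + c * weak_deriv U (0, 1) w z) (\<lambda>z. g z + c * h z) a b \<phi>"
      using p sm unfolding approx_on_def
      by (intro exI[of _ "\<lambda>n z. \<phi> n z + c * \<psi> n z"])
        (auto simp: d intro!: smooth_add smooth_mult smooth_const L2_tendsto_add L2_tendsto_cmult)
  qed
qed

lemma smooth_linepath_L2: assumes "smooth f" shows "L2_fun (lebesgue_on {0..1}) (\<lambda>t. f (linepath a b t))"
proof -
  have c: "continuous_on {0..1::real} (\<lambda>t. f (linepath a b t))"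
    using continuous_on_compose2[OF smooth_continuous[OF assms] continuous_on_linepath] by simp
  then have "integrable (lebesgue_on {0..1}) (\<lambda>t. (f (linepath a b t))\<^sup>2)" "(\<lambda>t. f (linepath a b t)) \<in> borel_measurable (lebesgue_on {0..1})"
    by (auto intro!: continuous_imp_integrable_real continuous_imp_measurable_on_sets_lebesgue continuous_intros)
  then show ?thesis by (simp add: L2_fun_def)
qed

lemma trace_on_smooth:
  assumes U: "open U" "bounded U" and f: "smooth f"
  shows "trace_on U \<Gamma> f f"
proof -
  have M: "U \<in> sets lebesgue" using U by (simp add: borel_open)
  note s = smooth_sobolev[OF f U(2) M]
  show ?thesis unfolding trace_on_iff[OF U(1) s] approx_on_def
    using f s smooth_linepath_L2[OF f] by (auto intro!: exI[of _ "\<lambda>n. f"] L2_tendsto_const simp: sobolev_def)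
qed

lemma trace_on_W0:
  assumes U: "open U" "bounded U" and w: "W0 U h hx hy"
  shows "trace_on U (frontier U) h (\<lambda>z. 0)"
proof -
  have M: "U \<in> sets lebesgue" using U by (simp add: borel_open)
  note s = W0_sobolev[OF M U(2) w]
  obtain \<phi> where p: "\<And>n. test_function U (\<phi> n)" "L2_tendsto (lebesgue_on U) \<phi> h"
    "L2_tendsto (lebesgue_on U) (\<lambda>n. dx (\<phi> n)) hx" "L2_tendsto (lebesgue_on U) (\<lambda>n. dy (\<phi> n)) hy"
    using w unfolding W0_def by blast
  have "L2_tendsto (lebesgue_on {0..1}) (\<lambda>n t. \<phi> n (linepath a b t)) (\<lambda>t. 0)" if seg: "closed_segment a b \<subseteq> frontier U" for a b
  proof -
    have "\<phi> n (linepath a b t) = 0" if "t \<in> {0..1}" for n t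
    proof -
      have "linepath a b t \<in> frontier U" using seg that by (auto simp: linepath_image_01[symmetric])
      then have "linepath a b t \<notin> U" using U(1) frontier_disjoint_eq by blast
      then show ?thesis using test_zero_outside[OF p(1)] by blast
    qed
    then have "(LINT t|lebesgue_on {0..1}. (\<phi> n (linepath a b t) - 0)\<^sup>2) = 0" for n
      by (intro integral_eq_zero_AE AE_I2) auto
    then show ?thesis unfolding L2_tendsto_def using smooth_linepath_L2[OF test_smooth[OF p(1)]] by (simp add: L2_zero)
  qed
  then show ?thesis unfolding trace_on_iff[OF U(1) s] approx_on_def using p test_smooth by blast
qed

lemma L2_tendsto_diagonal:
  assumes u: "L2_tendsto M u w" and f: "\<And>n. L2_fun M (f n)" "\<And>n. (LINT z|M. (f n z - u n z)\<^sup>2) \<le> inverse (real (Suc n))"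
  shows "L2_tendsto M f w"
proof -
  have "(\<lambda>n. LINT z|M. (f n z - w z)\<^sup>2) \<longlonglongrightarrow> 0"
  proof (rule tendsto_sandwich[OF _ _ tendsto_const])
    have "(LINT z|M. (f n z - w z)\<^sup>2) \<le> 2 * inverse (real (Suc n)) + 2 * (LINT z|M. (u n z - w z)\<^sup>2)" for n
      using integral_sq_add_le[OF L2_diff[OF f(1)[of n] L2_tendsto_D(1)[OF u, of n]] L2_diff[OF L2_tendsto_D(1)[OF u, of n] L2_tendsto_D(2)[OF u]]] f(2)[of n] by simp
    then show "\<forall>\<^sub>F n in sequentially. (LINT z|M. (f n z - w z)\<^sup>2) \<le> 2 * inverse (real (Suc n)) + 2 * (LINT z|M. (u n z - w z)\<^sup>2)"
      by simp
    show "(\<lambda>n. 2 * inverse (real (Suc n)) + 2 * (LINT z|M. (u n z - w z)\<^sup>2)) \<longlonglongrightarrow> 0"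
      using tendsto_add[OF tendsto_mult_left[OF LIMSEQ_inverse_real_of_nat, of 2] tendsto_mult_left[OF L2_tendsto_D(3)[OF u], of 2]] by simp
  qed simp
  then show ?thesis using f(1) L2_tendsto_D(2)[OF u] by (simp add: L2_tendsto_def)
qed

text \<open>The trace is stable under convergence in $W^{1,2}$: a diagonal sequence of the approximating smooth functions works.\<close>

lemma trace_on_limit:
  assumes U: "open U" and tr: "\<And>n. trace_on U \<Gamma> (u n) g" and s: "\<And>n. sobolev U (u n) (ux n) (uy n)"
    and lim: "L2_tendsto (lebesgue_on U) u w" "L2_tendsto (lebesgue_on U) ux wx" "L2_tendsto (lebesgue_on U) uy wy"
  shows "trace_on U \<Gamma> w g" "sobolev U w wx wy"
proof -
  have M: "U \<in> sets lebesgue" using U by (simp add: borel_open)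
  have d: "has_weak_deriv U (1, 0) (u n) (ux n)" "has_weak_deriv U (0, 1) (u n) (uy n)" for n using s by (auto simp: sobolev_def)
  show s': "sobolev U w wx wy" unfolding sobolev_def
    using lim[THEN L2_tendsto_D(2)] weak_deriv_L2_limit[OF M d(1) lim(1,2)] weak_deriv_L2_limit[OF M d(2) lim(1,3)] by blast
  show "trace_on U \<Gamma> w g" unfolding trace_on_iff[OF U s']
  proof (intro allI impI)
    fix a b assume ab: "a \<noteq> b \<and> closed_segment a b \<subseteq> \<Gamma>"
    let ?N = "lebesgue_on {0..1::real}" and ?M = "lebesgue_on U"
    define P where "P n f \<longleftrightarrow> smooth f \<and> (LINT z|?M. (f z - u n z)\<^sup>2) < inverse (real (Suc n)) \<and> (LINT z|?M. (dx f z - ux n z)\<^sup>2) < inverse (real (Suc n))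
       \<and> (LINT z|?M. (dy f z - uy n z)\<^sup>2) < inverse (real (Suc n)) \<and> (LINT t|?N. (f (linepath a b t) - g (linepath a b t))\<^sup>2) < inverse (real (Suc n))
       \<and> L2_fun ?M f \<and> L2_fun ?M (dx f) \<and> L2_fun ?M (dy f) \<and> L2_fun ?N (\<lambda>t. f (linepath a b t)) \<and> L2_fun ?N (\<lambda>t. g (linepath a b t))" for n f
    have "\<exists>f. P n f" for n
    proof -
      obtain \<phi> where p: "approx_on U (u n) (ux n) (uy n) g a b \<phi>" using tr[of n] ab unfolding trace_on_iff[OF U s] by blast
      have "\<forall>\<^sub>F k in sequentially. r k < inverse (real (Suc n))" if "r \<longlonglongrightarrow> (0::real)" for r
        using order_tendstoD(2)[OF that, of "inverse (real (Suc n))"] by simp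
      then have "\<forall>\<^sub>F k in sequentially. (LINT z|?M. (\<phi> k z - u n z)\<^sup>2) < inverse (real (Suc n)) \<and> (LINT z|?M. (dx (\<phi> k) z - ux n z)\<^sup>2) < inverse (real (Suc n))
         \<and> (LINT z|?M. (dy (\<phi> k) z - uy n z)\<^sup>2) < inverse (real (Suc n)) \<and> (LINT t|?N. (\<phi> k (linepath a b t) - g (linepath a b t))\<^sup>2) < inverse (real (Suc n))"
        using p by (intro eventually_conj) (auto simp: approx_on_def L2_tendsto_def)
      then obtain k where "(LINT z|?M. (\<phi> k z - u n z)\<^sup>2) < inverse (real (Suc n)) \<and> (LINT z|?M. (dx (\<phi> k) z - ux n z)\<^sup>2) < inverse (real (Suc n))
         \<and> (LINT z|?M. (dy (\<phi> k) z - uy n z)\<^sup>2) < inverse (real (Suc n)) \<and> (LINT t|?N. (\<phi> k (linepath a b t) - g (linepath a b t))\<^sup>2) < inverse (real (Suc n))"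
        using eventually_happens'[OF sequentially_bot] by blast
      then show ?thesis using p by (intro exI[of _ "\<phi> k"]) (auto simp: P_def approx_on_def L2_tendsto_def)
    qed
    then obtain f where f: "\<And>n. P n (f n)" by metis
    have g: "L2_fun ?N (\<lambda>t. g (linepath a b t))" using f unfolding P_def by blast
    have L: "L2_fun ?M (f n)" "L2_fun ?M (dx (f n))" "L2_fun ?M (dy (f n))" "L2_fun ?N (\<lambda>t. f n (linepath a b t))" "smooth (f n)" for n
      using f[of n] unfolding P_def by auto
    have d: "(LINT z|?M. (f n z - u n z)\<^sup>2) \<le> inverse (real (Suc n))" "(LINT z|?M. (dx (f n) z - ux n z)\<^sup>2) \<le> inverse (real (Suc n))"
      "(LINT z|?M. (dy (f n) z - uy n z)\<^sup>2) \<le> inverse (real (Suc n))" "(LINT t|?N. (f n (linepath a b t) - g (linepath a b t))\<^sup>2) \<le> inverse (real (Suc n))" for n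
      using f[of n] unfolding P_def by auto
    show "\<exists>\<phi>. approx_on U w wx wy g a b \<phi>" unfolding approx_on_def
      by (intro exI[of _ f] conjI allI L(5) L2_tendsto_diagonal[OF lim(1) L(1) d(1)] L2_tendsto_diagonal[OF lim(2) L(2) d(2)]
        L2_tendsto_diagonal[OF lim(3) L(3) d(3)] L2_tendsto_diagonal[OF L2_tendsto_const[OF g] L(4) d(4)])
  qed
qed

section \<open>The energy functional on pairs of a field and its gradient\<close>

text \<open>The fields on which the energy is defined. The fourth powers are the growth of the bulk potential.\<close>

definition nice :: "plane set \<Rightarrow> (plane \<Rightarrow> real^3) \<Rightarrow> (plane \<Rightarrow> (real^3) \<times> (real^3)) \<Rightarrow> bool" where
  "nice U q P \<longleftrightarrow> (\<forall>i. L2_fun (lebesgue_on U) (\<lambda>z. q z $ i) \<and> integrable (lebesgue_on U) (\<lambda>z. (q z $ i)^4)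
     \<and> L2_fun (lebesgue_on U) (\<lambda>z. fst (P z) $ i) \<and> L2_fun (lebesgue_on U) (\<lambda>z. snd (P z) $ i))"

lemma niceD:
  assumes "nice U q P"
  shows "L2_fun (lebesgue_on U) (\<lambda>z. q z $ i)" "integrable (lebesgue_on U) (\<lambda>z. (q z $ i)^4)"
    "L2_fun (lebesgue_on U) (\<lambda>z. fst (P z) $ i)" "L2_fun (lebesgue_on U) (\<lambda>z. snd (P z) $ i)"
    "(\<lambda>z. q z $ i) \<in> borel_measurable (lebesgue_on U)"
    "integrable (lebesgue_on U) (\<lambda>z. esq (q z))" "integrable (lebesgue_on U) (\<lambda>z. qs (q z))" "integrable (lebesgue_on U) (\<lambda>z. gsq (P z))"
  using assms L2_D by (auto simp: nice_def esq_def qs_def gsq_def intro!: Bochner_Integration.integrable_sum Bochner_Integration.integrable_add L2_D(2))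

lemma fourth_power_add_integrable:
  assumes "integrable M (\<lambda>z. (f z)^4)" "integrable M (\<lambda>z. (g z)^4)" "f \<in> borel_measurable M" "g \<in> borel_measurable M"
  shows "integrable M (\<lambda>z. (f z + c * g z :: real)^4)"
proof (rule Bochner_Integration.integrable_bound)
  show "integrable M (\<lambda>z. 8 * ((f z)^4 + c^4 * (g z)^4))" using assms by simp
  have "(x + c * y)^4 \<le> 8 * (x^4 + c^4 * y^4)" for x y using fourth_power_add_le[of x "c * y"] by (simp add: power_mult_distrib)
  then show "AE z in M. norm ((f z + c * g z)^4) \<le> norm (8 * ((f z)^4 + c^4 * (g z)^4))"
    by (intro AE_I2) (simp add: zero_le_even_power)
qed (use assms in measurable)

lemma nice_lincomb:
  assumes "nice U q P" "nice U e Q"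
  shows "nice U (\<lambda>z. q z + c *\<^sub>R e z) (\<lambda>z. P z + c *\<^sub>R Q z)"
  using niceD[OF assms(1)] niceD[OF assms(2)] unfolding nice_def
  by (auto intro!: L2_add L2_cmult fourth_power_add_integrable)

text \<open>The two inequalities are the consequences of vanishing boundary values that matter: Poincare's inequality, with the
  constant 4 for \<open>\<bar>x\<bar> \<le> 1\<close>, and control of the quartic bulk terms. The constant 600 is generous and serves both
  the octagon and its fundamental domain.\<close>

definition increment :: "plane set \<Rightarrow> (plane \<Rightarrow> real^3) \<Rightarrow> (plane \<Rightarrow> (real^3) \<times> (real^3)) \<Rightarrow> bool" where
  "increment U e Q \<longleftrightarrow> nice U e Q
     \<and> (LINT z|lebesgue_on U. esq (e z)) \<le> 4 * (LINT z|lebesgue_on U. gsq (Q z))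
     \<and> (LINT z|lebesgue_on U. qs (e z)) \<le> 600 * (LINT z|lebesgue_on U. gsq (Q z))\<^sup>2"

lemma esq_scale: "esq (c *\<^sub>R e) = c\<^sup>2 * esq e" and gsq_scale: "gsq (c *\<^sub>R Q) = c\<^sup>2 * gsq Q"
  by (simp_all add: esq_def gsq_def power_mult_distrib sum_distrib_left distrib_left)

lemma increment_scale:
  assumes "increment U e Q"
  shows "increment U (\<lambda>z. c *\<^sub>R e z) (\<lambda>z. c *\<^sub>R Q z)"
proof -
  have z: "nice U (\<lambda>z. 0) (\<lambda>z. 0)" by (simp add: nice_def L2_zero)
  have "c^4 * (LINT z|lebesgue_on U. qs (e z)) \<le> c^4 * (600 * (LINT z|lebesgue_on U. gsq (Q z))\<^sup>2)"
    using assms by (intro mult_left_mono) (auto simp: increment_def zero_le_even_power)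
  moreover have "c\<^sup>2 * (LINT z|lebesgue_on U. esq (e z)) \<le> c\<^sup>2 * (4 * (LINT z|lebesgue_on U. gsq (Q z)))"
    using assms by (intro mult_left_mono) (auto simp: increment_def)
  ultimately show ?thesis using nice_lincomb[OF z, of e Q c] assms
    by (simp add: increment_def esq_scale qs_scale gsq_scale power_mult_distrib flip: power_mult)
qed

locale energy_fun =
  fixes A B C L2 mu :: real and U :: "plane set"
  assumes pos: "C > 0" "B > 0" "L2 > -1" "mu \<ge> 0" and U: "U \<in> lmeasurable"
    and small: "8 * (mu * KB A B C) \<le> min 1 (1 + L2)"
begin

abbreviation M where "M \<equiv> lebesgue_on U"

definition En where "En q P = (LINT z|M. f_el L2 (P z) + mu * f_b A B C (q z))"
definition ell where "ell q P e Q = (LINT z|M. 2 * bel L2 (P z) (Q z) + mu * fb' A B C (q z) (e z))"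
definition kap where "kap = min 1 (1 + L2)"

lemma kap_pos: "kap > 0" using pos by (simp add: kap_def)

lemma const_integrable: "integrable M (\<lambda>z. c :: real)"
  using finite_measure.integrable_const[OF finite_measure_lebesgue_on[OF U]] .

lemma bel_integrable:
  assumes "nice U q P" "nice U e Q"
  shows "integrable M (\<lambda>z. bel L2 (P z) (Q z))"
  unfolding bel_def using niceD(3,4)[OF assms(1)] niceD(3,4)[OF assms(2)]
  by (intro Bochner_Integration.integrable_add Bochner_Integration.integrable_diff integrable_mult_right L2_mult_integrable)

lemma f_b_integrable:
  assumes "nice U q P"
  shows "integrable M (\<lambda>z. f_b A B C (q z))"
proof (rule Bochner_Integration.integrable_bound)
  show "integrable M (\<lambda>z. MB A B C * (1 + qs (q z)))" using niceD[OF assms] const_integrable by simp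
  show "(\<lambda>z. f_b A B C (q z)) \<in> borel_measurable M"
    unfolding f_b_def using niceD(5)[OF assms] by measurable
  show "AE z in M. norm (f_b A B C (q z)) \<le> norm (MB A B C * (1 + qs (q z)))"
    using f_b_bound by (intro AE_I2) (simp, meson abs_ge_self order_trans)
qed

lemma fb'_integrable:
  assumes "nice U q P" "nice U e Q"
  shows "integrable M (\<lambda>z. fb' A B C (q z) (e z))"
proof (rule Bochner_Integration.integrable_bound)
  show "integrable M (\<lambda>z. YB A B C * (1 * (1 + qs (q z)) + qs (e z) / 1^3))" using niceD[OF assms(1)] niceD[OF assms(2)] const_integrable by simp
  show "(\<lambda>z. fb' A B C (q z) (e z)) \<in> borel_measurable M"
    unfolding fb'_def using niceD(5)[OF assms(1)] niceD(5)[OF assms(2)] by measurable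
  show "AE z in M. norm (fb' A B C (q z) (e z)) \<le> norm (YB A B C * (1 * (1 + qs (q z)) + qs (e z) / 1^3))"
    unfolding real_norm_def by (intro AE_I2 order_trans[OF fb'_young abs_ge_self] pos) simp
qed

lemma En_integrable: "nice U q P \<Longrightarrow> integrable M (\<lambda>z. f_el L2 (P z) + mu * f_b A B C (q z))"
  unfolding f_el_bel using bel_integrable f_b_integrable by simp

lemma ell_integrable: "nice U q P \<Longrightarrow> nice U e Q \<Longrightarrow> integrable M (\<lambda>z. 2 * bel L2 (P z) (Q z) + mu * fb' A B C (q z) (e z))"
  using bel_integrable fb'_integrable by simp

lemma ell_lincomb:
  assumes "nice U q P" "nice U e Q" "nice U d R"
  shows "ell q P (\<lambda>z. e z + c *\<^sub>R d z) (\<lambda>z. Q z + c *\<^sub>R R z) = ell q P e Q + c * ell q P d R"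
proof -
  have "ell q P (\<lambda>z. e z + c *\<^sub>R d z) (\<lambda>z. Q z + c *\<^sub>R R z)
      = (LINT z|M. (2 * bel L2 (P z) (Q z) + mu * fb' A B C (q z) (e z)) + c * (2 * bel L2 (P z) (R z) + mu * fb' A B C (q z) (d z)))"
    unfolding ell_def bel_add fb'_add by (simp add: algebra_simps)
  also have "\<dots> = ell q P e Q + c * ell q P d R"
    unfolding ell_def using ell_integrable[OF assms(1,2)] ell_integrable[OF assms(1,3)] by simp
  finally show ?thesis .
qed

lemma ell_scale:
  assumes "nice U q P" "nice U e Q"
  shows "ell q P (\<lambda>z. c *\<^sub>R e z) (\<lambda>z. c *\<^sub>R Q z) = c * ell q P e Q"
  unfolding ell_def bel_add fb'_add by (simp add: distrib_left mult.left_commute flip: Bochner_Integration.integral_mult_right_zero)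

text \<open>Half of the elastic energy of the increment absorbs the defect of convexity of the bulk energy, by Poincare's
  inequality and the smallness of \<open>mu\<close>.\<close>

lemma En_convex:
  assumes "nice U q P" "increment U e Q"
  shows "En (\<lambda>z. q z + e z) (\<lambda>z. P z + Q z) \<ge> En q P + ell q P e Q + kap / 2 * (LINT z|M. gsq (Q z))"
proof -
  have e: "nice U e Q" using assms by (simp add: increment_def)
  have n: "nice U (\<lambda>z. q z + e z) (\<lambda>z. P z + Q z)" using nice_lincomb[OF assms(1) e, of 1] by simp
  have KB: "KB A B C \<ge> 0" using pos by (simp add: KB_def)
  have "En q P + ell q P e Q + (kap * (LINT z|M. gsq (Q z)) - mu * KB A B C * (LINT z|M. esq (e z)))
      = (LINT z|M. (f_el L2 (P z) + mu * f_b A B C (q z)) + (2 * bel L2 (P z) (Q z) + mu * fb' A B C (q z) (e z)) + (kap * gsq (Q z) - mu * KB A B C * esq (e z)))"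
    unfolding En_def ell_def using En_integrable[OF assms(1)] ell_integrable[OF assms(1) e] niceD[OF e] by simp
  also have "\<dots> \<le> En (\<lambda>z. q z + e z) (\<lambda>z. P z + Q z)"
    unfolding En_def
  proof (intro integral_mono)
    fix z
    have "mu * f_b A B C (q z + e z) \<ge> mu * (f_b A B C (q z) + fb' A B C (q z) (e z) - KB A B C * esq (e z))"
      using f_b_semiconvex pos by (intro mult_left_mono) auto
    then show "(f_el L2 (P z) + mu * f_b A B C (q z)) + (2 * bel L2 (P z) (Q z) + mu * fb' A B C (q z) (e z)) + (kap * gsq (Q z) - mu * KB A B C * esq (e z))
       \<le> f_el L2 (P z + Q z) + mu * f_b A B C (q z + e z)"
      unfolding f_el_add using f_el_coercive[OF pos(3), of "Q z"] by (simp add: kap_def algebra_simps)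
  qed (use En_integrable[OF n] En_integrable[OF assms(1)] ell_integrable[OF assms(1) e] niceD[OF e] in simp_all)
  finally have 1: "En (\<lambda>z. q z + e z) (\<lambda>z. P z + Q z) \<ge> En q P + ell q P e Q + (kap * (LINT z|M. gsq (Q z)) - mu * KB A B C * (LINT z|M. esq (e z)))" .
  have "mu * KB A B C * (LINT z|M. esq (e z)) \<le> mu * KB A B C * (4 * (LINT z|M. gsq (Q z)))"
    using assms KB pos by (intro mult_left_mono) (auto simp: increment_def)
  also have "\<dots> = 8 * (mu * KB A B C) * ((LINT z|M. gsq (Q z)) / 2)" by simp
  also have "\<dots> \<le> kap * ((LINT z|M. gsq (Q z)) / 2)"
    using small gsq_nonneg by (intro mult_right_mono) (auto simp: kap_def intro!: divide_nonneg_nonneg Bochner_Integration.integral_nonneg)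
  finally show ?thesis using 1 by simp
qed

text \<open>Young's inequality with a free parameter replaces Hoelder's inequality with the exponents 4/3 and 4.\<close>

lemma ell_tendsto_0:
  assumes q: "nice U q P" and e: "\<And>n. increment U (e n) (Q n)" and lim: "(\<lambda>n. LINT z|M. gsq (Q n z)) \<longlonglongrightarrow> 0"
  shows "(\<lambda>n. ell q P (e n) (Q n)) \<longlonglongrightarrow> 0"
proof -
  have n: "nice U (e n) (Q n)" for n using e by (simp add: increment_def)
  let ?G = "\<lambda>n. LINT z|M. gsq (Q n z)" and ?q = "LINT z|M. 1 + qs (q z)"
  let ?a = "18 * (3 + \<bar>L2\<bar>)" and ?b = "YB A B C"
  have i: "integrable M (\<lambda>z. 1 + qs (q z))" using niceD[OF q] const_integrable by simp
  have "(\<lambda>n. LINT z|M. bel L2 (P z) (Q n z)) \<longlonglongrightarrow> 0"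
  proof (rule tendsto_0_young[where k = 1])
    show "(\<lambda>n. ?a * ?G n) \<longlonglongrightarrow> 0" using tendsto_mult_left[OF lim, of ?a] by simp
    show "?a * (LINT z|M. gsq (P z)) \<ge> 0" by (simp add: gsq_nonneg)
    fix k and \<eta> :: real assume h: "\<eta> > 0"
    have "\<bar>LINT z|M. bel L2 (P z) (Q k z)\<bar> \<le> (LINT z|M. \<bar>bel L2 (P z) (Q k z)\<bar>)" using integral_abs_bound by blast
    also have "\<dots> \<le> (LINT z|M. ?a * (\<eta> * gsq (P z) + gsq (Q k z) / \<eta>))"
      by (intro integral_mono bel_bound[OF h]) (use bel_integrable[OF q n[of k]] niceD[OF q] niceD[OF n[of k]] in simp_all)
    also have "\<dots> = \<eta> * (?a * (LINT z|M. gsq (P z))) + ?a * ?G k / \<eta> ^ 1"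
      using niceD(8)[OF q] niceD(8)[OF n[of k]] by (simp add: algebra_simps add_divide_distrib)
    finally show "\<bar>LINT z|M. bel L2 (P z) (Q k z)\<bar> \<le> \<eta> * (?a * (LINT z|M. gsq (P z))) + ?a * ?G k / \<eta> ^ 1" .
  qed
  moreover have "(\<lambda>n. LINT z|M. fb' A B C (q z) (e n z)) \<longlonglongrightarrow> 0"
  proof (rule tendsto_0_young[where k = 3])
    show "(\<lambda>n. ?b * (600 * (?G n)\<^sup>2)) \<longlonglongrightarrow> 0" using tendsto_mult_left[OF tendsto_mult_left[OF tendsto_power[OF lim, of 2], of 600], of ?b] by simp
    show "?b * ?q \<ge> 0" using YB_nonneg pos qs_nonneg by (intro mult_nonneg_nonneg Bochner_Integration.integral_nonneg) auto
    fix k and \<eta> :: real assume h: "\<eta> > 0"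
    have "\<bar>LINT z|M. fb' A B C (q z) (e k z)\<bar> \<le> (LINT z|M. \<bar>fb' A B C (q z) (e k z)\<bar>)" using integral_abs_bound by blast
    also have "\<dots> \<le> (LINT z|M. ?b * (\<eta> * (1 + qs (q z)) + qs (e k z) / \<eta>^3))"
      by (intro integral_mono fb'_young[OF h] pos) (use fb'_integrable[OF q n[of k]] i niceD[OF n[of k]] in simp_all)
    also have "\<dots> = ?b * (\<eta> * ?q + (LINT z|M. qs (e k z)) / \<eta>^3)"
      using i niceD(7)[OF n[of k]] by simp
    also have "\<dots> \<le> ?b * (\<eta> * ?q + (600 * (?G k)\<^sup>2) / \<eta>^3)"
      using e[of k] h YB_nonneg pos by (intro mult_left_mono add_left_mono divide_right_mono) (auto simp: increment_def)
    also have "\<dots> = \<eta> * (?b * ?q) + ?b * (600 * (?G k)\<^sup>2) / \<eta>^3" by (simp add: distrib_left)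
    finally show "\<bar>LINT z|M. fb' A B C (q z) (e k z)\<bar> \<le> \<eta> * (?b * ?q) + ?b * (600 * (?G k)\<^sup>2) / \<eta>^3" .
  qed
  ultimately have "(\<lambda>k. 2 * (LINT z|M. bel L2 (P z) (Q k z)) + mu * (LINT z|M. fb' A B C (q z) (e k z))) \<longlonglongrightarrow> 2 * 0 + mu * 0"
    by (intro tendsto_intros)
  moreover have "ell q P (e k) (Q k) = 2 * (LINT z|M. bel L2 (P z) (Q k z)) + mu * (LINT z|M. fb' A B C (q z) (e k z))" for k
    unfolding ell_def using bel_integrable[OF q n[of k]] fb'_integrable[OF q n[of k]] by simp
  ultimately show ?thesis by simp
qed

text \<open>Adding the convexity inequalities in both directions shows that the difference of two critical fields has no
  gradient, and then it vanishes by Poincare's inequality.\<close>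

lemma critical_fields_agree:
  assumes q: "nice U q P" and e: "increment U e Q"
    and z: "ell q P e Q = 0" "ell (\<lambda>z. q z + e z) (\<lambda>z. P z + Q z) e Q = 0"
  shows "AE z in M. e z = 0"
proof -
  have n: "nice U e Q" using e by (simp add: increment_def)
  have p: "nice U (\<lambda>z. q z + e z) (\<lambda>z. P z + Q z)" using nice_lincomb[OF q n, of 1] by simp
  have l: "ell (\<lambda>z. q z + e z) (\<lambda>z. P z + Q z) (\<lambda>z. (-1) *\<^sub>R e z) (\<lambda>z. (-1) *\<^sub>R Q z) = 0"
    unfolding ell_scale[OF p n] using z(2) by simp
  have "En (\<lambda>z. (q z + e z) + (-1) *\<^sub>R e z) (\<lambda>z. (P z + Q z) + (-1) *\<^sub>R Q z) \<ge> En (\<lambda>z. q z + e z) (\<lambda>z. P z + Q z) + 0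
      + kap / 2 * (LINT z|M. gsq ((-1) *\<^sub>R Q z))"
    using En_convex[OF p increment_scale[OF e, of "-1"]] unfolding l .
  then have "En q P \<ge> En (\<lambda>z. q z + e z) (\<lambda>z. P z + Q z) + kap / 2 * (LINT z|M. gsq (Q z))"
    by (simp add: gsq_scale[of "-1", simplified])
  then have "kap * (LINT z|M. gsq (Q z)) \<le> 0" using En_convex[OF q e] z(1) by simp
  then have "(LINT z|M. gsq (Q z)) \<le> 0" using kap_pos by (simp add: mult_le_0_iff)
  then have "(LINT z|M. esq (e z)) \<le> 0" using e by (simp add: increment_def)
  moreover have "(LINT z|M. esq (e z)) \<ge> 0" by (simp add: esq_def sum_nonneg)
  ultimately have "(LINT z|M. esq (e z)) = 0" by linarith
  then have "AE z in M. esq (e z) = 0"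
    using integral_nonneg_eq_0_iff_AE[OF niceD(6)[OF n]] by (simp add: esq_def sum_nonneg)
  then show ?thesis by eventually_elim (auto simp: esq_def sum_nonneg_eq_0_iff vec_eq_iff)
qed

text \<open>If the derivative in the direction \<open>e\<close> were negative, convexity at the point \<open>q + t e\<close>, seen from there
  backwards towards \<open>q\<close>, would make the energy at \<open>q + t e\<close> too small for small \<open>t > 0\<close>.\<close>

lemma minimizer_ell_0:
  assumes q: "nice U q P" and e: "increment U e Q"
    and min: "\<And>t. En (\<lambda>z. q z + t *\<^sub>R e z) (\<lambda>z. P z + t *\<^sub>R Q z) \<ge> En q P"
  shows "ell q P e Q = 0"
proof -
  have ge: "0 \<le> ell q P e Q" if e: "increment U e Q" and min: "\<And>t. En (\<lambda>z. q z + t *\<^sub>R e z) (\<lambda>z. P z + t *\<^sub>R Q z) \<ge> En q P" for e Q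
  proof -
    have n: "nice U e Q" using e by (simp add: increment_def)
    define s where "s k = inverse (real (Suc k))" for k
    have s: "0 < s k" "s k \<le> 1" for k by (auto simp: s_def inverse_le_1_iff)
    have s0: "s \<longlonglongrightarrow> 0" unfolding s_def by (rule LIMSEQ_inverse_real_of_nat)
    define qk Pk where "qk k = (\<lambda>z. q z + s k *\<^sub>R e z)" and "Pk k = (\<lambda>z. P z + s k *\<^sub>R Q z)" for k
    have nk: "nice U (qk k) (Pk k)" for k unfolding qk_def Pk_def by (rule nice_lincomb[OF q n])
    have "0 \<le> ell (qk k) (Pk k) e Q" for k
    proof -
      have "En q P \<ge> En (qk k) (Pk k) + - s k * ell (qk k) (Pk k) e Q + kap / 2 * (LINT z|M. gsq ((- s k) *\<^sub>R Q z))"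
        using En_convex[OF nk[of k] increment_scale[OF e, of "- s k"]] unfolding ell_scale[OF nk n] by (simp add: qk_def Pk_def)
      moreover have "0 \<le> kap / 2 * (LINT z|M. gsq ((- s k) *\<^sub>R Q z))"
        using kap_pos gsq_nonneg by (intro mult_nonneg_nonneg Bochner_Integration.integral_nonneg) auto
      ultimately have "0 \<le> s k * ell (qk k) (Pk k) e Q" using min[of "s k"] unfolding qk_def Pk_def by linarith
      then show ?thesis using s(1)[of k] by (simp add: zero_le_mult_iff)
    qed
    moreover have "(\<lambda>k. ell (qk k) (Pk k) e Q) \<longlonglongrightarrow> ell q P e Q"
    proof -
      note b = bel_integrable[OF q n] bel_integrable[OF n n]
      have "(\<lambda>k. LINT z|M. fb' A B C (qk k z) (e z)) \<longlonglongrightarrow> (LINT z|M. fb' A B C (q z) (e z))"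
      proof (rule integral_dominated_convergence[where w = "\<lambda>z. YB A B C * (1 * (1 + 8 * (qs (q z) + qs (e z))) + qs (e z) / 1^3)"])
        show "integrable M (\<lambda>z. YB A B C * (1 * (1 + 8 * (qs (q z) + qs (e z))) + qs (e z) / 1^3))"
          using niceD(7)[OF q] niceD(7)[OF n] const_integrable by simp
        show "AE z in M. (\<lambda>k. fb' A B C (qk k z) (e z)) \<longlonglongrightarrow> fb' A B C (q z) (e z)"
        proof (intro AE_I2)
          fix z
          have "isCont (\<lambda>t. fb' A B C (q z + t *\<^sub>R e z) (e z)) 0"
            unfolding fb'_def vector_add_component vector_scaleR_component real_scaleR_def by (intro continuous_intros)
          from isCont_tendsto_compose[OF this s0] show "(\<lambda>k. fb' A B C (qk k z) (e z)) \<longlonglongrightarrow> fb' A B C (q z) (e z)" by (simp add: qk_def)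
        qed
        show "AE z in M. norm (fb' A B C (qk k z) (e z)) \<le> YB A B C * (1 * (1 + 8 * (qs (q z) + qs (e z))) + qs (e z) / 1^3)" for k
        proof (intro AE_I2)
          fix z
          have "qs (s k *\<^sub>R e z) \<le> 1 * qs (e z)" unfolding qs_scale using s[of k] by (intro mult_right_mono power_le_one qs_nonneg) auto
          then have "qs (qk k z) \<le> 8 * (qs (q z) + qs (e z))" using qs_add_le[of "q z" "s k *\<^sub>R e z"] by (simp add: qk_def)
          then show "norm (fb' A B C (qk k z) (e z)) \<le> YB A B C * (1 * (1 + 8 * (qs (q z) + qs (e z))) + qs (e z) / 1^3)"
            unfolding real_norm_def using YB_nonneg[OF pos(1)] by (intro order_trans[OF fb'_young[OF zero_less_one pos(1,2)]] mult_left_mono) auto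
        qed
      qed (use fb'_integrable[OF nk n] fb'_integrable[OF q n] in auto)
      then have "(\<lambda>k. 2 * ((LINT z|M. bel L2 (P z) (Q z)) + s k * (LINT z|M. bel L2 (Q z) (Q z))) + mu * (LINT z|M. fb' A B C (qk k z) (e z)))
          \<longlonglongrightarrow> 2 * ((LINT z|M. bel L2 (P z) (Q z)) + 0 * (LINT z|M. bel L2 (Q z) (Q z))) + mu * (LINT z|M. fb' A B C (q z) (e z))"
        by (intro tendsto_intros s0)
      moreover have "bel L2 (Pk k z) (Q z) = bel L2 (P z) (Q z) + s k * bel L2 (Q z) (Q z)" for k z
        using bel_add(1)[of L2 "Q z" "P z" "s k *\<^sub>R Q z"] bel_add(2)[of L2 "Q z" "s k" "Q z"] bel_commute[of L2 "Q z" "P z"]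
          bel_commute[of L2 "Q z" "Pk k z"] by (simp add: Pk_def)
      ultimately show ?thesis unfolding ell_def
        using b fb'_integrable[OF nk n] fb'_integrable[OF q n] by simp
    qed
    ultimately show ?thesis by (intro LIMSEQ_le_const) auto
  qed
  have n: "nice U e Q" using e by (simp add: increment_def)
  have "0 \<le> ell q P (\<lambda>z. (-1) *\<^sub>R e z) (\<lambda>z. (-1) *\<^sub>R Q z)"
    by (rule ge[OF increment_scale[OF e]]) (use min[of "- t" for t] in simp)
  then show ?thesis using ge[OF e min] unfolding ell_scale[OF q n] by simp
qed

end

section \<open>The symmetric extension\<close>

text \<open>The parity of each component under the reflections: \<open>q\<^sub>1\<close> is odd about the diagonals, \<open>q\<^sub>2\<close> is odd about the axes,
  \<open>q\<^sub>3\<close> is even about all of them.\<close>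

definition rho :: "3 \<Rightarrow> real \<times> real \<times> bool \<Rightarrow> real" where
  "rho i g = (case g of (a, b, s) \<Rightarrow> if i = 1 then (if s then -1 else 1) else if i = 2 then a * b else 1)"

lemma rho_sq: "g \<in> D4 \<Longrightarrow> rho i g * rho i g = 1"
  by (erule D4_cases) (auto simp: rho_def)

definition incr1 :: "plane set \<Rightarrow> (plane \<Rightarrow> real) \<Rightarrow> (plane \<Rightarrow> real) \<Rightarrow> (plane \<Rightarrow> real) \<Rightarrow> bool" where
  "incr1 U h hx hy \<longleftrightarrow> L2_fun (lebesgue_on U) h \<and> L2_fun (lebesgue_on U) hx \<and> L2_fun (lebesgue_on U) hy \<and> integrable (lebesgue_on U) (\<lambda>z. (h z)^4)
     \<and> (LINT z|lebesgue_on U. (h z)\<^sup>2) \<le> 4 * ((LINT z|lebesgue_on U. (hx z)\<^sup>2) + (LINT z|lebesgue_on U. (hy z)\<^sup>2))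
     \<and> (LINT z|lebesgue_on U. (h z)^4) \<le> 600 * ((LINT z|lebesgue_on U. (hx z)\<^sup>2) + (LINT z|lebesgue_on U. (hy z)\<^sup>2))\<^sup>2"

lemma gsq_integral:
  assumes "\<And>i. L2_fun M (\<lambda>z. fst (Q z) $ i)" "\<And>i. L2_fun M (\<lambda>z. snd (Q z) $ i)"
  shows "(LINT z|M. gsq (Q z)) = (\<Sum>i\<in>UNIV. (LINT z|M. (fst (Q z) $ i)\<^sup>2) + (LINT z|M. (snd (Q z) $ i)\<^sup>2))"
  unfolding gsq_def using assms[THEN L2_D(2)] by simp

lemma increment_from_components:
  assumes "\<And>i. incr1 U (\<lambda>z. e z $ i) (\<lambda>z. fst (Q z) $ i) (\<lambda>z. snd (Q z) $ i)"
  shows "increment U e Q"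
proof -
  let ?M = "lebesgue_on U"
  define r where "r i = (LINT z|?M. (fst (Q z) $ i)\<^sup>2) + (LINT z|?M. (snd (Q z) $ i)\<^sup>2)" for i
  have a: "L2_fun ?M (\<lambda>z. e z $ i)" "L2_fun ?M (\<lambda>z. fst (Q z) $ i)" "L2_fun ?M (\<lambda>z. snd (Q z) $ i)" "integrable ?M (\<lambda>z. (e z $ i)^4)"
    "(LINT z|?M. (e z $ i)\<^sup>2) \<le> 4 * r i" "(LINT z|?M. (e z $ i)^4) \<le> 600 * (r i)\<^sup>2" for i
    using assms[of i] unfolding incr1_def r_def by blast+
  have r0: "r i \<ge> 0" for i by (simp add: r_def)
  have G: "(LINT z|?M. gsq (Q z)) = (\<Sum>i\<in>UNIV. r i)" unfolding r_def by (rule gsq_integral[OF a(2,3)])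
  have "(LINT z|?M. esq (e z)) = (\<Sum>i\<in>UNIV. LINT z|?M. (e z $ i)\<^sup>2)" unfolding esq_def using L2_D(2)[OF a(1)] by simp
  also have "\<dots> \<le> (\<Sum>i\<in>UNIV. 4 * r i)" by (intro sum_mono a)
  finally have 1: "(LINT z|?M. esq (e z)) \<le> 4 * (\<Sum>i\<in>UNIV. r i)" by (simp add: sum_distrib_left)
  have "(LINT z|?M. qs (e z)) = (\<Sum>i\<in>UNIV. LINT z|?M. (e z $ i)^4)" unfolding qs_def using a(4) by simp
  also have "\<dots> \<le> (\<Sum>i\<in>UNIV. 600 * (r i)\<^sup>2)" by (intro sum_mono a)
  also have "\<dots> = 600 * (\<Sum>i\<in>UNIV. r i * r i)" by (simp add: sum_distrib_left power2_eq_square)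
  also have "\<dots> \<le> 600 * (\<Sum>i\<in>UNIV. r i * (\<Sum>j\<in>UNIV. r j))" using r0 by (intro mult_left_mono sum_mono member_le_sum) auto
  finally have 2: "(LINT z|?M. qs (e z)) \<le> 600 * (\<Sum>i\<in>UNIV. r i)\<^sup>2" by (simp add: sum_distrib_right power2_eq_square)
  show ?thesis unfolding increment_def nice_def G using a 1 2 by blast
qed

lemma smooth_L4: "smooth f \<Longrightarrow> bounded U \<Longrightarrow> U \<in> sets lebesgue \<Longrightarrow> integrable (lebesgue_on U) (\<lambda>z. (f z)^4)"
  using L2_D(2)[OF smooth_L2[OF smooth_mult[of f f]]] by (simp add: power2_eq_square power4_eq_xxxx mult.assoc)

locale lc_problem = domain_eps +
  fixes A B C L2 mu :: real
  assumes pos: "C > 0" "B > 0" "L2 > -1" "mu \<ge> 0" and small: "8 * (mu * KB A B C) \<le> min 1 (1 + L2)"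
begin

sublocale O: energy_fun A B C L2 mu "Omega \<epsilon>" using pos small Omega_lmeasurable by unfold_locales auto
sublocale Q: energy_fun A B C L2 mu "Omega_q \<epsilon>" using pos small Omega_lmeasurable by unfold_locales auto

definition bdry :: "3 \<Rightarrow> plane \<Rightarrow> real" where
  "bdry i = (if i = 1 then q_b A B C \<epsilon> else if i = 2 then (\<lambda>z. 0) else (\<lambda>z. - s_plus A B C / 6))"

definition lift :: "3 \<Rightarrow> plane \<Rightarrow> real" where
  "lift i = (if i = 1 then lift1 (s_plus A B C) \<epsilon> else if i = 2 then (\<lambda>z. 0) else (\<lambda>z. - s_plus A B C / 6))"

lemma smooth_lift: "smooth (lift i)"
  using smooth_lift1 smooth_const by (simp add: lift_def)

lemma lift_bdry: "z \<in> frontier (Omega \<epsilon>) \<Longrightarrow> lift i z = bdry i z"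
  using lift1_boundary by (simp add: lift_def bdry_def)

lemma lift_act: "g \<in> D4 \<Longrightarrow> lift i (act g z) = rho i g * lift i z"
  by (erule D4_cases) (simp add: lift_def rho_def lift1_act)

lemma dx_dy_act:
  assumes f: "smooth f" and g: "(a, b, s) \<in> D4"
  shows "dx (\<lambda>z. f (act (a, b, s) z)) z = (if s then b * dy f (act (a, b, s) z) else a * dx f (act (a, b, s) z))" (is ?A)
    "dy (\<lambda>z. f (act (a, b, s) z)) z = (if s then a * dx f (act (a, b, s) z) else b * dy f (act (a, b, s) z))" (is ?B)
proof -
  have bl: "bounded_linear (act (a, b, s))" using mplD(3)[OF mpl_act[OF g]] .
  show ?A
    using pderiv_affine[OF bl f, of "(1, 0)" 0 z] pderiv_dir_expand[OF f, of "act (a, b, s) (1, 0)" "act (a, b, s) z"] by (simp add: act_def)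
  show ?B
    using pderiv_affine[OF bl f, of "(0, 1)" 0 z] pderiv_dir_expand[OF f, of "act (a, b, s) (0, 1)" "act (a, b, s) z"] by (simp add: act_def)
qed

lemma smooth_act: "smooth f \<Longrightarrow> g \<in> D4 \<Longrightarrow> smooth (\<lambda>z. f (act g z))"
  using smooth_affine[OF mplD(3)[OF mpl_act], of g f 0] by simp

lemma lift_deriv_act:
  assumes g: "(a, b, s) \<in> D4"
  shows "dx (lift i) (act (a, b, s) z) = a * rho i (a, b, s) * (if s then dy (lift i) z else dx (lift i) z)" (is ?A)
    "dy (lift i) (act (a, b, s) z) = b * rho i (a, b, s) * (if s then dx (lift i) z else dy (lift i) z)"
proof -
  have e: "(\<lambda>z. lift i (act (a, b, s) z)) = (\<lambda>z. rho i (a, b, s) * lift i z)" using lift_act[OF g] by blast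
  have ab: "a * a = 1" "b * b = 1" using g by (auto simp: D4_def)
  have "a * (a * x) = x" "b * (b * x) = x" for x using ab by (simp_all flip: mult.assoc)
  then show ?A
    "dy (lift i) (act (a, b, s) z) = b * rho i (a, b, s) * (if s then dx (lift i) z else dy (lift i) z)"
    using dx_dy_act[OF smooth_lift g, of i z] unfolding e pderiv_cmult[OF smooth_lift]
    by (auto simp: mult.assoc split: if_splits)
qed

text \<open>The Dirichlet conditions on the \<open>i\<close>-th component. Those on the diagonal and on the axis are homogeneous for
  every \<open>g\<close>, so that differences of admissible functions satisfy the conditions with \<open>g = 0\<close>.\<close>

definition tr_q :: "3 \<Rightarrow> (plane \<Rightarrow> real) \<Rightarrow> (plane \<Rightarrow> real) \<Rightarrow> bool" where
  "tr_q i u g \<longleftrightarrow> trace_on (Omega_q \<epsilon>) (frontier (Omega_q \<epsilon>) \<inter> frontier (Omega \<epsilon>)) u g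
     \<and> (i = 1 \<longrightarrow> trace_on (Omega_q \<epsilon>) (frontier (Omega_q \<epsilon>) \<inter> {(x, y). y = x}) u (\<lambda>z. 0))
     \<and> (i = 2 \<longrightarrow> trace_on (Omega_q \<epsilon>) (frontier (Omega_q \<epsilon>) \<inter> {(x, y). y = 0}) u (\<lambda>z. 0))"

lemma three_cases: "(\<forall>i::3. P i) \<longleftrightarrow> P 1 \<and> P 2 \<and> P 3"
  using exhaust_3 by metis

lemma admissible_q_iff: "q \<in> admissible_q A B C \<epsilon> \<longleftrightarrow> (\<forall>i. tr_q i (\<lambda>z. q z $ i) (bdry i))"
  unfolding admissible_q_def tr_q_def three_cases Let_def by (auto simp: bdry_def trace_on_def)

lemma admissible_iff: "q \<in> admissible A B C \<epsilon> \<longleftrightarrow> (\<forall>i. trace_on (Omega \<epsilon>) (frontier (Omega \<epsilon>)) (\<lambda>z. q z $ i) (bdry i))"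
  unfolding admissible_def three_cases by (auto simp: bdry_def trace_on_def)

lemma tr_q_lincomb:
  assumes "tr_q i u g" "tr_q i w h"
  shows "tr_q i (\<lambda>z. u z + c * w z) (\<lambda>z. g z + c * h z)"
proof -
  have "trace_on (Omega_q \<epsilon>) \<Gamma> (\<lambda>z. u z + c * w z) (\<lambda>z. 0)" if "trace_on (Omega_q \<epsilon>) \<Gamma> u (\<lambda>z. 0)" "trace_on (Omega_q \<epsilon>) \<Gamma> w (\<lambda>z. 0)" for \<Gamma>
    using trace_on_lincomb[OF Omega_q_open that, of c] by simp
  then show ?thesis using assms trace_on_lincomb[OF Omega_q_open] unfolding tr_q_def by blast
qed

lemma tr_q_smooth:
  assumes "smooth f" "\<And>z. z \<in> frontier (Omega \<epsilon>) \<Longrightarrow> f z = g z" "i = 1 \<Longrightarrow> (\<forall>t. f (t, t) = 0)" "i = 2 \<Longrightarrow> (\<forall>t. f (t, 0) = 0)"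
  shows "tr_q i f g"
  unfolding tr_q_def using assms(2-4) by (intro conjI impI trace_on_cong[OF trace_on_smooth[OF Omega_q_open Omega_q_bounded assms(1)]]) auto

lemma lift_tr_q: "tr_q i (lift i) (bdry i)"
  by (rule tr_q_smooth[OF smooth_lift lift_bdry]) (auto simp: lift_def lift1_diagonal)

lemma tr_q_limit:
  assumes tr: "\<And>n. tr_q i (u n) g" and s: "\<And>n. sobolev (Omega_q \<epsilon>) (u n) (ux n) (uy n)"
    and lim: "L2_tendsto Q.M u w" "L2_tendsto Q.M ux wx" "L2_tendsto Q.M uy wy"
  shows "tr_q i w g" "sobolev (Omega_q \<epsilon>) w wx wy"
  using tr trace_on_limit[OF Omega_q_open _ s lim] unfolding tr_q_def by blast+

text \<open>The components that \<open>rho\<close> reflects oddly are the ones with a Dirichlet condition on the mirror.\<close>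

lemma unfold_tr_q:
  assumes tr: "tr_q i u g" and G: "smooth G" "\<And>z. z \<in> frontier (Omega \<epsilon>) \<Longrightarrow> G z = g z"
    "i = 1 \<Longrightarrow> (\<forall>t. G (t, t) = 0)" "i = 2 \<Longrightarrow> (\<forall>t. G (t, 0) = 0)"
  defines "h \<equiv> \<lambda>z. u z - G z" and "hx \<equiv> \<lambda>z. weak_deriv (Omega_q \<epsilon>) (1, 0) u z - dx G z" and "hy \<equiv> \<lambda>z. weak_deriv (Omega_q \<epsilon>) (0, 1) u z - dy G z"
  shows "W0 (Omega \<epsilon>) (unf (rho i) h) (unf_x (rho i) hx hy) (unf_y (rho i) hx hy)"
proof (rule unfold_W0)
  have o: "trace_on (Omega_q \<epsilon>) (frontier (Omega_q \<epsilon>) \<inter> frontier (Omega \<epsilon>)) u g"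
    and d: "i = 1 \<Longrightarrow> trace_on (Omega_q \<epsilon>) (frontier (Omega_q \<epsilon>) \<inter> {(x, y). y = x}) u (\<lambda>z. 0)"
    and a: "i = 2 \<Longrightarrow> trace_on (Omega_q \<epsilon>) (frontier (Omega_q \<epsilon>) \<inter> {(x, y). y = 0}) u (\<lambda>z. 0)"
    using tr by (auto simp: tr_q_def)
  have z: "zero_trace (Omega_q \<epsilon>) h hx hy T p a b"
    if "mpl T S" "a < b" "\<And>t. p t = \<alpha> + \<beta> * t" "\<And>t. a \<le> t \<Longrightarrow> t \<le> b \<Longrightarrow> T (p t, t) \<in> frontier (Omega_q \<epsilon>) \<inter> frontier (Omega \<epsilon>)" for T S p a b \<alpha> \<beta>
    unfolding h_def hx_def hy_def
    by (rule zero_trace_from_trace_on[OF that(1) Omega_sets(2) Omega_q_bounded o G(1) _ that(2,3,4)]) (use G(2) in auto)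
  show "outer_zero h hx hy" unfolding outer_zero_def
  proof (intro conjI)
    show "zero_trace (Omega_q \<epsilon>) h hx hy (\<lambda>z. z) (\<lambda>t. 1) 0 (1 - \<epsilon>)"
      using eps by (intro z[OF mpl_id, of _ _ _ 1 0] IntI frontier_Omega_qI frontier_OmegaI_abs) auto
    show "zero_trace (Omega_q \<epsilon>) h hx hy (\<lambda>z. z) (\<lambda>t. 2 - \<epsilon> - t) (1 - \<epsilon>) (1 - \<epsilon> / 2)"
      using eps by (intro z[OF mpl_id, of _ _ _ "2 - \<epsilon>" "-1"] IntI frontier_Omega_qI frontier_OmegaI_abs) auto
    show "zero_trace (Omega_q \<epsilon>) h hx hy diag (\<lambda>t. (2 - \<epsilon> - t) / 2) 0 \<epsilon>"
      using eps by (intro z[OF mpl_diag, of _ _ _ "(2 - \<epsilon>) / 2" "-1/2"]) (auto simp: diag_def field_simps intro!: frontier_Omega_qI frontier_OmegaI_abs)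
    show "zero_trace (Omega_q \<epsilon>) h hx hy diag (\<lambda>t. 1 - t) \<epsilon> 1"
      using eps by (intro z[OF mpl_diag, of _ _ _ 1 "-1"]) (auto simp: diag_def intro!: frontier_Omega_qI frontier_OmegaI_abs)
  qed
  show "diag_zero h hx hy \<or> (\<forall>a b s. rho i (a, b, s) = rho i (a, b, False))"
  proof (cases "i = 1")
    case True
    have "zero_trace (Omega_q \<epsilon>) h hx hy (\<lambda>z. z) (\<lambda>t. t) a b" if "0 \<le> a" "a < b" "b \<le> 1 - \<epsilon> / 2" for a b
      unfolding h_def hx_def hy_def
      by (rule zero_trace_from_trace_on[OF mpl_id Omega_sets(2) Omega_q_bounded d[OF True] G(1) _ that(2), where \<alpha> = 0 and \<beta> = 1])
        (use G(3) True eps that in \<open>auto intro!: frontier_Omega_qI\<close>)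
    then show ?thesis using eps by (auto simp: diag_zero_def)
  qed (simp add: rho_def)
  show "axis_zero h hx hy \<or> (\<forall>a b s. rho i (a, b, s) = rho i (1, 1, s))"
  proof (cases "i = 2")
    case True
    have "zero_trace (Omega_q \<epsilon>) h hx hy diag (\<lambda>t. 0) c b" if "0 \<le> c" "c < b" "b \<le> 1" for c b
      unfolding h_def hx_def hy_def
      by (rule zero_trace_from_trace_on[OF mpl_diag Omega_sets(2) Omega_q_bounded a[OF True] G(1) _ that(2), where \<alpha> = 0 and \<beta> = 0])
        (use G(4) True eps that in \<open>auto simp: diag_def intro!: frontier_Omega_qI\<close>)
    then show ?thesis using eps by (auto simp: axis_zero_def)
  qed (simp add: rho_def)
qed

lemma card_D4: "card D4 = 8" by (simp add: D4_def card_cartesian_product)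

text \<open>The inequalities on the fundamental domain follow from those on the octagon for the unfolded function, whose
  integrals are eight copies.\<close>

lemma tr_q_incr1:
  assumes tr: "tr_q i u (\<lambda>z. 0)" and s: "sobolev (Omega_q \<epsilon>) u ux uy"
  shows "incr1 (Omega_q \<epsilon>) u ux uy"
proof -
  define wx wy where "wx = weak_deriv (Omega_q \<epsilon>) (1, 0) u" and "wy = weak_deriv (Omega_q \<epsilon>) (0, 1) u"
  note a = sobolev_AE[OF Omega_q_open s, folded wx_def wy_def]
  have L: "L2_fun Q.M u" "L2_fun Q.M ux" "L2_fun Q.M uy" "L2_fun Q.M wx" "L2_fun Q.M wy"
    using s W12_sobolev[OF sobolev_W12[OF s] Omega_q_open] by (auto simp: sobolev_def wx_def wy_def)
  have I: "(LINT z|Q.M. (wx z)\<^sup>2) = (LINT z|Q.M. (ux z)\<^sup>2)" "(LINT z|Q.M. (wy z)\<^sup>2) = (LINT z|Q.M. (uy z)\<^sup>2)"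
    using L[THEN L2_D(1)] a by (auto intro!: integral_cong_AE)
  have w: "W0 (Omega \<epsilon>) (unf (rho i) u) (unf_x (rho i) wx wy) (unf_y (rho i) wx wy)"
    using unfold_tr_q[OF tr smooth_const[of 0]] by (simp add: wx_def wy_def)
  have p: "(unf (rho i) u (act g z))\<^sup>2 = (u z)\<^sup>2" (is ?A) "(unf (rho i) u (act g z))^4 = (u z)^4" (is ?B)
    "(unf_x (rho i) wx wy (act g z))\<^sup>2 = (if snd (snd g) then (wy z)\<^sup>2 else (wx z)\<^sup>2)" (is ?C)
    "(unf_y (rho i) wx wy (act g z))\<^sup>2 = (if snd (snd g) then (wx z)\<^sup>2 else (wy z)\<^sup>2)" (is ?D) if "g \<in> D4" "z \<in> Omega_q \<epsilon>" for g z
  proof -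
    note gD = that(1)
    obtain a b s where g: "g = (a, b, s)" "a = 1 \<or> a = -1" "b = 1 \<or> b = -1" using D4_cases[OF gD] by metis
    have r: "(rho i g)\<^sup>2 = 1" using rho_sq[OF that(1)] by (simp add: power2_eq_square)
    have r4: "(rho i g)^4 = 1" using rho_sq[OF that(1)] by (simp add: power4_eq_xxxx)
    have ab: "a\<^sup>2 = 1" "b\<^sup>2 = 1" using g by auto
    note u = unf_act[OF that(2) that(1)[unfolded g(1)], folded g(1)]
    show ?A ?B ?C ?D
      by (simp_all add: u power_mult_distrib r r4 ab) (simp_all add: g(1))
  qed
  have cong: "integrable Q.M (\<lambda>z. X (act g z)) \<longleftrightarrow> integrable Q.M (Y g)" "(LINT z|Q.M. X (act g z)) = (LINT z|Q.M. Y g z)"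
    if "\<And>z. z \<in> Omega_q \<epsilon> \<Longrightarrow> X (act g z) = Y g z" for g and X :: "plane \<Rightarrow> real" and Y
    using that by (auto intro!: Bochner_Integration.integrable_cong Bochner_Integration.integral_cong)
  have U: "(LINT z|O.M. X z) = (\<Sum>g\<in>D4. LINT z|Q.M. Y g z)"
    if "\<And>g z. g \<in> D4 \<Longrightarrow> z \<in> Omega_q \<epsilon> \<Longrightarrow> X (act g z) = Y g z" "\<And>g. g \<in> D4 \<Longrightarrow> integrable Q.M (Y g)" for X :: "plane \<Rightarrow> real" and Y
  proof -
    have "(LINT z|O.M. X z) = (\<Sum>g\<in>D4. LINT z|Q.M. X (act g z))"
      by (rule unfold_integral(2)) (use that cong(1)[of X _ Y] in auto)
    then show ?thesis using cong(2)[of X _ Y] that by (simp cong: sum.cong)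
  qed
  let ?G = "(LINT z|Q.M. (ux z)\<^sup>2) + (LINT z|Q.M. (uy z)\<^sup>2)"
  have ii: "integrable Q.M (\<lambda>z. if d then (wx z)\<^sup>2 else (wy z)\<^sup>2)" "integrable Q.M (\<lambda>z. if d then (wy z)\<^sup>2 else (wx z)\<^sup>2)" for d
    using L2_D(2)[OF L(4)] L2_D(2)[OF L(5)] by (cases d; simp)+
  have i4: "integrable Q.M (\<lambda>z. (u z)^4)"
  proof -
    have "integrable Q.M (\<lambda>z. (unf (rho i) u z)^4)"
      by (rule integrable_subset[OF W0_L4(1)[OF w Omega_sets(1)] Omega_sets Omega_q_subset])
    moreover have "unf (rho i) u z ^ 4 = (u z)^4" if "z \<in> Omega_q \<epsilon>" for z
    proof -
      have "(1, 1, False) \<in> D4" "act (1, 1, False) z = z" by (auto simp: D4_def act_def)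
      then show ?thesis using p(2)[OF _ that] by metis
    qed
    ultimately show ?thesis by (subst Bochner_Integration.integrable_cong[OF refl, of _ _ "\<lambda>z. (unf (rho i) u z)^4"]) auto
  qed
  have u2: "(LINT z|O.M. (unf (rho i) u z)\<^sup>2) = 8 * (LINT z|Q.M. (u z)\<^sup>2)"
    using U[of "\<lambda>z. (unf (rho i) u z)\<^sup>2" "\<lambda>g z. (u z)\<^sup>2"] p L2_D(2)[OF L(1)] by (simp add: card_D4)
  have u4: "(LINT z|O.M. (unf (rho i) u z)^4) = 8 * (LINT z|Q.M. (u z)^4)"
    using U[of "\<lambda>z. (unf (rho i) u z)^4" "\<lambda>g z. (u z)^4"] p i4 by (simp add: card_D4)
  have ux2: "(LINT z|O.M. (unf_x (rho i) wx wy z)\<^sup>2) = 4 * ?G"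
    using U[of "\<lambda>z. (unf_x (rho i) wx wy z)\<^sup>2" "\<lambda>g z. if snd (snd g) then (wy z)\<^sup>2 else (wx z)\<^sup>2"] p ii I by (simp add: D4_sum)
  have uy2: "(LINT z|O.M. (unf_y (rho i) wx wy z)\<^sup>2) = 4 * ?G"
    using U[of "\<lambda>z. (unf_y (rho i) wx wy z)\<^sup>2" "\<lambda>g z. if snd (snd g) then (wx z)\<^sup>2 else (wy z)\<^sup>2"] p ii I by (simp add: D4_sum)
  have G0: "?G \<ge> 0" by simp
  have P: "(LINT z|Q.M. (u z)\<^sup>2) \<le> 2 * ?G"
    using W0_poincare[OF w Omega_sets(1)] unfolding u2 ux2 by (simp add: Omega_iff)
  have "8 * (LINT z|Q.M. (u z)^4) \<le> (8 * (LINT z|Q.M. (u z)\<^sup>2) + 4 * ?G + 4 * ?G)\<^sup>2"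
    using W0_L4(2)[OF w Omega_sets(1)] unfolding u2 u4 ux2 uy2 .
  also have "\<dots> \<le> (24 * ?G)\<^sup>2" using P G0 by (intro power_mono) auto
  also have "\<dots> = 576 * ?G\<^sup>2" by (simp only: power_mult_distrib) simp
  finally have "(LINT z|Q.M. (u z)^4) \<le> 72 * ?G\<^sup>2" by linarith
  then have "(LINT z|Q.M. (u z)^4) \<le> 600 * ?G\<^sup>2" using zero_le_power2[of ?G] by linarith
  moreover have "(LINT z|Q.M. (u z)\<^sup>2) \<le> 4 * ?G" by (rule order_trans[OF P]) simp
  ultimately show ?thesis unfolding incr1_def using L i4 by blast
qed

lemma W0_incr1:
  assumes w: "W0 (Omega \<epsilon>) h hx hy"
  shows "incr1 (Omega \<epsilon>) h hx hy"
proof -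
  let ?G = "(LINT z|O.M. (hx z)\<^sup>2) + (LINT z|O.M. (hy z)\<^sup>2)"
  have "(LINT z|O.M. (h z)\<^sup>2) \<le> 4 * (LINT z|O.M. (hx z)\<^sup>2)"
    using W0_poincare[OF w Omega_sets(1)] by (simp add: Omega_iff)
  also have "\<dots> \<le> 4 * ?G" by simp
  finally have P: "(LINT z|O.M. (h z)\<^sup>2) \<le> 4 * ?G" .
  have "(LINT z|O.M. (h z)^4) \<le> ((LINT z|O.M. (h z)\<^sup>2) + (LINT z|O.M. (hx z)\<^sup>2) + (LINT z|O.M. (hy z)\<^sup>2))\<^sup>2"
    by (rule W0_L4(2)[OF w Omega_sets(1)])
  also have "\<dots> \<le> (5 * ?G)\<^sup>2" using P by (intro power_mono) auto
  also have "\<dots> = 25 * ?G\<^sup>2" by (simp only: power_mult_distrib) simp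
  also have "\<dots> \<le> 600 * ?G\<^sup>2" by simp
  finally show ?thesis unfolding incr1_def using P W0_D[OF w] W0_L4(1)[OF w Omega_sets(1)] by blast
qed

definition fields :: "(3 \<Rightarrow> plane \<Rightarrow> real) \<Rightarrow> (plane \<Rightarrow> real^3) \<Rightarrow> (plane \<Rightarrow> (real^3) \<times> (real^3)) \<Rightarrow> bool" where
  "fields f q P \<longleftrightarrow> (\<forall>i. tr_q i (\<lambda>z. q z $ i) (f i) \<and> sobolev (Omega_q \<epsilon>) (\<lambda>z. q z $ i) (\<lambda>z. fst (P z) $ i) (\<lambda>z. snd (P z) $ i))"

lemma fields_lincomb:
  assumes "fields f q P" "fields h e Q"
  shows "fields (\<lambda>i z. f i z + c * h i z) (\<lambda>z. q z + c *\<^sub>R e z) (\<lambda>z. P z + c *\<^sub>R Q z)"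
  using assms tr_q_lincomb sobolev_lincomb[OF Omega_sets(2)] unfolding fields_def by simp

abbreviation no_bdry :: "3 \<Rightarrow> plane \<Rightarrow> real" where "no_bdry \<equiv> \<lambda>i z. 0"

lemma fields_0_increment: "fields no_bdry e Q \<Longrightarrow> increment (Omega_q \<epsilon>) e Q"
  unfolding fields_def by (intro increment_from_components tr_q_incr1) blast+

lemma fields_diff: "fields f p R \<Longrightarrow> fields f q P \<Longrightarrow> fields no_bdry (\<lambda>z. p z - q z) (\<lambda>z. R z - P z)"
  using fields_lincomb[of f p R f q P "-1"] by simp

lemma fields_add: "fields f q P \<Longrightarrow> fields no_bdry e Q \<Longrightarrow> fields f (\<lambda>z. q z + c *\<^sub>R e z) (\<lambda>z. P z + c *\<^sub>R Q z)"
  using fields_lincomb[of f q P no_bdry e Q c] by simp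

lemma grad_component: "fst (grad \<phi> z) $ i = dx (\<lambda>w. \<phi> w $ i) z" "snd (grad \<phi> z) $ i = dy (\<lambda>w. \<phi> w $ i) z"
  "fst (weak_grad U q z) $ i = weak_deriv U (1, 0) (\<lambda>w. q w $ i) z" "snd (weak_grad U q z) $ i = weak_deriv U (0, 1) (\<lambda>w. q w $ i) z"
  by (simp_all add: grad_def weak_grad_def)

lemma fields_smooth:
  assumes "\<And>i. smooth (\<lambda>z. \<phi> z $ i)" "\<And>i. tr_q i (\<lambda>z. \<phi> z $ i) (f i)"
  shows "fields f \<phi> (grad \<phi>)"
  using assms smooth_sobolev[OF _ Omega_q_bounded Omega_sets(2)] by (simp add: fields_def grad_component)

definition lift_field :: "plane \<Rightarrow> real^3" where "lift_field z = (\<chi> i. lift i z)"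

lemma lift_fields: "fields bdry lift_field (grad lift_field)"
  by (rule fields_smooth) (simp_all add: lift_field_def smooth_lift lift_tr_q)

lemma smooth_nice: "(\<And>i. smooth (\<lambda>z. \<phi> z $ i)) \<Longrightarrow> bounded U \<Longrightarrow> U \<in> sets lebesgue \<Longrightarrow> nice U \<phi> (grad \<phi>)"
  unfolding nice_def by (auto simp: grad_component intro!: smooth_L2 smooth_L4 smooth_pderiv)

lemma fields_bdry_nice:
  assumes "fields bdry q P"
  shows "nice (Omega_q \<epsilon>) q P"
proof -
  have "nice (Omega_q \<epsilon>) (\<lambda>z. q z - lift_field z) (\<lambda>z. P z - grad lift_field z)"
    using fields_0_increment[OF fields_diff[OF assms lift_fields]] by (simp add: increment_def)
  from nice_lincomb[OF this smooth_nice[OF _ Omega_q_bounded Omega_sets(2), of lift_field], of 1]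
  show ?thesis by (simp add: lift_field_def smooth_lift)
qed

lemma admissible_q_fields: "q \<in> admissible_q A B C \<epsilon> \<longleftrightarrow> fields bdry q (weak_grad (Omega_q \<epsilon>) q)"
  unfolding admissible_q_iff fields_def grad_component
  using W12_sobolev[OF _ Omega_q_open] by (auto simp: tr_q_def trace_on_def)

lemma weak_grad_AE:
  assumes "open U" "\<And>i. sobolev U (\<lambda>z. q z $ i) (\<lambda>z. fst (P z) $ i) (\<lambda>z. snd (P z) $ i)"
  shows "AE z in lebesgue_on U. weak_grad U q z = P z"
proof -
  have "AE z in lebesgue_on U. \<forall>i\<in>UNIV. weak_deriv U (1, 0) (\<lambda>z. q z $ i) z = fst (P z) $ i \<and> weak_deriv U (0, 1) (\<lambda>z. q z $ i) z = snd (P z) $ i"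
    by (rule AE_finite_allI) (use sobolev_AE[OF assms(1) assms(2)] in auto)
  then show ?thesis by eventually_elim (simp add: prod_eq_iff vec_eq_iff grad_component)
qed

lemma fields_energy:
  assumes "fields bdry q P"
  shows "q \<in> admissible_q A B C \<epsilon>" "Q.En q (weak_grad (Omega_q \<epsilon>) q) = Q.En q P" (is ?A)
proof -
  have s: "sobolev (Omega_q \<epsilon>) (\<lambda>z. q z $ i) (\<lambda>z. fst (P z) $ i) (\<lambda>z. snd (P z) $ i)" for i using assms by (simp add: fields_def)
  show q: "q \<in> admissible_q A B C \<epsilon>" using assms by (simp add: admissible_q_iff fields_def)
  then have n: "nice (Omega_q \<epsilon>) q (weak_grad (Omega_q \<epsilon>) q)" using admissible_q_fields fields_bdry_nice by blast
  show ?A unfolding Q.En_def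
    using Q.En_integrable[OF n] Q.En_integrable[OF fields_bdry_nice[OF assms]] weak_grad_AE[OF Omega_q_open s]
    by (intro integral_cong_AE) (auto elim: eventually_mono)
qed

text \<open>The gradient of the symmetric extension, by the chain rule.\<close>

definition ext_grad :: "(plane \<Rightarrow> (real^3) \<times> (real^3)) \<Rightarrow> plane \<Rightarrow> (real^3) \<times> (real^3)" where
  "ext_grad P z = (\<chi> i. unf_x (rho i) (\<lambda>z. fst (P z) $ i) (\<lambda>z. snd (P z) $ i) z, \<chi> i. unf_y (rho i) (\<lambda>z. fst (P z) $ i) (\<lambda>z. snd (P z) $ i) z)"

lemma symmetric_extension_act:
  assumes "z \<in> Omega_q \<epsilon>" "g \<in> D4"
  shows "symmetric_extension q (act g z) $ i = rho i g * q z $ i"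
proof -
  obtain a b s where g: "g = (a, b, s)" "a = 1 \<or> a = -1" "b = 1 \<or> b = -1" using D4_cases[OF assms(2)] by metis
  obtain x y where z: "z = (x, y)" by (cases z)
  have xy: "0 < y" "y < x" "0 < x" using assms(1) by (auto simp: z Omega_q_iff)
  define x' y' where "x' = fst (act g z)" and "y' = snd (act g z)"
  have xy': "\<bar>x'\<bar> = (if s then y else x)" "\<bar>y'\<bar> = (if s then x else y)"
    using g(2,3) xy by (auto simp: x'_def y'_def g(1) z act_def)
  have s1: "sgn (\<bar>x'\<bar> - \<bar>y'\<bar>) = (if s then -1 else 1)" using xy by (simp add: xy')
  have w: "(max \<bar>x'\<bar> \<bar>y'\<bar>, min \<bar>x'\<bar> \<bar>y'\<bar>) = z" using xy by (simp add: xy' z)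
  have "x' * y' = a * b * (x * y)" by (simp add: x'_def y'_def g(1) z act_def)
  then have s2: "sgn (x' * y') = a * b" using xy g(2,3) by (auto simp: sgn_mult)
  have "symmetric_extension q (x', y') = vector [sgn (\<bar>x'\<bar> - \<bar>y'\<bar>) * q z $ 1, sgn (x' * y') * q z $ 2, q z $ 3]"
    unfolding symmetric_extension_def Let_def prod.case w ..
  then have "symmetric_extension q (act g z) = vector [(if s then -1 else 1) * q z $ 1, a * b * q z $ 2, q z $ 3]"
    unfolding s1 s2 by (simp add: x'_def y'_def)
  then show ?thesis using exhaust_3[of i] by (auto simp: g(1) rho_def)
qed

text \<open>The smooth lift of the boundary data has the same symmetry as the extension, so both unfold together, and the
  extension lies in \<open>W\<^sup>1\<^sup>,\<^sup>2\<close> and keeps the boundary values on the whole octagon.\<close>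

lemma symmetric_extension_W0:
  assumes q: "q \<in> admissible_q A B C \<epsilon>"
  defines "P \<equiv> weak_grad (Omega_q \<epsilon>) q"
  shows "W0 (Omega \<epsilon>) (\<lambda>z. symmetric_extension q z $ i - lift i z) (\<lambda>z. fst (ext_grad P z) $ i - dx (lift i) z) (\<lambda>z. snd (ext_grad P z) $ i - dy (lift i) z)"
proof -
  have tr: "tr_q i (\<lambda>z. q z $ i) (bdry i)" using q by (simp add: admissible_q_iff)
  note w = unfold_tr_q[OF tr smooth_lift lift_bdry]
  show ?thesis
  proof (rule W0_cong_AE[OF w Omega_sets(1) AE_unfold AE_unfold AE_unfold])
    fix z g assume z: "z \<in> Omega_q \<epsilon>" and g: "g \<in> D4"
    obtain a b s where gd: "g = (a, b, s)" using D4_cases[OF g] by metis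
    note u = unf_act[OF z g[unfolded gd], folded gd] and l = lift_deriv_act[OF g[unfolded gd], folded gd]
    show "unf (rho i) (\<lambda>z. q z $ i - lift i z) (act g z) = symmetric_extension q (act g z) $ i - lift i (act g z)"
      unfolding u symmetric_extension_act[OF z g] lift_act[OF g] by (simp add: algebra_simps)
    show "unf_x (rho i) (\<lambda>z. weak_deriv (Omega_q \<epsilon>) (1, 0) (\<lambda>z. q z $ i) z - dx (lift i) z) (\<lambda>z. weak_deriv (Omega_q \<epsilon>) (0, 1) (\<lambda>z. q z $ i) z - dy (lift i) z) (act g z)
        = fst (ext_grad P (act g z)) $ i - dx (lift i) (act g z)"
      by (simp add: ext_grad_def u l P_def grad_component algebra_simps)
    show "unf_y (rho i) (\<lambda>z. weak_deriv (Omega_q \<epsilon>) (1, 0) (\<lambda>z. q z $ i) z - dx (lift i) z) (\<lambda>z. weak_deriv (Omega_q \<epsilon>) (0, 1) (\<lambda>z. q z $ i) z - dy (lift i) z) (act g z)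
        = snd (ext_grad P (act g z)) $ i - dy (lift i) (act g z)"
      by (simp add: ext_grad_def u l P_def grad_component algebra_simps)
  qed (auto simp: lift_def lift1_diagonal)
qed

end

section \<open>Existence of minimizers\<close>

text \<open>The cubic term is at most quadratic in \<open>N\<close> with a small leading coefficient; then complete the square in \<open>N\<close>.\<close>

lemma f_b_bounded_below:
  assumes "C > 0" "B > 0"
  shows "f_b A B C q \<ge> - (3 * (\<bar>A\<bar> + B\<^sup>2 / C)\<^sup>2 / (8 * C))"
proof -
  define N where "N = (q $ 1)\<^sup>2 + (q $ 2)\<^sup>2 + 3 * (q $ 3)\<^sup>2"
  define k where "k = \<bar>A\<bar> + B\<^sup>2 / C"
  define x where "x = q $ 3"
  have N: "N \<ge> 0" "3 * x\<^sup>2 \<le> N" by (simp_all add: N_def x_def)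
  have "\<bar>(q $ 1)\<^sup>2 + (q $ 2)\<^sup>2 - x\<^sup>2\<bar> \<le> N" by (auto simp: N_def x_def abs_le_iff)
  then have "\<bar>2 * B * x * ((q $ 1)\<^sup>2 + (q $ 2)\<^sup>2 - x\<^sup>2)\<bar> \<le> 2 * B * \<bar>x\<bar> * N"
    by (rule prod_le[rotated]) (use assms in \<open>simp add: abs_mult\<close>)
  moreover have "2 * B * \<bar>x\<bar> * N \<le> (C * N / 3 + B\<^sup>2 / C) * N"
  proof (rule mult_right_mono[OF _ N(1)])
    have "0 \<le> (C * \<bar>x\<bar> - B)\<^sup>2 / C" using assms by simp
    also have "\<dots> = C * x\<^sup>2 - 2 * B * \<bar>x\<bar> + B\<^sup>2 / C" using assms by (simp add: power2_diff field_simps power2_eq_square)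
    finally have "2 * B * \<bar>x\<bar> \<le> C * x\<^sup>2 + B\<^sup>2 / C" by simp
    moreover have "C * x\<^sup>2 \<le> C * (N / 3)" using N assms by (intro mult_left_mono) auto
    ultimately show "2 * B * \<bar>x\<bar> \<le> C * N / 3 + B\<^sup>2 / C" by simp
  qed
  ultimately have 1: "2 * B * x * ((q $ 1)\<^sup>2 + (q $ 2)\<^sup>2 - x\<^sup>2) \<ge> - ((C * N / 3 + B\<^sup>2 / C) * N)"
    by (meson abs_le_D2 minus_le_iff order_trans)
  have "A * N \<ge> - \<bar>A\<bar> * N" using N by (intro mult_right_mono) auto
  then have "f_b A B C q \<ge> - \<bar>A\<bar> * N + C * N\<^sup>2 - (C * N / 3 + B\<^sup>2 / C) * N"
    using 1 unfolding f_b_def x_def N_def[symmetric] by linarith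
  also have "- \<bar>A\<bar> * N + C * N\<^sup>2 - (C * N / 3 + B\<^sup>2 / C) * N = 2 * C / 3 * (N - 3 * k / (4 * C))\<^sup>2 - 3 * k\<^sup>2 / (8 * C)"
    unfolding k_def using assms by (simp add: power2_eq_square field_simps)
  also have "\<dots> \<ge> - (3 * k\<^sup>2 / (8 * C))" using assms by simp
  finally show ?thesis by (simp add: k_def)
qed

context lc_problem
begin

lemma En_bounded_below: "\<exists>m. \<forall>q P. fields bdry q P \<longrightarrow> Q.En q P \<ge> m"
proof -
  define c where "c = mu * - (3 * (\<bar>A\<bar> + B\<^sup>2 / C)\<^sup>2 / (8 * C))"
  have "Q.En q P \<ge> (LINT z|Q.M. c)" if "fields bdry q P" for q P
    unfolding Q.En_def
  proof (intro integral_mono Q.En_integrable fields_bdry_nice that Q.const_integrable)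
    fix z
    have "c \<le> mu * f_b A B C (q z)" unfolding c_def by (rule mult_left_mono[OF f_b_bounded_below pos(4)]) (use pos in auto)
    moreover have "0 \<le> f_el L2 (P z)"
      using order_trans[OF mult_nonneg_nonneg[OF _ gsq_nonneg] f_el_coercive[OF pos(3)]] pos by auto
    ultimately show "c \<le> f_el L2 (P z) + mu * f_b A B C (q z)" by linarith
  qed
  then show ?thesis by blast
qed

text \<open>Expanding the energy about the midpoint towards both ends, the linear terms cancel, and the midpoint competes
  for the infimum.\<close>

lemma midpoint_convexity:
  assumes f: "fields bdry q P" "fields bdry p R" and I: "\<And>q P. fields bdry q P \<Longrightarrow> I \<le> Q.En q P"
  shows "Q.kap / 4 * (LINT z|Q.M. gsq (P z - R z)) \<le> Q.En q P + Q.En p R - 2 * I"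
proof -
  define e Q' where "e = (\<lambda>z. q z - p z)" and "Q' = (\<lambda>z. P z - R z)"
  have e: "fields no_bdry e Q'" unfolding e_def Q'_def by (rule fields_diff[OF f])
  define m N where "m = (\<lambda>z. p z + (1/2) *\<^sub>R e z)" and "N = (\<lambda>z. R z + (1/2) *\<^sub>R Q' z)"
  have m: "fields bdry m N" unfolding m_def N_def by (rule fields_add[OF f(2) e])
  note mn = fields_bdry_nice[OF m] and inc = fields_0_increment[OF e]
  have half: "(1/2) *\<^sub>R x + (1/2) *\<^sub>R x = x" for x :: "'b::real_vector" by (simp flip: scaleR_add_left)
  have 1: "Q.En q P \<ge> Q.En m N + Q.ell m N (\<lambda>z. (1/2) *\<^sub>R e z) (\<lambda>z. (1/2) *\<^sub>R Q' z) + Q.kap / 2 * (LINT z|Q.M. gsq ((1/2) *\<^sub>R Q' z))"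
  proof -
    have "(\<lambda>z. m z + (1/2) *\<^sub>R e z) = q" "(\<lambda>z. N z + (1/2) *\<^sub>R Q' z) = P"
      by (simp_all add: fun_eq_iff m_def N_def add.assoc half) (simp_all add: e_def Q'_def)
    then show ?thesis using Q.En_convex[OF mn increment_scale[OF inc, of "1/2"]] by simp
  qed
  have 2: "Q.En p R \<ge> Q.En m N + Q.ell m N (\<lambda>z. (-1/2) *\<^sub>R e z) (\<lambda>z. (-1/2) *\<^sub>R Q' z) + Q.kap / 2 * (LINT z|Q.M. gsq ((-1/2) *\<^sub>R Q' z))"
    using Q.En_convex[OF mn increment_scale[OF inc, of "-1/2"]] by (simp add: m_def N_def)
  have n: "nice (Omega_q \<epsilon>) e Q'" using inc by (simp add: increment_def)
  note l = Q.ell_scale[OF mn n]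
  have g: "(LINT z|Q.M. gsq ((1/2) *\<^sub>R Q' z)) = (LINT z|Q.M. gsq (Q' z)) / 4" "(LINT z|Q.M. gsq ((-1/2) *\<^sub>R Q' z)) = (LINT z|Q.M. gsq (Q' z)) / 4"
    unfolding gsq_scale by (simp_all add: power2_eq_square)
  show ?thesis using 1 2 I[OF m] unfolding l g by (simp add: Q'_def)
qed

text \<open>By the previous lemma a minimizing sequence is Cauchy in \<open>W\<^sup>1\<^sup>,\<^sup>2\<close>. Convexity at the limit bounds the energy of the limit
  by the energies along the sequence up to a linear term that tends to zero.\<close>

lemma minimizing_fields: "\<exists>q P. fields bdry q P \<and> (\<forall>p R. fields bdry p R \<longrightarrow> Q.En q P \<le> Q.En p R)"
proof -
  define s where "s n = inverse (real (Suc n))" for n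
  have s0: "s \<longlonglongrightarrow> 0" unfolding s_def by (rule LIMSEQ_inverse_real_of_nat)
  define S where "S = {Q.En q P | q P. fields bdry q P}"
  define I where "I = Inf S"
  have ne: "S \<noteq> {}" using lift_fields by (auto simp: S_def)
  have bdd: "bdd_below S" using En_bounded_below unfolding S_def bdd_below_def by blast
  have I: "I \<le> Q.En q P" if "fields bdry q P" for q P
    unfolding I_def by (rule cInf_lower[OF _ bdd]) (use that in \<open>auto simp: S_def\<close>)
  have "\<exists>q P. fields bdry q P \<and> Q.En q P < I + s n" for n
  proof -
    have "I < I + s n" by (simp add: s_def)
    then have "\<exists>e\<in>S. e < I + s n" using cInf_less_iff[OF ne bdd] unfolding I_def by blast
    then show ?thesis by (auto simp: S_def)
  qed
  then obtain q P where f: "\<And>n. fields bdry (q n) (P n)" and E: "\<And>n. Q.En (q n) (P n) < I + s n" by metis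
  have inc: "increment (Omega_q \<epsilon>) (\<lambda>z. q i z - q j z) (\<lambda>z. P i z - P j z)" for i j
    by (rule fields_0_increment[OF fields_diff[OF f f]])
  have d: "(LINT z|Q.M. gsq (P i z - P j z)) \<le> 4 / Q.kap * (s i + s j)" for i j
  proof -
    have k: "x \<le> 4 / Q.kap * y" if "Q.kap / 4 * x \<le> y" for x y using that Q.kap_pos by (simp add: field_simps)
    show ?thesis by (rule k) (use midpoint_convexity[OF f[of i] f[of j] I] E[of i] E[of j] in linarith)
  qed
  have d1: "(LINT z|Q.M. (fst (P i z) $ k - fst (P j z) $ k)\<^sup>2) \<le> 16 / Q.kap * (s i + s j)" (is ?A)
    "(LINT z|Q.M. (snd (P i z) $ k - snd (P j z) $ k)\<^sup>2) \<le> 16 / Q.kap * (s i + s j)" (is ?B)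
    "(LINT z|Q.M. (q i z $ k - q j z $ k)\<^sup>2) \<le> 16 / Q.kap * (s i + s j)" (is ?C) for i j k
  proof -
    have n: "nice (Omega_q \<epsilon>) (\<lambda>z. q i z - q j z) (\<lambda>z. P i z - P j z)" using inc by (simp add: increment_def)
    let ?G = "LINT z|Q.M. gsq (P i z - P j z)"
    have G: "?G \<ge> 0" by (simp add: gsq_nonneg)
    have "(LINT z|Q.M. (fst (P i z) $ k - fst (P j z) $ k)\<^sup>2) \<le> ?G"
      using gsq_component(1)[of "P i _ - P j _" k] L2_D(2)[OF niceD(3)[OF n, of k]] niceD(8)[OF n] by (intro integral_mono) auto
    moreover have "(LINT z|Q.M. (snd (P i z) $ k - snd (P j z) $ k)\<^sup>2) \<le> ?G"
      using gsq_component(2)[of "P i _ - P j _" k] L2_D(2)[OF niceD(4)[OF n, of k]] niceD(8)[OF n] by (intro integral_mono) auto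
    moreover have "(LINT z|Q.M. (q i z $ k - q j z $ k)\<^sup>2) \<le> (LINT z|Q.M. esq (q i z - q j z))"
    proof (intro integral_mono)
      show "(q i z $ k - q j z $ k)\<^sup>2 \<le> esq (q i z - q j z)" for z
        unfolding esq_def using member_le_sum[of k UNIV "\<lambda>k. ((q i z - q j z) $ k)\<^sup>2"] by simp
    qed (use L2_D(2)[OF niceD(1)[OF n, of k]] niceD(6)[OF n] in auto)
    moreover have "\<dots> \<le> 4 * ?G" using inc[of i j] by (simp add: increment_def)
    moreover have "4 * ?G \<le> 4 * (4 / Q.kap * (s i + s j))" by (rule mult_left_mono[OF d]) simp
    moreover have "\<dots> = 16 / Q.kap * (s i + s j)" by simp
    moreover have "?G \<le> 4 * ?G" using G by simp
    ultimately show ?A ?B ?C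
      by linarith+
  qed
  have C: "\<exists>N. \<forall>i\<ge>N. \<forall>j\<ge>N. 16 / Q.kap * (s i + s j) < e" if e: "e > 0" for e
  proof -
    have "(\<lambda>n. 32 / Q.kap * s n) \<longlonglongrightarrow> 0"
      using tendsto_mult_left[OF s0, of "32 / Q.kap"] by simp
    then have "\<forall>\<^sub>F n in sequentially. 32 / Q.kap * s n < e" using order_tendstoD(2)[OF _ e] by blast
    then obtain N where N: "32 / Q.kap * s N < e" using eventually_happens'[OF sequentially_bot] by blast
    have "16 / Q.kap * (s i + s j) < e" if "i \<ge> N" "j \<ge> N" for i j
    proof -
      have "s i \<le> s N" "s j \<le> s N"
        using that by (auto simp: s_def intro!: le_imp_inverse_le)
      then have "16 / Q.kap * (s i + s j) \<le> 16 / Q.kap * (2 * s N)"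
        by (intro mult_left_mono; (linarith | use Q.kap_pos in simp))
      then show ?thesis using N by simp
    qed
    then show ?thesis by blast
  qed
  note fin = finite_measure_lebesgue_on[OF Omega_lmeasurable(2)]
  have n: "nice (Omega_q \<epsilon>) (q i) (P i)" for i by (rule fields_bdry_nice[OF f])
  have L: "\<exists>u. L2_tendsto Q.M h u" if "\<And>n. L2_fun Q.M (h n)"
    "\<And>i j. (LINT z|Q.M. (h i z - h j z)\<^sup>2) \<le> 16 / Q.kap * (s i + s j)" for h
  proof (rule finite_measure.L2_complete[OF fin that(1)])
    fix e :: real assume "e > 0"
    from C[OF this] obtain N where "\<forall>i\<ge>N. \<forall>j\<ge>N. 16 / Q.kap * (s i + s j) < e" by blast
    then show "\<exists>N. \<forall>i\<ge>N. \<forall>j\<ge>N. (LINT z|Q.M. (h i z - h j z)\<^sup>2) < e"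
      by (intro exI[of _ N] allI impI order_le_less_trans[OF that(2)]) auto
  qed
  have "\<exists>u. L2_tendsto Q.M (\<lambda>n z. q n z $ k) u" for k by (rule L) (rule niceD[OF n], rule d1)
  moreover have "\<exists>u. L2_tendsto Q.M (\<lambda>n z. fst (P n z) $ k) u" for k by (rule L) (rule niceD[OF n], rule d1)
  moreover have "\<exists>u. L2_tendsto Q.M (\<lambda>n z. snd (P n z) $ k) u" for k by (rule L) (rule niceD[OF n], rule d1)
  ultimately obtain u ux uy where lim: "\<And>k. L2_tendsto Q.M (\<lambda>n z. q n z $ k) (u k)" "\<And>k. L2_tendsto Q.M (\<lambda>n z. fst (P n z) $ k) (ux k)" "\<And>k. L2_tendsto Q.M (\<lambda>n z. snd (P n z) $ k) (uy k)"
    by metis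
  define v R where "v = (\<lambda>z. (\<chi> k. u k z) :: real^3)" and "R = (\<lambda>z. ((\<chi> k. ux k z) :: real^3, (\<chi> k. uy k z) :: real^3))"
  have v: "fields bdry v R" unfolding fields_def
  proof (intro allI)
    fix k
    show "tr_q k (\<lambda>z. v z $ k) (bdry k) \<and> sobolev (Omega_q \<epsilon>) (\<lambda>z. v z $ k) (\<lambda>z. fst (R z) $ k) (\<lambda>z. snd (R z) $ k)"
      using tr_q_limit[OF _ _ lim(1,2,3)[of k], of k "bdry k"] f by (simp add: v_def R_def fields_def)
  qed
  have inc': "increment (Omega_q \<epsilon>) (\<lambda>z. q n z - v z) (\<lambda>z. P n z - R z)" for n by (rule fields_0_increment[OF fields_diff[OF f v]])
  then have n': "nice (Omega_q \<epsilon>) (\<lambda>z. q n z - v z) (\<lambda>z. P n z - R z)" for n by (simp add: increment_def)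
  have "(\<lambda>n. \<Sum>k\<in>UNIV. (LINT z|Q.M. (fst (P n z) $ k - ux k z)\<^sup>2) + (LINT z|Q.M. (snd (P n z) $ k - uy k z)\<^sup>2)) \<longlonglongrightarrow> (\<Sum>k\<in>(UNIV :: 3 set). 0 + 0)"
    by (intro tendsto_intros L2_tendsto_D(3) lim)
  then have "(\<lambda>n. LINT z|Q.M. gsq (P n z - R z)) \<longlonglongrightarrow> 0"
    using gsq_integral[OF niceD(3,4)[OF n']] by (simp add: R_def)
  from Q.ell_tendsto_0[OF fields_bdry_nice[OF v] inc' this]
  have "(\<lambda>n. I + s n - Q.ell v R (\<lambda>z. q n z - v z) (\<lambda>z. P n z - R z)) \<longlonglongrightarrow> I + 0 - 0"
    by (intro tendsto_intros s0)
  moreover have "Q.En v R \<le> I + s n - Q.ell v R (\<lambda>z. q n z - v z) (\<lambda>z. P n z - R z)" for n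
  proof -
    have "0 \<le> Q.kap / 2 * (LINT z|Q.M. gsq (P n z - R z))"
      using Q.kap_pos by (intro mult_nonneg_nonneg Bochner_Integration.integral_nonneg) (auto simp: gsq_nonneg)
    then show ?thesis using Q.En_convex[OF fields_bdry_nice[OF v] inc'[of n]] E[of n] by simp
  qed
  ultimately have "Q.En v R \<le> I" by (intro LIMSEQ_le_const) auto
  then show ?thesis using v I order_trans by blast
qed

section \<open>The Euler-Lagrange equations of the symmetric extension\<close>

lemma ell_sum:
  assumes q: "nice (Omega_q \<epsilon>) q P" and "finite S" "\<And>g. g \<in> S \<Longrightarrow> nice (Omega_q \<epsilon>) (e g) (Q' g)"
  shows "nice (Omega_q \<epsilon>) (\<lambda>z. \<Sum>g\<in>S. e g z) (\<lambda>z. \<Sum>g\<in>S. Q' g z)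
    \<and> Q.ell q P (\<lambda>z. \<Sum>g\<in>S. e g z) (\<lambda>z. \<Sum>g\<in>S. Q' g z) = (\<Sum>g\<in>S. Q.ell q P (e g) (Q' g))"
  using assms(2,3)
proof (induction S)
  case empty
  have z: "nice (Omega_q \<epsilon>) (\<lambda>z. 0) (\<lambda>z. 0)" by (simp add: nice_def L2_zero)
  then show ?case using Q.ell_lincomb[OF q z z, of 1] by simp
next
  case (insert g S)
  then show ?case using nice_lincomb[of "Omega_q \<epsilon>" "e g" "Q' g" "\<lambda>z. \<Sum>g\<in>S. e g z" "\<lambda>z. \<Sum>g\<in>S. Q' g z" 1]
    Q.ell_lincomb[OF q, of "e g" "Q' g" "\<lambda>z. \<Sum>g\<in>S. e g z" "\<lambda>z. \<Sum>g\<in>S. Q' g z" 1] by simp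
qed

text \<open>A field on the octagon transported by \<open>g\<close> to the fundamental domain, with the parities of \<open>rho\<close>.\<close>

definition pull :: "real \<times> real \<times> bool \<Rightarrow> (plane \<Rightarrow> real^3) \<Rightarrow> plane \<Rightarrow> real^3" where
  "pull g \<phi> z = (\<chi> i. rho i g * \<phi> (act g z) $ i)"

lemma pull_smooth: "(\<And>i. smooth (\<lambda>z. \<phi> z $ i)) \<Longrightarrow> g \<in> D4 \<Longrightarrow> smooth (\<lambda>z. pull g \<phi> z $ i)"
  unfolding pull_def using smooth_act[of "\<lambda>z. \<phi> z $ i" g] by (simp add: smooth_mult smooth_const)

lemma grad_pull:
  assumes "\<And>i. smooth (\<lambda>z. \<phi> z $ i)" "(a, b, s) \<in> D4"
  shows "fst (grad (pull (a, b, s) \<phi>) z) $ i = rho i (a, b, s) * (if s then b * snd (grad \<phi> (act (a, b, s) z)) $ i else a * fst (grad \<phi> (act (a, b, s) z)) $ i)" (is ?A)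
    "snd (grad (pull (a, b, s) \<phi>) z) $ i = rho i (a, b, s) * (if s then a * fst (grad \<phi> (act (a, b, s) z)) $ i else b * snd (grad \<phi> (act (a, b, s) z)) $ i)" (is ?B)
proof -
  have e: "(\<lambda>w. pull (a, b, s) \<phi> w $ i) = (\<lambda>w. rho i (a, b, s) * \<phi> (act (a, b, s) w) $ i)" by (simp add: pull_def)
  note sm = smooth_act[OF assms(1)[of i] assms(2)]
  show ?A
    unfolding grad_component e pderiv_cmult[OF sm] dx_dy_act(1)[OF assms] ..
  show ?B
    unfolding grad_component e pderiv_cmult[OF sm] dx_dy_act(2)[OF assms] ..
qed

lemma ext_grad_act:
  assumes "z \<in> Omega_q \<epsilon>" "(a, b, s) \<in> D4"
  shows "fst (ext_grad P (act (a, b, s) z)) $ i = a * rho i (a, b, s) * (if s then snd (P z) $ i else fst (P z) $ i)"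
    "snd (ext_grad P (act (a, b, s) z)) $ i = b * rho i (a, b, s) * (if s then fst (P z) $ i else snd (P z) $ i)"
  unfolding ext_grad_def fst_conv snd_conv vec_lambda_beta using unf_act[OF assms] by auto

text \<open>The group acts on the plane and, through \<open>rho\<close>, on the components. Exchanging the coordinates also changes the
  sign of \<open>q\<^sub>1\<close>, which restores the mixed terms of the elastic density.\<close>

lemma density_invariant:
  assumes z: "z \<in> Omega_q \<epsilon>" and g: "g \<in> D4" and sm: "\<And>i. smooth (\<lambda>z. \<phi> z $ i)"
  shows "bel L2 (ext_grad P (act g z)) (grad \<phi> (act g z)) = bel L2 (P z) (grad (pull g \<phi>) z)" (is ?A)
    "fb' A B C (symmetric_extension q (act g z)) (\<phi> (act g z)) = fb' A B C (q z) (pull g \<phi> z)" (is ?B)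
proof -
  obtain a b s where gd: "g = (a, b, s)" "a = 1 \<or> a = -1" "b = 1 \<or> b = -1" using D4_cases[OF g] by metis
  note e = ext_grad_act[OF z g[unfolded gd(1)]] grad_pull[OF sm g[unfolded gd(1)]]
  obtain x y where xy: "grad \<phi> (act (a, b, s) z) = (x, y)" by fastforce
  obtain p r where pr: "P z = (p, r)" by fastforce
  show ?A
  proof -
    have five: "c1 * t1 + c2 * t2 + c3 * t3 + c4 * t4 + c5 * t5 = c1 * u1 + c2 * u2 + c3 * u3 + c4 * u4 + c5 * (u5 :: real)"
      if "t1 = u1" "t2 = u2" "t3 = u3" "t4 = u4" "t5 = u5" for c1 c2 c3 c4 c5 t1 t2 t3 t4 t5 u1 u2 u3 u4 u5
      using that by simp
    show ?thesis unfolding bel_def gd(1) e xy pr fst_conv snd_conv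
      by (rule five; insert gd(2,3); cases s; elim disjE) (simp_all add: rho_def algebra_simps)
  qed
  show ?B
  proof -
    have r: "rho 1 g = 1 \<or> rho 1 g = -1" "rho 2 g = 1 \<or> rho 2 g = -1" "rho 3 g = 1"
      using gd(2,3) by (auto simp: rho_def gd(1))
    show ?thesis unfolding fb'_def symmetric_extension_act[OF z g] pull_def vec_lambda_beta r(3) using r(1,2)
      by (elim disjE) (simp_all only: mult_1 mult_minus1 power2_minus minus_mult_minus mult_minus_left mult_minus_right minus_minus)
  qed
qed

text \<open>The sum \<open>\<Phi>\<close> of the eight transported copies of a test field vanishes wherever the problem on the fundamental
  domain prescribes values, by the oddness in \<open>rho\<close>. So it is an admissible variation of the minimizer, and its first
  variation is the one of the extension in the direction of the test field.\<close>

lemma symmetric_extension_critical: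
  assumes f: "fields bdry q P" and min: "\<And>p R. fields bdry p R \<Longrightarrow> Q.En q P \<le> Q.En p R"
    and t: "\<And>i. test_function (Omega \<epsilon>) (\<lambda>z. \<phi> z $ i)"
  shows "O.ell (symmetric_extension q) (ext_grad P) \<phi> (grad \<phi>) = 0"
proof -
  have sm: "smooth (\<lambda>z. \<phi> z $ i)" for i using test_smooth[OF t] .
  define \<Phi> where "\<Phi> = (\<lambda>z. \<Sum>g\<in>D4. pull g \<phi> z)"
  have F: "\<Phi> z $ i = (\<Sum>g\<in>D4. rho i g * \<phi> (act g z) $ i)" for z i by (simp add: \<Phi>_def pull_def)
  have sF: "smooth (\<lambda>z. \<Phi> z $ i)" for i unfolding F
    by (intro smooth_sum smooth_mult smooth_const smooth_act sm)
  have "tr_q i (\<lambda>z. \<Phi> z $ i) (\<lambda>z. 0)" for i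
  proof (rule tr_q_smooth[OF sF])
    fix z assume "z \<in> frontier (Omega \<epsilon>)"
    then have "z \<notin> Omega \<epsilon>" using Omega_open frontier_disjoint_eq by blast
    then have "act g z \<notin> Omega \<epsilon>" if "g \<in> D4" for g using that by (elim D4_cases) (auto simp: Omega_iff_abs act_def abs_mult add.commute)
    then show "\<Phi> z $ i = 0" unfolding F using test_zero_outside[OF t] by (intro sum.neutral) simp
  next
    show "i = 1 \<Longrightarrow> \<forall>t. \<Phi> (t, t) $ i = 0" unfolding F D4_sum by (simp add: act_def rho_def)
    show "i = 2 \<Longrightarrow> \<forall>t. \<Phi> (t, 0) $ i = 0" unfolding F D4_sum by (simp add: act_def rho_def)
  qed
  then have fF: "fields no_bdry \<Phi> (grad \<Phi>)" using fields_smooth[where f = no_bdry, OF sF] by blast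
  have "Q.ell q P \<Phi> (grad \<Phi>) = 0"
  proof (rule Q.minimizer_ell_0[OF fields_bdry_nice[OF f] fields_0_increment[OF fF]])
    show "Q.En q P \<le> Q.En (\<lambda>z. q z + t *\<^sub>R \<Phi> z) (\<lambda>z. P z + t *\<^sub>R grad \<Phi> z)" for t
      by (rule min[OF fields_add[OF f fF]])
  qed
  moreover have gF: "grad \<Phi> = (\<lambda>z. \<Sum>g\<in>D4. grad (pull g \<phi>) z)"
    by (simp add: fun_eq_iff prod_eq_iff vec_eq_iff grad_component \<Phi>_def fst_sum snd_sum pderiv_sum pull_smooth sm)
  moreover have np: "nice (Omega_q \<epsilon>) (pull g \<phi>) (grad (pull g \<phi>))" if "g \<in> D4" for g
    by (intro smooth_nice pull_smooth sm that Omega_q_bounded Omega_sets)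
  ultimately have s0: "(\<Sum>g\<in>D4. Q.ell q P (pull g \<phi>) (grad (pull g \<phi>))) = 0"
    using ell_sum[OF fields_bdry_nice[OF f] D4_finite np] by (simp add: \<Phi>_def)
  define X where "X = (\<lambda>z. 2 * bel L2 (ext_grad P z) (grad \<phi> z) + mu * fb' A B C (symmetric_extension q z) (\<phi> z))"
  define Y where "Y g z = 2 * bel L2 (P z) (grad (pull g \<phi>) z) + mu * fb' A B C (q z) (pull g \<phi> z)" for g z
  have XY: "X (act g z) = Y g z" if "g \<in> D4" "z \<in> Omega_q \<epsilon>" for g z
    unfolding X_def Y_def density_invariant[OF that(2,1) sm] ..
  have iY: "integrable Q.M (Y g)" if "g \<in> D4" for g
    unfolding Y_def by (rule Q.ell_integrable[OF fields_bdry_nice[OF f] np[OF that]])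
  have "O.ell (symmetric_extension q) (ext_grad P) \<phi> (grad \<phi>) = (\<Sum>g\<in>D4. LINT z|Q.M. X (act g z))"
    unfolding O.ell_def X_def[symmetric]
  proof (rule unfold_integral(2)[unfolded atomize_imp])
    show "g \<in> D4 \<longrightarrow> integrable Q.M (\<lambda>z. X (act g z))" for g
    proof
      assume g: "g \<in> D4"
      have "integrable Q.M (\<lambda>z. X (act g z)) \<longleftrightarrow> integrable Q.M (Y g)"
        by (rule Bochner_Integration.integrable_cong[OF refl]) (use XY[OF g] in simp)
      then show "integrable Q.M (\<lambda>z. X (act g z))" using iY[OF g] by simp
    qed
  qed
  also have "\<dots> = (\<Sum>g\<in>D4. LINT z|Q.M. Y g z)"
    using XY by (intro sum.cong Bochner_Integration.integral_cong) auto
  also have "\<dots> = 0" using s0 by (simp add: Q.ell_def Y_def[abs_def])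
  finally show ?thesis .
qed

section \<open>Uniqueness\<close>

text \<open>Admissibility on the octagon, restated through approximation by test functions.\<close>

definition O_fields :: "(plane \<Rightarrow> real^3) \<Rightarrow> (plane \<Rightarrow> (real^3) \<times> (real^3)) \<Rightarrow> bool" where
  "O_fields q P \<longleftrightarrow> (\<forall>i. W0 (Omega \<epsilon>) (\<lambda>z. q z $ i - lift i z) (\<lambda>z. fst (P z) $ i - dx (lift i) z) (\<lambda>z. snd (P z) $ i - dy (lift i) z))"

lemma W0_increment: "(\<And>i. W0 (Omega \<epsilon>) (\<lambda>z. e z $ i) (\<lambda>z. fst (Q' z) $ i) (\<lambda>z. snd (Q' z) $ i)) \<Longrightarrow> increment (Omega \<epsilon>) e Q'"
  by (intro increment_from_components W0_incr1)

lemma O_fields_D: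
  assumes "O_fields q P"
  shows "nice (Omega \<epsilon>) q P" "q \<in> admissible A B C \<epsilon>" "AE z in O.M. weak_grad (Omega \<epsilon>) q z = P z" (is ?A)
proof -
  have w: "W0 (Omega \<epsilon>) (\<lambda>z. q z $ i - lift i z) (\<lambda>z. fst (P z) $ i - dx (lift i) z) (\<lambda>z. snd (P z) $ i - dy (lift i) z)" for i
    using assms by (simp add: O_fields_def)
  have l: "lift_field z $ i = lift i z" "fst (grad lift_field z) $ i = dx (lift i) z" "snd (grad lift_field z) $ i = dy (lift i) z" for z i
    by (simp_all add: lift_field_def grad_component)
  have "nice (Omega \<epsilon>) (\<lambda>z. q z - lift_field z) (\<lambda>z. P z - grad lift_field z)"
    using W0_increment[of "\<lambda>z. q z - lift_field z" "\<lambda>z. P z - grad lift_field z"] w by (simp add: l increment_def)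
  from nice_lincomb[OF this smooth_nice[OF _ Omega_bounded Omega_sets(1), of lift_field], of 1]
  show "nice (Omega \<epsilon>) q P" by (simp add: l smooth_lift)
  have s: "sobolev (Omega \<epsilon>) (\<lambda>z. q z $ i) (\<lambda>z. fst (P z) $ i) (\<lambda>z. snd (P z) $ i)" for i
    using sobolev_lincomb[OF Omega_sets(1) W0_sobolev[OF Omega_sets(1) Omega_bounded w] smooth_sobolev[OF smooth_lift Omega_bounded Omega_sets(1)], of i 1 i] by simp
  then show ?A by (intro weak_grad_AE Omega_open)
  have "trace_on (Omega \<epsilon>) (frontier (Omega \<epsilon>)) (\<lambda>z. q z $ i) (lift i)" for i
    using trace_on_lincomb[OF Omega_open trace_on_W0[OF Omega_open Omega_bounded w] trace_on_smooth[OF Omega_open Omega_bounded smooth_lift], of i 1 i] by simp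
  then show "q \<in> admissible A B C \<epsilon>" unfolding admissible_iff using lift_bdry by (blast intro: trace_on_cong)
qed

lemma admissible_O_fields: "q \<in> admissible A B C \<epsilon> \<Longrightarrow> O_fields q (weak_grad (Omega \<epsilon>) q)"
  unfolding O_fields_def grad_component admissible_iff using trace_zero_W0[OF _ smooth_lift lift_bdry] by blast

text \<open>The first variation is continuous along approximations in \<open>W\<^sup>1\<^sup>,\<^sup>2\<close>, so the test fields may be replaced by
  increments with vanishing boundary values, such as the difference of two critical points.\<close>

lemma ell_W0:
  assumes q: "nice (Omega \<epsilon>) q P" and EL: "\<And>\<phi>. (\<And>i. test_function (Omega \<epsilon>) (\<lambda>z. \<phi> z $ i)) \<Longrightarrow> O.ell q P \<phi> (grad \<phi>) = 0"
    and w: "\<And>i. W0 (Omega \<epsilon>) (\<lambda>z. e z $ i) (\<lambda>z. fst (Q' z) $ i) (\<lambda>z. snd (Q' z) $ i)"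
  shows "O.ell q P e Q' = 0"
proof -
  obtain \<phi> where p: "\<And>i n. test_function (Omega \<epsilon>) (\<phi> i n)" "\<And>i. L2_tendsto O.M (\<lambda>n. dx (\<phi> i n)) (\<lambda>z. fst (Q' z) $ i)" "\<And>i. L2_tendsto O.M (\<lambda>n. dy (\<phi> i n)) (\<lambda>z. snd (Q' z) $ i)"
    using w unfolding W0_def by metis
  define f :: "nat \<Rightarrow> plane \<Rightarrow> real^3" where "f n z = (\<chi> i. \<phi> i n z)" for n z
  have fi: "f n z $ i = \<phi> i n z" "fst (grad (f n) z) $ i = dx (\<phi> i n) z" "snd (grad (f n) z) $ i = dy (\<phi> i n) z" for n z i by (simp_all add: f_def grad_component)
  have t: "test_function (Omega \<epsilon>) (\<lambda>z. f n z $ i)" for n i using p(1) by (simp add: fi)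
  have inc: "increment (Omega \<epsilon>) (\<lambda>z. f n z - e z) (\<lambda>z. grad (f n) z - Q' z)" for n
    by (rule W0_increment) (use W0_add[where c = "-1", OF W0_test[OF p(1) Omega_sets(1)] w] in \<open>simp add: fi\<close>)
  have n: "nice (Omega \<epsilon>) (f n) (grad (f n))" for n by (intro smooth_nice test_smooth[OF t] Omega_bounded Omega_sets)
  have d: "nice (Omega \<epsilon>) (\<lambda>z. f n z - e z) (\<lambda>z. grad (f n) z - Q' z)" for n using inc by (simp add: increment_def)
  have "nice (Omega \<epsilon>) e Q'" using W0_increment[OF w] by (simp add: increment_def)
  from O.ell_lincomb[OF q this d, of 1]
  have "O.ell q P (f n) (grad (f n)) = O.ell q P e Q' + O.ell q P (\<lambda>z. f n z - e z) (\<lambda>z. grad (f n) z - Q' z)" for n by simp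
  then have l: "O.ell q P (\<lambda>z. f n z - e z) (\<lambda>z. grad (f n) z - Q' z) = - O.ell q P e Q'" for n using EL[OF t] by (simp add: add_eq_0_iff)
  have "(\<lambda>n. \<Sum>i\<in>UNIV. (LINT z|O.M. (dx (\<phi> i n) z - fst (Q' z) $ i)\<^sup>2) + (LINT z|O.M. (dy (\<phi> i n) z - snd (Q' z) $ i)\<^sup>2)) \<longlonglongrightarrow> (\<Sum>i\<in>(UNIV :: 3 set). 0 + 0)"
    by (intro tendsto_intros L2_tendsto_D(3) p)
  then have "(\<lambda>n. LINT z|O.M. gsq (grad (f n) z - Q' z)) \<longlonglongrightarrow> 0"
    using gsq_integral[OF niceD(3,4)[OF d]] by (simp add: fi)
  from O.ell_tendsto_0[OF q inc this] show ?thesis unfolding l by (simp add: LIMSEQ_const_iff)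
qed

lemma critical_unique:
  assumes "q \<in> admissible A B C \<epsilon>" "p \<in> admissible A B C \<epsilon>"
    and EL: "\<And>\<phi>. (\<And>i. test_function (Omega \<epsilon>) (\<lambda>z. \<phi> z $ i)) \<Longrightarrow> O.ell q (weak_grad (Omega \<epsilon>) q) \<phi> (grad \<phi>) = 0"
      "\<And>\<phi>. (\<And>i. test_function (Omega \<epsilon>) (\<lambda>z. \<phi> z $ i)) \<Longrightarrow> O.ell p (weak_grad (Omega \<epsilon>) p) \<phi> (grad \<phi>) = 0"
  shows "AE z in O.M. p z = q z"
proof -
  define P R where "P = weak_grad (Omega \<epsilon>) q" and "R = weak_grad (Omega \<epsilon>) p"
  have f: "O_fields q P" "O_fields p R" using assms(1,2) admissible_O_fields by (auto simp: P_def R_def)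
  have w: "W0 (Omega \<epsilon>) (\<lambda>z. (p z - q z) $ i) (\<lambda>z. fst (R z - P z) $ i) (\<lambda>z. snd (R z - P z) $ i)" for i
  proof -
    have "W0 (Omega \<epsilon>) (\<lambda>z. p z $ i - lift i z) (\<lambda>z. fst (R z) $ i - dx (lift i) z) (\<lambda>z. snd (R z) $ i - dy (lift i) z)"
      "W0 (Omega \<epsilon>) (\<lambda>z. q z $ i - lift i z) (\<lambda>z. fst (P z) $ i - dx (lift i) z) (\<lambda>z. snd (P z) $ i - dy (lift i) z)"
      using f by (simp_all add: O_fields_def)
    from W0_add[OF this, of "-1"] show ?thesis by simp
  qed
  have "AE z in O.M. p z - q z = 0"
  proof (rule O.critical_fields_agree[OF O_fields_D(1)[OF f(1)] W0_increment[OF w]])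
    show "O.ell q P (\<lambda>z. p z - q z) (\<lambda>z. R z - P z) = 0"
      by (rule ell_W0[OF O_fields_D(1)[OF f(1)] EL(1)[folded P_def] w])
    show "O.ell (\<lambda>z. q z + (p z - q z)) (\<lambda>z. P z + (R z - P z)) (\<lambda>z. p z - q z) (\<lambda>z. R z - P z) = 0"
      using ell_W0[OF O_fields_D(1)[OF f(2)] EL(2)[folded R_def] w] by simp
  qed
  then show ?thesis by eventually_elim simp
qed

end

theorem proposition3p4:
  fixes A B C L L2 \<epsilon> :: real
  assumes "A < 0" "B > 0" "C > 0" "L > 0" "L2 > -1" "0 < \<epsilon>" "\<epsilon> < 1"
  shows "\<exists>lam0 > 0. \<forall>lam. 0 < lam \<and> lam < lam0 \<longrightarrow>
    (\<exists>q. minimizer_q A B C L L2 \<epsilon> lam q) \<and>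
    (\<forall>q. minimizer_q A B C L L2 \<epsilon> lam q \<longrightarrow>
      critical_point A B C L L2 \<epsilon> lam (symmetric_extension q) \<and>
      (\<forall>p. critical_point A B C L L2 \<epsilon> lam p \<longrightarrow>
        (AE z in lebesgue_on (Omega \<epsilon>). p z = symmetric_extension q z)))"
proof -
  have KB: "KB A B C > 0" unfolding KB_def using assms by (intro mult_pos_pos add_pos_nonneg) auto
  define lam0 where "lam0 = sqrt (L * min 1 (1 + L2) / (8 * KB A B C))"
  have arg: "L * min 1 (1 + L2) / (8 * KB A B C) > 0" using assms KB by (intro divide_pos_pos mult_pos_pos) auto
  then have "lam0 > 0" by (simp add: lam0_def)
  moreover have "(\<exists>q. minimizer_q A B C L L2 \<epsilon> lam q) \<and>
    (\<forall>q. minimizer_q A B C L L2 \<epsilon> lam q \<longrightarrow>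
      critical_point A B C L L2 \<epsilon> lam (symmetric_extension q) \<and>
      (\<forall>p. critical_point A B C L L2 \<epsilon> lam p \<longrightarrow>
        (AE z in lebesgue_on (Omega \<epsilon>). p z = symmetric_extension q z)))" if lam: "0 < lam" "lam < lam0" for lam
  proof -
    define mu where "mu = lam\<^sup>2 / L"
    have "lam\<^sup>2 \<le> lam0\<^sup>2" using lam by (intro power_mono) auto
    then have "lam\<^sup>2 \<le> L * min 1 (1 + L2) / (8 * KB A B C)" using arg by (simp add: lam0_def)
    then have "lam\<^sup>2 * (8 * KB A B C) \<le> min 1 (1 + L2) * L" using KB by (simp add: pos_le_divide_eq mult.commute)
    then have "lam\<^sup>2 * (8 * KB A B C) / L \<le> min 1 (1 + L2)" by (simp only: pos_divide_le_eq[OF assms(4)])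
    then have small: "8 * (mu * KB A B C) \<le> min 1 (1 + L2)" by (simp add: mu_def mult_ac)
    interpret lc_problem \<epsilon> A B C L2 mu
      by unfold_locales (use assms small in \<open>auto simp: mu_def\<close>)
    have en: "energy A B C L L2 lam (Omega_q \<epsilon>) q = Q.En q (weak_grad (Omega_q \<epsilon>) q)" for q
      by (simp only: energy_def Q.En_def mu_def[symmetric])
    have EL: "weak_Euler_Lagrange A B C L L2 lam (Omega \<epsilon>) q \<longleftrightarrow>
        (\<forall>\<phi>. (\<forall>i. test_function (Omega \<epsilon>) (\<lambda>z. \<phi> z $ i)) \<longrightarrow> O.ell q (weak_grad (Omega \<epsilon>) q) \<phi> (grad \<phi>) = 0)" for q
      by (simp only: weak_Euler_Lagrange_def O.ell_def mu_def[symmetric] f_el_frechet f_b_frechet)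
    have min: "minimizer_q A B C L L2 \<epsilon> lam q \<longleftrightarrow> fields bdry q (weak_grad (Omega_q \<epsilon>) q)
        \<and> (\<forall>p R. fields bdry p R \<longrightarrow> Q.En q (weak_grad (Omega_q \<epsilon>) q) \<le> Q.En p R)" for q
      unfolding minimizer_q_def en using admissible_q_fields fields_energy by metis
    have ex: "\<exists>q. minimizer_q A B C L L2 \<epsilon> lam q"
    proof -
      obtain q P where "fields bdry q P" "\<forall>p R. fields bdry p R \<longrightarrow> Q.En q P \<le> Q.En p R" using minimizing_fields by blast
      then show ?thesis unfolding min using fields_energy admissible_q_fields by metis
    qed
    have crit: "critical_point A B C L L2 \<epsilon> lam (symmetric_extension q)" if m: "minimizer_q A B C L L2 \<epsilon> lam q" for q
    proof -
      let ?P = "weak_grad (Omega_q \<epsilon>) q" and ?s = "symmetric_extension q"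
      have q: "q \<in> admissible_q A B C \<epsilon>" using m by (simp add: minimizer_q_def)
      have f: "O_fields ?s (ext_grad ?P)" unfolding O_fields_def using symmetric_extension_W0[OF q] by blast
      note s = O_fields_D[OF f]
      have "O.ell ?s (weak_grad (Omega \<epsilon>) ?s) \<phi> (grad \<phi>) = 0" if t: "\<forall>i. test_function (Omega \<epsilon>) (\<lambda>z. \<phi> z $ i)" for \<phi>
      proof -
        have n: "nice (Omega \<epsilon>) \<phi> (grad \<phi>)" using t by (intro smooth_nice test_smooth[of "Omega \<epsilon>"] Omega_bounded Omega_sets) blast
        have "O.ell ?s (weak_grad (Omega \<epsilon>) ?s) \<phi> (grad \<phi>) = O.ell ?s (ext_grad ?P) \<phi> (grad \<phi>)"
          unfolding O.ell_def
          using O.ell_integrable[OF O_fields_D(1)[OF admissible_O_fields[OF s(2)]] n] O.ell_integrable[OF s(1) n] s(3)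
          by (intro integral_cong_AE) (auto elim: eventually_mono)
        also have "\<dots> = 0" by (rule symmetric_extension_critical) (use m t min in auto)
        finally show ?thesis .
      qed
      then show ?thesis unfolding critical_point_def EL using s(2) by blast
    qed
    moreover have "AE z in lebesgue_on (Omega \<epsilon>). p z = symmetric_extension q z"
      if "minimizer_q A B C L L2 \<epsilon> lam q" "critical_point A B C L L2 \<epsilon> lam p" for p q
      using crit[OF that(1)] that(2) unfolding critical_point_def EL by (intro critical_unique) blast+
    ultimately show ?thesis using ex by blast
  qed
  ultimately show ?thesis by blast
qed

end
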